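(* Let $(X,d,\mu)$ be a doubling metric measure space which supports a weak $(1,2)$-Poincaré inequality, let $D$ be a Cheeger derivative on $X$ and let $f\in N^{1,2}(X)$. Then, for each ball $B=B(z,R)$ with $z\in X$ and $0<R\le\operatorname{diam}(X)$, $R<\infty$, $$\left\|\frac{f-\langle f\rangle_B}{R}\right\|_{L^2(B)}^2+\int_0^R\int_B H_{f,D}(x,r)^2\,d\mu(x)\,\frac{dr}{r}\le C\,\|Df\|_{L^2(AB)}^2,$$ where $A\ge1$ is a constant multiple of the dilation constant in the weak Poincaré inequality, and $C$ depends only on the doubling constant and the constants appearing in the Poincaré inequality.
   Context: A metric measure space is a triple $(X,d,\mu)$ with $(X,d)$ a separable metric space and $\mu$ a non-trivial locally finite Borel-regular measure. It is doubling if there is $C_\mu\ge1$ (the doubling constant) with $0<\mu(2B)\le C_\mu\,\mu(B)<\infty$ for all balls $B$. $B(x,r)$ is the open ball, $AB(x,r)=B(x,Ar)$, $\langle u\rangle_E=\frac1{\mu(E)}\int_Eu\,d\mu$. A Borel function $g\ge0$ is an upper gradient of $u:X\to\mathbb{R}$ if $|u(\gamma(a))-u(\gamma(b))|\le\int_\gamma g\,ds$ for every rectifiable curve $\gamma:[a,b]\to X$. $N^{1,2}(X)$ is the set of $f\in L^2(X)$ having an upper gradient in $L^2(X)$; $g_f$ is the minimal weak upper gradient (the a.e. smallest function that is an upper gradient along $2$-almost every rectifiable curve in the sense of $2$-modulus). $N^{1,2}_0(U)$ is the set of $u\in N^{1,2}(X)$ vanishing $2$-quasi-everywhere (outside a set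 of zero Sobolev $2$-capacity) in $X\setminus U$. For $U$ open, $N^{1,2}_{\mathrm{loc}}(U)$ is the set of $u\in L^2_{\mathrm{loc}}(U)$ with $\eta u\in N^{1,2}(X)$ for every Lipschitz $\eta$ with compact support in $U$. Weak $(1,2)$-Poincaré inequality: there are constants $A_{\mathrm{PI}},C_{\mathrm{PI}}\ge1$ ($A_{\mathrm{PI}}$ is the dilation constant) such that $\frac1{\mu(B)}\int_B|u-\langle u\rangle_B|\,d\mu\le C_{\mathrm{PI}}\,r_B\left(\frac1{\mu(A_{\mathrm{PI}}B)}\int_{A_{\mathrm{PI}}B}g_u^2\,d\mu\right)^{1/2}$ for all balls $B$ of radius $r_B$ and all integrable functions $u$ with minimal weak upper gradient $g_u$. Cheeger derivative: an operator $D$ assigning to each $u\in N^{1,2}(X)$ an a.e.-defined measurable function $Du$ on $X$ with values in a finite-dimensional Hilbert space $(H,\langle\cdot,\cdot\rangle,\|\cdot\|)$, which is linear, satisfies the Leibniz rule, and satisfies $\|Du\|\sim g_u$ $\mu$-a.e. for every $u\in N^{1,2}(X)$, i.e. $C_0^{-1}g_u\le\|Du\|\le C_0g_u$ with a constant $C_0\ge1$ regarded as fixed (absolute), so other constants may depend on it. By locality of $g_u$, $Du$ is also defined a.e. in $U$ for $u\in N^{1,2}_{\mathrm{loc}}(U)$. A function $u\in N^{1,2}_{\mathrm{loc}}(U)$ is Cheeger harmonic in the open set $U$ (with respect to $D$) if $\int_U\|Du\|^2d\mu\le\int_U\|D(u+\phi)\|^2d\mu$ for all $\phi\in N^{1,2}_0(U)$;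 equivalently $\int_U\langle Du,D\phi\rangle\,d\mu=0$ for all such $\phi$. For $x\in X$, $0<r<\operatorname{diam}(X)$: $H_{f,D}(x,r)^2=\inf_h\frac1{\mu(B(x,r))}\int_{B(x,r)}\left(\frac{f-h}{r}\right)^2d\mu$, the infimum over all $h:X\to\mathbb{R}$ Cheeger harmonic (with respect to $D$) in $B(x,r)$. *)

theory Defs
  imports "HOL-Analysis.Analysis"
begin

text \<open>
  Metric spaces are given by a carrier and a distance, as in the locale \<open>Metric_space\<close>, and not by
  the type class: only in this form can a constant be quantified before the metric space, which is
  what ``depends only on the structural constants'' means.
\<close>

section \<open>Curves and line integrals\<close>

context Metric_space
begin

definition diam_carrier :: ereal where
  "diam_carrier = (SUP (x, y) \<in> M \<times> M. ereal (d x y))"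

definition borel_sigma :: "'a measure" where
  "borel_sigma = sigma M {U. openin mtopology U}"

text \<open>A curve on a compact interval \<open>{a..b}\<close> is a triple \<open>(a, b, \<gamma>)\<close>.\<close>

definition curve :: "real \<times> real \<times> (real \<Rightarrow> 'a) \<Rightarrow> bool" where
  "curve = (\<lambda>(a, b, \<gamma>). a \<le> b \<and> continuous_map (top_of_set {a..b}) mtopology \<gamma>)"

definition curve_length :: "real \<times> real \<times> (real \<Rightarrow> 'a) \<Rightarrow> ennreal" where
  "curve_length = (\<lambda>(a, b, \<gamma>).
     (SUP ts \<in> {ts. sorted ts \<and> set ts \<subseteq> {a..b}}.
        \<Sum>i < length ts - 1. ennreal (d (\<gamma> (ts ! i)) (\<gamma> (ts ! Suc i)))))"

definition rectifiable_curve :: "real \<times> real \<times> (real \<Rightarrow> 'a) \<Rightarrow> bool" where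
  "rectifiable_curve c \<longleftrightarrow> curve c \<and> curve_length c < \<infinity>"

text \<open>
  The choice of the parameter \<open>t\<close> is immaterial: \<open>\<gamma>\<close> is constant between two parameters with the
  same arc length.
\<close>

definition arc_length_param :: "real \<times> real \<times> (real \<Rightarrow> 'a) \<Rightarrow> real \<Rightarrow> 'a" where
  "arc_length_param = (\<lambda>(a, b, \<gamma>) s.
     \<gamma> (SOME t. t \<in> {a..b} \<and> curve_length (a, t, \<gamma>) = ennreal s))"

definition line_integral :: "real \<times> real \<times> (real \<Rightarrow> 'a) \<Rightarrow> ('a \<Rightarrow> ennreal) \<Rightarrow> ennreal" where
  "line_integral c g =
     (\<integral>\<^sup>+ s \<in> {0..enn2real (curve_length c)}. g (arc_length_param c s) \<partial>lborel)"

definition upper_gradient_along ::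
    "('a \<Rightarrow> real) \<Rightarrow> ('a \<Rightarrow> ennreal) \<Rightarrow> real \<times> real \<times> (real \<Rightarrow> 'a) \<Rightarrow> bool" where
  "upper_gradient_along u g c \<longleftrightarrow>
     (case c of (a, b, \<gamma>) \<Rightarrow> ennreal \<bar>u (\<gamma> a) - u (\<gamma> b)\<bar> \<le> line_integral c g)"

definition upper_gradient :: "('a \<Rightarrow> real) \<Rightarrow> ('a \<Rightarrow> ennreal) \<Rightarrow> bool" where
  "upper_gradient u g \<longleftrightarrow>
     g \<in> borel_measurable borel_sigma \<and> (\<forall>c. rectifiable_curve c \<longrightarrow> upper_gradient_along u g c)"

end


section \<open>Metric measure spaces and Newtonian functions\<close>

text \<open>
  \<open>\<mu>\<close> is the Borel-regular (outer) measure restricted to its measurable sets; hence it is complete,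
  and functions measurable with respect to \<open>\<mu>\<close> need not be Borel.
\<close>

locale metric_measure_space = Metric_space M d + complete_measure \<mu>
  for M :: "'a set" and d :: "'a \<Rightarrow> 'a \<Rightarrow> real" and \<mu> :: "'a measure" +
  assumes separable: "separable_space mtopology"
    and space_eq: "space \<mu> = M"
    and borel_sets: "sets borel_sigma \<subseteq> sets \<mu>"
    and borel_regular:
      "\<And>A. A \<in> sets \<mu> \<Longrightarrow> \<exists>B \<in> sets borel_sigma. A \<subseteq> B \<and> emeasure \<mu> B = emeasure \<mu> A"
    and locally_finite: "\<And>x. x \<in> M \<Longrightarrow> \<exists>r>0. emeasure \<mu> (mball x r) < \<infinity>"
    and nontrivial: "emeasure \<mu> M \<noteq> 0"
begin

definition doubling :: "real \<Rightarrow> bool" where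
  "doubling C \<longleftrightarrow>
     (\<forall>x \<in> M. \<forall>r>0. 0 < emeasure \<mu> (mball x (2 * r)) \<and>
        emeasure \<mu> (mball x (2 * r)) \<le> ennreal C * emeasure \<mu> (mball x r) \<and>
        emeasure \<mu> (mball x r) < \<infinity>)"

definition average :: "'a set \<Rightarrow> ('a \<Rightarrow> real) \<Rightarrow> real" where
  "average E u = (LINT x:E|\<mu>. u x) / measure \<mu> E"

definition modulus2 :: "(real \<times> real \<times> (real \<Rightarrow> 'a)) set \<Rightarrow> ennreal" where
  "modulus2 \<Gamma> =
     (INF \<rho> \<in> {\<rho> \<in> borel_measurable borel_sigma.
                 \<forall>c \<in> \<Gamma>. rectifiable_curve c \<longrightarrow> 1 \<le> line_integral c \<rho>}.
        \<integral>\<^sup>+ x. (\<rho> x)\<^sup>2 \<partial>\<mu>)"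

definition weak_upper_gradient :: "('a \<Rightarrow> real) \<Rightarrow> ('a \<Rightarrow> ennreal) \<Rightarrow> bool" where
  "weak_upper_gradient u g \<longleftrightarrow>
     g \<in> borel_measurable borel_sigma \<and>
     modulus2 {c. rectifiable_curve c \<and> \<not> upper_gradient_along u g c} = 0"

text \<open>
  Minimality is among square integrable weak upper gradients. Without integrability it would fail:
  on the real line there are finite a.e. functions whose integral over every interval is infinite,
  and small multiples of these are upper gradients of everything.
\<close>

definition minimal_weak_upper_gradient :: "('a \<Rightarrow> real) \<Rightarrow> ('a \<Rightarrow> ennreal) \<Rightarrow> bool" where
  "minimal_weak_upper_gradient u g \<longleftrightarrow>
     weak_upper_gradient u g \<and> (\<integral>\<^sup>+ x. (g x)\<^sup>2 \<partial>\<mu>) < \<infinity> \<and>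
     (\<forall>g'. weak_upper_gradient u g' \<and> (\<integral>\<^sup>+ x. (g' x)\<^sup>2 \<partial>\<mu>) < \<infinity> \<longrightarrow> (AE x in \<mu>. g x \<le> g' x))"

definition poincare12 :: "real \<Rightarrow> real \<Rightarrow> bool" where
  "poincare12 A C \<longleftrightarrow>
     (\<forall>x \<in> M. \<forall>r>0. \<forall>u g. integrable \<mu> u \<and> minimal_weak_upper_gradient u g \<longrightarrow>
        average (mball x r) (\<lambda>y. \<bar>u y - average (mball x r) u\<bar>)
          \<le> C * r * sqrt (average (mball x (A * r)) (\<lambda>y. (enn2real (g y))\<^sup>2)))"

definition N12 :: "('a \<Rightarrow> real) set" where
  "N12 = {u \<in> borel_measurable \<mu>. (\<integral>\<^sup>+ x. ennreal ((u x)\<^sup>2) \<partial>\<mu>) < \<infinity> \<and>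
            (\<exists>g. upper_gradient u g \<and> (\<integral>\<^sup>+ x. (g x)\<^sup>2 \<partial>\<mu>) < \<infinity>)}"

definition N12_norm_sq :: "('a \<Rightarrow> real) \<Rightarrow> ennreal" where
  "N12_norm_sq u =
     (\<integral>\<^sup>+ x. ennreal ((u x)\<^sup>2) \<partial>\<mu>) + (INF g \<in> {g. upper_gradient u g}. \<integral>\<^sup>+ x. (g x)\<^sup>2 \<partial>\<mu>)"

definition capacity2 :: "'a set \<Rightarrow> ennreal" where
  "capacity2 E = (INF u \<in> {u \<in> N12. \<forall>x \<in> E. 1 \<le> u x}. N12_norm_sq u)"

definition N12_zero :: "'a set \<Rightarrow> ('a \<Rightarrow> real) set" where
  "N12_zero U = {u \<in> N12. capacity2 {x \<in> M - U. u x \<noteq> 0} = 0}"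

definition L2_loc :: "'a set \<Rightarrow> ('a \<Rightarrow> real) set" where
  "L2_loc U = {u. \<forall>x \<in> U. \<exists>r>0. mball x r \<subseteq> U \<and> set_borel_measurable \<mu> (mball x r) u \<and>
                 (\<integral>\<^sup>+ y \<in> mball x r. ennreal ((u y)\<^sup>2) \<partial>\<mu>) < \<infinity>}"

definition lipschitz_cutoff :: "'a set \<Rightarrow> ('a \<Rightarrow> real) \<Rightarrow> bool" where
  "lipschitz_cutoff U \<eta> \<longleftrightarrow>
     (\<exists>L. \<forall>x \<in> M. \<forall>y \<in> M. \<bar>\<eta> x - \<eta> y\<bar> \<le> L * d x y) \<and>
     compactin mtopology (mtopology closure_of {x \<in> M. \<eta> x \<noteq> 0}) \<and>
     mtopology closure_of {x \<in> M. \<eta> x \<noteq> 0} \<subseteq> U"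

definition N12_loc :: "'a set \<Rightarrow> ('a \<Rightarrow> real) set" where
  "N12_loc U = {u \<in> L2_loc U. \<forall>\<eta>. lipschitz_cutoff U \<eta> \<longrightarrow> (\<lambda>x. \<eta> x * u x) \<in> N12}"


section \<open>Cheeger derivatives and Cheeger harmonic functions\<close>

text \<open>
  The finite-dimensional Hilbert space of values is a finite-dimensional subspace \<open>H\<close> of a real
  inner product space, so that its dimension is not fixed by the type.
\<close>

definition cheeger_derivative ::
    "real \<Rightarrow> 'h :: {real_inner, second_countable_topology} set \<Rightarrow>
     (('a \<Rightarrow> real) \<Rightarrow> 'a \<Rightarrow> 'h) \<Rightarrow> bool" where
  "cheeger_derivative C0 H D \<longleftrightarrow>
     subspace H \<and> (\<exists>B. finite B \<and> H = span B) \<and>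
     (\<forall>u \<in> N12. D u \<in> borel_measurable \<mu> \<and> (AE x in \<mu>. D u x \<in> H)) \<and>
     (\<forall>u \<in> N12. \<forall>v \<in> N12. \<forall>a b.
        AE x in \<mu>. D (\<lambda>y. a * u y + b * v y) x = a *\<^sub>R D u x + b *\<^sub>R D v x) \<and>
     (\<forall>u \<in> N12. \<forall>v \<in> N12. (\<lambda>y. u y * v y) \<in> N12 \<longrightarrow>
        (AE x in \<mu>. D (\<lambda>y. u y * v y) x = u x *\<^sub>R D v x + v x *\<^sub>R D u x)) \<and>
     (\<forall>u \<in> N12. \<forall>g. minimal_weak_upper_gradient u g \<longrightarrow>
        (AE x in \<mu>. ennreal (1 / C0) * g x \<le> ennreal (norm (D u x)) \<and>
                    ennreal (norm (D u x)) \<le> ennreal C0 * g x))"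

text \<open>
  \<open>v\<close> represents \<open>Du\<close> on the open set \<open>U\<close>: every point of \<open>U\<close> has a neighbourhood on which \<open>u\<close> agrees
  with some \<open>w \<in> N12\<close> and \<open>v\<close> agrees a.e. with \<open>Dw\<close>. If \<open>M\<close> is locally compact and \<open>u \<in> N12_loc U\<close>,
  one can take \<open>w = \<eta>u\<close> for a cutoff \<open>\<eta>\<close> equal to 1 near the point. By locality and separability \<open>v\<close> is
  unique up to null sets.
\<close>

definition derivative_on ::
    "(('a \<Rightarrow> real) \<Rightarrow> 'a \<Rightarrow> 'h) \<Rightarrow> 'a set \<Rightarrow> ('a \<Rightarrow> real) \<Rightarrow>
     ('a \<Rightarrow> 'h :: {real_inner, second_countable_topology}) \<Rightarrow> bool" where
  "derivative_on D U u v \<longleftrightarrow>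
     (\<forall>x \<in> U. \<exists>V. openin mtopology V \<and> x \<in> V \<and> V \<subseteq> U \<and>
        (\<exists>w \<in> N12. (\<forall>y \<in> V. w y = u y) \<and> (AE y in \<mu>. y \<in> V \<longrightarrow> v y = D w y)))"

text \<open>
  The energy of \<open>u\<close> on \<open>U\<close> is required to be finite: with infinite energy the minimality condition
  would hold vacuously and would not be equivalent to its Euler--Lagrange equation.
\<close>

definition cheeger_harmonic_on ::
    "(('a \<Rightarrow> real) \<Rightarrow> 'a \<Rightarrow> 'h :: {real_inner, second_countable_topology}) \<Rightarrow>
     'a set \<Rightarrow> ('a \<Rightarrow> real) \<Rightarrow> bool" where
  "cheeger_harmonic_on D U u \<longleftrightarrow>
     openin mtopology U \<and> u \<in> N12_loc U \<and>
     (\<exists>v. derivative_on D U u v \<and>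
        (\<integral>\<^sup>+ x \<in> U. ennreal ((norm (v x))\<^sup>2) \<partial>\<mu>) < \<infinity> \<and>
        (\<forall>\<phi> \<in> N12_zero U. \<forall>v'. derivative_on D U (\<lambda>x. u x + \<phi> x) v' \<longrightarrow>
           (\<integral>\<^sup>+ x \<in> U. ennreal ((norm (v x))\<^sup>2) \<partial>\<mu>) \<le> (\<integral>\<^sup>+ x \<in> U. ennreal ((norm (v' x))\<^sup>2) \<partial>\<mu>)))"

text \<open>This is the square of the coefficient \<open>H\<^sub>f\<^sub>,\<^sub>D(x, r)\<close>.\<close>

definition H_sq ::
    "(('a \<Rightarrow> real) \<Rightarrow> 'a \<Rightarrow> 'h :: {real_inner, second_countable_topology}) \<Rightarrow>
     ('a \<Rightarrow> real) \<Rightarrow> 'a \<Rightarrow> real \<Rightarrow> ennreal" where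
  "H_sq D f x r =
     (INF h \<in> {h. cheeger_harmonic_on D (mball x r) h}.
        (\<integral>\<^sup>+ y \<in> mball x r. ennreal (((f y - h y) / r)\<^sup>2) \<partial>\<mu>) / emeasure \<mu> (mball x r))"

end

end

theory Submission
  imports Defs
begin

text \<open>
  Fix a cut-off function that is \<open>1\<close> on \<open>2B\<close>, and let \<open>F\<close> be its product with \<open>f - \<langle>f\<rangle>\<^bsub>4B\<^esub>\<close>. For \<open>\<lambda> > 0\<close> let \<open>u\<^sub>\<lambda>\<close> minimise
  \<open>\<lambda> \<parallel>F - u\<parallel>\<^sup>2 + \<parallel>Du\<parallel>\<^sup>2\<close> over the whole space, so that \<open>\<lambda> (F - u\<^sub>\<lambda>)\<close> is the Cheeger Laplacian of \<open>u\<^sub>\<lambda>\<close>. With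
  \<open>\<lambda> = r\<^sup>-\<^sup>2\<close>, the harmonic replacement of \<open>u\<^sub>\<lambda>\<close> in \<open>B(x, r)\<close> differs from \<open>u\<^sub>\<lambda>\<close> by at most a constant times
  \<open>\<parallel>F - u\<^sub>\<lambda>\<parallel>\<close> in \<open>L\<^sup>2(B(x, r))\<close>, by the Friedrichs inequality. Hence the square function is bounded by
  \<open>\<integral> r\<^sup>-\<^sup>2 \<parallel>F - u\<^sub>\<lambda>\<parallel>\<^sup>2 dr / r\<close>. The minimal value, as a function of \<open>\<lambda>\<close>, increases with slope \<open>\<parallel>F - u\<^sub>\<lambda>\<parallel>\<^sup>2\<close> and is bounded by
  \<open>\<parallel>DF\<parallel>\<^sup>2\<close>, so this integral is bounded by \<open>\<parallel>DF\<parallel>\<^sup>2\<close>, and the \<open>L\<^sup>2\<close> Poincare inequality returns to \<open>Df\<close>. Only the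
  dyadic values of \<open>\<lambda>\<close> are used. For \<open>r\<close> comparable to \<open>R\<close>, where the Friedrichs inequality may fail, constants serve as
  harmonic functions.
\<close>

section \<open>Arc length of rectifiable curves\<close>

text \<open>The harmonic replacement of the function itself would not do: its error in B(x, r) is
  bounded by the energy there, with no decay as r tends to 0, and dr / r is not integrable at 0.
  Smoothing at scale r is what produces a square-integrable Laplacian, and comparing minimal values
  at consecutive penalties makes the contributions of the scales add up to one energy.

  Three obstacles shape the development. The derivative is tied to gradients only through a minimal
  weak upper gradient, so the existence of one has to be proved; this needs the minimum of two weak
  upper gradients, obtained by a gauge integral argument along arc length curves. Minimisers need
  completeness of the Newtonian space, whose members are everywhere defined functions with true
  upper gradients, so limits are built pointwise along rapidly converging sequences. Finally, the
  coefficient is an infimum that is not known to be measurable, so it is dominated pointwise by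
  measurable functions before any integral is split.

  The dilation 12 = 3 * 4 combines the factor 3 lost in the L2 Poincare inequality with the radius
  \<open>4 * R\<close> of the support of the cut-off.\<close>

lemma ennreal_SUP_approx:
  fixes f :: "'i \<Rightarrow> ennreal"
  assumes "I \<noteq> {}" "(SUP i\<in>I. f i) < \<infinity>" "0 < e"
  shows "\<exists>i\<in>I. (SUP i\<in>I. f i) \<le> f i + e"
proof (rule ccontr)
  assume "\<not> ?thesis"
  then have "\<And>i. i \<in> I \<Longrightarrow> f i + e \<le> (SUP i\<in>I. f i)"
    by (meson linear)
  then have "(SUP i\<in>I. f i + e) \<le> (SUP i\<in>I. f i)"
    by (rule SUP_least)
  then have "(SUP i\<in>I. f i) + e \<le> (SUP i\<in>I. f i)"
    using ennreal_SUP_add_left[OF assms(1), of f e] by simp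
  then show False
    using assms(2,3)
    by (metis add.commute ennreal_add_left_cancel_le add.right_neutral infinity_ennreal_def leD order.strict_iff_order)
qed

section \<open>Lengths of inscribed chains\<close>

context Metric_space
begin

text \<open>The recursive form of the sum in \<open>curve_length\<close>; refining a chain then
  becomes an induction on the list.\<close>

fun chain_length :: "(real \<Rightarrow> 'a) \<Rightarrow> real list \<Rightarrow> ennreal" where
  "chain_length \<gamma> (x # y # zs) = ennreal (d (\<gamma> x) (\<gamma> y)) + chain_length \<gamma> (y # zs)"
| "chain_length \<gamma> _ = 0"

lemma chain_length_sum:
  "chain_length \<gamma> ts = (\<Sum>i < length ts - 1. ennreal (d (\<gamma> (ts ! i)) (\<gamma> (ts ! Suc i))))"
proof (induction \<gamma> ts rule: chain_length.induct)
  case (1 \<gamma> x y zs)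
  then show ?case
    by (simp add: sum.lessThan_Suc_shift del: sum.lessThan_Suc)
qed auto

lemma curve_length_SUP:
  "curve_length (a, b, \<gamma>) = (SUP ts \<in> {ts. sorted ts \<and> set ts \<subseteq> {a..b}}. chain_length \<gamma> ts)"
  by (simp add: curve_length_def chain_length_sum)

lemma chain_length_le_curve_length:
  "sorted ts \<Longrightarrow> set ts \<subseteq> {a..b} \<Longrightarrow> chain_length \<gamma> ts \<le> curve_length (a, b, \<gamma>)"
  unfolding curve_length_SUP by (rule SUP_upper) auto

lemma dist_le_curve_length: "a \<le> b \<Longrightarrow> ennreal (d (\<gamma> a) (\<gamma> b)) \<le> curve_length (a, b, \<gamma>)"
  using chain_length_le_curve_length[of "[a, b]" a b \<gamma>] by simp

lemma chain_length_append_ge: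
  "chain_length \<gamma> xs + chain_length \<gamma> ys \<le> chain_length \<gamma> (xs @ ys)"
proof (induction \<gamma> xs rule: chain_length.induct)
  case (1 \<gamma> x y zs)
  then show ?case by (simp add: add.assoc add_left_mono)
next
  case ("2_2" \<gamma> v)
  then show ?case by (cases ys) auto
qed auto

lemma chain_length_const: "(\<And>t. t \<in> set ts \<Longrightarrow> \<gamma> t = p) \<Longrightarrow> p \<in> M \<Longrightarrow> chain_length \<gamma> ts = 0"
  by (induction \<gamma> ts rule: chain_length.induct) auto

text \<open>The triangle inequality at the new vertex. Since \<open>t\<close> closes one chain and
  opens the other, the estimate also covers empty \<open>xs\<close> or \<open>ys\<close>, where
  there is no link to replace.\<close>

lemma chain_length_insert:
  assumes "\<And>s. s \<in> set (xs @ t # ys) \<Longrightarrow> \<gamma> s \<in> M"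
  shows "chain_length \<gamma> (xs @ ys) \<le> chain_length \<gamma> (xs @ [t]) + chain_length \<gamma> (t # ys)"
  using assms
proof (induction \<gamma> xs rule: chain_length.induct)
  case (1 \<gamma> x y zs)
  then show ?case by (simp add: add.assoc add_left_mono)
next
  case ("2_1" \<gamma>)
  then show ?case by (cases ys) auto
next
  case ("2_2" \<gamma> v)
  show ?case
  proof (cases ys)
    case (Cons y zs)
    have "ennreal (d (\<gamma> v) (\<gamma> y)) \<le> ennreal (d (\<gamma> v) (\<gamma> t)) + ennreal (d (\<gamma> t) (\<gamma> y))"
      using "2_2" Cons triangle[of "\<gamma> v" "\<gamma> t" "\<gamma> y"] by (simp flip: ennreal_plus)
    then show ?thesis
      using Cons by (simp add: add_right_mono flip: add.assoc)
  qed auto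
qed

lemma curve_length_superadditive:
  assumes "a \<le> t" "t \<le> b"
  shows "curve_length (a, t, \<gamma>) + curve_length (t, b, \<gamma>) \<le> curve_length (a, b, \<gamma>)"
proof -
  let ?S = "\<lambda>a b. {ts::real list. sorted ts \<and> set ts \<subseteq> {a..b}}"
  have ne: "\<And>a b. ?S a b \<noteq> {}"
    by (metis (mono_tags) empty_iff empty_set empty_subsetI mem_Collect_eq sorted0)
  have "chain_length \<gamma> xs + chain_length \<gamma> ys \<le> curve_length (a, b, \<gamma>)"
    if "xs \<in> ?S a t" "ys \<in> ?S t b" for xs ys
  proof -
    have "chain_length \<gamma> (xs @ ys) \<le> curve_length (a, b, \<gamma>)"
      using that assms by (intro chain_length_le_curve_length) (force simp: sorted_append)+
    then show ?thesis using chain_length_append_ge order_trans by blast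
  qed
  then have "chain_length \<gamma> xs + curve_length (t, b, \<gamma>) \<le> curve_length (a, b, \<gamma>)"
    if "xs \<in> ?S a t" for xs
    unfolding curve_length_SUP[of t b]
    by (subst ennreal_SUP_add_right[OF ne], rule SUP_least) (use that in blast)
  then show ?thesis
    unfolding curve_length_SUP[of a t]
    by (subst ennreal_SUP_add_left[OF ne, symmetric], intro SUP_least) blast
qed

lemma curve_length_mono:
  assumes "a' \<le> a" "b \<le> b'"
  shows "curve_length (a, b, \<gamma>) \<le> curve_length (a', b', \<gamma>)"
  unfolding curve_length_SUP using assms by (intro SUP_subset_mono) force+

lemma curve_length_point: "\<gamma> a \<in> M \<Longrightarrow> curve_length (a, a, \<gamma>) = 0"
proof -
  assume "\<gamma> a \<in> M"
  then have "\<And>ts. set ts \<subseteq> {a..a} \<Longrightarrow> chain_length \<gamma> ts \<le> 0"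
    by (subst chain_length_const[where p="\<gamma> a"]) auto
  then show ?thesis
    unfolding curve_length_SUP by (intro antisym SUP_least) auto
qed

lemma sorted_split_at:
  fixes t :: real
  shows "sorted ts \<Longrightarrow> ts = filter (\<lambda>s. s \<le> t) ts @ filter (\<lambda>s. t < s) ts"
proof (induction ts)
  case (Cons a ts)
  show ?case
  proof (cases "a \<le> t")
    case False
    have "filter (\<lambda>s. s \<le> t) (a # ts) = []"
      using Cons.prems False by (subst filter_empty_conv) force
    moreover have "filter (\<lambda>s. t < s) (a # ts) = a # ts"
      using Cons.prems False by (subst filter_id_conv) force
    ultimately show ?thesis by simp
  qed (use Cons in auto)
qed simp

lemma sorted_split_at':
  fixes t :: real
  shows "sorted ts \<Longrightarrow> ts = filter (\<lambda>s. s < t) ts @ filter (\<lambda>s. t \<le> s) ts"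
proof (induction ts)
  case (Cons a ts)
  show ?case
  proof (cases "a < t")
    case False
    have "filter (\<lambda>s. s < t) (a # ts) = []"
      using Cons.prems False by (subst filter_empty_conv) force
    moreover have "filter (\<lambda>s. t \<le> s) (a # ts) = a # ts"
      using Cons.prems False by (subst filter_id_conv) force
    ultimately show ?thesis by simp
  qed (use Cons in auto)
qed simp

text \<open>Inserting \<open>t\<close> as a vertex does not shorten a chain, and the refined chain
  splits at \<open>t\<close>.\<close>

lemma curve_length_subadditive:
  assumes "a \<le> t" "t \<le> b" and M: "\<And>s. s \<in> {a..b} \<Longrightarrow> \<gamma> s \<in> M"
  shows "curve_length (a, b, \<gamma>) \<le> curve_length (a, t, \<gamma>) + curve_length (t, b, \<gamma>)"
  unfolding curve_length_SUP[of a b]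
proof (rule SUP_least, clarify)
  fix ts :: "real list"
  assume ts: "sorted ts" "set ts \<subseteq> {a..b}"
  let ?xs = "filter (\<lambda>s. s \<le> t) ts" and ?ys = "filter (\<lambda>s. t < s) ts"
  have "chain_length \<gamma> ts \<le> chain_length \<gamma> (?xs @ [t]) + chain_length \<gamma> (t # ?ys)"
    by (subst sorted_split_at[OF ts(1), of t], rule chain_length_insert) (use ts assms in auto)
  also have "\<dots> \<le> curve_length (a, t, \<gamma>) + curve_length (t, b, \<gamma>)"
    using ts assms
    by (intro add_mono chain_length_le_curve_length)
       (auto simp: sorted_append sorted_wrt_filter)
  finally show "chain_length \<gamma> ts \<le> curve_length (a, t, \<gamma>) + curve_length (t, b, \<gamma>)" .
qed

lemma curve_length_add:
  assumes "a \<le> t" "t \<le> b" and "\<And>s. s \<in> {a..b} \<Longrightarrow> \<gamma> s \<in> M"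
  shows "curve_length (a, b, \<gamma>) = curve_length (a, t, \<gamma>) + curve_length (t, b, \<gamma>)"
  using curve_length_superadditive curve_length_subadditive assms by (metis order_antisym)

lemma curve_in_carrier: "curve (a, b, \<gamma>) \<Longrightarrow> t \<in> {a..b} \<Longrightarrow> \<gamma> t \<in> M"
  unfolding curve_def continuous_map_def by auto

section \<open>Continuity of arc length\<close>

lemma curve_dist_continuous:
  assumes "curve (a, b, \<gamma>)" "t0 \<in> {a..b}" "0 < e"
  shows "\<exists>\<delta>>0. \<forall>t\<in>{a..b}. \<bar>t - t0\<bar> < \<delta> \<longrightarrow> d (\<gamma> t0) (\<gamma> t) < e"
proof -
  let ?U = "{t \<in> {a..b}. \<gamma> t \<in> mball (\<gamma> t0) e}"
  have "continuous_map (top_of_set {a..b}) mtopology \<gamma>"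
    using assms(1) by (simp add: curve_def)
  then have "openin (top_of_set {a..b}) ?U"
    using openin_continuous_map_preimage[of "top_of_set {a..b}" mtopology \<gamma> "mball (\<gamma> t0) e"] by simp
  moreover have "t0 \<in> ?U"
    using assms curve_in_carrier by auto
  ultimately obtain \<delta> where "\<delta> > 0" "\<And>t. t \<in> {a..b} \<Longrightarrow> dist t t0 < \<delta> \<Longrightarrow> t \<in> ?U"
    unfolding openin_euclidean_subtopology_iff by blast
  then show ?thesis
    by (intro exI[of _ \<delta>]) (auto simp: dist_real_def)
qed

text \<open>Take a chain on \<open>{t0..b}\<close> that is optimal up to \<open>e/2\<close>. If
  \<open>t\<close> lies before its first vertex after \<open>t0\<close>, inserting \<open>t\<close>
  costs one link of length \<open>d (\<gamma> t0) (\<gamma> t) < e/2\<close>, and the remaining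
  chain is bounded by the length from \<open>t\<close> on. Superadditivity then leaves at most
  \<open>e\<close> for \<open>{t0..t}\<close>.\<close>

lemma curve_length_right_continuous:
  assumes c: "curve (a, b, \<gamma>)" "curve_length (a, b, \<gamma>) < \<infinity>" and t0: "t0 \<in> {a..b}" and e: "0 < e"
  shows "\<exists>\<delta>>0. \<forall>t\<in>{t0..b}. t < t0 + \<delta> \<longrightarrow> curve_length (t0, t, \<gamma>) \<le> ennreal e"
proof -
  note M = curve_in_carrier[OF c(1)]
  have fin: "curve_length (s, t, \<gamma>) < \<infinity>" if "a \<le> s" "t \<le> b" for s t
    using curve_length_mono[OF that, of \<gamma>] c(2) by (simp add: order_le_less_trans)
  have "\<exists>ts\<in>{ts. sorted ts \<and> set ts \<subseteq> {t0..b}}.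
      (SUP ts \<in> {ts. sorted ts \<and> set ts \<subseteq> {t0..b}}. chain_length \<gamma> ts) \<le> chain_length \<gamma> ts + ennreal (e/2)"
    using fin[of t0 b] t0 e unfolding curve_length_SUP
    by (intro ennreal_SUP_approx) (auto intro!: exI[of _ "[]"])
  then obtain ts where ts: "sorted ts" "set ts \<subseteq> {t0..b}"
    "curve_length (t0, b, \<gamma>) \<le> chain_length \<gamma> ts + ennreal (e/2)"
    unfolding curve_length_SUP by auto
  define ys where "ys = filter (\<lambda>s. t0 < s) ts"
  have "chain_length \<gamma> ts \<le> chain_length \<gamma> (filter (\<lambda>s. s \<le> t0) ts @ [t0]) + chain_length \<gamma> (t0 # ys)"
    unfolding ys_def
    by (subst sorted_split_at[OF ts(1), of t0], rule chain_length_insert) (use ts t0 M in auto)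
  \<comment> \<open>The chain lies in \<open>{t0..b}\<close>, so its vertices up to
    \<open>t0\<close> are copies of \<open>t0\<close>.\<close>
  also have "chain_length \<gamma> (filter (\<lambda>s. s \<le> t0) ts @ [t0]) = 0"
    using ts(2) M t0 by (intro chain_length_const[where p="\<gamma> t0"]) (auto simp: subset_iff dest: antisym)
  finally have ge: "curve_length (t0, b, \<gamma>) \<le> chain_length \<gamma> (t0 # ys) + ennreal (e/2)"
    using ts(3) by (metis add.left_neutral add_right_mono order_trans)
  obtain \<delta>1 where \<delta>1: "\<delta>1 > 0" "\<And>t. t \<in> {a..b} \<Longrightarrow> \<bar>t - t0\<bar> < \<delta>1 \<Longrightarrow> d (\<gamma> t0) (\<gamma> t) < e / 2"
    using curve_dist_continuous[OF c(1) t0, of "e/2"] e by auto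
  \<comment> \<open>The distance from \<open>t0\<close> to the next vertex; the inserted
    \<open>1\<close> keeps \<open>Min\<close> meaningful if there is none.\<close>
  define \<delta>2 where "\<delta>2 = Min (insert 1 ((\<lambda>s. s - t0) ` set ys))"
  have "\<delta>2 > 0"
    unfolding \<delta>2_def ys_def by (subst Min_gr_iff) auto
  have \<delta>2: "s \<ge> t0 + \<delta>2" if "s \<in> set ys" for s
  proof -
    have "\<delta>2 \<le> s - t0" unfolding \<delta>2_def by (rule Min_le) (use that in auto)
    then show ?thesis by simp
  qed
  have "curve_length (t0, t, \<gamma>) \<le> ennreal e" if t: "t \<in> {t0..b}" "t < t0 + min \<delta>1 \<delta>2" for t
  proof -
    have "t \<in> {a..b}" using t t0 by auto
    have d: "d (\<gamma> t0) (\<gamma> t) < e / 2"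
      using \<delta>1(2)[OF \<open>t \<in> {a..b}\<close>] t by auto
    have sorted: "sorted (t # ys)"
      using ts(1) \<delta>2 t unfolding ys_def by (fastforce simp: sorted_wrt_filter)
    have sub: "set ys \<subseteq> {t0..b}" using ts by (auto simp: ys_def)
    have in_ab: "s \<in> {a..b}" if "s \<in> set ([t0] @ t # ys)" for s
      using that sub t0 \<open>t \<in> {a..b}\<close> by auto
    have "chain_length \<gamma> (t0 # ys) \<le> chain_length \<gamma> ([t0] @ [t]) + chain_length \<gamma> (t # ys)"
      using chain_length_insert[of "[t0]" t ys \<gamma>, OF M[OF in_ab]] by auto
    also have "\<dots> \<le> ennreal (e/2) + curve_length (t, b, \<gamma>)"
    proof (rule add_mono)
      show "chain_length \<gamma> ([t0] @ [t]) \<le> ennreal (e/2)"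
        using d by (simp add: ennreal_leI)
      show "chain_length \<gamma> (t # ys) \<le> curve_length (t, b, \<gamma>)"
        using sorted sub t by (intro chain_length_le_curve_length) auto
    qed
    finally have "curve_length (t0, b, \<gamma>) \<le> ennreal (e/2) + curve_length (t, b, \<gamma>) + ennreal (e/2)"
      using ge by (meson add_right_mono order_trans)
    also have "\<dots> = ennreal e + curve_length (t, b, \<gamma>)"
      using e by (simp add: ac_simps flip: ennreal_plus)
    finally have "curve_length (t0, t, \<gamma>) + curve_length (t, b, \<gamma>) \<le> ennreal e + curve_length (t, b, \<gamma>)"
      using curve_length_superadditive[of t0 t b \<gamma>] t by (meson atLeastAtMost_iff order_trans)
    moreover have "curve_length (t, b, \<gamma>) \<noteq> \<infinity>"
      using fin[of t b] \<open>t \<in> {a..b}\<close> by auto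
    ultimately show ?thesis
      by (metis add.commute ennreal_add_left_cancel_le infinity_ennreal_def)
  qed
  then show ?thesis
    using \<open>\<delta>1 > 0\<close> \<open>\<delta>2 > 0\<close> by (intro exI[of _ "min \<delta>1 \<delta>2"]) auto
qed

text \<open>The mirror image of \<open>curve_length_right_continuous\<close>, with the last vertex
  before \<open>t0\<close> in place of the first one after it.\<close>

lemma curve_length_left_continuous:
  assumes c: "curve (a, b, \<gamma>)" "curve_length (a, b, \<gamma>) < \<infinity>" and t0: "t0 \<in> {a..b}" and e: "0 < e"
  shows "\<exists>\<delta>>0. \<forall>t\<in>{a..t0}. t0 - \<delta> < t \<longrightarrow> curve_length (t, t0, \<gamma>) \<le> ennreal e"
proof -
  note M = curve_in_carrier[OF c(1)]
  have fin: "curve_length (s, t, \<gamma>) < \<infinity>" if "a \<le> s" "t \<le> b" for s t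
    using curve_length_mono[OF that, of \<gamma>] c(2) by (simp add: order_le_less_trans)
  have "\<exists>ts\<in>{ts. sorted ts \<and> set ts \<subseteq> {a..t0}}.
      (SUP ts \<in> {ts. sorted ts \<and> set ts \<subseteq> {a..t0}}. chain_length \<gamma> ts) \<le> chain_length \<gamma> ts + ennreal (e/2)"
    using fin[of a t0] t0 e unfolding curve_length_SUP
    by (intro ennreal_SUP_approx) (auto intro!: exI[of _ "[]"])
  then obtain ts where ts: "sorted ts" "set ts \<subseteq> {a..t0}"
    "curve_length (a, t0, \<gamma>) \<le> chain_length \<gamma> ts + ennreal (e/2)"
    unfolding curve_length_SUP by auto
  define ys where "ys = filter (\<lambda>s. s < t0) ts"
  have "chain_length \<gamma> ts \<le> chain_length \<gamma> (ys @ [t0]) + chain_length \<gamma> (t0 # filter (\<lambda>s. t0 \<le> s) ts)"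
    unfolding ys_def
    by (subst sorted_split_at'[OF ts(1), of t0], rule chain_length_insert) (use ts t0 M in auto)
  also have "chain_length \<gamma> (t0 # filter (\<lambda>s. t0 \<le> s) ts) = 0"
    using ts(2) M t0 by (intro chain_length_const[where p="\<gamma> t0"]) (auto simp: subset_iff dest: antisym)
  finally have ge: "curve_length (a, t0, \<gamma>) \<le> chain_length \<gamma> (ys @ [t0]) + ennreal (e/2)"
    using ts(3) by (metis add.right_neutral add_right_mono order_trans)
  obtain \<delta>1 where \<delta>1: "\<delta>1 > 0" "\<And>t. t \<in> {a..b} \<Longrightarrow> \<bar>t - t0\<bar> < \<delta>1 \<Longrightarrow> d (\<gamma> t0) (\<gamma> t) < e / 2"
    using curve_dist_continuous[OF c(1) t0, of "e/2"] e by auto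
  define \<delta>2 where "\<delta>2 = Min (insert 1 ((\<lambda>s. t0 - s) ` set ys))"
  have "\<delta>2 > 0"
    unfolding \<delta>2_def ys_def by (subst Min_gr_iff) auto
  have \<delta>2: "s \<le> t0 - \<delta>2" if "s \<in> set ys" for s
  proof -
    have "\<delta>2 \<le> t0 - s" unfolding \<delta>2_def by (rule Min_le) (use that in auto)
    then show ?thesis by simp
  qed
  have "curve_length (t, t0, \<gamma>) \<le> ennreal e" if t: "t \<in> {a..t0}" "t0 - min \<delta>1 \<delta>2 < t" for t
  proof -
    have "t \<in> {a..b}" using t t0 by auto
    have d: "d (\<gamma> t) (\<gamma> t0) < e / 2"
      using \<delta>1(2)[OF \<open>t \<in> {a..b}\<close>] t by (auto simp: commute)
    have sorted: "sorted (ys @ [t])"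
      using ts(1) \<delta>2 t unfolding ys_def by (fastforce simp: sorted_wrt_filter sorted_append)
    have sub: "set ys \<subseteq> {a..t0}" using ts by (auto simp: ys_def)
    have in_ab: "s \<in> {a..b}" if "s \<in> set (ys @ t # [t0])" for s
      using that sub t0 \<open>t \<in> {a..b}\<close> by auto
    have "chain_length \<gamma> (ys @ [t0]) \<le> chain_length \<gamma> (ys @ [t]) + chain_length \<gamma> (t # [t0])"
      using chain_length_insert[of ys t "[t0]" \<gamma>, OF M[OF in_ab]] by auto
    also have "\<dots> \<le> curve_length (a, t, \<gamma>) + ennreal (e/2)"
    proof (rule add_mono)
      show "chain_length \<gamma> (t # [t0]) \<le> ennreal (e/2)"
        using d by (simp add: ennreal_leI)
      show "chain_length \<gamma> (ys @ [t]) \<le> curve_length (a, t, \<gamma>)"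
        using sorted sub t by (intro chain_length_le_curve_length) (auto simp: sorted_append)
    qed
    finally have "curve_length (a, t0, \<gamma>) \<le> curve_length (a, t, \<gamma>) + ennreal (e/2) + ennreal (e/2)"
      using ge by (meson add_right_mono order_trans)
    also have "\<dots> = curve_length (a, t, \<gamma>) + ennreal e"
      using e by (simp add: add.assoc flip: ennreal_plus)
    finally have "curve_length (a, t, \<gamma>) + curve_length (t, t0, \<gamma>) \<le> curve_length (a, t, \<gamma>) + ennreal e"
      using curve_length_superadditive[of a t t0 \<gamma>] t by (meson atLeastAtMost_iff order_trans)
    moreover have "curve_length (a, t, \<gamma>) \<noteq> \<infinity>"
      using fin[of a t] \<open>t \<in> {a..b}\<close> by auto
    ultimately show ?thesis
      by (metis ennreal_add_left_cancel_le infinity_ennreal_def)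
  qed
  then show ?thesis
    using \<open>\<delta>1 > 0\<close> \<open>\<delta>2 > 0\<close> by (intro exI[of _ "min \<delta>1 \<delta>2"]) auto
qed

text \<open>The intermediate value theorem for arc length. It provides the witness for the choice
  made in \<open>arc_length_param\<close>.\<close>

lemma curve_length_surj:
  assumes c: "curve (a, b, \<gamma>)" "curve_length (a, b, \<gamma>) < \<infinity>"
    and s: "0 \<le> s" "ennreal s \<le> curve_length (a, b, \<gamma>)"
  shows "\<exists>t\<in>{a..b}. curve_length (a, t, \<gamma>) = ennreal s"
proof -
  define l where "l t = enn2real (curve_length (a, t, \<gamma>))" for t
  note M = curve_in_carrier[OF c(1)]
  have ab: "a \<le> b" using c(1) by (auto simp: curve_def)
  have fin: "curve_length (s, t, \<gamma>) < \<infinity>" if "a \<le> s" "t \<le> b" for s t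
    using curve_length_mono[OF that, of \<gamma>] c(2) by (simp add: order_le_less_trans)
  have l_eq: "ennreal (l t) = curve_length (a, t, \<gamma>)" if "t \<in> {a..b}" for t
    unfolding l_def using fin[of a t] that by simp
  have diff: "l t' - l t = enn2real (curve_length (t, t', \<gamma>))" if "t \<in> {a..b}" "t' \<in> {a..b}" "t \<le> t'" for t t'
  proof -
    have "curve_length (a, t', \<gamma>) = curve_length (a, t, \<gamma>) + curve_length (t, t', \<gamma>)"
      using that M by (intro curve_length_add) auto
    then show ?thesis unfolding l_def using fin[of a t] fin[of t t'] that by (simp add: enn2real_plus)
  qed
  have "continuous_on {a..b} l"
    unfolding continuous_on_iff
  proof (intro ballI allI impI)
    fix t0 e :: real assume t0: "t0 \<in> {a..b}" and e: "0 < e"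
    obtain \<delta>1 where \<delta>1: "\<delta>1 > 0" "\<And>t. t \<in> {t0..b} \<Longrightarrow> t < t0 + \<delta>1 \<Longrightarrow> curve_length (t0, t, \<gamma>) \<le> ennreal (e/2)"
      using curve_length_right_continuous[OF c t0, of "e/2"] e by auto
    obtain \<delta>2 where \<delta>2: "\<delta>2 > 0" "\<And>t. t \<in> {a..t0} \<Longrightarrow> t0 - \<delta>2 < t \<Longrightarrow> curve_length (t, t0, \<gamma>) \<le> ennreal (e/2)"
      using curve_length_left_continuous[OF c t0, of "e/2"] e by auto
    have "dist (l t) (l t0) < e" if "t \<in> {a..b}" "dist t t0 < min \<delta>1 \<delta>2" for t
    proof (cases "t0 \<le> t")
      case True
      then have "curve_length (t0, t, \<gamma>) \<le> ennreal (e/2)"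
        using that by (intro \<delta>1) (auto simp: dist_real_def)
      then have "enn2real (curve_length (t0, t, \<gamma>)) \<le> e/2" using e by (intro enn2real_leI) auto
      then show ?thesis using diff[OF t0 that(1) True] e enn2real_nonneg[of "curve_length (t0, t, \<gamma>)"]
        by (auto simp: dist_real_def simp del: enn2real_nonneg)
    next
      case False
      then have "curve_length (t, t0, \<gamma>) \<le> ennreal (e/2)"
        using that by (intro \<delta>2) (auto simp: dist_real_def)
      then have "enn2real (curve_length (t, t0, \<gamma>)) \<le> e/2" using e by (intro enn2real_leI) auto
      then show ?thesis using diff[OF that(1) t0] False e enn2real_nonneg[of "curve_length (t, t0, \<gamma>)"]
        by (auto simp: dist_real_def simp del: enn2real_nonneg)
    qed
    then show "\<exists>\<delta>>0. \<forall>t\<in>{a..b}. dist t t0 < \<delta> \<longrightarrow> dist (l t) (l t0) < e"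
      using \<delta>1(1) \<delta>2(1) by (intro exI[of _ "min \<delta>1 \<delta>2"]) auto
  qed
  moreover have "l a \<le> s"
    using s(1) ab M curve_length_point[of \<gamma> a] by (simp add: l_def)
  moreover have "s \<le> l b"
    using s(2) l_eq[of b] ab s(1) by (metis atLeastAtMost_iff ennreal_le_iff2 enn2real_nonneg l_def order_refl order_trans)
  ultimately obtain t where "a \<le> t" "t \<le> b" "l t = s"
    using IVT'[of l a s b] ab by auto
  then show ?thesis using l_eq[of t] by auto
qed

section \<open>Parametrisation by arc length\<close>

definition arc_length_curve :: "real \<Rightarrow> (real \<Rightarrow> 'a) \<Rightarrow> bool" where
  "arc_length_curve l \<Gamma> \<longleftrightarrow> 0 \<le> l \<and> (\<forall>s\<in>{0..l}. \<Gamma> s \<in> M) \<and>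
     (\<forall>s t. 0 \<le> s \<longrightarrow> s \<le> t \<longrightarrow> t \<le> l \<longrightarrow> curve_length (s, t, \<Gamma>) = ennreal (t - s))"

lemma chain_length_le_Lipschitz:
  assumes "\<And>s t. s \<in> S \<Longrightarrow> t \<in> S \<Longrightarrow> s \<le> t \<Longrightarrow> d (\<Gamma> s) (\<Gamma> t) \<le> t - s" "sorted ts" "set ts \<subseteq> S" "ts \<noteq> []"
  shows "chain_length \<Gamma> ts \<le> ennreal (last ts - hd ts)"
  using assms
proof (induction \<Gamma> ts rule: chain_length.induct)
  case (1 \<gamma> x y zs)
  have "chain_length \<gamma> (x # y # zs) \<le> ennreal (y - x) + ennreal (last (y # zs) - y)"
    using 1 by (auto intro!: add_mono ennreal_leI)
  also have "\<dots> = ennreal (last (y # zs) - x)"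
    using 1(3) last_in_set[of "y # zs"] by (subst ennreal_plus[symmetric]) auto
  finally show ?case by simp
qed auto

text \<open>Two parameters with the same arc length bound a piece of length 0, so
  \<open>\<gamma>\<close> agrees at both and the choice in \<open>arc_length_param\<close> is
  immaterial: \<open>\<Gamma> (L t) = \<gamma> t\<close>. A piece of \<open>\<Gamma>\<close> is no
  longer than its parameter interval because \<open>\<Gamma>\<close> is 1-Lipschitz, and no shorter
  because \<open>L\<close> carries chains of \<open>\<gamma>\<close> to chains of
  \<open>\<Gamma>\<close>.\<close>

lemma arc_length_paramE:
  assumes c: "curve (a, b, \<gamma>)" "curve_length (a, b, \<gamma>) < \<infinity>"
  obtains l \<Gamma> where "arc_length_curve l \<Gamma>" "\<Gamma> = arc_length_param (a, b, \<gamma>)"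
    "l = enn2real (curve_length (a, b, \<gamma>))" "\<Gamma> 0 = \<gamma> a" "\<Gamma> l = \<gamma> b"
proof -
  note M = curve_in_carrier[OF c(1)]
  have ab: "a \<le> b" using c(1) by (auto simp: curve_def)
  have fin: "curve_length (s, t, \<gamma>) < \<infinity>" if "a \<le> s" "t \<le> b" for s t
    using curve_length_mono[OF that, of \<gamma>] c(2) by (simp add: order_le_less_trans)
  define L where "L t = enn2real (curve_length (a, t, \<gamma>))" for t
  have L_eq: "ennreal (L t) = curve_length (a, t, \<gamma>)" if "t \<in> {a..b}" for t
    unfolding L_def using fin[of a t] that by simp
  have L_nn: "0 \<le> L t" for t by (simp add: L_def)
  have diff: "curve_length (t, t', \<gamma>) = ennreal (L t' - L t)" "L t \<le> L t'"
    if "t \<in> {a..b}" "t' \<in> {a..b}" "t \<le> t'" for t t'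
  proof -
    have eq: "curve_length (a, t', \<gamma>) = curve_length (a, t, \<gamma>) + curve_length (t, t', \<gamma>)"
      using that M by (intro curve_length_add) auto
    then have "L t' - L t = enn2real (curve_length (t, t', \<gamma>))"
      unfolding L_def using fin[of a t] fin[of t t'] that by (simp add: enn2real_plus)
    then show "curve_length (t, t', \<gamma>) = ennreal (L t' - L t)" "L t \<le> L t'"
      using fin[of t t'] that enn2real_nonneg[of "curve_length (t, t', \<gamma>)"]
      by (auto simp del: enn2real_nonneg) 
  qed
  define \<Gamma> where "\<Gamma> = arc_length_param (a, b, \<gamma>)"
  define l where "l = L b"
  have \<Gamma>_ex: "\<exists>t\<in>{a..b}. L t = s \<and> \<Gamma> s = \<gamma> t" if "s \<in> {0..l}" for s
  proof -
    have "ennreal s \<le> curve_length (a, b, \<gamma>)"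
      using that L_eq[of b] ab unfolding l_def by (metis atLeastAtMost_iff ennreal_leI order_refl)
    then have "\<exists>t. t \<in> {a..b} \<and> curve_length (a, t, \<gamma>) = ennreal s"
      using curve_length_surj[OF c, of s] that by auto
    then have "(SOME t. t \<in> {a..b} \<and> curve_length (a, t, \<gamma>) = ennreal s) \<in> {a..b} \<and>
      curve_length (a, (SOME t. t \<in> {a..b} \<and> curve_length (a, t, \<gamma>) = ennreal s), \<gamma>) = ennreal s"
      by (rule someI_ex)
    then show ?thesis
      unfolding \<Gamma>_def arc_length_param_def using that
      by (intro bexI[of _ "SOME t. t \<in> {a..b} \<and> curve_length (a, t, \<gamma>) = ennreal s"]) (auto simp: L_def)
  qed
  have \<Gamma>_L: "\<Gamma> (L t) = \<gamma> t" if t: "t \<in> {a..b}" for t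
  proof -
    have "L t \<in> {0..l}" using diff(2)[OF t, of b] t ab L_nn by (auto simp: l_def)
    then obtain t' where t': "t' \<in> {a..b}" "L t' = L t" "\<Gamma> (L t) = \<gamma> t'"
      using \<Gamma>_ex by blast
    have "curve_length (min t t', max t t', \<gamma>) = 0"
      using diff(1)[of "min t t'" "max t t'"] t t' by (auto simp: min_def max_def split: if_splits)
    then have "d (\<gamma> (min t t')) (\<gamma> (max t t')) = 0"
      using dist_le_curve_length[of "min t t'" "max t t'" \<gamma>] by (simp add: antisym)
    then show ?thesis
      using t' t M zero by (cases "t \<le> t'") (auto simp: min_def max_def)
  qed
  have Lip: "d (\<Gamma> s) (\<Gamma> s') \<le> s' - s" if "s \<in> {0..l}" "s' \<in> {0..l}" "s \<le> s'" for s s'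
  proof -
    obtain t t' where t: "t \<in> {a..b}" "L t = s" "\<Gamma> s = \<gamma> t" "t' \<in> {a..b}" "L t' = s'" "\<Gamma> s' = \<gamma> t'"
      using \<Gamma>_ex \<open>s \<in> _\<close> \<open>s' \<in> _\<close> by metis
    show ?thesis
    proof (cases "t \<le> t'")
      case True
      then have "ennreal (d (\<gamma> t) (\<gamma> t')) \<le> ennreal (s' - s)"
        using dist_le_curve_length[of t t' \<gamma>] diff(1)[of t t'] t by simp
      then show ?thesis using t that by (subst (asm) ennreal_le_iff) auto
    next
      case False
      then have "s' = s" using diff(2)[of t' t] t that by auto
      then show ?thesis using t M by (metis diff_self mdist_zero order_refl)
    qed
  qed
  have "curve_length (s, s', \<Gamma>) = ennreal (s' - s)" if s: "0 \<le> s" "s \<le> s'" "s' \<le> l" for s s'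
  proof (rule antisym)
    show "curve_length (s, s', \<Gamma>) \<le> ennreal (s' - s)"
      unfolding curve_length_SUP
    proof (rule SUP_least, clarify)
      fix ts assume ts: "sorted ts" "set ts \<subseteq> {s..s'}"
      show "chain_length \<Gamma> ts \<le> ennreal (s' - s)"
      proof (cases "ts = []")
        case False
        have "chain_length \<Gamma> ts \<le> ennreal (last ts - hd ts)"
          using ts s False by (intro chain_length_le_Lipschitz[where S="{0..l}"] Lip) auto
        also have "\<dots> \<le> ennreal (s' - s)"
          using ts False hd_in_set[of ts] last_in_set[of ts] by (intro ennreal_leI) (auto simp: subset_iff intro!: diff_mono)
        finally show ?thesis .
      qed auto
    qed
    obtain t where t: "t \<in> {a..b}" "L t = s" using \<Gamma>_ex[of s] s by auto
    obtain t' where t': "t' \<in> {a..b}" "L t' = s'" using \<Gamma>_ex[of s'] s by auto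
    show "ennreal (s' - s) \<le> curve_length (s, s', \<Gamma>)"
    proof (cases "t \<le> t'")
      case True
      have "curve_length (t, t', \<gamma>) \<le> curve_length (s, s', \<Gamma>)"
        unfolding curve_length_SUP[of t t']
      proof (rule SUP_least, clarify)
        fix ts assume ts: "sorted ts" "set ts \<subseteq> {t..t'}"
        then have ts': "set ts \<subseteq> {a..b}" using t t' by auto
        have "chain_length \<gamma> ts = chain_length \<Gamma> (map L ts)"
          using ts' \<Gamma>_L by (induction \<gamma> ts rule: chain_length.induct) auto
        also have "\<dots> \<le> curve_length (s, s', \<Gamma>)"
        proof (rule chain_length_le_curve_length)
          show "sorted (map L ts)"
            unfolding sorted_map
            by (rule sorted_wrt_mono_rel[OF _ ts(1)], rule diff(2)) (use ts' in auto)
          show "set (map L ts) \<subseteq> {s..s'}"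
          proof
            fix x assume "x \<in> set (map L ts)"
            then obtain q where q: "q \<in> set ts" "x = L q" by auto
            then show "x \<in> {s..s'}"
              using ts ts' t t' diff(2)[of t q] diff(2)[of q t'] by auto
          qed
        qed
        finally show "chain_length \<gamma> ts \<le> curve_length (s, s', \<Gamma>)" .
      qed
      then show ?thesis using diff(1)[of t t'] t t' True by simp
    next
      case False
      then have "s' = s" using diff(2)[of t' t] t t' s by auto
      then show ?thesis by simp
    qed
  qed
  moreover have "\<Gamma> s \<in> M" if "s \<in> {0..l}" for s
    using \<Gamma>_ex[OF that] M by auto
  ultimately have "arc_length_curve l \<Gamma>"
    unfolding arc_length_curve_def by (auto simp: l_def L_nn)
  moreover have "\<Gamma> 0 = \<gamma> a"
    using \<Gamma>_L[of a] ab curve_length_point[of \<gamma> a] M by (auto simp: L_def)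
  moreover have "\<Gamma> l = \<gamma> b" using \<Gamma>_L[of b] ab by (auto simp: l_def)
  ultimately show ?thesis
    using that[of l \<Gamma>] by (simp add: \<Gamma>_def l_def L_def)
qed

lemma arc_length_curve_dist:
  assumes "arc_length_curve l \<Gamma>" "0 \<le> s" "s \<le> t" "t \<le> l"
  shows "d (\<Gamma> s) (\<Gamma> t) \<le> t - s"
  using dist_le_curve_length[of s t \<Gamma>] assms by (auto simp: arc_length_curve_def)

lemma arc_length_curve_continuous:
  assumes "arc_length_curve l \<Gamma>"
  shows "continuous_map (top_of_set {0..l}) mtopology \<Gamma>"
proof -
  have M: "\<And>s. s \<in> {0..l} \<Longrightarrow> \<Gamma> s \<in> M" using assms by (auto simp: arc_length_curve_def)
  have dist: "d (\<Gamma> s) (\<Gamma> t) \<le> \<bar>t - s\<bar>" if "s \<in> {0..l}" "t \<in> {0..l}" for s t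
    using arc_length_curve_dist[OF assms, of s t] arc_length_curve_dist[OF assms, of t s] that
    by (cases "s \<le> t") (auto simp: commute)
  have "openin (top_of_set {0..l}) {t \<in> {0..l}. \<Gamma> t \<in> U}" if U: "openin mtopology U" for U
    unfolding openin_euclidean_subtopology_iff
  proof (intro conjI ballI)
    fix t assume t: "t \<in> {t \<in> {0..l}. \<Gamma> t \<in> U}"
    obtain r where r: "r > 0" "mball (\<Gamma> t) r \<subseteq> U"
      using U t by (auto simp: openin_mtopology)
    show "\<exists>e>0. \<forall>x'\<in>{0..l}. dist x' t < e \<longrightarrow> x' \<in> {t \<in> {0..l}. \<Gamma> t \<in> U}"
    proof (intro exI[of _ r] conjI ballI impI)
      fix x' assume x': "x' \<in> {0..l}" "dist x' t < r"
      then have "\<Gamma> x' \<in> mball (\<Gamma> t) r"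
        using t M dist[of t x'] by (auto simp: dist_real_def)
      then show "x' \<in> {t \<in> {0..l}. \<Gamma> t \<in> U}" using r x' by auto
    qed (use r in auto)
  qed auto
  then show ?thesis
    by (auto simp: continuous_map_def M)
qed

lemma arc_length_curve_subcurve:
  assumes "arc_length_curve l \<Gamma>" "0 \<le> s" "s \<le> t" "t \<le> l"
  shows "rectifiable_curve (s, t, \<Gamma>)"
  using continuous_map_from_subtopology_mono[OF arc_length_curve_continuous[OF assms(1)], of "{s..t}"] assms
  unfolding rectifiable_curve_def curve_def
  by (auto simp: arc_length_curve_def)

end

section \<open>Upper gradients along arc length curves\<close>

lemma ennreal_power2_add_le: "(x + y)\<^sup>2 \<le> 2 * x\<^sup>2 + 2 * (y\<^sup>2 :: ennreal)"
proof (cases "x = \<infinity> \<or> y = \<infinity>")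
  case True
  then show ?thesis by (auto simp: ennreal_mult_eq_top_iff power2_eq_square)
next
  case False
  then obtain a b where ab: "x = ennreal a" "y = ennreal b" "0 \<le> a" "0 \<le> b"
    by (metis ennreal_cases infinity_ennreal_def)
  have "(a + b)\<^sup>2 \<le> 2 * a\<^sup>2 + 2 * b\<^sup>2"
    using zero_le_power2[of "a - b"] by (simp add: power2_eq_square algebra_simps)
  then have "ennreal ((a + b)\<^sup>2) \<le> ennreal (2 * a\<^sup>2 + 2 * b\<^sup>2)"
    by (rule ennreal_leI)
  moreover have "ennreal (2 * a\<^sup>2 + 2 * b\<^sup>2) = 2 * x\<^sup>2 + 2 * y\<^sup>2"
    using ab by (simp add: ennreal_mult ennreal_power)
  moreover have "ennreal ((a + b)\<^sup>2) = (x + y)\<^sup>2"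
    using ab by (simp add: ennreal_power flip: ennreal_plus)
  ultimately show ?thesis by simp
qed

text \<open>Splitting off the first term doubles the weight of all later ones. The geometric weights
  replace Cauchy-Schwarz; wherever the estimate is used, the terms decay fast enough to absorb
  them.\<close>

lemma sum_power2_le_ennreal:
  fixes a :: "nat \<Rightarrow> ennreal"
  shows "(\<Sum>i<n. a i)\<^sup>2 \<le> (\<Sum>i<n. 2 ^ Suc i * (a i)\<^sup>2)"
proof (induction n arbitrary: a)
  case (Suc n)
  have "(\<Sum>i<Suc n. a i)\<^sup>2 = (a 0 + (\<Sum>i<n. a (Suc i)))\<^sup>2"
    by (simp add: sum.lessThan_Suc_shift del: sum.lessThan_Suc)
  also have "\<dots> \<le> 2 * (a 0)\<^sup>2 + 2 * (\<Sum>i<n. a (Suc i))\<^sup>2"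
    by (rule ennreal_power2_add_le)
  also have "\<dots> \<le> 2 * (a 0)\<^sup>2 + 2 * (\<Sum>i<n. 2 ^ Suc i * (a (Suc i))\<^sup>2)"
    by (intro add_left_mono mult_left_mono Suc) auto
  also have "\<dots> = (\<Sum>i<Suc n. 2 ^ Suc i * (a i)\<^sup>2)"
    by (simp add: sum.lessThan_Suc_shift sum_distrib_left mult.assoc del: sum.lessThan_Suc)
  finally show ?case .
qed simp

lemma suminf_power2_le_ennreal:
  fixes a :: "nat \<Rightarrow> ennreal"
  shows "(\<Sum>i. a i)\<^sup>2 \<le> (\<Sum>i. 2 ^ Suc i * (a i)\<^sup>2)"
proof -
  define S where "S n = (\<Sum>i<n. a i)" for n
  let ?c = "\<Sum>i. 2 ^ Suc i * (a i)\<^sup>2"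
  have "S m * S n \<le> ?c" for m n
  proof -
    have "S m * S n \<le> S (max m n) * S (max m n)"
      unfolding S_def by (intro mult_mono sum_mono2) auto
    also have "\<dots> \<le> (\<Sum>i<max m n. 2 ^ Suc i * (a i)\<^sup>2)"
      using sum_power2_le_ennreal[of a "max m n"] by (simp add: S_def power2_eq_square)
    also have "\<dots> \<le> ?c" by (rule sum_le_suminf) auto
    finally show ?thesis .
  qed
  then have "(SUP m. SUP n. S m * S n) \<le> ?c" by (intro SUP_least)
  also have "(SUP m. SUP n. S m * S n) = (SUP n. S n) * (SUP n. S n)"
    by (subst SUP_mult_left_ennreal[symmetric], subst SUP_mult_right_ennreal) (rule refl)
  also have "(SUP n. S n) = (\<Sum>i. a i)" unfolding S_def by (rule suminf_eq_SUP[symmetric])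
  finally show ?thesis by (simp add: power2_eq_square)
qed

text \<open>On a fine tagged division each piece is charged to whichever of \<open>G1\<close> and
  \<open>G2\<close> is smaller at the tag. The Henstock lemma bounds the accumulated error of each
  function over any choice of pieces, so the mixed sum is a Riemann sum of the minimum up to
  \<open>e\<close>. No derivative of \<open>\<phi>\<close> is taken.\<close>

lemma abs_diff_le_integral_min:
  fixes \<phi> G1 G2 :: "real \<Rightarrow> real"
  assumes ab: "a \<le> b"
    and int: "G1 integrable_on {a..b}" "G2 integrable_on {a..b}" "(\<lambda>x. min (G1 x) (G2 x)) integrable_on {a..b}"
    and le: "\<And>s t. a \<le> s \<Longrightarrow> s \<le> t \<Longrightarrow> t \<le> b \<Longrightarrow> \<bar>\<phi> t - \<phi> s\<bar> \<le> integral {s..t} G1"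
      "\<And>s t. a \<le> s \<Longrightarrow> s \<le> t \<Longrightarrow> t \<le> b \<Longrightarrow> \<bar>\<phi> t - \<phi> s\<bar> \<le> integral {s..t} G2"
  shows "\<bar>\<phi> b - \<phi> a\<bar> \<le> integral {a..b} (\<lambda>x. min (G1 x) (G2 x))"
proof (rule field_le_epsilon)
  fix e :: real assume "0 < e"
  then have e: "e / 3 > 0" by simp
  let ?m = "\<lambda>x. min (G1 x) (G2 x)"
  note int' = int[unfolded cbox_interval[symmetric]]
  obtain g1 where g1: "gauge g1" "\<And>p. p tagged_partial_division_of cbox a b \<Longrightarrow> g1 fine p \<Longrightarrow>
    (\<Sum>(x,k)\<in>p. norm (measure lborel k *\<^sub>R G1 x - integral k G1)) < e / 3"
    using Henstock_lemma[OF int'(1) e] by blast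
  obtain g2 where g2: "gauge g2" "\<And>p. p tagged_partial_division_of cbox a b \<Longrightarrow> g2 fine p \<Longrightarrow>
    (\<Sum>(x,k)\<in>p. norm (measure lborel k *\<^sub>R G2 x - integral k G2)) < e / 3"
    using Henstock_lemma[OF int'(2) e] by blast
  obtain g3 where g3: "gauge g3" "\<forall>p. p tagged_division_of cbox a b \<and> g3 fine p \<longrightarrow>
    norm ((\<Sum>(x,k)\<in>p. measure lborel k *\<^sub>R ?m x) - integral (cbox a b) ?m) < e / 3"
    using has_integral[THEN iffD1, OF integrable_integral[OF int'(3)], rule_format, OF e]
    by (elim exE conjE) (rule that)
  have "gauge (\<lambda>x. g1 x \<inter> g2 x \<inter> g3 x)" using g1(1) g2(1) g3(1) by (intro gauge_Int) auto
  then obtain p where p: "p tagged_division_of cbox a b" "(\<lambda>x. g1 x \<inter> g2 x \<inter> g3 x) fine p"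
    using fine_division_exists by blast
  then have fine: "g1 fine p" "g2 fine p" "g3 fine p" by (auto simp: fine_Int)
  have part: "p tagged_partial_division_of cbox a b" using p(1) by (simp add: tagged_division_of_def)
  let ?E = "\<lambda>G x k. norm (measure lborel k *\<^sub>R G x - integral k G)"
  \<comment> \<open>\<open>Inf k\<close> and \<open>Sup k\<close> are the end points of the piece,
    so the increments telescope over the division. Both errors are kept because the choice between
    \<open>G1\<close> and \<open>G2\<close> varies with the tag.\<close>
  have piece: "\<bar>\<phi> (Sup k) - \<phi> (Inf k)\<bar> \<le> measure lborel k *\<^sub>R ?m x + (?E G1 x k + ?E G2 x k)" if xk_in: "(x,k) \<in> p" for x k
  proof -
    obtain u v where k: "k = cbox u v" using tagged_division_ofD(4)[OF p(1) xk_in] by blast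
    have xk: "x \<in> k" "k \<subseteq> cbox a b" using tagged_division_ofD(2,3)[OF p(1) xk_in] by auto
    then have uv: "u \<le> v" "a \<le> u" "v \<le> b" using k by auto
    then have S: "Sup k = v" "Inf k = u" using k by auto
    have "\<bar>\<phi> v - \<phi> u\<bar> \<le> integral k G1" "\<bar>\<phi> v - \<phi> u\<bar> \<le> integral k G2"
      using le[of u v] uv k by auto
    then show ?thesis
      unfolding S by (cases "G1 x \<le> G2 x") (auto simp: min_def)
  qed
  have "\<bar>\<phi> b - \<phi> a\<bar> = \<bar>\<Sum>(x,k)\<in>p. \<phi> (Sup k) - \<phi> (Inf k)\<bar>"
    using additive_tagged_division_1[OF ab, of p \<phi>] p(1) by simp
  also have "\<dots> \<le> (\<Sum>(x,k)\<in>p. measure lborel k *\<^sub>R ?m x + (?E G1 x k + ?E G2 x k))"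
    by (rule order_trans[OF sum_abs]) (rule sum_mono, use piece in force)
  also have "\<dots> = (\<Sum>(x,k)\<in>p. measure lborel k *\<^sub>R ?m x) + ((\<Sum>(x,k)\<in>p. ?E G1 x k) + (\<Sum>(x,k)\<in>p. ?E G2 x k))"
    by (simp add: sum.distrib split_def)
  also have "\<dots> \<le> integral {a..b} ?m + e"
    using g1(2)[OF part fine(1)] g2(2)[OF part fine(2)] g3(2)[rule_format, OF conjI[OF p(1) fine(3)]]
    unfolding cbox_interval real_norm_def by linarith
  finally show "\<bar>\<phi> b - \<phi> a\<bar> \<le> integral {a..b} ?m + e" .
qed

text \<open>The bridge from line integrals with values in \<open>ennreal\<close> to the gauge
  integral. As the integral is finite, \<open>enn2real\<close> alters the integrand only on a null
  set.\<close>

lemma nn_integral_interval_eq_integral: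
  fixes h :: "real \<Rightarrow> ennreal"
  assumes meas: "(\<lambda>x. h x * indicator {a..b} x) \<in> borel_measurable lborel"
    and fin: "(\<integral>\<^sup>+x\<in>{a..b}. h x \<partial>lborel) < \<infinity>" and st: "a \<le> s" "t \<le> b"
  shows "(\<lambda>x. enn2real (h x)) integrable_on {s..t}"
    and "(\<integral>\<^sup>+x\<in>{s..t}. h x \<partial>lborel) = ennreal (integral {s..t} (\<lambda>x. enn2real (h x)))"
proof -
  let ?h = "\<lambda>x. h x * indicator {s..t} x"
  have eq: "?h = (\<lambda>x. (h x * indicator {a..b} x) * indicator {s..t} x)"
    using st by (auto simp: indicator_def)
  have m: "?h \<in> borel_measurable lborel" unfolding eq using meas by measurable
  have "(\<integral>\<^sup>+x. ?h x \<partial>lborel) \<le> (\<integral>\<^sup>+x\<in>{a..b}. h x \<partial>lborel)"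
    by (rule nn_integral_mono) (use st in \<open>auto simp: indicator_def\<close>)
  then have fin': "(\<integral>\<^sup>+x. ?h x \<partial>lborel) < \<infinity>" using fin by simp
  have ae: "AE x in lborel. ennreal (enn2real (?h x)) = ?h x"
    using nn_integral_PInf_AE[OF m] fin' by (auto elim: eventually_mono simp: less_top)
  have "integrable lborel (\<lambda>x. enn2real (?h x))"
    using m fin' by (intro integrableI_nonneg) (auto simp: nn_integral_cong_AE[OF ae])
  moreover have e2: "(\<lambda>x. enn2real (?h x)) = (\<lambda>x. indicator {s..t} x *\<^sub>R enn2real (h x))"
    by (auto simp: indicator_def)
  ultimately have i: "set_integrable lborel {s..t} (\<lambda>x. enn2real (h x))"
    unfolding set_integrable_def by metis
  from set_borel_integral_eq_integral[OF i]
  show "(\<lambda>x. enn2real (h x)) integrable_on {s..t}" by auto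
  have "(\<integral>\<^sup>+x. ?h x \<partial>lborel) = (\<integral>\<^sup>+x. ennreal (enn2real (?h x)) \<partial>lborel)"
    by (rule nn_integral_cong_AE) (use ae in auto)
  also have "\<dots> = ennreal (\<integral>x. enn2real (?h x) \<partial>lborel)"
    using \<open>integrable lborel (\<lambda>x. enn2real (?h x))\<close> by (rule nn_integral_eq_integral) auto
  also have "(\<integral>x. enn2real (?h x) \<partial>lborel) = integral {s..t} (\<lambda>x. enn2real (h x))"
    using set_borel_integral_eq_integral(2)[OF i] unfolding set_lebesgue_integral_def e2 .
  finally show "(\<integral>\<^sup>+x\<in>{s..t}. h x \<partial>lborel) = ennreal (integral {s..t} (\<lambda>x. enn2real (h x)))" .
qed

section \<open>Line integrals along arc length curves\<close>

context Metric_space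
begin

lemma open_Pow: "{U. openin mtopology U} \<subseteq> Pow M"
  using openin_subset[of mtopology] by auto

lemma space_borel_sigma [simp]: "space borel_sigma = M"
  unfolding borel_sigma_def by (rule space_measure_of[OF open_Pow])

lemma sets_borel_sigma: "sets borel_sigma = sigma_sets M {U. openin mtopology U}"
  unfolding borel_sigma_def by (rule sets_measure_of[OF open_Pow])

lemma open_in_borel_sigma: "openin mtopology U \<Longrightarrow> U \<in> sets borel_sigma"
  unfolding sets_borel_sigma by (auto intro: sigma_sets.Basic)

lemma arc_length_curve_measurable:
  assumes "arc_length_curve l \<Gamma>"
  shows "\<Gamma> \<in> restrict_space lborel {0..l} \<rightarrow>\<^sub>M borel_sigma"
  unfolding borel_sigma_def
proof (rule measurable_measure_of)
  show "\<Gamma> \<in> space (restrict_space lborel {0..l}) \<rightarrow> M"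
    using assms by (auto simp: arc_length_curve_def space_restrict_space)
  fix U assume "U \<in> {U. openin mtopology U}"
  then have "openin (top_of_set {0..l}) {x \<in> {0..l}. \<Gamma> x \<in> U}"
    using openin_continuous_map_preimage[OF arc_length_curve_continuous[OF assms], of U] by simp
  then obtain T where T: "open T" "{x \<in> {0..l}. \<Gamma> x \<in> U} = {0..l} \<inter> T"
    by (auto simp: openin_open)
  have "\<Gamma> -` U \<inter> space (restrict_space lborel {0..l}) = {x \<in> {0..l}. \<Gamma> x \<in> U}"
    by (auto simp: space_restrict_space)
  also note T(2)
  finally show "\<Gamma> -` U \<inter> space (restrict_space lborel {0..l}) \<in> sets (restrict_space lborel {0..l})"
    using T(1) by (auto simp: sets_restrict_space)
qed (rule open_Pow)

text \<open>Nothing is known about \<open>\<Gamma>\<close> outside \<open>{0..l}\<close>, so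
  measurability is available only for the product with an indicator. All integrals along curves are
  therefore written with one.\<close>

lemma arc_integrand_measurable:
  assumes "arc_length_curve l \<Gamma>" "g \<in> borel_measurable borel_sigma" "0 \<le> s" "t \<le> l"
  shows "(\<lambda>x. g (\<Gamma> x) * indicator {s..t} x :: ennreal) \<in> borel_measurable lborel"
proof -
  have "(\<lambda>x. g (\<Gamma> x)) \<in> borel_measurable (restrict_space lborel {0..l})"
    using measurable_compose[OF arc_length_curve_measurable[OF assms(1)] assms(2)] .
  then have "(\<lambda>x. g (\<Gamma> x) * indicator {0..l} x) \<in> borel_measurable lborel"
    by (subst (asm) borel_measurable_restrict_space_iff_ennreal) auto
  then have "(\<lambda>x. (g (\<Gamma> x) * indicator {0..l} x) * indicator {s..t} x) \<in> borel_measurable lborel"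
    by measurable
  moreover have "(\<lambda>x. (g (\<Gamma> x) * indicator {0..l} x) * indicator {s..t} x) = (\<lambda>x. g (\<Gamma> x) * indicator {s..t} x)"
    using assms(3,4) by (auto simp: indicator_def)
  ultimately show ?thesis by simp
qed

text \<open>On the subcurve the parameter at arc length \<open>x\<close> is uniquely
  \<open>s + x\<close>, so the choice in \<open>arc_length_param\<close> is determined and the line
  integral is a translate.\<close>

lemma line_integral_subcurve:
  assumes arc: "arc_length_curve l \<Gamma>" and g: "g \<in> borel_measurable borel_sigma"
    and st: "0 \<le> s" "s \<le> t" "t \<le> l"
  shows "line_integral (s, t, \<Gamma>) g = (\<integral>\<^sup>+x\<in>{s..t}. g (\<Gamma> x) \<partial>lborel)"
proof -
  have len: "curve_length (s, r, \<Gamma>) = ennreal (r - s)" if "r \<in> {s..t}" for r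
    using that arc st by (auto simp: arc_length_curve_def)
  have param: "arc_length_param (s, t, \<Gamma>) x = \<Gamma> (s + x)" if "x \<in> {0..t - s}" for x
  proof -
    have "(r \<in> {s..t} \<and> curve_length (s, r, \<Gamma>) = ennreal x) = (r = s + x)" for r
      using that len[of r] by auto
    then show ?thesis by (simp add: arc_length_param_def)
  qed
  have "line_integral (s, t, \<Gamma>) g = (\<integral>\<^sup>+x\<in>{0..t - s}. g (arc_length_param (s, t, \<Gamma>) x) \<partial>lborel)"
    using len[of t] st by (simp add: line_integral_def)
  also have "\<dots> = (\<integral>\<^sup>+x. (\<lambda>y. g (\<Gamma> y) * indicator {s..t} y) (s + 1 * x) \<partial>lborel)"
    by (rule nn_integral_cong) (auto simp: indicator_def param)
  also have "\<dots> = (\<integral>\<^sup>+x\<in>{s..t}. g (\<Gamma> x) \<partial>lborel)"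
    using nn_integral_real_affine[of "\<lambda>y. g (\<Gamma> y) * indicator {s..t} y" 1 s]
      arc_integrand_measurable[OF arc g st(1,3)] by simp
  finally show ?thesis .
qed

text \<open>The exceptional curves are those on which \<open>\<rho>\<close> is not integrable.\<close>

definition gradient_off :: "('a \<Rightarrow> ennreal) \<Rightarrow> ('a \<Rightarrow> real) \<Rightarrow> ('a \<Rightarrow> ennreal) \<Rightarrow> bool" where
  "gradient_off \<rho> u g \<longleftrightarrow> (\<forall>l \<Gamma> s t. arc_length_curve l \<Gamma> \<longrightarrow> (\<integral>\<^sup>+x\<in>{0..l}. \<rho> (\<Gamma> x) \<partial>lborel) < \<infinity> \<longrightarrow>
      0 \<le> s \<longrightarrow> s \<le> t \<longrightarrow> t \<le> l \<longrightarrow>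
      ennreal \<bar>u (\<Gamma> t) - u (\<Gamma> s)\<bar> \<le> (\<integral>\<^sup>+x\<in>{s..t}. g (\<Gamma> x) \<partial>lborel))"

lemma gradient_offD:
  "gradient_off \<rho> u g \<Longrightarrow> arc_length_curve l \<Gamma> \<Longrightarrow> (\<integral>\<^sup>+x\<in>{0..l}. \<rho> (\<Gamma> x) \<partial>lborel) < \<infinity> \<Longrightarrow>
    0 \<le> s \<Longrightarrow> s \<le> t \<Longrightarrow> t \<le> l \<Longrightarrow>
    ennreal \<bar>u (\<Gamma> t) - u (\<Gamma> s)\<bar> \<le> (\<integral>\<^sup>+x\<in>{s..t}. g (\<Gamma> x) \<partial>lborel)"
  unfolding gradient_off_def by blast

lemma rectifiable_curveE:
  assumes "rectifiable_curve (a, b, \<gamma>)"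
  obtains l \<Gamma> where "arc_length_curve l \<Gamma>"
    "\<And>g. line_integral (a, b, \<gamma>) g = (\<integral>\<^sup>+x\<in>{0..l}. g (\<Gamma> x) \<partial>lborel)" "\<Gamma> 0 = \<gamma> a" "\<Gamma> l = \<gamma> b"
proof -
  have "curve (a, b, \<gamma>)" "curve_length (a, b, \<gamma>) < \<infinity>"
    using assms by (auto simp: rectifiable_curve_def)
  then obtain l \<Gamma> where L: "arc_length_curve l \<Gamma>" "\<Gamma> = arc_length_param (a, b, \<gamma>)"
    "l = enn2real (curve_length (a, b, \<gamma>))" "\<Gamma> 0 = \<gamma> a" "\<Gamma> l = \<gamma> b"
    using arc_length_paramE by metis
  have "line_integral (a, b, \<gamma>) h = (\<integral>\<^sup>+x\<in>{0..l}. h (\<Gamma> x) \<partial>lborel)" for h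
    unfolding line_integral_def L(2,3) ..
  then show ?thesis using that L by blast
qed

text \<open>The weight \<open>\<rho>\<close> is carried along so that its integral and that of
  \<open>g\<close> refer to the same parametrisation.\<close>

lemma upper_gradient_alongI:
  assumes "rectifiable_curve c"
    and "\<And>l \<Gamma>. arc_length_curve l \<Gamma> \<Longrightarrow> line_integral c g = (\<integral>\<^sup>+x\<in>{0..l}. g (\<Gamma> x) \<partial>lborel) \<Longrightarrow>
      line_integral c \<rho> = (\<integral>\<^sup>+x\<in>{0..l}. \<rho> (\<Gamma> x) \<partial>lborel) \<Longrightarrow>
      ennreal \<bar>u (\<Gamma> l) - u (\<Gamma> 0)\<bar> \<le> (\<integral>\<^sup>+x\<in>{0..l}. g (\<Gamma> x) \<partial>lborel)"
  shows "upper_gradient_along u g c"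
proof -
  obtain a b \<gamma> where c: "c = (a, b, \<gamma>)" by (metis prod_cases3)
  then obtain l \<Gamma> where L: "arc_length_curve l \<Gamma>"
    "\<And>g. line_integral c g = (\<integral>\<^sup>+x\<in>{0..l}. g (\<Gamma> x) \<partial>lborel)" "\<Gamma> 0 = \<gamma> a" "\<Gamma> l = \<gamma> b"
    using rectifiable_curveE assms(1) by metis
  show ?thesis
    using assms(2)[OF L(1,2,2)] L(2)[of g] L(3,4)
    by (simp add: upper_gradient_along_def c abs_minus_commute)
qed

lemma gradient_off_upper_gradient_along:
  assumes "gradient_off \<rho> u g" "rectifiable_curve c" "line_integral c \<rho> < \<infinity>"
  shows "upper_gradient_along u g c"
  using assms(2)
proof (rule upper_gradient_alongI[where \<rho>=\<rho>])
  fix l \<Gamma> assume *: "arc_length_curve l \<Gamma>" "line_integral c \<rho> = (\<integral>\<^sup>+x\<in>{0..l}. \<rho> (\<Gamma> x) \<partial>lborel)"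
  then have "0 \<le> l" by (simp add: arc_length_curve_def)
  then show "ennreal \<bar>u (\<Gamma> l) - u (\<Gamma> 0)\<bar> \<le> (\<integral>\<^sup>+x\<in>{0..l}. g (\<Gamma> x) \<partial>lborel)"
    using gradient_offD[OF assms(1) *(1)] * assms(3) by simp
qed

lemma upper_gradientI:
  assumes "g \<in> borel_measurable borel_sigma"
    and "\<And>l \<Gamma>. arc_length_curve l \<Gamma> \<Longrightarrow> ennreal \<bar>u (\<Gamma> l) - u (\<Gamma> 0)\<bar> \<le> (\<integral>\<^sup>+x\<in>{0..l}. g (\<Gamma> x) \<partial>lborel)"
  shows "upper_gradient u g"
  unfolding upper_gradient_def using assms upper_gradient_alongI[where \<rho>="\<lambda>_. 0"] by blast

lemma upper_gradientD:
  assumes "upper_gradient u g" "arc_length_curve l \<Gamma>" "0 \<le> s" "s \<le> t" "t \<le> l"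
  shows "ennreal \<bar>u (\<Gamma> t) - u (\<Gamma> s)\<bar> \<le> (\<integral>\<^sup>+x\<in>{s..t}. g (\<Gamma> x) \<partial>lborel)"
proof -
  have "upper_gradient_along u g (s, t, \<Gamma>)"
    using assms arc_length_curve_subcurve by (auto simp: upper_gradient_def)
  then show ?thesis
    using line_integral_subcurve[OF assms(2) _ assms(3-5), of g] assms(1)
    by (simp add: upper_gradient_along_def upper_gradient_def abs_minus_commute)
qed

lemma upper_gradient_gradient_off: "upper_gradient u g \<Longrightarrow> gradient_off \<rho> u g"
  unfolding gradient_off_def using upper_gradientD by blast

text \<open>Besides the two old weights the new one contains \<open>g1\<close> and
  \<open>g2\<close>, because \<open>abs_diff_le_integral_min\<close> needs both of them integrable
  along the curve.\<close>

lemma gradient_off_min: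
  assumes "gradient_off \<rho>1 u g1" "gradient_off \<rho>2 u g2"
    and meas: "\<rho>1 \<in> borel_measurable borel_sigma" "\<rho>2 \<in> borel_measurable borel_sigma"
      "g1 \<in> borel_measurable borel_sigma" "g2 \<in> borel_measurable borel_sigma"
  shows "gradient_off (\<lambda>x. \<rho>1 x + \<rho>2 x + g1 x + g2 x) u (\<lambda>x. min (g1 x) (g2 x))"
  unfolding gradient_off_def
proof (intro allI impI)
  fix l \<Gamma> s t
  assume arc: "arc_length_curve l \<Gamma>"
    and fin: "(\<integral>\<^sup>+x\<in>{0..l}. (\<rho>1 (\<Gamma> x) + \<rho>2 (\<Gamma> x) + g1 (\<Gamma> x) + g2 (\<Gamma> x)) \<partial>lborel) < \<infinity>"
    and st: "0 \<le> s" "s \<le> t" "t \<le> l"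
  note m = arc_integrand_measurable[OF arc, of _ 0 l]
  have le: "(\<integral>\<^sup>+x\<in>{0..l}. h (\<Gamma> x) \<partial>lborel) < \<infinity>"
    if "\<And>x. h x \<le> \<rho>1 x + \<rho>2 x + g1 x + g2 x" for h
    by (rule order_le_less_trans[OF nn_integral_mono fin]) (intro mult_right_mono that, auto)
  have f1: "(\<integral>\<^sup>+x\<in>{0..l}. \<rho>1 (\<Gamma> x) \<partial>lborel) < \<infinity>"
    by (rule le) (simp add: add.assoc)
  have f2: "(\<integral>\<^sup>+x\<in>{0..l}. \<rho>2 (\<Gamma> x) \<partial>lborel) < \<infinity>"
    by (rule le) (simp add: add.assoc add_increasing)
  have f3: "(\<integral>\<^sup>+x\<in>{0..l}. g1 (\<Gamma> x) \<partial>lborel) < \<infinity>"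
    by (rule le) (simp add: add_increasing add_increasing2)
  have f4: "(\<integral>\<^sup>+x\<in>{0..l}. g2 (\<Gamma> x) \<partial>lborel) < \<infinity>"
    by (rule le) (simp add: add_increasing)
  have f5: "(\<integral>\<^sup>+x\<in>{0..l}. min (g1 (\<Gamma> x)) (g2 (\<Gamma> x)) \<partial>lborel) < \<infinity>"
    by (rule le) (simp add: add_increasing min.coboundedI2)
  have mm: "(\<lambda>x. min (g1 x) (g2 x)) \<in> borel_measurable borel_sigma" using meas by measurable
  note I1 = nn_integral_interval_eq_integral[OF m[OF meas(3)] f3]
  note I2 = nn_integral_interval_eq_integral[OF m[OF meas(4)] f4]
  note I3 = nn_integral_interval_eq_integral[OF m[OF mm] f5]
  have fin_ae: "AE x in lborel. h (\<Gamma> x) * indicator {0..l} x < \<infinity>"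
    if "h \<in> borel_measurable borel_sigma" "(\<integral>\<^sup>+x\<in>{0..l}. h (\<Gamma> x) \<partial>lborel) < \<infinity>" for h
    using nn_integral_PInf_AE[OF m[OF that(1)]] that(2) by (auto elim: eventually_mono simp: less_top)
  let ?G1 = "\<lambda>x. enn2real (g1 (\<Gamma> x))" and ?G2 = "\<lambda>x. enn2real (g2 (\<Gamma> x))"
  let ?G3 = "\<lambda>x. enn2real (min (g1 (\<Gamma> x)) (g2 (\<Gamma> x)))"
  have "\<bar>u (\<Gamma> t) - u (\<Gamma> s)\<bar> \<le> integral {s..t} (\<lambda>x. min (?G1 x) (?G2 x))"
    and "integral {s..t} (\<lambda>x. min (?G1 x) (?G2 x)) = integral {s..t} ?G3"
  proof -
    have *: "\<bar>u (\<Gamma> t') - u (\<Gamma> s')\<bar> \<le> integral {s'..t'} ?G1" "\<bar>u (\<Gamma> t') - u (\<Gamma> s')\<bar> \<le> integral {s'..t'} ?G2"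
      if "s \<le> s'" "s' \<le> t'" "t' \<le> t" for s' t'
    proof -
      have nn: "0 \<le> integral {s'..t'} ?G1" "0 \<le> integral {s'..t'} ?G2" 
        using that st by (auto intro!: integral_nonneg I1 I2)
      show "\<bar>u (\<Gamma> t') - u (\<Gamma> s')\<bar> \<le> integral {s'..t'} ?G1"
        using gradient_offD[OF assms(1) arc f1, of s' t'] I1(2)[of s' t'] that st nn by simp
      show "\<bar>u (\<Gamma> t') - u (\<Gamma> s')\<bar> \<le> integral {s'..t'} ?G2"
        using gradient_offD[OF assms(2) arc f2, of s' t'] I2(2)[of s' t'] that st nn by simp
    qed
    \<comment> \<open>\<open>enn2real\<close> sends infinity to 0 and so respects minima only where
      both values are finite.\<close>
    have "AE x in lborel. x \<in> {s..t} \<longrightarrow> min (?G1 x) (?G2 x) = ?G3 x"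
      using fin_ae[OF meas(3) f3] fin_ae[OF meas(4) f4]
    proof eventually_elim
      case (elim x)
      then show ?case
        using enn2real_mono[of "g1 (\<Gamma> x)" "g2 (\<Gamma> x)"] enn2real_mono[of "g2 (\<Gamma> x)" "g1 (\<Gamma> x)"] st
        by (cases "g1 (\<Gamma> x) \<le> g2 (\<Gamma> x)") (auto simp: min_def indicator_def)
    qed
    then obtain N where N: "N \<in> null_sets lborel" "\<And>x. x \<in> {s..t} - N \<Longrightarrow> min (?G1 x) (?G2 x) = ?G3 x"
      by (auto elim!: AE_E3)
    then have neg: "negligible N" by (simp add: negligible_iff_null_sets null_sets_completionI)
    have i3: "?G3 integrable_on {s..t}" using st by (intro I3) auto
    have i3': "(\<lambda>x. min (?G1 x) (?G2 x)) integrable_on {s..t}"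
      by (rule integrable_spike[OF i3 neg]) (use N in auto)
    show "integral {s..t} (\<lambda>x. min (?G1 x) (?G2 x)) = integral {s..t} ?G3"
      by (rule integral_spike[OF neg]) (use N in auto)
    show "\<bar>u (\<Gamma> t) - u (\<Gamma> s)\<bar> \<le> integral {s..t} (\<lambda>x. min (?G1 x) (?G2 x))"
      using st * i3' by (intro abs_diff_le_integral_min[where \<phi>="\<lambda>x. u (\<Gamma> x)"] I1 I2) auto
  qed
  then show "ennreal \<bar>u (\<Gamma> t) - u (\<Gamma> s)\<bar> \<le> (\<integral>\<^sup>+x\<in>{s..t}. min (g1 (\<Gamma> x)) (g2 (\<Gamma> x)) \<partial>lborel)"
    using I3(2)[of s t] st by (simp add: ennreal_leI)
qed

end

section \<open>Minimal weak upper gradients\<close>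

lemma ennreal_power2_le_iff: "x\<^sup>2 \<le> y\<^sup>2 \<longleftrightarrow> x \<le> (y :: ennreal)"
proof
  assume le: "x\<^sup>2 \<le> y\<^sup>2"
  show "x \<le> y"
  proof (cases "x = \<infinity> \<or> y = \<infinity>")
    case True
    then show ?thesis using le
      by (auto simp: power2_eq_square top_unique ennreal_mult_eq_top_iff)
  next
    case False
    then obtain a b where ab: "x = ennreal a" "y = ennreal b" "0 \<le> a" "0 \<le> b"
      by (metis ennreal_cases infinity_ennreal_def)
    then have "ennreal (a\<^sup>2) \<le> ennreal (b\<^sup>2)" using le by (simp add: ennreal_power)
    then have "a\<^sup>2 \<le> b\<^sup>2" by (subst (asm) ennreal_le_iff) auto
    then have "a \<le> b" using ab(4) by (rule power2_le_imp_le)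
    then show ?thesis using ab(1,2) by (simp add: ennreal_leI)
  qed
qed (rule power_mono, auto)

lemma ennreal_2_power: "ennreal (2 ^ n) = 2 ^ n"
  by (metis ennreal_numeral ennreal_power zero_le_numeral)

section \<open>Exceptional families of curves\<close>

context metric_measure_space
begin

lemma borel_sigma_imp_measurable: "g \<in> borel_measurable borel_sigma \<Longrightarrow> g \<in> borel_measurable \<mu>"
  using borel_sets by (auto simp: measurable_def space_eq)

text \<open>Merges the exceptional weights of countably many weak upper gradients into one: a curve
  with finite integral of \<open>\<sigma>\<close> has finite integral of every
  \<open>\<rho> n\<close>.\<close>

lemma L2_dominate:
  fixes \<rho> :: "nat \<Rightarrow> 'a \<Rightarrow> ennreal"
  assumes m: "\<And>n. \<rho> n \<in> borel_measurable borel_sigma" and L2: "\<And>n. (\<integral>\<^sup>+x. (\<rho> n x)\<^sup>2 \<partial>\<mu>) < \<infinity>"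
  shows "\<exists>\<sigma>\<in>borel_measurable borel_sigma. (\<integral>\<^sup>+x. (\<sigma> x)\<^sup>2 \<partial>\<mu>) < \<infinity> \<and>
    (\<forall>n. \<exists>c<\<infinity>. \<forall>x. \<rho> n x \<le> c * \<sigma> x)"
proof -
  define K where "K n = enn2real (\<integral>\<^sup>+x. (\<rho> n x)\<^sup>2 \<partial>\<mu>)" for n
  have K: "(\<integral>\<^sup>+x. (\<rho> n x)\<^sup>2 \<partial>\<mu>) = ennreal (K n)" "0 \<le> K n" for n
    using L2[of n] by (simp_all add: K_def)
  \<comment> \<open>Chosen so that the weight \<open>2 ^ Suc n\<close> lost by squaring the series,
    times \<open>(c n)\<^sup>2 * K n\<close>, is at most \<open>(1/2)^Suc n\<close>. The summand 1
    in the denominator covers \<open>K n = 0\<close>.\<close>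
  define c where "c n = (1/2)^Suc n / (1 + K n)" for n
  have c: "0 < c n" for n using K(2)[of n] by (simp add: c_def add_pos_nonneg)
  have cK: "2 ^ Suc n * ((c n)\<^sup>2 * K n) \<le> (1/2)^Suc n" for n
  proof -
    have "(c n)\<^sup>2 * K n = ((1/2)^Suc n)\<^sup>2 * (K n / (1 + K n)\<^sup>2)"
      by (simp add: c_def power_divide power_mult_distrib del: power_Suc)
    also have "K n / (1 + K n)\<^sup>2 \<le> 1"
      using K(2)[of n] by (simp add: power2_eq_square algebra_simps divide_simps add_nonneg_pos)
    finally have "(c n)\<^sup>2 * K n \<le> ((1/2)^Suc n)\<^sup>2" by (simp add: mult_left_le)
    then have "2 ^ Suc n * ((c n)\<^sup>2 * K n) \<le> 2 ^ Suc n * ((1/2)^Suc n)\<^sup>2" by (intro mult_left_mono) auto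
    also have "2 ^ Suc n * ((1/2)^Suc n)\<^sup>2 = ((1/2::real)^Suc n)"
      by (simp add: power2_eq_square power_one_over)
    finally show ?thesis .
  qed
  define \<sigma> where "\<sigma> x = (\<Sum>n. ennreal (c n) * \<rho> n x)" for x
  have m\<sigma>: "\<sigma> \<in> borel_measurable borel_sigma" unfolding \<sigma>_def using m by measurable
  have mm: "\<And>n. \<rho> n \<in> borel_measurable \<mu>" using m borel_sigma_imp_measurable by blast
  have "(\<integral>\<^sup>+x. (\<sigma> x)\<^sup>2 \<partial>\<mu>) \<le> (\<integral>\<^sup>+x. (\<Sum>n. 2 ^ Suc n * (ennreal (c n) * \<rho> n x)\<^sup>2) \<partial>\<mu>)"
    unfolding \<sigma>_def by (intro nn_integral_mono suminf_power2_le_ennreal)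
  also have "\<dots> = (\<integral>\<^sup>+x. (\<Sum>n. ennreal (2 ^ Suc n * (c n)\<^sup>2) * (\<rho> n x)\<^sup>2) \<partial>\<mu>)"
  proof (rule nn_integral_cong, rule suminf_cong)
    fix x n
    have "ennreal (2 ^ Suc n * (c n)\<^sup>2) = 2 ^ Suc n * (ennreal (c n))\<^sup>2"
      using c[of n] by (simp add: ennreal_mult ennreal_power flip: ennreal_numeral)
    then show "2 ^ Suc n * (ennreal (c n) * \<rho> n x)\<^sup>2 = ennreal (2 ^ Suc n * (c n)\<^sup>2) * (\<rho> n x)\<^sup>2"
      by (simp add: power_mult_distrib mult.assoc)
  qed
  also have "\<dots> = (\<Sum>n. ennreal (2 ^ Suc n * (c n)\<^sup>2) * ennreal (K n))"
    using mm by (subst nn_integral_suminf) (auto simp: nn_integral_cmult K)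
  also have "\<dots> \<le> (\<Sum>n. ennreal ((1/2)^Suc n))"
    using cK K(2) c by (intro suminf_le) (auto simp: mult.assoc intro!: ennreal_leI simp flip: ennreal_mult)
  also have "\<dots> < \<infinity>"
    by (subst suminf_ennreal2) (auto simp: summable_geometric)
  finally have "(\<integral>\<^sup>+x. (\<sigma> x)\<^sup>2 \<partial>\<mu>) < \<infinity>" .
  moreover have "\<rho> n x \<le> ennreal (1 / c n) * \<sigma> x" for n x
  proof -
    have "ennreal (c n) * \<rho> n x \<le> \<sigma> x"
      unfolding \<sigma>_def using sum_le_suminf[of "\<lambda>n. ennreal (c n) * \<rho> n x" "{n}"] by auto
    then have "ennreal (1 / c n) * (ennreal (c n) * \<rho> n x) \<le> ennreal (1 / c n) * \<sigma> x"
      by (intro mult_left_mono) auto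
    moreover have "ennreal (1 / c n) * ennreal (c n) = 1"
      using c[of n] by (simp flip: ennreal_mult)
    ultimately show ?thesis by (simp flip: mult.assoc)
  qed
  then have "\<exists>C<\<infinity>. \<forall>x. \<rho> n x \<le> C * \<sigma> x" for n
    by (intro exI[of _ "ennreal (1 / c n)"]) simp
  ultimately show ?thesis using m\<sigma> by blast
qed

text \<open>Admissible weights with squared norm below \<open>(1/4)^Suc n\<close> have a
  square-integrable sum, and each of them contributes at least 1 along every curve of
  \<open>F\<close>.\<close>

lemma modulus_zero_imp_exceptional:
  assumes "modulus2 F = 0"
  shows "\<exists>\<rho>\<in>borel_measurable borel_sigma. (\<integral>\<^sup>+x. (\<rho> x)\<^sup>2 \<partial>\<mu>) < \<infinity> \<and>
    (\<forall>c\<in>F. rectifiable_curve c \<longrightarrow> line_integral c \<rho> = \<infinity>)"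
proof -
  have "\<exists>\<rho>\<in>borel_measurable borel_sigma. (\<forall>c\<in>F. rectifiable_curve c \<longrightarrow> 1 \<le> line_integral c \<rho>) \<and>
      (\<integral>\<^sup>+x. (\<rho> x)\<^sup>2 \<partial>\<mu>) < ennreal ((1/4)^Suc n)" for n
  proof -
    have "modulus2 F < ennreal ((1/4)^Suc n)" using assms by simp
    then show ?thesis unfolding modulus2_def INF_less_iff by auto
  qed
  then obtain \<rho> where \<rho>: "\<And>n. \<rho> n \<in> borel_measurable borel_sigma"
    "\<And>n c. c \<in> F \<Longrightarrow> rectifiable_curve c \<Longrightarrow> 1 \<le> line_integral c (\<rho> n)"
    "\<And>n. (\<integral>\<^sup>+x. (\<rho> n x)\<^sup>2 \<partial>\<mu>) < ennreal ((1/4)^Suc n)" by metis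
  have mm: "\<And>n. \<rho> n \<in> borel_measurable \<mu>" using \<rho>(1) borel_sigma_imp_measurable by blast
  define \<sigma> where "\<sigma> x = (\<Sum>n. \<rho> n x)" for x
  have m\<sigma>: "\<sigma> \<in> borel_measurable borel_sigma" unfolding \<sigma>_def using \<rho>(1) by measurable
  have "(\<integral>\<^sup>+x. (\<sigma> x)\<^sup>2 \<partial>\<mu>) \<le> (\<integral>\<^sup>+x. (\<Sum>n. 2 ^ Suc n * (\<rho> n x)\<^sup>2) \<partial>\<mu>)"
    unfolding \<sigma>_def by (intro nn_integral_mono suminf_power2_le_ennreal)
  also have "\<dots> = (\<Sum>n. 2 ^ Suc n * (\<integral>\<^sup>+x. (\<rho> n x)\<^sup>2 \<partial>\<mu>))"
    using mm by (subst nn_integral_suminf) (auto simp: nn_integral_cmult)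
  also have "\<dots> \<le> (\<Sum>n. ennreal ((1/2)^Suc n))"
  proof (intro suminf_le)
    fix n
    have "2 ^ Suc n * (\<integral>\<^sup>+x. (\<rho> n x)\<^sup>2 \<partial>\<mu>) \<le> ennreal (2 ^ Suc n) * ennreal ((1/4)^Suc n)"
      using \<rho>(3)[of n] unfolding ennreal_2_power by (intro mult_mono) auto
    also have "\<dots> = ennreal ((1/2)^Suc n)"
      by (simp add: power_mult_distrib[symmetric] flip: ennreal_mult power_Suc)
    finally show "2 ^ Suc n * (\<integral>\<^sup>+x. (\<rho> n x)\<^sup>2 \<partial>\<mu>) \<le> ennreal ((1/2)^Suc n)" .
  qed auto
  also have "\<dots> < \<infinity>"
    by (subst suminf_ennreal2) (auto simp: summable_geometric)
  finally have fin: "(\<integral>\<^sup>+x. (\<sigma> x)\<^sup>2 \<partial>\<mu>) < \<infinity>" .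
  have "line_integral c \<sigma> = \<infinity>" if c: "c \<in> F" "rectifiable_curve c" for c
  proof -
    obtain a b \<gamma> where abg: "c = (a, b, \<gamma>)" by (metis prod_cases3)
    obtain l \<Gamma> where L: "arc_length_curve l \<Gamma>"
      "\<And>g. line_integral c g = (\<integral>\<^sup>+x\<in>{0..l}. g (\<Gamma> x) \<partial>lborel)"
      using rectifiable_curveE c(2) unfolding abg by metis
    note m = arc_integrand_measurable[OF L(1) \<rho>(1), of 0 l]
    have "line_integral c \<sigma> = (\<integral>\<^sup>+x. (\<Sum>n. \<rho> n (\<Gamma> x) * indicator {0..l} x) \<partial>lborel)"
      unfolding L(2) \<sigma>_def by simp
    also have "\<dots> = (\<Sum>n. line_integral c (\<rho> n))"
      unfolding L(2) using m by (intro nn_integral_suminf) auto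
    also have "\<dots> \<ge> (\<Sum>n. 1)"
      using \<rho>(2)[OF c] by (intro suminf_le) auto
    finally have "(\<Sum>n. 1) \<le> line_integral c \<sigma>" .
    moreover have "(\<Sum>n. 1::ennreal) = top"
      by (simp add: suminf_eq_SUP ennreal_SUP_of_nat_eq_top)
    ultimately show ?thesis by (simp add: top_unique)
  qed
  then show ?thesis using m\<sigma> fin by blast
qed

text \<open>Modulus zero means that one square-integrable weight is non-integrable on the whole
  family; conversely every multiple \<open>e * \<rho>\<close> of such a weight is admissible, so the
  modulus is at most \<open>e\<^sup>2\<close> times a constant. The form with
  \<open>gradient_off\<close> is the workable one: subcurves inherit finiteness of the integral of
  \<open>\<rho>\<close>, so the inequality holds on all of them at once.\<close>

lemma weak_upper_gradient_iff:
  "weak_upper_gradient u g \<longleftrightarrow> g \<in> borel_measurable borel_sigma \<and>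
    (\<exists>\<rho>\<in>borel_measurable borel_sigma. (\<integral>\<^sup>+x. (\<rho> x)\<^sup>2 \<partial>\<mu>) < \<infinity> \<and> gradient_off \<rho> u g)"
  (is "?L \<longleftrightarrow> ?R")
proof
  let ?F = "{c. rectifiable_curve c \<and> \<not> upper_gradient_along u g c}"
  assume ?L
  then have g: "g \<in> borel_measurable borel_sigma" and "modulus2 ?F = 0"
    by (auto simp: weak_upper_gradient_def)
  from modulus_zero_imp_exceptional[OF this(2)]
  obtain \<rho> where \<rho>: "\<rho> \<in> borel_measurable borel_sigma" "(\<integral>\<^sup>+x. (\<rho> x)\<^sup>2 \<partial>\<mu>) < \<infinity>"
    "\<And>c. c \<in> ?F \<Longrightarrow> rectifiable_curve c \<Longrightarrow> line_integral c \<rho> = \<infinity>" by blast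
  have "gradient_off \<rho> u g"
    unfolding gradient_off_def
  proof (intro allI impI)
    fix l \<Gamma> s t
    assume *: "arc_length_curve l \<Gamma>" "(\<integral>\<^sup>+x\<in>{0..l}. \<rho> (\<Gamma> x) \<partial>lborel) < \<infinity>" "0 \<le> s" "s \<le> t" "t \<le> l"
    have "line_integral (s, t, \<Gamma>) \<rho> = (\<integral>\<^sup>+x\<in>{s..t}. \<rho> (\<Gamma> x) \<partial>lborel)"
      by (rule line_integral_subcurve[OF *(1) \<rho>(1) *(3-5)])
    also have "\<dots> \<le> (\<integral>\<^sup>+x\<in>{0..l}. \<rho> (\<Gamma> x) \<partial>lborel)"
      using * by (intro nn_integral_mono) (auto simp: indicator_def)
    finally have "line_integral (s, t, \<Gamma>) \<rho> < \<infinity>" using *(2) by simp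
    moreover have r: "rectifiable_curve (s, t, \<Gamma>)"
      by (rule arc_length_curve_subcurve[OF *(1) *(3-5)])
    ultimately have "upper_gradient_along u g (s, t, \<Gamma>)" using \<rho>(3) by fastforce
    then show "ennreal \<bar>u (\<Gamma> t) - u (\<Gamma> s)\<bar> \<le> (\<integral>\<^sup>+x\<in>{s..t}. g (\<Gamma> x) \<partial>lborel)"
      using line_integral_subcurve[OF *(1) g *(3-5)]
      by (simp add: upper_gradient_along_def abs_minus_commute)
  qed
  then show ?R using g \<rho> by blast
next
  let ?F = "{c. rectifiable_curve c \<and> \<not> upper_gradient_along u g c}"
  assume ?R
  then obtain \<rho> where g: "g \<in> borel_measurable borel_sigma" and \<rho>: "\<rho> \<in> borel_measurable borel_sigma"
    "(\<integral>\<^sup>+x. (\<rho> x)\<^sup>2 \<partial>\<mu>) < \<infinity>" "gradient_off \<rho> u g" by blast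
  have inf: "line_integral c \<rho> = \<infinity>" if "c \<in> ?F" for c
    using gradient_off_upper_gradient_along[OF \<rho>(3), of c] that
    by (cases "line_integral c \<rho> < \<infinity>") (auto simp: not_less top_unique)
  have m\<rho>: "\<rho> \<in> borel_measurable \<mu>" using \<rho>(1) borel_sigma_imp_measurable by blast
  have le: "modulus2 ?F \<le> (ennreal e)\<^sup>2 * (\<integral>\<^sup>+x. (\<rho> x)\<^sup>2 \<partial>\<mu>)" if e: "0 < e" for e
  proof -
    have "1 \<le> line_integral c (\<lambda>x. ennreal e * \<rho> x)" if c: "c \<in> ?F" for c
    proof -
      obtain a b \<gamma> where abg: "c = (a, b, \<gamma>)" by (metis prod_cases3)
      then obtain l \<Gamma> where L: "arc_length_curve l \<Gamma>"
        "\<And>g. line_integral c g = (\<integral>\<^sup>+x\<in>{0..l}. g (\<Gamma> x) \<partial>lborel)"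
        using rectifiable_curveE c by (metis mem_Collect_eq)
      have "line_integral c (\<lambda>x. ennreal e * \<rho> x) = ennreal e * line_integral c \<rho>"
        unfolding L(2) mult.assoc
        by (rule nn_integral_cmult) (use arc_integrand_measurable[OF L(1) \<rho>(1), of 0 l] in auto)
      then show ?thesis using inf[OF c] e by (simp add: ennreal_mult_top)
    qed
    then have "modulus2 ?F \<le> (\<integral>\<^sup>+x. (ennreal e * \<rho> x)\<^sup>2 \<partial>\<mu>)"
      unfolding modulus2_def using \<rho>(1) by (intro INF_lower) auto
    also have "\<dots> = (ennreal e)\<^sup>2 * (\<integral>\<^sup>+x. (\<rho> x)\<^sup>2 \<partial>\<mu>)"
      unfolding power_mult_distrib using m\<rho> by (intro nn_integral_cmult) auto
    finally show ?thesis .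
  qed
  obtain K where K: "(\<integral>\<^sup>+x. (\<rho> x)\<^sup>2 \<partial>\<mu>) = ennreal K" "0 \<le> K"
    using \<rho>(2) by (metis ennreal_cases less_irrefl infinity_ennreal_def)
  have "modulus2 ?F \<le> 0"
  proof (rule ennreal_le_epsilon)
    fix e :: real assume e: "0 < e"
    define e' where "e' = sqrt (e / (1 + K))"
    have "0 < e'" using e K by (simp add: e'_def add_pos_nonneg)
    then have "modulus2 ?F \<le> ennreal (e'\<^sup>2 * K)"
      using le[of e'] K by (simp add: ennreal_mult ennreal_power)
    also have "e'\<^sup>2 * K \<le> e"
    proof -
      have "e'\<^sup>2 = e / (1 + K)" using e K by (simp add: e'_def)
      moreover have "e * K \<le> e * (1 + K)" using e by simp
      ultimately show ?thesis using K e by (simp add: pos_divide_le_eq add_pos_nonneg)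
    qed
    finally show "modulus2 ?F \<le> 0 + ennreal e" by (simp add: ennreal_leI)
  qed
  then show ?L using g by (simp add: weak_upper_gradient_def)
qed

lemma upper_gradient_imp_weak: "upper_gradient u g \<Longrightarrow> weak_upper_gradient u g"
  unfolding weak_upper_gradient_iff
  by (auto simp: upper_gradient_def intro!: bexI[of _ "\<lambda>_. 0"] upper_gradient_gradient_off)

lemma weak_upper_gradient_min:
  assumes "weak_upper_gradient u g1" "weak_upper_gradient u g2"
    "(\<integral>\<^sup>+x. (g1 x)\<^sup>2 \<partial>\<mu>) < \<infinity>" "(\<integral>\<^sup>+x. (g2 x)\<^sup>2 \<partial>\<mu>) < \<infinity>"
  shows "weak_upper_gradient u (\<lambda>x. min (g1 x) (g2 x))"
proof -
  obtain \<rho>1 \<rho>2 where \<rho>: "g1 \<in> borel_measurable borel_sigma" "g2 \<in> borel_measurable borel_sigma"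
    "\<rho>1 \<in> borel_measurable borel_sigma" "(\<integral>\<^sup>+x. (\<rho>1 x)\<^sup>2 \<partial>\<mu>) < \<infinity>" "gradient_off \<rho>1 u g1"
    "\<rho>2 \<in> borel_measurable borel_sigma" "(\<integral>\<^sup>+x. (\<rho>2 x)\<^sup>2 \<partial>\<mu>) < \<infinity>" "gradient_off \<rho>2 u g2"
    using assms(1,2) unfolding weak_upper_gradient_iff by blast
  have L2: "(\<integral>\<^sup>+x. (f x + g x)\<^sup>2 \<partial>\<mu>) < \<infinity>"
    if "f \<in> borel_measurable borel_sigma" "g \<in> borel_measurable borel_sigma"
      "(\<integral>\<^sup>+x. (f x)\<^sup>2 \<partial>\<mu>) < \<infinity>" "(\<integral>\<^sup>+x. (g x)\<^sup>2 \<partial>\<mu>) < \<infinity>" for f g :: "'a \<Rightarrow> ennreal"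
  proof -
    have "(\<integral>\<^sup>+x. (f x + g x)\<^sup>2 \<partial>\<mu>) \<le> (\<integral>\<^sup>+x. 2 * (f x)\<^sup>2 + 2 * (g x)\<^sup>2 \<partial>\<mu>)"
      by (intro nn_integral_mono ennreal_power2_add_le)
    also have "\<dots> = 2 * (\<integral>\<^sup>+x. (f x)\<^sup>2 \<partial>\<mu>) + 2 * (\<integral>\<^sup>+x. (g x)\<^sup>2 \<partial>\<mu>)"
      using that(1,2)[THEN borel_sigma_imp_measurable] by (simp add: nn_integral_add nn_integral_cmult)
    also have "\<dots> < \<infinity>" using that(3,4) by (simp add: ennreal_mult_less_top)
    finally show ?thesis .
  qed
  have "(\<integral>\<^sup>+x. (\<rho>1 x + \<rho>2 x + g1 x + g2 x)\<^sup>2 \<partial>\<mu>) < \<infinity>"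
    using \<rho> assms(3,4) by (intro L2 borel_measurable_add) auto
  then show ?thesis
    unfolding weak_upper_gradient_iff using gradient_off_min[OF \<rho>(5,8,3,6,1,2)] \<rho>(1,2,3,6)
    by (intro conjI bexI[of _ "\<lambda>x. \<rho>1 x + \<rho>2 x + g1 x + g2 x"]) auto
qed

text \<open>Decreasing convergence along every curve on which all the weights are integrable; one
  weight for all \<open>n\<close> comes from \<open>L2_dominate\<close>.\<close>

lemma weak_upper_gradient_INF:
  fixes g :: "nat \<Rightarrow> 'a \<Rightarrow> ennreal"
  assumes wug: "\<And>n. weak_upper_gradient u (g n)" and L2: "(\<integral>\<^sup>+x. (g 0 x)\<^sup>2 \<partial>\<mu>) < \<infinity>"
    and dec: "\<And>n x. g (Suc n) x \<le> g n x"
  shows "weak_upper_gradient u (\<lambda>x. INF n. g n x)"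
proof -
  have mg: "\<And>n. g n \<in> borel_measurable borel_sigma" using wug by (simp add: weak_upper_gradient_def)
  obtain \<rho> where \<rho>: "\<And>n. \<rho> n \<in> borel_measurable borel_sigma" "\<And>n. (\<integral>\<^sup>+x. (\<rho> n x)\<^sup>2 \<partial>\<mu>) < \<infinity>"
    "\<And>n. gradient_off (\<rho> n) u (g n)"
    using wug unfolding weak_upper_gradient_iff by metis
  \<comment> \<open>\<open>g 0\<close> joins the weights because the decreasing limit under the
    integral needs a finite first integral.\<close>
  define \<rho>' where "\<rho>' n = (case n of 0 \<Rightarrow> g 0 | Suc n \<Rightarrow> \<rho> n)" for n
  have "\<And>n. \<rho>' n \<in> borel_measurable borel_sigma" "\<And>n. (\<integral>\<^sup>+x. (\<rho>' n x)\<^sup>2 \<partial>\<mu>) < \<infinity>"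
    using \<rho> mg L2 by (auto simp: \<rho>'_def split: nat.splits)
  from L2_dominate[of \<rho>', OF this] obtain \<sigma> where \<sigma>: "\<sigma> \<in> borel_measurable borel_sigma"
    "(\<integral>\<^sup>+x. (\<sigma> x)\<^sup>2 \<partial>\<mu>) < \<infinity>" "\<And>n. \<exists>c<\<infinity>. \<forall>x. \<rho>' n x \<le> c * \<sigma> x" by blast
  have "gradient_off \<sigma> u (\<lambda>x. INF n. g n x)"
    unfolding gradient_off_def
  proof (intro allI impI)
    fix l \<Gamma> s t
    assume arc: "arc_length_curve l \<Gamma>" and fin: "(\<integral>\<^sup>+x\<in>{0..l}. \<sigma> (\<Gamma> x) \<partial>lborel) < \<infinity>"
      and st: "0 \<le> s" "s \<le> t" "t \<le> l"
    note m = arc_integrand_measurable[OF arc]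
    have fin': "(\<integral>\<^sup>+x\<in>{0..l}. \<rho>' n (\<Gamma> x) \<partial>lborel) < \<infinity>" for n
    proof -
      obtain c where c: "c < \<infinity>" "\<And>x. \<rho>' n x \<le> c * \<sigma> x" using \<sigma>(3) by blast
      have "(\<integral>\<^sup>+x\<in>{0..l}. \<rho>' n (\<Gamma> x) \<partial>lborel) \<le> (\<integral>\<^sup>+x. c * (\<sigma> (\<Gamma> x) * indicator {0..l} x) \<partial>lborel)"
        unfolding mult.assoc[symmetric] by (intro nn_integral_mono mult_right_mono c) auto
      also have "\<dots> = c * (\<integral>\<^sup>+x\<in>{0..l}. \<sigma> (\<Gamma> x) \<partial>lborel)"
        by (rule nn_integral_cmult) (use m[OF \<sigma>(1), of 0 l] in auto)
      also have "\<dots> < \<infinity>" using c(1) fin by (simp add: ennreal_mult_less_top)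
      finally show ?thesis .
    qed
    have "ennreal \<bar>u (\<Gamma> t) - u (\<Gamma> s)\<bar> \<le> (\<integral>\<^sup>+x\<in>{s..t}. g n (\<Gamma> x) \<partial>lborel)" for n
      using gradient_offD[OF \<rho>(3) arc _ st] fin'[of "Suc n"] by (simp add: \<rho>'_def)
    then have "ennreal \<bar>u (\<Gamma> t) - u (\<Gamma> s)\<bar> \<le> (INF n. \<integral>\<^sup>+x\<in>{s..t}. g n (\<Gamma> x) \<partial>lborel)"
      by (rule INF_greatest)
    also have "\<dots> = (\<integral>\<^sup>+x. (INF n. g n (\<Gamma> x) * indicator {s..t} x) \<partial>lborel)"
    proof (rule nn_integral_monotone_convergence_INF_decseq[symmetric])
      show "decseq (\<lambda>n x. g n (\<Gamma> x) * indicator {s..t} x)"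
        by (intro decseq_SucI le_funI mult_right_mono dec) auto
      show "(\<lambda>x. g n (\<Gamma> x) * indicator {s..t} x) \<in> borel_measurable lborel" for n
        by (rule m[OF mg st(1,3)])
      have "(\<integral>\<^sup>+x\<in>{s..t}. g 0 (\<Gamma> x) \<partial>lborel) \<le> (\<integral>\<^sup>+x\<in>{0..l}. g 0 (\<Gamma> x) \<partial>lborel)"
        using st by (intro nn_integral_mono) (auto simp: indicator_def)
      also have "\<dots> < \<infinity>" using fin'[of 0] by (simp add: \<rho>'_def)
      finally show "(\<integral>\<^sup>+x. g 0 (\<Gamma> x) * indicator {s..t} x \<partial>lborel) < \<infinity>" .
    qed
    also have "\<dots> = (\<integral>\<^sup>+x\<in>{s..t}. (INF n. g n (\<Gamma> x)) \<partial>lborel)"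
      by (intro nn_integral_cong) (auto simp: indicator_def)
    finally show "ennreal \<bar>u (\<Gamma> t) - u (\<Gamma> s)\<bar> \<le> (\<integral>\<^sup>+x\<in>{s..t}. (INF n. g n (\<Gamma> x)) \<partial>lborel)" .
  qed
  then show ?thesis
    unfolding weak_upper_gradient_iff using \<sigma> mg by (intro conjI bexI[of _ \<sigma>]) auto
qed

text \<open>The direct method. Taking minima makes a minimising sequence decreasing, and its infimum
  \<open>h\<close> has the least norm. For a competitor \<open>g'\<close>, the minimum of
  \<open>h\<close> and \<open>g'\<close> is a weak upper gradient below \<open>h\<close> whose norm
  cannot be smaller, so it equals \<open>h\<close> almost everywhere.\<close>

lemma minimal_weak_upper_gradient_exists:
  assumes "weak_upper_gradient u g0" "(\<integral>\<^sup>+x. (g0 x)\<^sup>2 \<partial>\<mu>) < \<infinity>"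
  shows "\<exists>g. minimal_weak_upper_gradient u g"
proof -
  let ?W = "{g. weak_upper_gradient u g \<and> (\<integral>\<^sup>+x. (g x)\<^sup>2 \<partial>\<mu>) < \<infinity>}"
  define m where "m = (INF g\<in>?W. \<integral>\<^sup>+x. (g x)\<^sup>2 \<partial>\<mu>)"
  have "m \<le> (\<integral>\<^sup>+x. (g0 x)\<^sup>2 \<partial>\<mu>)" unfolding m_def using assms by (intro INF_lower) auto
  then have m: "m < \<infinity>" using assms(2) by simp
  have "\<exists>g\<in>?W. (\<integral>\<^sup>+x. (g x)\<^sup>2 \<partial>\<mu>) < m + ennreal (1 / Suc n)" for n
  proof -
    have "m < m + ennreal (1 / Suc n)" using m
      by (cases m) (auto simp: ennreal_less_iff simp flip: ennreal_plus)
    then show ?thesis unfolding m_def INF_less_iff by simp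
  qed
  then obtain g where g: "\<And>n. weak_upper_gradient u (g n)" "\<And>n. (\<integral>\<^sup>+x. (g n x)\<^sup>2 \<partial>\<mu>) < \<infinity>"
    "\<And>n. (\<integral>\<^sup>+x. (g n x)\<^sup>2 \<partial>\<mu>) < m + ennreal (1 / Suc n)" 
    by (simp add: Bex_def) metis
  define G where "G = rec_nat (g 0) (\<lambda>n h x. min (h x) (g (Suc n) x))"
  have G0: "G 0 = g 0" and GS: "G (Suc n) = (\<lambda>x. min (G n x) (g (Suc n) x))" for n
    by (auto simp: G_def)
  have Gle: "G n x \<le> g n x" for n x by (cases n) (auto simp: G0 GS)
  have GL2: "(\<integral>\<^sup>+x. (G n x)\<^sup>2 \<partial>\<mu>) < \<infinity>" for n
    using nn_integral_mono[of \<mu> "\<lambda>x. (G n x)\<^sup>2" "\<lambda>x. (g n x)\<^sup>2"] g(2)[of n] Gle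
    by (meson order_le_less_trans power_mono zero_le)
  have GW: "weak_upper_gradient u (G n)" for n
  proof (induction n)
    case (Suc n)
    then show ?case unfolding GS by (rule weak_upper_gradient_min[OF _ g(1) GL2 g(2)])
  qed (simp add: G0 g)
  define h where "h x = (INF n. G n x)" for x
  have hW: "weak_upper_gradient u h"
    unfolding h_def by (rule weak_upper_gradient_INF[OF GW GL2]) (simp add: GS)
  have hle: "(\<integral>\<^sup>+x. (h x)\<^sup>2 \<partial>\<mu>) \<le> m"
  proof (rule ennreal_le_epsilon)
    fix e :: real assume "0 < e"
    then obtain n where n: "1 / Suc n < e" by (metis nat_approx_posE)
    have "(\<integral>\<^sup>+x. (h x)\<^sup>2 \<partial>\<mu>) \<le> (\<integral>\<^sup>+x. (g n x)\<^sup>2 \<partial>\<mu>)"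
      unfolding h_def by (intro nn_integral_mono power_mono) (auto intro: INF_lower2[of n] Gle)
    also have "\<dots> \<le> m + ennreal e"
      using g(3)[of n] n by (meson add_left_mono ennreal_leI less_imp_le order_trans)
    finally show "(\<integral>\<^sup>+x. (h x)\<^sup>2 \<partial>\<mu>) \<le> m + ennreal e" .
  qed
  then have hL2: "(\<integral>\<^sup>+x. (h x)\<^sup>2 \<partial>\<mu>) < \<infinity>" using m by simp
  have "AE x in \<mu>. h x \<le> g' x"
    if g': "weak_upper_gradient u g'" "(\<integral>\<^sup>+x. (g' x)\<^sup>2 \<partial>\<mu>) < \<infinity>" for g'
  proof -
    let ?k = "\<lambda>x. min (h x) (g' x)"
    have kW: "weak_upper_gradient u ?k" by (rule weak_upper_gradient_min[OF hW g'(1) hL2 g'(2)])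
    have kle: "(?k x)\<^sup>2 \<le> (h x)\<^sup>2" for x by (intro power_mono) auto
    have kL2: "(\<integral>\<^sup>+x. (?k x)\<^sup>2 \<partial>\<mu>) < \<infinity>"
      using nn_integral_mono[of \<mu> "\<lambda>x. (?k x)\<^sup>2" "\<lambda>x. (h x)\<^sup>2"] kle hL2 by (meson order_le_less_trans)
    have mk: "?k \<in> borel_measurable \<mu>" and mh: "h \<in> borel_measurable \<mu>"
      using kW hW borel_sigma_imp_measurable by (auto simp: weak_upper_gradient_def)
    have "m \<le> (\<integral>\<^sup>+x. (?k x)\<^sup>2 \<partial>\<mu>)" unfolding m_def using kW kL2 by (intro INF_lower) auto
    then have le: "(\<integral>\<^sup>+x. (h x)\<^sup>2 \<partial>\<mu>) \<le> (\<integral>\<^sup>+x. (?k x)\<^sup>2 \<partial>\<mu>)" using hle by simp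
    have "(\<integral>\<^sup>+x. (h x)\<^sup>2 - (?k x)\<^sup>2 \<partial>\<mu>) = (\<integral>\<^sup>+x. (h x)\<^sup>2 \<partial>\<mu>) - (\<integral>\<^sup>+x. (?k x)\<^sup>2 \<partial>\<mu>)"
      using mk mh kL2 kle by (intro nn_integral_diff) (auto simp del: power_mono)
    also have "\<dots> = 0" using le hL2 by (simp add: diff_eq_0_iff_ennreal)
    finally have "AE x in \<mu>. (h x)\<^sup>2 - (?k x)\<^sup>2 = 0"
      using mk mh by (subst (asm) nn_integral_0_iff_AE) auto
    moreover have "AE x in \<mu>. (h x)\<^sup>2 \<noteq> \<infinity>"
      using hL2 mh by (intro nn_integral_PInf_AE) auto
    ultimately show ?thesis
    proof eventually_elim
      case (elim x)
      then have "(h x)\<^sup>2 \<le> (?k x)\<^sup>2" by (simp add: diff_eq_0_iff_ennreal less_top)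
      then show ?case by (simp add: ennreal_power2_le_iff)
    qed
  qed
  then show ?thesis
    unfolding minimal_weak_upper_gradient_def using hW hL2 by blast
qed

end

section \<open>Operations on upper gradients\<close>

lemma nn_integral_interval_split:
  fixes h :: "real \<Rightarrow> ennreal"
  assumes meas: "(\<lambda>x. h x * indicator {a..b} x) \<in> borel_measurable lborel" and s: "a \<le> s" "s \<le> b"
  shows "(\<integral>\<^sup>+x\<in>{a..s}. h x \<partial>lborel) + (\<integral>\<^sup>+x\<in>{s..b}. h x \<partial>lborel) = (\<integral>\<^sup>+x\<in>{a..b}. h x \<partial>lborel)"
proof -
  let ?h = "\<lambda>x. h x * indicator {a..b} x"
  have eq: "(\<lambda>x. h x * indicator {a..s} x) = (\<lambda>x. ?h x * indicator {a..s} x)"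
    "(\<lambda>x. h x * indicator {s..b} x) = (\<lambda>x. ?h x * indicator {s..b} x)"
    using s by (auto simp: indicator_def)
  have m: "(\<lambda>x. ?h x * indicator {a..s} x) \<in> borel_measurable lborel"
    "(\<lambda>x. ?h x * indicator {s..b} x) \<in> borel_measurable lborel"
    by (rule borel_measurable_times_ennreal[OF meas], simp)+
  have "(\<integral>\<^sup>+x\<in>{a..s}. h x \<partial>lborel) + (\<integral>\<^sup>+x\<in>{s..b}. h x \<partial>lborel)
      = (\<integral>\<^sup>+x. ?h x * indicator {a..s} x + ?h x * indicator {s..b} x \<partial>lborel)"
    unfolding eq by (rule nn_integral_add[symmetric, OF m])
  also have "\<dots> = (\<integral>\<^sup>+x. ?h x \<partial>lborel)"
  proof (rule nn_integral_cong_AE)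
    show "AE x in lborel. ?h x * indicator {a..s} x + ?h x * indicator {s..b} x = ?h x"
      using AE_lborel_singleton[of s]
      by eventually_elim (use s in \<open>auto simp: indicator_def\<close>)
  qed
  finally show ?thesis .
qed

text \<open>Let \<open>h\<close> dominate the increments of \<open>\<phi>\<close>. The increments are the same if \<open>\<phi>\<close> is cut at the first and the last
  time where \<open>\<phi> = c\<close>, so that \<open>h\<close> is only needed on \<open>{\<phi> \<noteq> c}\<close>.\<close>

lemma abs_diff_le_nn_integral_restrict:
  fixes \<phi> :: "real \<Rightarrow> real" and h h' :: "real \<Rightarrow> ennreal"
  assumes l: "0 \<le> l"
    and meas: "(\<lambda>x. h x * indicator {0..l} x) \<in> borel_measurable lborel"
      "(\<lambda>x. h' x * indicator {0..l} x) \<in> borel_measurable lborel"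
    and fin: "(\<integral>\<^sup>+x\<in>{0..l}. h x \<partial>lborel) < \<infinity>"
    and le: "\<And>s t. 0 \<le> s \<Longrightarrow> s \<le> t \<Longrightarrow> t \<le> l \<Longrightarrow> ennreal \<bar>\<phi> t - \<phi> s\<bar> \<le> (\<integral>\<^sup>+x\<in>{s..t}. h x \<partial>lborel)"
    and eq: "\<And>x. x \<in> {0..l} \<Longrightarrow> \<phi> x \<noteq> c \<Longrightarrow> h x \<le> h' x"
  shows "ennreal \<bar>\<phi> l - \<phi> 0\<bar> \<le> (\<integral>\<^sup>+x\<in>{0..l}. h' x \<partial>lborel)"
proof (cases "\<exists>x\<in>{0..l}. \<phi> x = c")
  case False
  have "ennreal \<bar>\<phi> l - \<phi> 0\<bar> \<le> (\<integral>\<^sup>+x\<in>{0..l}. h x \<partial>lborel)" using le l by auto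
  also have "\<dots> \<le> (\<integral>\<^sup>+x\<in>{0..l}. h' x \<partial>lborel)"
    using eq False by (intro nn_integral_mono) (auto simp: indicator_def)
  finally show ?thesis .
next
  case True
  let ?G = "\<lambda>x. enn2real (h x)"
  note I = nn_integral_interval_eq_integral[OF meas(1) fin]
  have "continuous_on {0..l} (\<lambda>t. integral {0..t} ?G)"
    by (rule indefinite_integral_continuous_1) (use I(1)[of 0 l] in auto)
  moreover have incr: "\<bar>\<phi> t - \<phi> s\<bar> \<le> integral {0..t} ?G - integral {0..s} ?G" if "0 \<le> s" "s \<le> t" "t \<le> l" for s t
  proof -
    have "integral {0..s} ?G + integral {s..t} ?G = integral {0..t} ?G"
      using that I(1)[of 0 t] by (intro Henstock_Kurzweil_Integration.integral_combine) auto
    moreover have "ennreal \<bar>\<phi> t - \<phi> s\<bar> \<le> ennreal (integral {s..t} ?G)"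
      using le[OF that] I(2)[of s t] that by simp
    moreover have "0 \<le> integral {s..t} ?G" using that by (intro integral_nonneg I(1)) auto
    ultimately show ?thesis by simp
  qed
  \<comment> \<open>Continuity makes the level set closed, so that a first and a last time exist in
    it. It holds because the increments of an indefinite integral dominate those of
    \<open>\<phi>\<close>.\<close>
  ultimately have "continuous_on {0..l} \<phi>"
    unfolding continuous_on_iff
  proof (intro ballI allI impI)
    fix x e :: real
    assume *: "\<forall>x\<in>{0..l}. \<forall>e>0. \<exists>d>0. \<forall>x'\<in>{0..l}. dist x' x < d \<longrightarrow>
        dist (integral {0..x'} ?G) (integral {0..x} ?G) < e" and x: "x \<in> {0..l}" and e: "0 < e"
    then obtain d where d: "d > 0" "\<And>x'. x' \<in> {0..l} \<Longrightarrow> dist x' x < d \<Longrightarrow>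
        dist (integral {0..x'} ?G) (integral {0..x} ?G) < e" by blast
    have "dist (\<phi> x') (\<phi> x) < e" if "x' \<in> {0..l}" "dist x' x < d" for x'
      using d(2)[OF that] incr[of x x'] incr[of x' x] that x unfolding dist_real_def
      by (cases "x \<le> x'") auto
    then show "\<exists>d>0. \<forall>x'\<in>{0..l}. dist x' x < d \<longrightarrow> dist (\<phi> x') (\<phi> x) < e" using d(1) by blast
  qed
  then have "closed {x \<in> {0..l}. \<phi> x = c}"
    by (rule continuous_closed_preimage_constant) simp
  moreover define Z where "Z = {x \<in> {0..l}. \<phi> x = c}"
  ultimately have Z: "closed Z" "Z \<noteq> {}" "Z \<subseteq> {0..l}" using True by auto
  then have bdd: "bdd_below Z" "bdd_above Z" by (auto intro: bdd_below_mono bdd_above_mono)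
  define s0 where "s0 = Inf Z" define t0 where "t0 = Sup Z"
  have s0: "s0 \<in> Z" and t0: "t0 \<in> Z"
    unfolding s0_def t0_def
    using closed_contains_Inf[OF Z(2) bdd(1) Z(1)] closed_contains_Sup[OF Z(2) bdd(2) Z(1)] by auto
  have st: "0 \<le> s0" "s0 \<le> t0" "t0 \<le> l" "\<phi> s0 = c" "\<phi> t0 = c"
    using s0 t0 Z bdd unfolding Z_def by (auto simp: t0_def[unfolded Z_def] intro!: cSup_upper)
  have nz: "\<phi> x \<noteq> c" if "x \<in> {0..l}" "x < s0 \<or> t0 < x" for x
    using that bdd cInf_lower[of x Z] cSup_upper[of x Z] by (auto simp: s0_def t0_def Z_def)
  have "\<phi> l - \<phi> 0 = (\<phi> s0 - \<phi> 0) + (\<phi> l - \<phi> t0)" using st by simp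
  then have "ennreal \<bar>\<phi> l - \<phi> 0\<bar> \<le> ennreal (\<bar>\<phi> s0 - \<phi> 0\<bar> + \<bar>\<phi> l - \<phi> t0\<bar>)" by (intro ennreal_leI) linarith
  also have "\<dots> \<le> (\<integral>\<^sup>+x\<in>{0..s0}. h x \<partial>lborel) + (\<integral>\<^sup>+x\<in>{t0..l}. h x \<partial>lborel)"
    using le[of 0 s0] le[of t0 l] st by (simp add: ennreal_plus add_mono)
  also have "\<dots> \<le> (\<integral>\<^sup>+x\<in>{0..s0}. h' x \<partial>lborel) + (\<integral>\<^sup>+x\<in>{t0..l}. h' x \<partial>lborel)"
  proof (intro add_mono nn_integral_mono_AE)
    show "AE x in lborel. h x * indicator {0..s0} x \<le> h' x * indicator {0..s0} x"
      using AE_lborel_singleton[of s0]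
      by eventually_elim (use st eq nz in \<open>auto simp: indicator_def\<close>)
    show "AE x in lborel. h x * indicator {t0..l} x \<le> h' x * indicator {t0..l} x"
      using AE_lborel_singleton[of t0]
      by eventually_elim (use st eq nz in \<open>auto simp: indicator_def\<close>)
  qed
  also have "\<dots> \<le> (\<integral>\<^sup>+x\<in>{0..s0}. h' x \<partial>lborel) + (\<integral>\<^sup>+x\<in>{s0..l}. h' x \<partial>lborel)"
    using st by (intro add_left_mono nn_integral_mono) (auto simp: indicator_def)
  also have "\<dots> = (\<integral>\<^sup>+x\<in>{0..l}. h' x \<partial>lborel)"
    using st by (intro nn_integral_interval_split meas) auto
  finally show ?thesis .
qed

context Metric_space
begin

lemma upper_gradient_measurable: "upper_gradient u g \<Longrightarrow> g \<in> borel_measurable borel_sigma"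
  by (simp add: upper_gradient_def)

lemma arc_length_curveD:
  "arc_length_curve l \<Gamma> \<Longrightarrow> 0 \<le> l" "arc_length_curve l \<Gamma> \<Longrightarrow> s \<in> {0..l} \<Longrightarrow> \<Gamma> s \<in> M"
  by (auto simp: arc_length_curve_def)

lemma upper_gradient_lincomb:
  assumes u: "upper_gradient u g" and v: "upper_gradient v h"
  shows "upper_gradient (\<lambda>x. a * u x + b * v x) (\<lambda>x. ennreal \<bar>a\<bar> * g x + ennreal \<bar>b\<bar> * h x)"
proof (rule upper_gradientI)
  show "(\<lambda>x. ennreal \<bar>a\<bar> * g x + ennreal \<bar>b\<bar> * h x) \<in> borel_measurable borel_sigma"
    using u v by (intro borel_measurable_add borel_measurable_times_ennreal) (auto simp: upper_gradient_def)
  fix l \<Gamma> assume arc: "arc_length_curve l \<Gamma>"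
  note l = arc_length_curveD(1)[OF arc]
  have m: "(\<lambda>x. g (\<Gamma> x) * indicator {0..l} x) \<in> borel_measurable lborel"
    "(\<lambda>x. h (\<Gamma> x) * indicator {0..l} x) \<in> borel_measurable lborel"
    using arc_integrand_measurable[OF arc] u v by (auto simp: upper_gradient_def)
  have "\<bar>(a * u (\<Gamma> l) + b * v (\<Gamma> l)) - (a * u (\<Gamma> 0) + b * v (\<Gamma> 0))\<bar>
      = \<bar>a * (u (\<Gamma> l) - u (\<Gamma> 0)) + b * (v (\<Gamma> l) - v (\<Gamma> 0))\<bar>" by (simp add: algebra_simps)
  also have "\<dots> \<le> \<bar>a\<bar> * \<bar>u (\<Gamma> l) - u (\<Gamma> 0)\<bar> + \<bar>b\<bar> * \<bar>v (\<Gamma> l) - v (\<Gamma> 0)\<bar>"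
    using abs_triangle_ineq by (simp only: abs_mult[symmetric])
  finally have "ennreal \<bar>(a * u (\<Gamma> l) + b * v (\<Gamma> l)) - (a * u (\<Gamma> 0) + b * v (\<Gamma> 0))\<bar>
      \<le> ennreal \<bar>a\<bar> * ennreal \<bar>u (\<Gamma> l) - u (\<Gamma> 0)\<bar> + ennreal \<bar>b\<bar> * ennreal \<bar>v (\<Gamma> l) - v (\<Gamma> 0)\<bar>"
    by (simp add: ennreal_leI flip: ennreal_mult ennreal_plus)
  also have "\<dots> \<le> ennreal \<bar>a\<bar> * (\<integral>\<^sup>+x\<in>{0..l}. g (\<Gamma> x) \<partial>lborel) + ennreal \<bar>b\<bar> * (\<integral>\<^sup>+x\<in>{0..l}. h (\<Gamma> x) \<partial>lborel)"
    using upper_gradientD[OF u arc, of 0 l] upper_gradientD[OF v arc, of 0 l] l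
    by (intro add_mono mult_left_mono) auto
  also have "\<dots> = (\<integral>\<^sup>+x\<in>{0..l}. (ennreal \<bar>a\<bar> * g (\<Gamma> x) + ennreal \<bar>b\<bar> * h (\<Gamma> x)) \<partial>lborel)"
    unfolding distrib_right mult.assoc using m
    by (subst nn_integral_add) (auto simp: nn_integral_cmult)
  finally show "ennreal \<bar>(a * u (\<Gamma> l) + b * v (\<Gamma> l)) - (a * u (\<Gamma> 0) + b * v (\<Gamma> 0))\<bar>
    \<le> (\<integral>\<^sup>+x\<in>{0..l}. (ennreal \<bar>a\<bar> * g (\<Gamma> x) + ennreal \<bar>b\<bar> * h (\<Gamma> x)) \<partial>lborel)" .
qed

text \<open>The cutting argument of \<open>abs_diff_le_nn_integral_restrict\<close> works only on
  curves where \<open>g\<close> is integrable; on the others the summand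
  \<open>ennreal e * g x\<close> keeps the line integral infinite. This is the source of locality
  for the derivative.\<close>

lemma upper_gradient_restrict:
  assumes u: "upper_gradient u g" and B: "B \<in> sets borel_sigma" "\<And>x. x \<in> M \<Longrightarrow> u x \<noteq> c \<Longrightarrow> x \<in> B" and e: "0 < e"
  shows "upper_gradient u (\<lambda>x. g x * indicator B x + ennreal e * g x)"
proof (rule upper_gradientI)
  have g: "g \<in> borel_measurable borel_sigma" using u by (simp add: upper_gradient_def)
  show m1: "(\<lambda>x. g x * indicator B x + ennreal e * g x) \<in> borel_measurable borel_sigma"
    using g B(1) by measurable
  fix l \<Gamma> assume arc: "arc_length_curve l \<Gamma>"
  note l = arc_length_curveD(1)[OF arc]
  note m = arc_integrand_measurable[OF arc _ order_refl order_refl]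
  show "ennreal \<bar>u (\<Gamma> l) - u (\<Gamma> 0)\<bar> \<le> (\<integral>\<^sup>+x\<in>{0..l}. (g (\<Gamma> x) * indicator B (\<Gamma> x) + ennreal e * g (\<Gamma> x)) \<partial>lborel)"
  proof (cases "(\<integral>\<^sup>+x\<in>{0..l}. g (\<Gamma> x) \<partial>lborel) < \<infinity>")
    case True
    show ?thesis
    proof (rule abs_diff_le_nn_integral_restrict[where \<phi>="\<lambda>x. u (\<Gamma> x)" and c=c and h="\<lambda>x. g (\<Gamma> x)"])
      show "ennreal \<bar>u (\<Gamma> t) - u (\<Gamma> s)\<bar> \<le> (\<integral>\<^sup>+x\<in>{s..t}. g (\<Gamma> x) \<partial>lborel)" if "0 \<le> s" "s \<le> t" "t \<le> l" for s t
        using upper_gradientD[OF u arc that] .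
      show "g (\<Gamma> x) \<le> g (\<Gamma> x) * indicator B (\<Gamma> x) + ennreal e * g (\<Gamma> x)" if "x \<in> {0..l}" "u (\<Gamma> x) \<noteq> c" for x
        using B(2)[OF arc_length_curveD(2)[OF arc that(1)] that(2)] by simp
    qed (use l m[OF g] m[OF m1] True in auto)
  next
    case False
    have "ennreal e * (\<integral>\<^sup>+x\<in>{0..l}. g (\<Gamma> x) \<partial>lborel) = (\<integral>\<^sup>+x\<in>{0..l}. (ennreal e * g (\<Gamma> x)) \<partial>lborel)"
      unfolding mult.assoc using m[OF g] by (simp add: nn_integral_cmult)
    also have "\<dots> \<le> (\<integral>\<^sup>+x\<in>{0..l}. (g (\<Gamma> x) * indicator B (\<Gamma> x) + ennreal e * g (\<Gamma> x)) \<partial>lborel)"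
      by (intro nn_integral_mono mult_right_mono) auto
    finally show ?thesis
      using False e by (simp add: not_less top_unique ennreal_mult_top)
  qed
qed

text \<open>In arc length \<open>\<eta>\<close> becomes an \<open>L\<close>-Lipschitz function of
  one variable, so the constant \<open>L\<close> dominates its increments; cutting at the level
  \<open>c\<close> confines it to \<open>B\<close>.\<close>

lemma upper_gradient_Lipschitz:
  assumes Lip: "\<And>x y. x \<in> M \<Longrightarrow> y \<in> M \<Longrightarrow> \<bar>\<eta> x - \<eta> y\<bar> \<le> L * d x y" and L: "0 \<le> L"
    and B: "B \<in> sets borel_sigma" "\<And>x. x \<in> M \<Longrightarrow> \<eta> x \<noteq> c \<Longrightarrow> x \<in> B"
  shows "upper_gradient \<eta> (\<lambda>x. ennreal L * indicator B x)"
proof (rule upper_gradientI)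
  show m1: "(\<lambda>x. ennreal L * indicator B x) \<in> borel_measurable borel_sigma"
    using B(1) by measurable
  fix l \<Gamma> assume arc: "arc_length_curve l \<Gamma>"
  note l = arc_length_curveD(1)[OF arc]
  note m = arc_integrand_measurable[OF arc _ order_refl order_refl]
  have int: "(\<integral>\<^sup>+x\<in>{s..t}. ennreal L \<partial>lborel) = ennreal (L * (t - s))" if "s \<le> t" for s t :: real
    using that L by (simp add: nn_integral_cmult_indicator ennreal_mult)
  show "ennreal \<bar>\<eta> (\<Gamma> l) - \<eta> (\<Gamma> 0)\<bar> \<le> (\<integral>\<^sup>+x\<in>{0..l}. (ennreal L * indicator B (\<Gamma> x)) \<partial>lborel)"
  proof (rule abs_diff_le_nn_integral_restrict[where \<phi>="\<lambda>x. \<eta> (\<Gamma> x)" and c=c and h="\<lambda>x. ennreal L"])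
    show "ennreal \<bar>\<eta> (\<Gamma> t) - \<eta> (\<Gamma> s)\<bar> \<le> (\<integral>\<^sup>+x\<in>{s..t}. ennreal L \<partial>lborel)" if st: "0 \<le> s" "s \<le> t" "t \<le> l" for s t
    proof -
      have "\<bar>\<eta> (\<Gamma> t) - \<eta> (\<Gamma> s)\<bar> \<le> L * d (\<Gamma> s) (\<Gamma> t)"
        using Lip[of "\<Gamma> t" "\<Gamma> s"] arc_length_curveD(2)[OF arc] st by (simp add: commute)
      also have "\<dots> \<le> L * (t - s)" by (intro mult_left_mono arc_length_curve_dist[OF arc] st L)
      finally show ?thesis unfolding int[OF st(2)] by (rule ennreal_leI)
    qed
    show "ennreal L \<le> ennreal L * indicator B (\<Gamma> x)" if "x \<in> {0..l}" "\<eta> (\<Gamma> x) \<noteq> c" for x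
      using B(2)[OF arc_length_curveD(2)[OF arc that(1)] that(2)] by simp
  qed (use l m[OF m1] int in auto)
qed

text \<open>The increment of the product along a curve is estimated through an intermediate point \<open>s\<close>, and
  then averaged over \<open>s\<close>.\<close>

lemma upper_gradient_mult_Lipschitz:
  assumes u: "upper_gradient u g"
    and Lip: "\<And>x y. x \<in> M \<Longrightarrow> y \<in> M \<Longrightarrow> \<bar>\<eta> x - \<eta> y\<bar> \<le> L * d x y" and L: "0 \<le> L"
    and K: "\<And>x. x \<in> M \<Longrightarrow> \<bar>\<eta> x\<bar> \<le> K"
    and w: "w \<in> borel_measurable borel_sigma" "\<And>x. x \<in> M \<Longrightarrow> ennreal \<bar>u x\<bar> \<le> w x"
  shows "upper_gradient (\<lambda>x. \<eta> x * u x) (\<lambda>x. ennreal K * g x + ennreal L * w x)"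
proof (rule upper_gradientI)
  have g: "g \<in> borel_measurable borel_sigma" using u by (simp add: upper_gradient_def)
  show "(\<lambda>x. ennreal K * g x + ennreal L * w x) \<in> borel_measurable borel_sigma"
    using g w(1) by measurable
  fix l \<Gamma> assume arc: "arc_length_curve l \<Gamma>"
  note m = arc_integrand_measurable[OF arc _ order_refl order_refl]
  note \<Gamma>M = arc_length_curveD(2)[OF arc]
  let ?g = "\<integral>\<^sup>+x\<in>{0..l}. g (\<Gamma> x) \<partial>lborel" and ?w = "\<integral>\<^sup>+x\<in>{0..l}. w (\<Gamma> x) \<partial>lborel"
  let ?\<Delta> = "ennreal \<bar>\<eta> (\<Gamma> l) * u (\<Gamma> l) - \<eta> (\<Gamma> 0) * u (\<Gamma> 0)\<bar>"
  have "?\<Delta> \<le> ennreal K * ?g + ennreal L * ?w"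
  proof (cases "l = 0")
    case False
    then have l: "0 < l" using arc_length_curveD(1)[OF arc] by simp
    have K0: "0 \<le> K" using K[OF \<Gamma>M[of 0]] l by (meson abs_ge_zero atLeastAtMost_iff less_imp_le order_refl order_trans)
    have pt: "?\<Delta> \<le> ennreal K * ?g + ennreal (L * l) * w (\<Gamma> s)" if s: "s \<in> {0..l}" for s
    proof -
      have sM: "\<Gamma> s \<in> M" "\<Gamma> 0 \<in> M" "\<Gamma> l \<in> M" using \<Gamma>M s l by auto
      have "\<eta> (\<Gamma> l) * u (\<Gamma> l) - \<eta> (\<Gamma> 0) * u (\<Gamma> 0) = \<eta> (\<Gamma> l) * (u (\<Gamma> l) - u (\<Gamma> s))
          + (\<eta> (\<Gamma> l) - \<eta> (\<Gamma> 0)) * u (\<Gamma> s) + \<eta> (\<Gamma> 0) * (u (\<Gamma> s) - u (\<Gamma> 0))"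
        by (simp add: algebra_simps)
      then have "\<bar>\<eta> (\<Gamma> l) * u (\<Gamma> l) - \<eta> (\<Gamma> 0) * u (\<Gamma> 0)\<bar> \<le> \<bar>\<eta> (\<Gamma> l)\<bar> * \<bar>u (\<Gamma> l) - u (\<Gamma> s)\<bar>
          + \<bar>\<eta> (\<Gamma> l) - \<eta> (\<Gamma> 0)\<bar> * \<bar>u (\<Gamma> s)\<bar> + \<bar>\<eta> (\<Gamma> 0)\<bar> * \<bar>u (\<Gamma> s) - u (\<Gamma> 0)\<bar>"
        unfolding abs_mult[symmetric] by linarith
      also have "\<dots> \<le> K * \<bar>u (\<Gamma> l) - u (\<Gamma> s)\<bar> + (L * l) * \<bar>u (\<Gamma> s)\<bar> + K * \<bar>u (\<Gamma> s) - u (\<Gamma> 0)\<bar>"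
      proof (intro add_mono mult_right_mono)
        have "\<bar>\<eta> (\<Gamma> l) - \<eta> (\<Gamma> 0)\<bar> \<le> L * d (\<Gamma> 0) (\<Gamma> l)" using Lip[OF sM(3,2)] by (simp add: commute)
        also have "\<dots> \<le> L * (l - 0)" by (intro mult_left_mono arc_length_curve_dist[OF arc] L) (use l in auto)
        finally show "\<bar>\<eta> (\<Gamma> l) - \<eta> (\<Gamma> 0)\<bar> \<le> L * l" by simp
      qed (use K sM in auto)
      finally have "?\<Delta> \<le> ennreal (K * \<bar>u (\<Gamma> l) - u (\<Gamma> s)\<bar> + (L * l) * \<bar>u (\<Gamma> s)\<bar> + K * \<bar>u (\<Gamma> s) - u (\<Gamma> 0)\<bar>)"
        by (rule ennreal_leI)
      also have "\<dots> = ennreal K * ennreal \<bar>u (\<Gamma> l) - u (\<Gamma> s)\<bar> + ennreal (L * l) * ennreal \<bar>u (\<Gamma> s)\<bar>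
          + ennreal K * ennreal \<bar>u (\<Gamma> s) - u (\<Gamma> 0)\<bar>"
        using K0 L l by (simp add: ennreal_plus ennreal_mult)
      also have "\<dots> \<le> ennreal K * (\<integral>\<^sup>+x\<in>{s..l}. g (\<Gamma> x) \<partial>lborel) + ennreal (L * l) * w (\<Gamma> s)
          + ennreal K * (\<integral>\<^sup>+x\<in>{0..s}. g (\<Gamma> x) \<partial>lborel)"
        using upper_gradientD[OF u arc, of s l] upper_gradientD[OF u arc, of 0 s] s w(2)[OF sM(1)]
        by (intro add_mono mult_left_mono) auto
      also have "\<dots> = ennreal K * ((\<integral>\<^sup>+x\<in>{0..s}. g (\<Gamma> x) \<partial>lborel) + (\<integral>\<^sup>+x\<in>{s..l}. g (\<Gamma> x) \<partial>lborel)) + ennreal (L * l) * w (\<Gamma> s)"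
        by (simp add: distrib_left ac_simps)
      also have "(\<integral>\<^sup>+x\<in>{0..s}. g (\<Gamma> x) \<partial>lborel) + (\<integral>\<^sup>+x\<in>{s..l}. g (\<Gamma> x) \<partial>lborel) = ?g"
        by (rule nn_integral_interval_split[OF m[OF g]]) (use s in auto)
      finally show ?thesis .
    qed
    have "ennreal l * ?\<Delta> = (\<integral>\<^sup>+s\<in>{0..l}. ?\<Delta> \<partial>lborel)"
      using l by (subst mult.commute, subst nn_integral_cmult_indicator) auto
    also have "\<dots> \<le> (\<integral>\<^sup>+s. ennreal K * ?g * indicator {0..l} s + ennreal (L * l) * (w (\<Gamma> s) * indicator {0..l} s) \<partial>lborel)"
      using pt by (intro nn_integral_mono) (auto simp: indicator_def)
    also have "\<dots> = ennreal K * ?g * ennreal l + ennreal (L * l) * ?w"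
      using m[OF w(1)] l by (simp add: nn_integral_add nn_integral_cmult nn_integral_cmult_indicator)
    also have "\<dots> = ennreal l * (ennreal K * ?g + ennreal L * ?w)"
      using L l by (simp add: ennreal_mult distrib_left ac_simps)
    finally have "ennreal l * ?\<Delta> \<le> ennreal l * (ennreal K * ?g + ennreal L * ?w)" .
    then show ?thesis using l by (simp add: ennreal_mult_le_mult_iff)
  qed simp
  also have "\<dots> = (\<integral>\<^sup>+x\<in>{0..l}. (ennreal K * g (\<Gamma> x) + ennreal L * w (\<Gamma> x)) \<partial>lborel)"
    unfolding distrib_right mult.assoc using m[OF g] m[OF w(1)]
    by (subst nn_integral_add) (auto simp: nn_integral_cmult)
  finally show "?\<Delta> \<le> (\<integral>\<^sup>+x\<in>{0..l}. (ennreal K * g (\<Gamma> x) + ennreal L * w (\<Gamma> x)) \<partial>lborel)" .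
qed

text \<open>Junk value \<open>0\<close> where the series diverges: a curve either avoids divergence altogether or
  lies entirely in the exceptional set \<open>N\<close>, where the second summand is infinite.\<close>

lemma upper_gradient_limit:
  fixes u :: "nat \<Rightarrow> 'a \<Rightarrow> real"
  assumes G: "\<And>k. upper_gradient (\<lambda>x. u (Suc k) x - u k x) (G k)"
    and N: "N \<in> sets borel_sigma" "\<And>x. x \<in> M - N \<Longrightarrow> summable (\<lambda>k. \<bar>u (Suc k) x - u k x\<bar>)"
    and v: "\<And>x. v x = (if summable (\<lambda>k. \<bar>u (Suc k) x - u k x\<bar>) then lim (\<lambda>k. u k x) else 0)"
  shows "upper_gradient (\<lambda>x. v x - u k x) (\<lambda>x. (\<Sum>j. G (j + k) x) + top * indicator N x)"
proof (rule upper_gradientI)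
  have mG: "G k \<in> borel_measurable borel_sigma" for k using G[of k] by (simp add: upper_gradient_def)
  show mm: "(\<lambda>x. (\<Sum>j. G (j + k) x) + top * indicator N x) \<in> borel_measurable borel_sigma"
    using mG N(1) by measurable
  fix l \<Gamma> assume arc: "arc_length_curve l \<Gamma>"
  note m = arc_integrand_measurable[OF arc _ order_refl order_refl]
  note \<Gamma>M = arc_length_curveD(2)[OF arc]
  have l0: "0 \<le> l" by (rule arc_length_curveD(1)[OF arc])
  let ?R = "\<integral>\<^sup>+x\<in>{0..l}. ((\<Sum>j. G (j + k) (\<Gamma> x)) + top * indicator N (\<Gamma> x)) \<partial>lborel"
  let ?w = "\<lambda>j x. u (Suc j) x - u j x"
  show "ennreal \<bar>(v (\<Gamma> l) - u k (\<Gamma> l)) - (v (\<Gamma> 0) - u k (\<Gamma> 0))\<bar> \<le> ?R"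
  proof (cases "l = 0 \<or> ?R = top")
    case True
    then show ?thesis by auto
  next
    case False
    then have l: "0 < l" and fin: "?R < top" using l0 by (auto simp: less_top)
    \<comment> \<open>The integral of \<open>top * indicator N\<close> along a curve of positive
      length inside \<open>N\<close> would be infinite.\<close>
    have "\<exists>s\<in>{0..l}. \<Gamma> s \<notin> N"
    proof (rule ccontr)
      assume "\<not> ?thesis"
      then have "(\<integral>\<^sup>+x. top * indicator {0..l} x \<partial>lborel) \<le> ?R"
        by (intro nn_integral_mono) (auto simp: indicator_def)
      moreover have "(\<integral>\<^sup>+x. top * indicator {0..l} x \<partial>lborel) = (top :: ennreal)"
        using l by (subst nn_integral_cmult_indicator) (auto simp: ennreal_top_mult)
      ultimately show False using fin by (simp add: top_unique)
    qed
    then obtain s where s: "s \<in> {0..l}" "\<Gamma> s \<in> M - N" using \<Gamma>M by auto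
    define a where "a j = enn2real (\<integral>\<^sup>+x\<in>{0..l}. G (j + k) (\<Gamma> x) \<partial>lborel)" for j
    have sumG: "(\<Sum>j. \<integral>\<^sup>+x\<in>{0..l}. G (j + k) (\<Gamma> x) \<partial>lborel) \<le> ?R"
    proof -
      have "(\<Sum>j. \<integral>\<^sup>+x\<in>{0..l}. G (j + k) (\<Gamma> x) \<partial>lborel) = (\<integral>\<^sup>+x. (\<Sum>j. G (j + k) (\<Gamma> x) * indicator {0..l} x) \<partial>lborel)"
        using m[OF mG] by (intro nn_integral_suminf[symmetric]) auto
      also have "\<dots> \<le> ?R" by (intro nn_integral_mono) (auto simp: indicator_def)
      finally show ?thesis .
    qed
    have "(\<integral>\<^sup>+x\<in>{0..l}. G (j + k) (\<Gamma> x) \<partial>lborel) < top" for j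
      using sum_le_suminf[of "\<lambda>j. \<integral>\<^sup>+x\<in>{0..l}. G (j + k) (\<Gamma> x) \<partial>lborel" "{j}"] sumG fin by auto
    then have a: "(\<integral>\<^sup>+x\<in>{0..l}. G (j + k) (\<Gamma> x) \<partial>lborel) = ennreal (a j)" "0 \<le> a j" for j
      by (auto simp: a_def)
    have summ_a: "summable a"
      using sumG fin a by (intro summable_suminf_not_top) auto
    have incr: "\<bar>?w (j + k) (\<Gamma> t) - ?w (j + k) (\<Gamma> r)\<bar> \<le> a j" if "t \<in> {0..l}" "r \<in> {0..l}" "r \<le> t" for j r t
    proof -
      have "ennreal \<bar>?w (j + k) (\<Gamma> t) - ?w (j + k) (\<Gamma> r)\<bar> \<le> (\<integral>\<^sup>+x\<in>{r..t}. G (j + k) (\<Gamma> x) \<partial>lborel)"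
        using upper_gradientD[OF G arc, of r t "j + k"] that by auto
      also have "\<dots> \<le> (\<integral>\<^sup>+x\<in>{0..l}. G (j + k) (\<Gamma> x) \<partial>lborel)"
        using that by (intro nn_integral_mono) (auto simp: indicator_def)
      also have "\<dots> = ennreal (a j)" by (rule a)
      finally show ?thesis using a(2) by simp
    qed
    \<comment> \<open>Summability at the single point \<open>\<Gamma> s\<close> spreads along the
      curve, since the increments of the terms are bounded by the summable
      \<open>a j\<close>.\<close>
    have summ: "summable (\<lambda>j. \<bar>?w j (\<Gamma> t)\<bar>)" if t: "t \<in> {0..l}" for t
    proof -
      have "summable (\<lambda>j. \<bar>?w (j + k) (\<Gamma> s)\<bar> + a j)"
        using N(2)[OF s(2)] summ_a by (intro summable_add) (auto simp: summable_iff_shift[of "\<lambda>j. \<bar>?w j (\<Gamma> s)\<bar>" k])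
      then have "summable (\<lambda>j. \<bar>?w (j + k) (\<Gamma> t)\<bar>)"
      proof (rule summable_comparison_test'[where N=0])
        fix j
        have "\<bar>?w (j + k) (\<Gamma> t) - ?w (j + k) (\<Gamma> s)\<bar> \<le> a j"
          using incr[of t s j] incr[of s t j] s t by (cases "s \<le> t") auto
        then show "norm \<bar>?w (j + k) (\<Gamma> t)\<bar> \<le> \<bar>?w (j + k) (\<Gamma> s)\<bar> + a j" by simp
      qed
      then show ?thesis by (simp only: summable_iff_shift[of "\<lambda>j. \<bar>?w j (\<Gamma> t)\<bar>" k])
    qed
    have sums: "(\<lambda>j. ?w (j + k) (\<Gamma> t)) sums (v (\<Gamma> t) - u k (\<Gamma> t))" if t: "t \<in> {0..l}" for t
    proof -
      have "summable (\<lambda>j. ?w j (\<Gamma> t))" using summ[OF t] by (rule summable_rabs_cancel)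
      then have "convergent (\<lambda>n. u n (\<Gamma> t) - u 0 (\<Gamma> t))"
        unfolding summable_iff_convergent sum_lessThan_telescope[of "\<lambda>n. u n (\<Gamma> t)"] .
      then have "convergent (\<lambda>n. u n (\<Gamma> t))"
        using convergent_diff_const_right_iff[of "\<lambda>n. u n (\<Gamma> t)"] by simp
      then have "(\<lambda>n. u n (\<Gamma> t)) \<longlonglongrightarrow> v (\<Gamma> t)"
        using v[of "\<Gamma> t"] summ[OF t] by (simp add: convergent_LIMSEQ_iff)
      then have "(\<lambda>n. u (n + k) (\<Gamma> t)) \<longlonglongrightarrow> v (\<Gamma> t)" by (rule LIMSEQ_ignore_initial_segment)
      from telescope_sums[OF this] show ?thesis by simp
    qed
    have "(\<lambda>j. ?w (j + k) (\<Gamma> l) - ?w (j + k) (\<Gamma> 0)) sums ((v (\<Gamma> l) - u k (\<Gamma> l)) - (v (\<Gamma> 0) - u k (\<Gamma> 0)))"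
      using l by (intro sums_diff sums) auto
    then have "\<bar>(v (\<Gamma> l) - u k (\<Gamma> l)) - (v (\<Gamma> 0) - u k (\<Gamma> 0))\<bar> = \<bar>\<Sum>j. ?w (j + k) (\<Gamma> l) - ?w (j + k) (\<Gamma> 0)\<bar>"
      by (simp add: sums_iff)
    also have "\<dots> \<le> (\<Sum>j. a j)"
      using norm_suminf_le[of "\<lambda>j. ?w (j + k) (\<Gamma> l) - ?w (j + k) (\<Gamma> 0)" a] incr[of l 0] l summ_a by auto
    finally have "ennreal \<bar>(v (\<Gamma> l) - u k (\<Gamma> l)) - (v (\<Gamma> 0) - u k (\<Gamma> 0))\<bar> \<le> ennreal (\<Sum>j. a j)" by (rule ennreal_leI)
    also have "\<dots> = (\<Sum>j. ennreal (a j))"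
      using a(2) summ_a by (intro suminf_ennreal2[symmetric]) auto
    also have "\<dots> \<le> ?R" using sumG a(1) by simp
    finally show ?thesis .
  qed
qed

end

section \<open>Newtonian functions and doubling measures\<close>

context Metric_space
begin

section \<open>Lipschitz cut-off functions\<close>

lemma Lipschitz_borel_measurable:
  fixes \<eta> :: "'a \<Rightarrow> real"
  assumes Lip: "\<And>x y. x \<in> M \<Longrightarrow> y \<in> M \<Longrightarrow> \<bar>\<eta> x - \<eta> y\<bar> \<le> L * d x y"
  shows "\<eta> \<in> borel_measurable borel_sigma"
proof (rule borel_measurableI)
  fix S :: "real set" assume S: "open S"
  have "openin mtopology {x \<in> M. \<eta> x \<in> S}"
    unfolding openin_mtopology
  proof (intro conjI allI impI)
    fix x assume x: "x \<in> {x \<in> M. \<eta> x \<in> S}"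
    then obtain e where e: "e > 0" "\<And>t. \<bar>t - \<eta> x\<bar> < e \<Longrightarrow> t \<in> S"
      using S unfolding open_dist dist_real_def by blast
    have "mball x (e / (1 + \<bar>L\<bar>)) \<subseteq> {x \<in> M. \<eta> x \<in> S}"
    proof
      fix y assume y: "y \<in> mball x (e / (1 + \<bar>L\<bar>))"
      then have yM: "y \<in> M" "d y x < e / (1 + \<bar>L\<bar>)" by (auto simp: commute)
      have "\<bar>\<eta> y - \<eta> x\<bar> \<le> L * d y x" using Lip yM x by auto
      also have "\<dots> \<le> (1 + \<bar>L\<bar>) * d y x" by (intro mult_right_mono) auto
      also have "\<dots> < e" using yM(2) by (simp add: field_simps)
      finally show "y \<in> {x \<in> M. \<eta> x \<in> S}" using e(2) yM by simp
    qed
    then show "\<exists>r>0. mball x r \<subseteq> {x \<in> M. \<eta> x \<in> S}"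
      using e(1) by (intro exI[of _ "e / (1 + \<bar>L\<bar>)"]) (auto simp: add_pos_nonneg)
  qed auto
  then have "{x \<in> M. \<eta> x \<in> S} \<in> sets borel_sigma" by (rule open_in_borel_sigma)
  moreover have "\<eta> -` S \<inter> space borel_sigma = {x \<in> M. \<eta> x \<in> S}" by auto
  ultimately show "\<eta> -` S \<inter> space borel_sigma \<in> sets borel_sigma" by simp
qed

definition bump :: "'a \<Rightarrow> real \<Rightarrow> 'a \<Rightarrow> real" where
  "bump p r x = max 0 (min 1 (2 - d p x / r))"

lemma bump_bounds: "0 \<le> bump p r x" "bump p r x \<le> 1" "\<bar>bump p r x\<bar> \<le> 1"
  by (auto simp: bump_def)

lemma bump_eq_1: "0 < r \<Longrightarrow> x \<in> mball p r \<Longrightarrow> bump p r x = 1"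
  by (auto simp: bump_def divide_simps max_def min_def)

lemma bump_neq_0: "0 < r \<Longrightarrow> p \<in> M \<Longrightarrow> x \<in> M \<Longrightarrow> bump p r x \<noteq> 0 \<Longrightarrow> x \<in> mball p (2 * r)"
  by (auto simp: bump_def divide_simps max_def min_def split: if_splits)

lemma bump_Lipschitz:
  assumes "0 < r" "p \<in> M" "x \<in> M" "y \<in> M"
  shows "\<bar>bump p r x - bump p r y\<bar> \<le> (1 / r) * d x y"
proof -
  have "\<bar>bump p r x - bump p r y\<bar> \<le> \<bar>d p x / r - d p y / r\<bar>"
    unfolding bump_def by (auto simp: max_def min_def abs_if)
  also have "\<dots> = \<bar>d p x - d p y\<bar> / r" using assms(1) by (simp add: diff_divide_distrib[symmetric])
  also have "\<dots> \<le> d x y / r"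
    using triangle[of p x y] triangle[of p y x] assms by (intro divide_right_mono) (auto simp: commute abs_le_iff)
  finally show ?thesis by simp
qed

end

context metric_measure_space
begin

lemma ball_sets [measurable, simp]: "mball x r \<in> sets \<mu>"
  using borel_sets open_in_borel_sigma[OF openin_mball] by blast

lemma M_nonempty: "M \<noteq> {}"
  using nontrivial by auto

lemma N12D:
  assumes "u \<in> N12"
  shows "u \<in> borel_measurable \<mu>" "(\<integral>\<^sup>+ x. ennreal ((u x)\<^sup>2) \<partial>\<mu>) < \<infinity>"
    "\<exists>g. upper_gradient u g \<and> (\<integral>\<^sup>+ x. (g x)\<^sup>2 \<partial>\<mu>) < \<infinity>"
  using assms by (auto simp: N12_def)

lemma N12_L2: "u \<in> N12 \<Longrightarrow> integrable \<mu> (\<lambda>x. (u x)\<^sup>2)"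
  using N12D(1,2)[of u] by (intro integrableI_nonneg) auto

lemma nn_integral_power2_add_finite:
  fixes f g :: "'a \<Rightarrow> ennreal"
  assumes "f \<in> borel_measurable \<mu>" "g \<in> borel_measurable \<mu>"
    "(\<integral>\<^sup>+x. (f x)\<^sup>2 \<partial>\<mu>) < \<infinity>" "(\<integral>\<^sup>+x. (g x)\<^sup>2 \<partial>\<mu>) < \<infinity>" "a < \<infinity>" "b < \<infinity>"
  shows "(\<integral>\<^sup>+x. (a * f x + b * g x)\<^sup>2 \<partial>\<mu>) < \<infinity>"
proof -
  have "(\<integral>\<^sup>+x. (a * f x + b * g x)\<^sup>2 \<partial>\<mu>) \<le> (\<integral>\<^sup>+x. (2 * a\<^sup>2) * (f x)\<^sup>2 + (2 * b\<^sup>2) * (g x)\<^sup>2 \<partial>\<mu>)"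
    using ennreal_power2_add_le[of "a * f _" "b * g _"]
    by (intro nn_integral_mono) (simp add: power_mult_distrib mult.assoc)
  also have "\<dots> = (2 * a\<^sup>2) * (\<integral>\<^sup>+x. (f x)\<^sup>2 \<partial>\<mu>) + (2 * b\<^sup>2) * (\<integral>\<^sup>+x. (g x)\<^sup>2 \<partial>\<mu>)"
    using assms(1,2) by (simp add: nn_integral_add nn_integral_cmult)
  also have "\<dots> < \<infinity>" using assms(3-) by (simp add: ennreal_mult_less_top power2_eq_square)
  finally show ?thesis .
qed

lemma N12_lincomb:
  assumes "u \<in> N12" "v \<in> N12"
  shows "(\<lambda>x. a * u x + b * v x) \<in> N12"
proof -
  obtain g h where g: "upper_gradient u g" "(\<integral>\<^sup>+ x. (g x)\<^sup>2 \<partial>\<mu>) < \<infinity>"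
    and h: "upper_gradient v h" "(\<integral>\<^sup>+ x. (h x)\<^sup>2 \<partial>\<mu>) < \<infinity>"
    using N12D(3) assms by meson
  note m = N12D(1)[OF assms(1)] N12D(1)[OF assms(2)]
  have "(\<integral>\<^sup>+ x. ennreal ((a * u x + b * v x)\<^sup>2) \<partial>\<mu>)
      \<le> (\<integral>\<^sup>+ x. ennreal (2 * a\<^sup>2) * ennreal ((u x)\<^sup>2) + ennreal (2 * b\<^sup>2) * ennreal ((v x)\<^sup>2) \<partial>\<mu>)"
  proof (rule nn_integral_mono)
    fix x
    have "(a * u x + b * v x)\<^sup>2 \<le> 2 * a\<^sup>2 * (u x)\<^sup>2 + 2 * b\<^sup>2 * (v x)\<^sup>2"
      using zero_le_power2[of "a * u x - b * v x"] by (simp add: power2_eq_square algebra_simps)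
    then show "ennreal ((a * u x + b * v x)\<^sup>2) \<le> ennreal (2 * a\<^sup>2) * ennreal ((u x)\<^sup>2) + ennreal (2 * b\<^sup>2) * ennreal ((v x)\<^sup>2)"
      by (simp add: ennreal_leI flip: ennreal_mult ennreal_plus)
  qed
  also have "\<dots> = ennreal (2 * a\<^sup>2) * (\<integral>\<^sup>+ x. ennreal ((u x)\<^sup>2) \<partial>\<mu>) + ennreal (2 * b\<^sup>2) * (\<integral>\<^sup>+ x. ennreal ((v x)\<^sup>2) \<partial>\<mu>)"
    using m by (simp add: nn_integral_add nn_integral_cmult)
  also have "\<dots> < \<infinity>"
    using N12D(2)[OF assms(1)] N12D(2)[OF assms(2)] by (simp add: ennreal_mult_less_top)
  finally have "(\<integral>\<^sup>+ x. ennreal ((a * u x + b * v x)\<^sup>2) \<partial>\<mu>) < \<infinity>" .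
  moreover have "(\<integral>\<^sup>+x. (ennreal \<bar>a\<bar> * g x + ennreal \<bar>b\<bar> * h x)\<^sup>2 \<partial>\<mu>) < \<infinity>"
    using g h by (intro nn_integral_power2_add_finite borel_sigma_imp_measurable upper_gradient_measurable) auto
  moreover have "(\<lambda>x. a * u x + b * v x) \<in> borel_measurable \<mu>" using m by measurable
  ultimately show ?thesis
    using upper_gradient_lincomb[OF g(1) h(1), of a b] by (auto simp: N12_def)
qed

lemma N12_diff: "u \<in> N12 \<Longrightarrow> v \<in> N12 \<Longrightarrow> (\<lambda>x. u x - v x) \<in> N12"
  using N12_lincomb[of u v 1 "-1"] by simp

lemma N12_add: "u \<in> N12 \<Longrightarrow> v \<in> N12 \<Longrightarrow> (\<lambda>x. u x + v x) \<in> N12"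
  using N12_lincomb[of u v 1 1] by simp

lemma N12_scale: "u \<in> N12 \<Longrightarrow> (\<lambda>x. a * u x) \<in> N12"
  using N12_lincomb[of u u a 0] by simp

lemma openin_subset_sets: "openin mtopology U \<Longrightarrow> U \<in> sets \<mu>"
  using borel_sets open_in_borel_sigma by blast

text \<open>By separability, the diagonal strip is a countable union of products of balls.\<close>

lemma strip_measurable: "{z \<in> M \<times> M. d (fst z) (snd z) < s} \<in> sets (\<mu> \<Otimes>\<^sub>M \<mu>)"
proof -
  obtain Q where Q: "countable Q" "Q \<subseteq> M" "mtopology closure_of Q = M"
    using separable unfolding separable_space_def by auto
  have "{z \<in> M \<times> M. d (fst z) (snd z) < s} = (\<Union>q\<in>Q. \<Union>r\<in>\<rat>. mball q r \<times> mball q (s - r))"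
  proof (intro equalityI subsetI)
    fix z assume "z \<in> {z \<in> M \<times> M. d (fst z) (snd z) < s}"
    then obtain x y where z: "z = (x, y)" and xy: "x \<in> M" "y \<in> M" "d x y < s" by (cases z) auto
    define e where "e = (s - d x y) / 2"
    have e: "0 < e" using xy by (simp add: e_def)
    have "x \<in> mtopology closure_of Q" using Q xy by simp
    then obtain q where q: "q \<in> Q" "q \<in> mball x e"
      unfolding metric_closure_of using e by blast
    obtain r where r: "r \<in> \<rat>" "d q x < r" "r < e"
      using Rats_dense_in_real[of "d q x" e] q by (auto simp: commute)
    have "d q y \<le> d q x + d x y" using triangle[of q x y] q xy by auto
    then have "d q y < s - r" using q r unfolding e_def by (auto simp: commute field_simps)
    then have "z \<in> mball q r \<times> mball q (s - r)" using z xy q r Q by auto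
    then show "z \<in> (\<Union>q\<in>Q. \<Union>r\<in>\<rat>. mball q r \<times> mball q (s - r))" using q r by blast
  next
    fix z assume "z \<in> (\<Union>q\<in>Q. \<Union>r\<in>\<rat>. mball q r \<times> mball q (s - r))"
    then obtain q r x y where z: "z = (x, y)" "x \<in> mball q r" "y \<in> mball q (s - r)" by auto
    then have "d x y < s" using triangle[of x q y] by (auto simp: commute)
    then show "z \<in> {z \<in> M \<times> M. d (fst z) (snd z) < s}" using z by auto
  qed
  also have "\<dots> \<in> sets (\<mu> \<Otimes>\<^sub>M \<mu>)"
    using Q(1) countable_rat by (intro sets.countable_UN'' pair_measureI) auto
  finally show ?thesis .
qed

end

section \<open>Doubling measures and Borel approximation\<close>

locale doubling_space = metric_measure_space M d \<mu>
  for M :: "'a set" and d and \<mu> +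
  fixes Cm :: real
  assumes Cm_ge_1: "1 \<le> Cm" and doubling_Cm: "doubling Cm"
begin

lemma ball_pos: "x \<in> M \<Longrightarrow> 0 < r \<Longrightarrow> 0 < emeasure \<mu> (mball x r)"
  using doubling_Cm unfolding doubling_def by (metis half_gt_zero_iff mult.commute nonzero_mult_div_cancel_left times_divide_eq_left times_divide_eq_right zero_neq_numeral)

lemma ball_finite: "emeasure \<mu> (mball x r) < \<infinity>"
proof (cases "x \<in> M \<and> 0 < r")
  case False
  then have "y \<notin> mball x r" for y using nonneg[of x y] by (auto simp del: nonneg)
  then have "mball x r = {}" by blast
  then show ?thesis by simp
qed (use doubling_Cm in \<open>auto simp: doubling_def\<close>)

lemma ball_double: "x \<in> M \<Longrightarrow> 0 < r \<Longrightarrow> emeasure \<mu> (mball x (2 * r)) \<le> ennreal Cm * emeasure \<mu> (mball x r)"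
  using doubling_Cm by (auto simp: doubling_def)

lemma ball_measure: "emeasure \<mu> (mball x r) = ennreal (measure \<mu> (mball x r))"
  using ball_finite[of x r] by (intro emeasure_eq_ennreal_measure) auto

lemma ball_measure_pos: "x \<in> M \<Longrightarrow> 0 < r \<Longrightarrow> 0 < measure \<mu> (mball x r)"
  using ball_pos[of x r] by (simp add: ball_measure)

lemma ball_measure_double: "x \<in> M \<Longrightarrow> 0 < r \<Longrightarrow> measure \<mu> (mball x (2 * r)) \<le> Cm * measure \<mu> (mball x r)"
  using ball_double[of x r] Cm_ge_1 unfolding ball_measure by (simp flip: ennreal_mult)

lemma ball_fmeasurable: "mball x r \<in> fmeasurable \<mu>"
  using ball_finite by (intro fmeasurableI) auto

lemma ball_measure_mono: "mball x r \<subseteq> mball y s \<Longrightarrow> measure \<mu> (mball x r) \<le> measure \<mu> (mball y s)"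
  by (intro measure_mono_fmeasurable ball_fmeasurable) auto

lemma ball_cover: "p \<in> M \<Longrightarrow> (\<Union>n. mball p (real n)) = M"
  by (auto simp: reals_Archimedean2)

lemma sigma_finite: "sigma_finite_measure \<mu>"
proof -
  obtain p where p: "p \<in> M" using M_nonempty by blast
  show ?thesis
  proof
    show "\<exists>A. countable A \<and> A \<subseteq> sets \<mu> \<and> \<Union> A = space \<mu> \<and> (\<forall>a\<in>A. emeasure \<mu> a \<noteq> \<infinity>)"
      using ball_cover[OF p] ball_finite
      by (intro exI[of _ "range (\<lambda>n. mball p (real n))"]) (auto simp: space_eq less_top[symmetric])
  qed
qed

text \<open>Equal measures give a null difference only when they are finite. The set is therefore
  exhausted by its intersections with balls, and the hulls are united.\<close>

lemma borel_superset:
  assumes "A \<in> sets \<mu>"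
  shows "\<exists>B\<in>sets borel_sigma. A \<subseteq> B \<and> emeasure \<mu> (B - A) = 0"
proof -
  obtain p where p: "p \<in> M" using M_nonempty by blast
  have "\<exists>B\<in>sets borel_sigma. A \<inter> mball p (real n) \<subseteq> B \<and> emeasure \<mu> B = emeasure \<mu> (A \<inter> mball p (real n))" for n
    using assms by (intro borel_regular) auto
  then obtain B where B: "\<And>n. B n \<in> sets borel_sigma" "\<And>n. A \<inter> mball p (real n) \<subseteq> B n"
    "\<And>n. emeasure \<mu> (B n) = emeasure \<mu> (A \<inter> mball p (real n))" by metis
  have Bm: "\<And>n. B n \<in> sets \<mu>" using B(1) borel_sets by blast
  have null: "emeasure \<mu> (B n - A \<inter> mball p (real n)) = 0" for n
  proof -
    have "emeasure \<mu> (A \<inter> mball p (real n)) \<le> emeasure \<mu> (mball p (real n))"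
      by (intro emeasure_mono) auto
    then have "emeasure \<mu> (A \<inter> mball p (real n)) \<noteq> \<infinity>" using ball_finite[of p "real n"] by auto
    then show ?thesis
      using B(2)[of n] B(3)[of n] Bm[of n] assms by (subst emeasure_Diff) auto
  qed
  have "emeasure \<mu> (\<Union>n. B n - A \<inter> mball p (real n)) = 0"
    using null Bm assms by (intro emeasure_UN_eq_0) auto
  moreover have "(\<Union>n. B n) - A \<subseteq> (\<Union>n. B n - A \<inter> mball p (real n))" by auto
  moreover have "(\<Union>n. B n - A \<inter> mball p (real n)) \<in> sets \<mu>" using Bm assms by (intro sets.countable_UN') auto
  ultimately have "emeasure \<mu> ((\<Union>n. B n) - A) = 0" by (metis (no_types, lifting) emeasure_eq_0)
  moreover have "A \<subseteq> (\<Union>n. B n)"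
  proof
    fix x assume x: "x \<in> A"
    then have "x \<in> (\<Union>n. mball p (real n))"
      using ball_cover[OF p] sets.sets_into_space[OF assms] by (auto simp: space_eq)
    then obtain n where "x \<in> mball p (real n)" by blast
    then show "x \<in> (\<Union>n. B n)" using B(2)[of n] x by blast
  qed
  ultimately show ?thesis using B(1) by (intro bexI[of _ "\<Union>n. B n"]) auto
qed

text \<open>Upper gradients have to be Borel, while functions measurable for \<open>\<mu>\<close>
  need not be. A majorant at every point that is equal almost everywhere repairs this without
  changing integrals. It is built from the layers \<open>{u > q}\<close>, with \<open>q\<close> in a
  countable dense set, each enlarged to a Borel hull.\<close>

lemma borel_envelope:
  fixes u :: "'a \<Rightarrow> ennreal"
  assumes u: "u \<in> borel_measurable \<mu>"
  shows "\<exists>w\<in>borel_measurable borel_sigma. (\<forall>x\<in>M. u x \<le> w x) \<and> (AE x in \<mu>. w x = u x)"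
proof -
  obtain Q :: "ennreal set" where Q: "countable Q" "\<And>X. open X \<Longrightarrow> X \<noteq> {} \<Longrightarrow> \<exists>q\<in>Q. q \<in> X"
    by (rule countable_dense_setE) blast
  let ?A = "\<lambda>q. {x \<in> M. q < u x}"
  have A: "?A q \<in> sets \<mu>" for q using u unfolding space_eq[symmetric] by (rule borel_measurable_less[OF borel_measurable_const])
  have "\<forall>q. \<exists>B. B \<in> sets borel_sigma \<and> ?A q \<subseteq> B \<and> emeasure \<mu> (B - ?A q) = 0"
    using borel_superset[OF A] by blast
  from choice[OF this] obtain B where B': "\<forall>q. B q \<in> sets borel_sigma \<and> ?A q \<subseteq> B q \<and> emeasure \<mu> (B q - ?A q) = 0" ..
  then have B: "B q \<in> sets borel_sigma" "?A q \<subseteq> B q" "emeasure \<mu> (B q - ?A q) = 0" for q by simp_all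
  define w where "w x = (SUP q\<in>Q. q * indicator (B q) x)" for x
  have w: "w \<in> borel_measurable borel_sigma"
    unfolding w_def using Q(1) B(1) by (intro borel_measurable_SUP) auto
  have "u x \<le> w x" if "x \<in> M" for x
  proof (rule ccontr)
    assume "\<not> ?thesis"
    then have "{w x<..<u x} \<noteq> {}" using dense[of "w x" "u x"] by auto
    then obtain q where q: "q \<in> Q" "w x < q" "q < u x" using Q(2)[of "{w x<..<u x}"] by auto
    then have "x \<in> B q" using B(2) that by blast
    then have "q \<le> w x" unfolding w_def using q(1) by (intro SUP_upper2[of q]) auto
    then show False using q(2) by simp
  qed
  moreover have "AE x in \<mu>. w x = u x"
  proof -
    have null: "B q - ?A q \<in> null_sets \<mu>" for q
      using B(1)[of q] A[of q] borel_sets by (intro null_setsI B(3)) auto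
    have "AE x in \<mu>. \<forall>q\<in>Q. x \<notin> B q - ?A q"
      unfolding AE_ball_countable[OF Q(1)] by (intro ballI AE_not_in null)
    then show ?thesis
      using AE_space
    proof eventually_elim
      case (elim x)
      have "w x \<le> u x"
        unfolding w_def by (intro SUP_least) (use elim in \<open>auto simp: indicator_def less_imp_le\<close>)
      then show ?case using calculation[of x] elim(2) by (simp add: space_eq antisym)
    qed
  qed
  ultimately show ?thesis using w by blast
qed

section \<open>Averaging over balls of fixed radius\<close>

lemma ball_emeasure_measurable: "(\<lambda>x. emeasure \<mu> (mball x s)) \<in> borel_measurable \<mu>"
proof -
  interpret sigma_finite_measure \<mu> by (rule sigma_finite)
  define E where "E = {z \<in> M \<times> M. d (fst z) (snd z) < s}"
  have "(\<lambda>x. emeasure \<mu> (Pair x -` E)) \<in> borel_measurable \<mu>"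
    unfolding E_def by (rule measurable_emeasure_Pair[OF strip_measurable])
  moreover have "emeasure \<mu> (mball x s) = emeasure \<mu> (Pair x -` E)" if "x \<in> space \<mu>" for x
    using that by (intro arg_cong[where f="emeasure \<mu>"]) (auto simp: E_def space_eq)
  ultimately show ?thesis by (subst measurable_cong[of _ _ "\<lambda>x. emeasure \<mu> (Pair x -` E)"]) auto
qed

text \<open>Exchanges the roles of centre and integration variable on the strip
  \<open>d x y < s\<close>. The denominators are comparable there: \<open>mball y s\<close> lies in
  \<open>mball x (2 * s)\<close>, whence a single factor \<open>Cm\<close>.\<close>

lemma averaging_Fubini:
  fixes F :: "'a \<Rightarrow> 'a \<Rightarrow> ennreal"
  assumes S: "S \<in> sets \<mu>" and F: "(\<lambda>(x, y). F x y) \<in> borel_measurable (\<mu> \<Otimes>\<^sub>M \<mu>)" and s: "0 < s"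
    and T: "T \<in> sets \<mu>" "\<And>x. x \<in> S \<Longrightarrow> mball x s \<subseteq> T"
  shows "(\<integral>\<^sup>+x\<in>S. ((\<integral>\<^sup>+y\<in>mball x s. F x y \<partial>\<mu>) / emeasure \<mu> (mball x s)) \<partial>\<mu>)
    \<le> ennreal Cm * (\<integral>\<^sup>+y\<in>T. ((\<integral>\<^sup>+x\<in>mball y s. F x y \<partial>\<mu>) / emeasure \<mu> (mball y s)) \<partial>\<mu>)"
proof -
  interpret sigma_finite_measure \<mu> by (rule sigma_finite)
  interpret pair: pair_sigma_finite \<mu> \<mu> ..
  define E where "E = {z \<in> M \<times> M. d (fst z) (snd z) < s}"
  have E [measurable]: "E \<in> sets (\<mu> \<Otimes>\<^sub>M \<mu>)" unfolding E_def by (rule strip_measurable)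
  note S [measurable] F [measurable] T(1) [measurable] ball_emeasure_measurable [measurable]
  have SM: "S \<subseteq> M" using sets.sets_into_space[OF S] by (simp add: space_eq)
  let ?K = "\<lambda>x y. indicator S x * (F x y * indicator E (x, y) / emeasure \<mu> (mball x s))"
  have K [measurable]: "(\<lambda>(x, y). ?K x y) \<in> borel_measurable (\<mu> \<Otimes>\<^sub>M \<mu>)"
    by measurable
  have "(\<integral>\<^sup>+x\<in>S. ((\<integral>\<^sup>+y\<in>mball x s. F x y \<partial>\<mu>) / emeasure \<mu> (mball x s)) \<partial>\<mu>)
      = (\<integral>\<^sup>+x. (\<integral>\<^sup>+y. ?K x y \<partial>\<mu>) \<partial>\<mu>)"
  proof (rule nn_integral_cong)
    fix x assume xs: "x \<in> space \<mu>"
    then have x: "x \<in> M" by (simp add: space_eq)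
    have [measurable]: "F x \<in> borel_measurable \<mu>"
      using measurable_compose[OF measurable_Pair1'[OF xs] F] by simp
    have ind: "indicator E (x, y) = (indicator (mball x s) y :: ennreal)" for y
      using x by (auto simp: E_def indicator_def)
    have "(\<integral>\<^sup>+y. ?K x y \<partial>\<mu>) = indicator S x * ((\<integral>\<^sup>+y. F x y * indicator (mball x s) y \<partial>\<mu>) / emeasure \<mu> (mball x s))"
      unfolding ind by (subst nn_integral_cmult, simp, subst nn_integral_divide) auto
    then show "(\<integral>\<^sup>+y\<in>mball x s. F x y \<partial>\<mu>) / emeasure \<mu> (mball x s) * indicator S x = (\<integral>\<^sup>+y. ?K x y \<partial>\<mu>)"
      by (simp add: mult.commute)
  qed
  also have "\<dots> = (\<integral>\<^sup>+y. (\<integral>\<^sup>+x. ?K x y \<partial>\<mu>) \<partial>\<mu>)"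
    by (rule pair.Fubini'[OF K, symmetric])
  also have "\<dots> \<le> (\<integral>\<^sup>+y. ennreal Cm * (((\<integral>\<^sup>+x\<in>mball y s. F x y \<partial>\<mu>) / emeasure \<mu> (mball y s)) * indicator T y) \<partial>\<mu>)"
  proof (rule nn_integral_mono)
    fix y assume ys: "y \<in> space \<mu>"
    then have y: "y \<in> M" by (simp add: space_eq)
    have [measurable]: "(\<lambda>x. F x y) \<in> borel_measurable \<mu>"
      using measurable_compose[OF measurable_Pair2'[OF ys] F] by simp
    have vy: "0 < measure \<mu> (mball y s)" by (rule ball_measure_pos[OF y s])
    have Kle: "?K x y \<le> ennreal (Cm / measure \<mu> (mball y s)) * indicator T y * (F x y * indicator (mball y s) x)" for x
    proof (cases "x \<in> S \<and> x \<in> mball y s")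
      case True
      then have x: "x \<in> M" "d x y < s" using SM y by (auto simp: commute)
      then have "y \<in> mball x s" using y by simp
      then have yT: "y \<in> T" using T(2) True by blast
      have vx: "0 < measure \<mu> (mball x s)" by (rule ball_measure_pos[OF x(1) s])
      have "measure \<mu> (mball y s) \<le> measure \<mu> (mball x (2 * s))"
      proof (intro ball_measure_mono subsetI)
        fix z assume "z \<in> mball y s"
        then show "z \<in> mball x (2 * s)" using x triangle[of x y z] by auto
      qed
      then have "measure \<mu> (mball y s) \<le> Cm * measure \<mu> (mball x s)"
        using ball_measure_double[OF x(1) s] by simp
      then have "1 / measure \<mu> (mball x s) \<le> Cm / measure \<mu> (mball y s)"
        using vx vy by (simp add: field_simps)
      then have inv: "inverse (emeasure \<mu> (mball x s)) \<le> ennreal (Cm / measure \<mu> (mball y s))"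
        using vx by (simp add: ball_measure inverse_ennreal ennreal_leI inverse_eq_divide)
      have "?K x y \<le> F x y * inverse (emeasure \<mu> (mball x s))"
        by (auto simp: indicator_def divide_ennreal_def)
      also have "\<dots> \<le> F x y * ennreal (Cm / measure \<mu> (mball y s))" by (intro mult_left_mono inv) auto
      finally show ?thesis using True yT by (simp add: mult.commute)
    next
      case False
      then show ?thesis using y SM by (auto simp: E_def indicator_def commute)
    qed
    have "(\<integral>\<^sup>+x. ?K x y \<partial>\<mu>) \<le> (\<integral>\<^sup>+x. ennreal (Cm / measure \<mu> (mball y s)) * indicator T y * (F x y * indicator (mball y s) x) \<partial>\<mu>)"
      by (intro nn_integral_mono Kle)
    also have "\<dots> = ennreal (Cm / measure \<mu> (mball y s)) * indicator T y * (\<integral>\<^sup>+x\<in>mball y s. F x y \<partial>\<mu>)"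
      by (rule nn_integral_cmult) measurable
    also have "ennreal (Cm / measure \<mu> (mball y s)) = ennreal Cm * inverse (emeasure \<mu> (mball y s))"
      using vy Cm_ge_1 by (simp add: ball_measure inverse_ennreal divide_inverse ennreal_mult)
    also have "ennreal Cm * inverse (emeasure \<mu> (mball y s)) * indicator T y * (\<integral>\<^sup>+x\<in>mball y s. F x y \<partial>\<mu>)
        = ennreal Cm * (((\<integral>\<^sup>+x\<in>mball y s. F x y \<partial>\<mu>) / emeasure \<mu> (mball y s)) * indicator T y)"
      by (simp add: divide_ennreal_def ac_simps)
    finally show "(\<integral>\<^sup>+x. ?K x y \<partial>\<mu>) \<le> ennreal Cm * (((\<integral>\<^sup>+x\<in>mball y s. F x y \<partial>\<mu>) / emeasure \<mu> (mball y s)) * indicator T y)" .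
  qed
  also have "\<dots> = ennreal Cm * (\<integral>\<^sup>+y\<in>T. ((\<integral>\<^sup>+x\<in>mball y s. F x y \<partial>\<mu>) / emeasure \<mu> (mball y s)) \<partial>\<mu>)"
  proof (rule nn_integral_cmult)
    have "(\<lambda>y. \<integral>\<^sup>+x. F x y * indicator E (y, x) \<partial>\<mu>) \<in> borel_measurable \<mu>"
      by measurable
    moreover have "(\<integral>\<^sup>+x\<in>mball y s. F x y \<partial>\<mu>) = (\<integral>\<^sup>+x. F x y * indicator E (y, x) \<partial>\<mu>)" if "y \<in> space \<mu>" for y
      using that by (intro nn_integral_cong) (auto simp: E_def indicator_def space_eq)
    ultimately have "(\<lambda>y. \<integral>\<^sup>+x\<in>mball y s. F x y \<partial>\<mu>) \<in> borel_measurable \<mu>"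
      by (subst measurable_cong[of _ _ "\<lambda>y. \<integral>\<^sup>+x. F x y * indicator E (y, x) \<partial>\<mu>"]) auto
    then show "(\<lambda>y. (\<integral>\<^sup>+x\<in>mball y s. F x y \<partial>\<mu>) / emeasure \<mu> (mball y s) * indicator T y) \<in> borel_measurable \<mu>"
      by measurable
  qed
  finally show ?thesis .
qed

lemma averaging:
  fixes w :: "'a \<Rightarrow> ennreal"
  assumes S: "S \<in> sets \<mu>" and w: "w \<in> borel_measurable \<mu>" and s: "0 < s"
    and T: "T \<in> sets \<mu>" "\<And>x. x \<in> S \<Longrightarrow> mball x s \<subseteq> T"
  shows "(\<integral>\<^sup>+x\<in>S. ((\<integral>\<^sup>+y\<in>mball x s. w y \<partial>\<mu>) / emeasure \<mu> (mball x s)) \<partial>\<mu>) \<le> ennreal Cm * (\<integral>\<^sup>+y\<in>T. w y \<partial>\<mu>)"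
proof -
  have "(\<integral>\<^sup>+x\<in>S. ((\<integral>\<^sup>+y\<in>mball x s. w y \<partial>\<mu>) / emeasure \<mu> (mball x s)) \<partial>\<mu>)
      \<le> ennreal Cm * (\<integral>\<^sup>+y\<in>T. ((\<integral>\<^sup>+x\<in>mball y s. w y \<partial>\<mu>) / emeasure \<mu> (mball y s)) \<partial>\<mu>)"
    by (rule averaging_Fubini[OF S _ s T]) (use w in measurable)
  also have "(\<integral>\<^sup>+y\<in>T. ((\<integral>\<^sup>+x\<in>mball y s. w y \<partial>\<mu>) / emeasure \<mu> (mball y s)) \<partial>\<mu>) = (\<integral>\<^sup>+y\<in>T. w y \<partial>\<mu>)"
  proof (rule nn_integral_cong)
    fix y assume "y \<in> space \<mu>"
    then have y: "y \<in> M" by (simp add: space_eq)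
    have "(\<integral>\<^sup>+x\<in>mball y s. w y \<partial>\<mu>) = w y * emeasure \<mu> (mball y s)"
      by (rule nn_integral_cmult_indicator) simp
    then show "(\<integral>\<^sup>+x\<in>mball y s. w y \<partial>\<mu>) / emeasure \<mu> (mball y s) * indicator T y = w y * indicator T y"
      using ball_pos[OF y s] ball_finite[of y s] by (simp add: ennreal_mult_divide_eq)
  qed
  finally show ?thesis .
qed

section \<open>Products and localisation in the Newtonian space\<close>

lemma Lipschitz_N12:
  assumes Lip: "\<And>x y. x \<in> M \<Longrightarrow> y \<in> M \<Longrightarrow> \<bar>\<eta> x - \<eta> y\<bar> \<le> L * d x y" and L: "0 \<le> L"
    and K: "\<And>x. x \<in> M \<Longrightarrow> \<bar>\<eta> x\<bar> \<le> K" and supp: "\<And>x. x \<in> M \<Longrightarrow> \<eta> x \<noteq> 0 \<Longrightarrow> x \<in> mball p r"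
  shows "\<eta> \<in> N12" "upper_gradient \<eta> (\<lambda>x. ennreal L * indicator (mball p r) x)"
    "(\<integral>\<^sup>+x. (ennreal L * indicator (mball p r) x)\<^sup>2 \<partial>\<mu>) < \<infinity>"
proof -
  show ug: "upper_gradient \<eta> (\<lambda>x. ennreal L * indicator (mball p r) x)"
    by (rule upper_gradient_Lipschitz[where c=0]) (use assms open_in_borel_sigma in auto)
  have "(\<integral>\<^sup>+x. (ennreal L * indicator (mball p r) x)\<^sup>2 \<partial>\<mu>) = (\<integral>\<^sup>+x. ennreal (L\<^sup>2) * indicator (mball p r) x \<partial>\<mu>)"
    using L by (intro nn_integral_cong) (auto simp: indicator_def ennreal_power)
  also have "\<dots> < \<infinity>"
    using ball_finite[of p r] by (subst nn_integral_cmult_indicator) (auto simp: ennreal_mult_less_top)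
  finally show fin: "(\<integral>\<^sup>+x. (ennreal L * indicator (mball p r) x)\<^sup>2 \<partial>\<mu>) < \<infinity>" .
  have "(\<integral>\<^sup>+x. ennreal ((\<eta> x)\<^sup>2) \<partial>\<mu>) \<le> (\<integral>\<^sup>+x. ennreal (K\<^sup>2) * indicator (mball p r) x \<partial>\<mu>)"
  proof (rule nn_integral_mono)
    fix x assume "x \<in> space \<mu>"
    then have x: "x \<in> M" by (simp add: space_eq)
    then show "ennreal ((\<eta> x)\<^sup>2) \<le> ennreal (K\<^sup>2) * indicator (mball p r) x"
      using supp[OF x] power_mono[OF K[OF x], of 2] by (cases "\<eta> x = 0") (auto intro!: ennreal_leI)
  qed
  also have "\<dots> < \<infinity>"
    using ball_finite[of p r] by (subst nn_integral_cmult_indicator) (auto simp: ennreal_mult_less_top)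
  finally have "(\<integral>\<^sup>+x. ennreal ((\<eta> x)\<^sup>2) \<partial>\<mu>) < \<infinity>" .
  moreover have "\<eta> \<in> borel_measurable \<mu>"
    by (rule borel_sigma_imp_measurable[OF Lipschitz_borel_measurable[OF Lip]])
  ultimately show "\<eta> \<in> N12" using ug fin by (auto simp: N12_def)
qed

text \<open>The product rule produces the upper gradient \<open>K g + L |u|\<close>;
  \<open>borel_envelope\<close> replaces \<open>|u|\<close> by a Borel function \<open>w\<close>
  with the same norm.\<close>

lemma mult_Lipschitz_N12:
  assumes Lip: "\<And>x y. x \<in> M \<Longrightarrow> y \<in> M \<Longrightarrow> \<bar>\<eta> x - \<eta> y\<bar> \<le> L * d x y" and L: "0 \<le> L"
    and K: "\<And>x. x \<in> M \<Longrightarrow> \<bar>\<eta> x\<bar> \<le> K" and u: "u \<in> N12"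
  shows "(\<lambda>x. \<eta> x * u x) \<in> N12"
proof -
  obtain g where g: "upper_gradient u g" "(\<integral>\<^sup>+ x. (g x)\<^sup>2 \<partial>\<mu>) < \<infinity>" using N12D(3)[OF u] by blast
  note mu = N12D(1)[OF u]
  have "(\<lambda>x. ennreal \<bar>u x\<bar>) \<in> borel_measurable \<mu>" using mu by measurable
  from borel_envelope[OF this] obtain w where w: "w \<in> borel_measurable borel_sigma"
    "\<And>x. x \<in> M \<Longrightarrow> ennreal \<bar>u x\<bar> \<le> w x" "AE x in \<mu>. w x = ennreal \<bar>u x\<bar>" by blast
  have "(\<integral>\<^sup>+ x. (w x)\<^sup>2 \<partial>\<mu>) = (\<integral>\<^sup>+ x. ennreal ((u x)\<^sup>2) \<partial>\<mu>)"
    by (rule nn_integral_cong_AE) (use w(3) in \<open>auto elim!: eventually_mono simp: ennreal_power\<close>)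
  then have w2: "(\<integral>\<^sup>+ x. (w x)\<^sup>2 \<partial>\<mu>) < \<infinity>" using N12D(2)[OF u] by simp
  have "upper_gradient (\<lambda>x. \<eta> x * u x) (\<lambda>x. ennreal K * g x + ennreal L * w x)"
    by (rule upper_gradient_mult_Lipschitz[OF g(1) Lip L K w(1,2)])
  moreover have "(\<integral>\<^sup>+ x. (ennreal K * g x + ennreal L * w x)\<^sup>2 \<partial>\<mu>) < \<infinity>"
    using g(2) w2 by (intro nn_integral_power2_add_finite borel_sigma_imp_measurable[OF w(1)]
        borel_sigma_imp_measurable[OF upper_gradient_measurable[OF g(1)]]) auto
  moreover have "\<eta> \<in> borel_measurable \<mu>"
    by (rule borel_sigma_imp_measurable[OF Lipschitz_borel_measurable[OF Lip]])
  then have "(\<lambda>x. \<eta> x * u x) \<in> borel_measurable \<mu>" using mu by measurable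
  moreover have "(\<integral>\<^sup>+ x. ennreal ((\<eta> x * u x)\<^sup>2) \<partial>\<mu>) < \<infinity>"
  proof -
    have "(\<integral>\<^sup>+ x. ennreal ((\<eta> x * u x)\<^sup>2) \<partial>\<mu>) \<le> (\<integral>\<^sup>+ x. ennreal (K\<^sup>2) * ennreal ((u x)\<^sup>2) \<partial>\<mu>)"
    proof (rule nn_integral_mono)
      fix x assume "x \<in> space \<mu>"
      then have x: "x \<in> M" by (simp add: space_eq)
      then have "(\<eta> x)\<^sup>2 \<le> K\<^sup>2" using power_mono[OF K[OF x], of 2] by simp
      then have "(\<eta> x * u x)\<^sup>2 \<le> K\<^sup>2 * (u x)\<^sup>2" by (simp add: power_mult_distrib mult_right_mono)
      then show "ennreal ((\<eta> x * u x)\<^sup>2) \<le> ennreal (K\<^sup>2) * ennreal ((u x)\<^sup>2)"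
        by (simp add: ennreal_leI flip: ennreal_mult)
    qed
    also have "\<dots> = ennreal (K\<^sup>2) * (\<integral>\<^sup>+ x. ennreal ((u x)\<^sup>2) \<partial>\<mu>)" using mu by (intro nn_integral_cmult) auto
    also have "\<dots> < \<infinity>" using N12D(2)[OF u] by (simp add: ennreal_mult_less_top)
    finally show ?thesis .
  qed
  ultimately show ?thesis by (auto simp: N12_def)
qed

lemma bump_N12:
  assumes "p \<in> M" "0 < r"
  shows "bump p r \<in> N12" "upper_gradient (bump p r) (\<lambda>x. ennreal (1 / r) * indicator (mball p (2 * r)) x)"
    "(\<integral>\<^sup>+x. (ennreal (1 / r) * indicator (mball p (2 * r)) x)\<^sup>2 \<partial>\<mu>) < \<infinity>"
  using Lipschitz_N12[OF bump_Lipschitz[OF assms(2,1)], of 1 p "2 * r"] bump_bounds(3) bump_neq_0[OF assms(2,1)] assms by auto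

lemma bump_mult_N12:
  assumes "p \<in> M" "0 < r" "u \<in> N12"
  shows "(\<lambda>x. bump p r x * u x) \<in> N12"
  using mult_Lipschitz_N12[OF bump_Lipschitz[OF assms(2,1)] _ _ assms(3), of 1] bump_bounds(3) assms by auto

lemma N12_imp_N12_loc:
  assumes u: "u \<in> N12" and U: "openin mtopology U"
  shows "u \<in> N12_loc U"
  unfolding N12_loc_def L2_loc_def
proof (intro CollectI conjI ballI allI impI)
  fix x assume "x \<in> U"
  then obtain r where r: "r > 0" "mball x r \<subseteq> U" using U by (auto simp: openin_mtopology)
  have "(\<integral>\<^sup>+ y \<in> mball x r. ennreal ((u y)\<^sup>2) \<partial>\<mu>) \<le> (\<integral>\<^sup>+ y. ennreal ((u y)\<^sup>2) \<partial>\<mu>)"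
    by (intro nn_integral_mono) (auto simp: indicator_def)
  also have "\<dots> < \<infinity>" by (rule N12D(2)[OF u])
  finally show "\<exists>r>0. mball x r \<subseteq> U \<and> set_borel_measurable \<mu> (mball x r) u \<and>
      (\<integral>\<^sup>+ y \<in> mball x r. ennreal ((u y)\<^sup>2) \<partial>\<mu>) < \<infinity>"
    using r N12D(1)[OF u] by (intro exI[of _ r]) (auto simp: set_borel_measurable_def)
next
  fix \<eta> assume "lipschitz_cutoff U \<eta>"
  then obtain L where L: "\<And>x y. x \<in> M \<Longrightarrow> y \<in> M \<Longrightarrow> \<bar>\<eta> x - \<eta> y\<bar> \<le> L * d x y"
    and K: "compactin mtopology (mtopology closure_of {x \<in> M. \<eta> x \<noteq> 0})"
    unfolding lipschitz_cutoff_def by blast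
  have L': "\<bar>\<eta> x - \<eta> y\<bar> \<le> \<bar>L\<bar> * d x y" if "x \<in> M" "y \<in> M" for x y
    by (rule order_trans[OF L[OF that] mult_right_mono]) auto
  obtain p r where pr: "mtopology closure_of {x \<in> M. \<eta> x \<noteq> 0} \<subseteq> mcball p r"
    using compactin_imp_mbounded[OF K] unfolding mbounded_def by blast
  then have supp: "x \<in> mcball p r" if "x \<in> M" "\<eta> x \<noteq> 0" for x
    using that closure_of_subset[of "{x \<in> M. \<eta> x \<noteq> 0}" mtopology] by auto
  \<comment> \<open>A Lipschitz function with bounded support is bounded: points where
    \<open>\<eta>\<close> is nonzero lie within \<open>2 * \<bar>r\<bar>\<close> of a fixed such
    point \<open>q\<close>.\<close>
  obtain K where K: "\<And>x. x \<in> M \<Longrightarrow> \<bar>\<eta> x\<bar> \<le> K"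
  proof (cases "\<exists>q\<in>M. \<eta> q \<noteq> 0")
    case True
    then obtain q where q: "q \<in> M" "\<eta> q \<noteq> 0" by blast
    have "\<bar>\<eta> x\<bar> \<le> \<bar>\<eta> q\<bar> + \<bar>L\<bar> * (2 * \<bar>r\<bar>)" if x: "x \<in> M" for x
    proof (cases "\<eta> x = 0")
      case False
      have "d x q \<le> 2 * \<bar>r\<bar>"
        using triangle[of x p q] supp[OF x False] supp[OF q] by (auto simp: commute)
      then have "\<bar>L\<bar> * d x q \<le> \<bar>L\<bar> * (2 * \<bar>r\<bar>)" by (intro mult_left_mono) auto
      then show ?thesis using L'[OF x q(1)] by linarith
    qed auto
    then show ?thesis using that by blast
  qed (use that[of 0] in auto)
  show "(\<lambda>x. \<eta> x * u x) \<in> N12"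
    by (rule mult_Lipschitz_N12[OF L' _ K u]) auto
qed

end

section \<open>The energy form of a Cheeger derivative\<close>

text \<open>Formulated for functions rather than classes modulo null sets, so the form is only
  semidefinite. The same lemmas then serve the L2 product, the energy and their combinations on one
  underlying set of functions.\<close>

definition semi_inner :: "('a \<Rightarrow> real) set \<Rightarrow> (('a \<Rightarrow> real) \<Rightarrow> ('a \<Rightarrow> real) \<Rightarrow> real) \<Rightarrow> bool" where
  "semi_inner S B \<longleftrightarrow>
     (\<forall>u\<in>S. \<forall>v\<in>S. \<forall>a b. (\<lambda>x. a * u x + b * v x) \<in> S) \<and>
     (\<forall>u\<in>S. \<forall>v\<in>S. B u v = B v u) \<and>
     (\<forall>u\<in>S. \<forall>v\<in>S. \<forall>w\<in>S. \<forall>a b. B (\<lambda>x. a * u x + b * v x) w = a * B u w + b * B v w) \<and>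
     (\<forall>u\<in>S. 0 \<le> B u u)"

context
  fixes S :: "('a \<Rightarrow> real) set" and B
  assumes si: "semi_inner S B"
begin

lemma semi_inner_closed: "u \<in> S \<Longrightarrow> v \<in> S \<Longrightarrow> (\<lambda>x. a * u x + b * v x) \<in> S"
  and semi_inner_sym: "u \<in> S \<Longrightarrow> v \<in> S \<Longrightarrow> B u v = B v u"
  and semi_inner_left: "u \<in> S \<Longrightarrow> v \<in> S \<Longrightarrow> w \<in> S \<Longrightarrow> B (\<lambda>x. a * u x + b * v x) w = a * B u w + b * B v w"
  and semi_inner_nonneg: "u \<in> S \<Longrightarrow> 0 \<le> B u u"
  using si unfolding semi_inner_def by blast+

lemma semi_inner_right:
  "u \<in> S \<Longrightarrow> v \<in> S \<Longrightarrow> w \<in> S \<Longrightarrow> B w (\<lambda>x. a * u x + b * v x) = a * B w u + b * B w v"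
  using semi_inner_sym[of w] semi_inner_left[of u v w a b] semi_inner_closed[of u v a b] by simp

lemma semi_inner_square:
  assumes "u \<in> S" "v \<in> S"
  shows "B (\<lambda>x. a * u x + b * v x) (\<lambda>x. a * u x + b * v x) = a\<^sup>2 * B u u + 2 * a * b * B u v + b\<^sup>2 * B v v"
proof -
  note c = semi_inner_closed[OF assms, of a b]
  have "B (\<lambda>x. a * u x + b * v x) (\<lambda>x. a * u x + b * v x)
      = a * (a * B u u + b * B u v) + b * (a * B v u + b * B v v)"
    using assms c by (simp add: semi_inner_left semi_inner_right)
  then show ?thesis
    using semi_inner_sym[OF assms] by (simp add: power2_eq_square algebra_simps)
qed

lemma semi_inner_closed_diff: "u \<in> S \<Longrightarrow> v \<in> S \<Longrightarrow> (\<lambda>x. u x - v x) \<in> S"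
  using semi_inner_closed[of u v 1 "-1"] by simp

lemma semi_inner_diff_left: "u \<in> S \<Longrightarrow> v \<in> S \<Longrightarrow> w \<in> S \<Longrightarrow> B (\<lambda>x. u x - v x) w = B u w - B v w"
  using semi_inner_left[of u v w 1 "-1"] by simp

lemma semi_inner_diff_square:
  "u \<in> S \<Longrightarrow> v \<in> S \<Longrightarrow> B (\<lambda>x. u x - v x) (\<lambda>x. u x - v x) = B u u - 2 * B u v + B v v"
  using semi_inner_square[of u v 1 "-1"] by simp

lemma semi_inner_Cauchy_Schwarz:
  assumes "u \<in> S" "v \<in> S"
  shows "\<bar>B u v\<bar> \<le> sqrt (B u u) * sqrt (B v v)"
proof -
  have quad: "0 \<le> a\<^sup>2 * B u u + 2 * a * b * B u v + b\<^sup>2 * B v v" for a b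
    using semi_inner_nonneg[OF semi_inner_closed[OF assms, of a b]] semi_inner_square[OF assms] by simp
  have "(B u v)\<^sup>2 \<le> B u u * B v v"
  proof (cases "B v v = 0")
    case True
    have "B u v = 0"
    proof (rule ccontr)
      assume "B u v \<noteq> 0"
      \<comment> \<open>With this choice of \<open>b\<close> the quadratic form takes the value
        -1.\<close>
      then show False
        using quad[of 1 "- (1 + B u u) / (2 * B u v)"] True by (simp add: field_simps)
    qed
    then show ?thesis using True by simp
  next
    case False
    then have "0 < B v v" using semi_inner_nonneg[OF assms(2)] by simp
    \<comment> \<open>The minimising combination of \<open>u\<close> and \<open>v\<close>,
      multiplied by \<open>B v v\<close> to avoid a quotient.\<close>
    moreover have "0 \<le> B v v * (B v v * B u u - (B u v)\<^sup>2)"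
      using quad[of "B v v" "- B u v"] by (simp add: power2_eq_square algebra_simps)
    ultimately show ?thesis by (simp add: zero_le_mult_iff mult.commute)
  qed
  then have "sqrt ((B u v)\<^sup>2) \<le> sqrt (B u u * B v v)" by (rule real_sqrt_le_mono)
  then show ?thesis by (simp add: real_sqrt_mult)
qed

lemma semi_inner_tendsto:
  assumes w: "\<And>k. w k \<in> S" and u: "u \<in> S" and v: "v \<in> S"
    and lim: "(\<lambda>k. B (\<lambda>x. u x - w k x) (\<lambda>x. u x - w k x)) \<longlonglongrightarrow> 0"
  shows "(\<lambda>k. B (w k) v) \<longlonglongrightarrow> B u v"
proof -
  have "(\<lambda>k. B u v - B (w k) v) \<longlonglongrightarrow> 0"
  proof (rule Lim_null_comparison)
    show "\<forall>\<^sub>F k in sequentially. norm (B u v - B (w k) v)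
        \<le> sqrt (B (\<lambda>x. u x - w k x) (\<lambda>x. u x - w k x)) * sqrt (B v v)"
      using semi_inner_Cauchy_Schwarz[OF semi_inner_closed_diff[OF u w] v] semi_inner_diff_left[OF u w v] by simp
    show "(\<lambda>k. sqrt (B (\<lambda>x. u x - w k x) (\<lambda>x. u x - w k x)) * sqrt (B v v)) \<longlonglongrightarrow> 0"
      using tendsto_mult_right[OF tendsto_real_sqrt[OF lim], of "sqrt (B v v)"] by simp
  qed
  from tendsto_diff[OF tendsto_const[of "B u v"] this] show ?thesis by simp
qed

lemma semi_inner_tendsto_square:
  assumes w: "\<And>k. w k \<in> S" and u: "u \<in> S"
    and lim: "(\<lambda>k. B (\<lambda>x. u x - w k x) (\<lambda>x. u x - w k x)) \<longlonglongrightarrow> 0"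
  shows "(\<lambda>k. B (w k) (w k)) \<longlonglongrightarrow> B u u"
proof -
  have "B (w k) (w k) = B (\<lambda>x. u x - w k x) (\<lambda>x. u x - w k x) + 2 * B (w k) u - B u u" for k
    using semi_inner_diff_square[OF u w] semi_inner_sym[OF u w] by simp
  moreover have "(\<lambda>k. B (\<lambda>x. u x - w k x) (\<lambda>x. u x - w k x) + 2 * B (w k) u - B u u) \<longlonglongrightarrow> 0 + 2 * B u u - B u u"
    by (intro tendsto_intros lim semi_inner_tendsto w u)
  ultimately show ?thesis by simp
qed

end

lemma semi_inner_subset:
  assumes "semi_inner S B" "T \<subseteq> S" "\<And>u v a b. u \<in> T \<Longrightarrow> v \<in> T \<Longrightarrow> (\<lambda>x. a * u x + b * v x) \<in> T"
  shows "semi_inner T B"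
  using assms unfolding semi_inner_def by (meson subsetD)

lemma semi_inner_combine:
  assumes B: "semi_inner S B" and B': "semi_inner S B'" and a: "0 \<le> a"
  shows "semi_inner S (\<lambda>u v. a * B u v + B' u v)"
  unfolding semi_inner_def
proof (intro conjI ballI allI)
  fix u v w and c e :: real assume *: "u \<in> S" "v \<in> S" "w \<in> S"
  show "a * B (\<lambda>x. c * u x + e * v x) w + B' (\<lambda>x. c * u x + e * v x) w
      = c * (a * B u w + B' u w) + e * (a * B v w + B' v w)"
    unfolding semi_inner_left[OF B *] semi_inner_left[OF B' *] by (simp add: algebra_simps)
qed (use a in \<open>simp_all add: semi_inner_closed[OF B] semi_inner_sym[OF B] semi_inner_sym[OF B']
    semi_inner_nonneg[OF B] semi_inner_nonneg[OF B']\<close>)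

lemma integrable_inner_L2:
  fixes f g :: "'a \<Rightarrow> 'b :: {real_inner, second_countable_topology}"
  assumes m: "f \<in> borel_measurable M" "g \<in> borel_measurable M"
    and i: "integrable M (\<lambda>x. (norm (f x))\<^sup>2)" "integrable M (\<lambda>x. (norm (g x))\<^sup>2)"
  shows "integrable M (\<lambda>x. f x \<bullet> g x)"
proof (rule Bochner_Integration.integrable_bound)
  show "integrable M (\<lambda>x. (norm (f x))\<^sup>2 + (norm (g x))\<^sup>2)" using i by simp
  show "AE x in M. norm (f x \<bullet> g x) \<le> norm ((norm (f x))\<^sup>2 + (norm (g x))\<^sup>2)"
  proof (rule AE_I2)
    fix x
    have "\<bar>f x \<bullet> g x\<bar> \<le> norm (f x) * norm (g x)" by (rule Cauchy_Schwarz_ineq2)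
    also have "\<dots> \<le> (norm (f x))\<^sup>2 + (norm (g x))\<^sup>2"
    proof -
      have "2 * (norm (f x) * norm (g x)) \<le> (norm (f x))\<^sup>2 + (norm (g x))\<^sup>2"
        using zero_le_power2[of "norm (f x) - norm (g x)"] by (simp add: power2_eq_square algebra_simps)
      moreover have "0 \<le> norm (f x) * norm (g x)" by simp
      ultimately show ?thesis by linarith
    qed
    finally show "norm (f x \<bullet> g x) \<le> norm ((norm (f x))\<^sup>2 + (norm (g x))\<^sup>2)" by simp
  qed
qed (use m in measurable)

context Metric_space
begin

text \<open>On the exceptional curves \<open>e * \<rho>\<close> has infinite integral, so a weak
  upper gradient becomes a genuine one at arbitrarily small cost in L2.\<close>

lemma gradient_off_imp_upper_gradient:
  assumes "gradient_off \<rho> u g" "g \<in> borel_measurable borel_sigma" "\<rho> \<in> borel_measurable borel_sigma" "0 < e"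
  shows "upper_gradient u (\<lambda>x. g x + ennreal e * \<rho> x)"
proof (rule upper_gradientI)
  show "(\<lambda>x. g x + ennreal e * \<rho> x) \<in> borel_measurable borel_sigma" using assms by measurable
  fix l \<Gamma> assume arc: "arc_length_curve l \<Gamma>"
  note l = arc_length_curveD(1)[OF arc]
  note m = arc_integrand_measurable[OF arc _ order_refl order_refl]
  show "ennreal \<bar>u (\<Gamma> l) - u (\<Gamma> 0)\<bar> \<le> (\<integral>\<^sup>+x\<in>{0..l}. (g (\<Gamma> x) + ennreal e * \<rho> (\<Gamma> x)) \<partial>lborel)"
  proof (cases "(\<integral>\<^sup>+x\<in>{0..l}. \<rho> (\<Gamma> x) \<partial>lborel) < \<infinity>")
    case True
    have "ennreal \<bar>u (\<Gamma> l) - u (\<Gamma> 0)\<bar> \<le> (\<integral>\<^sup>+x\<in>{0..l}. g (\<Gamma> x) \<partial>lborel)"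
      using gradient_offD[OF assms(1) arc True] l by simp
    also have "\<dots> \<le> (\<integral>\<^sup>+x\<in>{0..l}. (g (\<Gamma> x) + ennreal e * \<rho> (\<Gamma> x)) \<partial>lborel)"
      by (intro nn_integral_mono mult_right_mono) auto
    finally show ?thesis .
  next
    case False
    have "ennreal e * (\<integral>\<^sup>+x\<in>{0..l}. \<rho> (\<Gamma> x) \<partial>lborel) = (\<integral>\<^sup>+x\<in>{0..l}. (ennreal e * \<rho> (\<Gamma> x)) \<partial>lborel)"
      unfolding mult.assoc using m[OF assms(3)] by (simp add: nn_integral_cmult)
    also have "\<dots> \<le> (\<integral>\<^sup>+x\<in>{0..l}. (g (\<Gamma> x) + ennreal e * \<rho> (\<Gamma> x)) \<partial>lborel)"
      by (intro nn_integral_mono mult_right_mono) auto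
    finally show ?thesis using False assms(4) by (simp add: not_less top_unique ennreal_mult_top)
  qed
qed

end

section \<open>Cheeger derivatives\<close>

locale cheeger_space = doubling_space M d \<mu> Cm
  for M :: "'a set" and d and \<mu> and Cm +
  fixes C0 :: real and H :: "'h :: {real_inner, second_countable_topology} set"
    and D :: "('a \<Rightarrow> real) \<Rightarrow> 'a \<Rightarrow> 'h"
  assumes C0_ge_1: "1 \<le> C0" and cheeger: "cheeger_derivative C0 H D"
begin

lemma D_measurable [measurable_dest]: "u \<in> N12 \<Longrightarrow> D u \<in> borel_measurable \<mu>"
  using cheeger by (simp add: cheeger_derivative_def)

lemma D_lincomb:
  "u \<in> N12 \<Longrightarrow> v \<in> N12 \<Longrightarrow> AE x in \<mu>. D (\<lambda>y. a * u y + b * v y) x = a *\<^sub>R D u x + b *\<^sub>R D v x"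
  using cheeger by (simp add: cheeger_derivative_def)

lemma D_diff: "u \<in> N12 \<Longrightarrow> v \<in> N12 \<Longrightarrow> AE x in \<mu>. D (\<lambda>y. u y - v y) x = D u x - D v x"
  using D_lincomb[of u v 1 "-1"] by simp

lemma D_add: "u \<in> N12 \<Longrightarrow> v \<in> N12 \<Longrightarrow> AE x in \<mu>. D (\<lambda>y. u y + v y) x = D u x + D v x"
  using D_lincomb[of u v 1 1] by simp

lemma D_Leibniz:
  "u \<in> N12 \<Longrightarrow> v \<in> N12 \<Longrightarrow> (\<lambda>y. u y * v y) \<in> N12 \<Longrightarrow>
    AE x in \<mu>. D (\<lambda>y. u y * v y) x = u x *\<^sub>R D v x + v x *\<^sub>R D u x"
  using cheeger by (simp add: cheeger_derivative_def)

text \<open>The comparison in \<open>cheeger_derivative\<close> ranges over minimal weak upper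
  gradients and would say nothing if there were none; the existence theorem makes it
  effective.\<close>

lemma D_minimal:
  assumes "u \<in> N12"
  obtains g where "minimal_weak_upper_gradient u g"
    "AE x in \<mu>. g x \<le> ennreal (C0 * norm (D u x)) \<and> ennreal (norm (D u x)) \<le> ennreal C0 * g x"
proof -
  obtain g where g: "minimal_weak_upper_gradient u g"
    using N12D(3)[OF assms] minimal_weak_upper_gradient_exists upper_gradient_imp_weak by metis
  have "AE x in \<mu>. ennreal (1 / C0) * g x \<le> ennreal (norm (D u x)) \<and> ennreal (norm (D u x)) \<le> ennreal C0 * g x"
    using cheeger assms g by (simp add: cheeger_derivative_def)
  then have "AE x in \<mu>. g x \<le> ennreal (C0 * norm (D u x)) \<and> ennreal (norm (D u x)) \<le> ennreal C0 * g x"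
  proof eventually_elim
    case (elim x)
    then have "ennreal C0 * (ennreal (1 / C0) * g x) \<le> ennreal C0 * ennreal (norm (D u x))"
      by (intro mult_left_mono) auto
    moreover have "ennreal C0 * ennreal (1 / C0) = 1"
      using C0_ge_1 by (simp flip: ennreal_mult)
    ultimately show ?case using elim C0_ge_1 by (simp add: ennreal_mult flip: mult.assoc)
  qed
  then show ?thesis using that g by blast
qed

lemma D_le_upper_gradient:
  assumes "u \<in> N12" "upper_gradient u g" "(\<integral>\<^sup>+x. (g x)\<^sup>2 \<partial>\<mu>) < \<infinity>"
  shows "AE x in \<mu>. ennreal (norm (D u x)) \<le> ennreal C0 * g x"
proof -
  obtain h where h: "minimal_weak_upper_gradient u h"
    "AE x in \<mu>. h x \<le> ennreal (C0 * norm (D u x)) \<and> ennreal (norm (D u x)) \<le> ennreal C0 * h x"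
    using D_minimal[OF assms(1)] .
  have "AE x in \<mu>. h x \<le> g x"
    using h(1) upper_gradient_imp_weak[OF assms(2)] assms(3) by (auto simp: minimal_weak_upper_gradient_def)
  with h(2) show ?thesis
    by eventually_elim (meson mult_left_mono order_trans zero_le)
qed

lemma D_L2: "u \<in> N12 \<Longrightarrow> integrable \<mu> (\<lambda>x. (norm (D u x))\<^sup>2)"
  and D_nn_integral_le: "u \<in> N12 \<Longrightarrow> upper_gradient u g \<Longrightarrow> (\<integral>\<^sup>+x. (g x)\<^sup>2 \<partial>\<mu>) < \<infinity> \<Longrightarrow>
    (\<integral>\<^sup>+x. ennreal ((norm (D u x))\<^sup>2) \<partial>\<mu>) \<le> ennreal (C0\<^sup>2) * (\<integral>\<^sup>+x. (g x)\<^sup>2 \<partial>\<mu>)"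
proof -
  assume u: "u \<in> N12"
  have *: "(\<integral>\<^sup>+x. ennreal ((norm (D u x))\<^sup>2) \<partial>\<mu>) \<le> ennreal (C0\<^sup>2) * (\<integral>\<^sup>+x. (g x)\<^sup>2 \<partial>\<mu>)"
    if g: "upper_gradient u g" "(\<integral>\<^sup>+x. (g x)\<^sup>2 \<partial>\<mu>) < \<infinity>" for g
  proof -
    have "(\<integral>\<^sup>+x. ennreal ((norm (D u x))\<^sup>2) \<partial>\<mu>) \<le> (\<integral>\<^sup>+x. ennreal (C0\<^sup>2) * (g x)\<^sup>2 \<partial>\<mu>)"
    proof (rule nn_integral_mono_AE)
      show "AE x in \<mu>. ennreal ((norm (D u x))\<^sup>2) \<le> ennreal (C0\<^sup>2) * (g x)\<^sup>2"
        using D_le_upper_gradient[OF u g]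
      proof eventually_elim
        case (elim x)
        have "ennreal ((norm (D u x))\<^sup>2) = (ennreal (norm (D u x)))\<^sup>2" by (simp add: ennreal_power)
        also have "\<dots> \<le> (ennreal C0 * g x)\<^sup>2" using elim by (rule power_mono) auto
        finally show ?case using C0_ge_1 by (simp add: power_mult_distrib ennreal_power)
      qed
    qed
    also have "\<dots> = ennreal (C0\<^sup>2) * (\<integral>\<^sup>+x. (g x)\<^sup>2 \<partial>\<mu>)"
      using borel_sigma_imp_measurable[OF upper_gradient_measurable[OF g(1)]] by (intro nn_integral_cmult) auto
    finally show ?thesis .
  qed
  obtain g where g: "upper_gradient u g" "(\<integral>\<^sup>+x. (g x)\<^sup>2 \<partial>\<mu>) < \<infinity>" using N12D(3)[OF u] by blast
  have "(\<integral>\<^sup>+x. ennreal ((norm (D u x))\<^sup>2) \<partial>\<mu>) < \<infinity>"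
    using g(2) by (intro order_le_less_trans[OF *[OF g]]) (simp add: ennreal_mult_less_top)
  then show "integrable \<mu> (\<lambda>x. (norm (D u x))\<^sup>2)"
    using D_measurable[OF u] by (intro integrableI_nonneg) auto
  show "(\<integral>\<^sup>+x. ennreal ((norm (D u x))\<^sup>2) \<partial>\<mu>) \<le> ennreal (C0\<^sup>2) * (\<integral>\<^sup>+x. (g x)\<^sup>2 \<partial>\<mu>)"
    if "upper_gradient u g" "(\<integral>\<^sup>+x. (g x)\<^sup>2 \<partial>\<mu>) < \<infinity>" for g using * that by blast
qed

text \<open>Outside a Borel hull \<open>B\<close> of \<open>{u \<noteq> c}\<close>, the upper
  gradients of \<open>upper_gradient_restrict\<close> reduce to \<open>g / Suc n\<close>. They bound
  the derivative for all \<open>n\<close> at once and tend to 0 wherever \<open>g\<close> is finite;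
  the part of \<open>B\<close> inside the level set is null.\<close>

lemma D_zero_on_level:
  assumes u: "u \<in> N12"
  shows "AE x in \<mu>. u x = c \<longrightarrow> D u x = 0"
proof -
  obtain g where g: "upper_gradient u g" "(\<integral>\<^sup>+x. (g x)\<^sup>2 \<partial>\<mu>) < \<infinity>" using N12D(3)[OF u] by blast
  note mg = borel_sigma_imp_measurable[OF upper_gradient_measurable[OF g(1)]]
  have A: "{x \<in> M. u x \<noteq> c} \<in> sets \<mu>"
    unfolding space_eq[symmetric] using N12D(1)[OF u] by measurable
  obtain B where B: "B \<in> sets borel_sigma" "{x \<in> M. u x \<noteq> c} \<subseteq> B" "emeasure \<mu> (B - {x \<in> M. u x \<noteq> c}) = 0"
    using borel_superset[OF A] by blast
  have Bm: "B \<in> sets \<mu>" using B(1) borel_sets by blast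
  have "AE x in \<mu>. ennreal (norm (D u x)) \<le> ennreal C0 * (g x * indicator B x + ennreal (1 / Suc n) * g x)" for n
  proof (rule D_le_upper_gradient[OF u])
    show "upper_gradient u (\<lambda>x. g x * indicator B x + ennreal (1 / Suc n) * g x)"
      by (rule upper_gradient_restrict[OF g(1) B(1), where c=c]) (use B(2) in auto)
    have "(\<integral>\<^sup>+x. (g x * indicator B x + ennreal (1 / Suc n) * g x)\<^sup>2 \<partial>\<mu>)
      \<le> (\<integral>\<^sup>+x. (1 * g x + ennreal (1 / Suc n) * g x)\<^sup>2 \<partial>\<mu>)"
      by (intro nn_integral_mono power_mono add_right_mono) (auto simp: indicator_def)
    also have "\<dots> < \<infinity>" using mg g(2) by (intro nn_integral_power2_add_finite) auto
    finally show "(\<integral>\<^sup>+x. (g x * indicator B x + ennreal (1 / Suc n) * g x)\<^sup>2 \<partial>\<mu>) < \<infinity>" .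
  qed
  then have "AE x in \<mu>. \<forall>n. ennreal (norm (D u x)) \<le> ennreal C0 * (g x * indicator B x + ennreal (1 / Suc n) * g x)"
    by (simp add: AE_all_countable)
  moreover have "AE x in \<mu>. (g x)\<^sup>2 \<noteq> \<infinity>"
    using g(2) mg by (intro nn_integral_PInf_AE) auto
  moreover have "AE x in \<mu>. x \<notin> B - {x \<in> M. u x \<noteq> c}"
    using B(3) Bm A by (intro AE_not_in null_setsI) auto
  ultimately show ?thesis
  proof eventually_elim
    case (elim x)
    show ?case
    proof
      assume "u x = c"
      then have xB: "x \<notin> B" using elim(3) by auto
      have "g x \<noteq> \<infinity>" using elim(2) by auto
      then obtain r where r: "g x = ennreal r" "0 \<le> r" by (metis ennreal_cases infinity_ennreal_def)
      have le: "norm (D u x) \<le> C0 * r * (1 / Suc n)" for n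
      proof -
        have "ennreal (norm (D u x)) \<le> ennreal (C0 * r * (1 / Suc n))"
          using elim(1)[rule_format, of n] xB r C0_ge_1 by (simp add: ac_simps flip: ennreal_mult)
        then show ?thesis using r C0_ge_1 by (subst (asm) ennreal_le_iff) auto
      qed
      have "(\<lambda>n. C0 * r * (1 / Suc n)) \<longlonglongrightarrow> C0 * r * 0"
        by (intro tendsto_mult_left LIMSEQ_inverse_real_of_nat[unfolded inverse_eq_divide])
      then have "norm (D u x) \<le> C0 * r * 0"
        by (rule LIMSEQ_le_const) (use le in blast)
      then show "D u x = 0" by simp
    qed
  qed
qed

lemma D_eq_on:
  assumes "u \<in> N12" "v \<in> N12"
  shows "AE x in \<mu>. u x = v x \<longrightarrow> D u x = D v x"
  using D_zero_on_level[OF N12_diff[OF assms], of 0] D_diff[OF assms]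
  by eventually_elim auto

text \<open>The way back from the energy to a true upper gradient, which completeness needs because
  \<open>N12\<close> is defined by true upper gradients. The factor 2 comes from squaring a sum, and
  \<open>e\<close> pays for the exceptional curves.\<close>

lemma D_nn_integral_gradient:
  assumes u: "u \<in> N12" and e: "0 < e"
  shows "\<exists>G. upper_gradient u G \<and>
    (\<integral>\<^sup>+x. (G x)\<^sup>2 \<partial>\<mu>) \<le> ennreal (2 * C0\<^sup>2 * (\<integral>x. (norm (D u x))\<^sup>2 \<partial>\<mu>) + e)"
proof -
  obtain g where g: "minimal_weak_upper_gradient u g"
    "AE x in \<mu>. g x \<le> ennreal (C0 * norm (D u x)) \<and> ennreal (norm (D u x)) \<le> ennreal C0 * g x"
    using D_minimal[OF u] .
  then obtain \<rho> where \<rho>: "g \<in> borel_measurable borel_sigma" "\<rho> \<in> borel_measurable borel_sigma"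
    "(\<integral>\<^sup>+x. (\<rho> x)\<^sup>2 \<partial>\<mu>) < \<infinity>" "gradient_off \<rho> u g"
    unfolding minimal_weak_upper_gradient_def weak_upper_gradient_iff by blast
  obtain K where K: "(\<integral>\<^sup>+x. (\<rho> x)\<^sup>2 \<partial>\<mu>) = ennreal K" "0 \<le> K"
    using \<rho>(3) by (metis ennreal_cases less_irrefl infinity_ennreal_def)
  \<comment> \<open>Small enough that \<open>2 * \<delta>\<^sup>2 * K \<le> e\<close>; the summand 1
    covers \<open>K = 0\<close>.\<close>
  define \<delta> where "\<delta> = sqrt (e / (2 * (1 + K)))"
  have \<delta>: "0 < \<delta>" using e K by (simp add: \<delta>_def add_pos_nonneg)
  have \<delta>2: "2 * \<delta>\<^sup>2 * K \<le> e"
  proof -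
    have "\<delta>\<^sup>2 = e / (2 * (1 + K))" using e K by (simp add: \<delta>_def)
    then have "2 * \<delta>\<^sup>2 * K = e * (K / (1 + K))" using K by (simp add: field_simps)
    also have "\<dots> \<le> e * 1" using e K by (intro mult_left_mono) (auto simp: divide_simps)
    finally show ?thesis by simp
  qed
  note m = borel_sigma_imp_measurable[OF \<rho>(1)] borel_sigma_imp_measurable[OF \<rho>(2)]
  note mD = D_measurable[OF u]
  have "(\<integral>\<^sup>+x. (g x + ennreal \<delta> * \<rho> x)\<^sup>2 \<partial>\<mu>) \<le> (\<integral>\<^sup>+x. 2 * (g x)\<^sup>2 + ennreal (2 * \<delta>\<^sup>2) * (\<rho> x)\<^sup>2 \<partial>\<mu>)"
  proof (rule nn_integral_mono)
    fix x
    have "ennreal (2 * \<delta>\<^sup>2) = 2 * (ennreal \<delta>)\<^sup>2" using \<delta> by (simp add: ennreal_mult ennreal_power)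
    then show "(g x + ennreal \<delta> * \<rho> x)\<^sup>2 \<le> 2 * (g x)\<^sup>2 + ennreal (2 * \<delta>\<^sup>2) * (\<rho> x)\<^sup>2"
      using ennreal_power2_add_le[of "g x" "ennreal \<delta> * \<rho> x"] by (simp add: power_mult_distrib mult.assoc)
  qed
  also have "\<dots> = 2 * (\<integral>\<^sup>+x. (g x)\<^sup>2 \<partial>\<mu>) + ennreal (2 * \<delta>\<^sup>2) * ennreal K"
    using m by (simp add: nn_integral_add nn_integral_cmult K)
  also have "\<dots> \<le> 2 * ennreal (C0\<^sup>2 * (\<integral>x. (norm (D u x))\<^sup>2 \<partial>\<mu>)) + ennreal e"
  proof (intro add_mono mult_left_mono)
    have "(\<integral>\<^sup>+x. (g x)\<^sup>2 \<partial>\<mu>) \<le> (\<integral>\<^sup>+x. ennreal (C0\<^sup>2 * (norm (D u x))\<^sup>2) \<partial>\<mu>)"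
    proof (rule nn_integral_mono_AE)
      show "AE x in \<mu>. (g x)\<^sup>2 \<le> ennreal (C0\<^sup>2 * (norm (D u x))\<^sup>2)"
        using g(2)
      proof eventually_elim
        case (elim x)
        then have "(g x)\<^sup>2 \<le> (ennreal (C0 * norm (D u x)))\<^sup>2" by (intro power_mono) auto
        then show ?case using C0_ge_1 by (simp add: ennreal_power power_mult_distrib)
      qed
    qed
    also have "\<dots> = ennreal (C0\<^sup>2 * (\<integral>x. (norm (D u x))\<^sup>2 \<partial>\<mu>))"
      using D_L2[OF u] by (subst nn_integral_eq_integral) auto
    finally show "(\<integral>\<^sup>+x. (g x)\<^sup>2 \<partial>\<mu>) \<le> ennreal (C0\<^sup>2 * (\<integral>x. (norm (D u x))\<^sup>2 \<partial>\<mu>))" .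
    show "ennreal (2 * \<delta>\<^sup>2) * ennreal K \<le> ennreal e"
      using \<delta>2 K by (simp add: ennreal_leI flip: ennreal_mult)
  qed auto
  also have "\<dots> = ennreal (2 * C0\<^sup>2 * (\<integral>x. (norm (D u x))\<^sup>2 \<partial>\<mu>) + e)"
    using e by (simp add: ennreal_mult ennreal_plus mult.assoc)
  finally show ?thesis
    using gradient_off_imp_upper_gradient[OF \<rho>(4,1,2) \<delta>] by blast
qed

section \<open>The L2 product and the energy form\<close>

definition ip :: "('a \<Rightarrow> real) \<Rightarrow> ('a \<Rightarrow> real) \<Rightarrow> real" where
  "ip u v = (\<integral>x. u x * v x \<partial>\<mu>)"

definition energy :: "('a \<Rightarrow> real) \<Rightarrow> ('a \<Rightarrow> real) \<Rightarrow> real" where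
  "energy u v = (\<integral>x. D u x \<bullet> D v x \<partial>\<mu>)"

definition L2 :: "('a \<Rightarrow> real) set" where
  "L2 = {u \<in> borel_measurable \<mu>. integrable \<mu> (\<lambda>x. (u x)\<^sup>2)}"

lemma N12_sub_L2: "N12 \<subseteq> L2"
  using N12D(1) N12_L2 by (auto simp: L2_def)

lemma L2_mult_integrable: "u \<in> L2 \<Longrightarrow> v \<in> L2 \<Longrightarrow> integrable \<mu> (\<lambda>x. u x * v x)"
  using integrable_inner_L2[of u \<mu> v] by (simp add: L2_def mult.commute)

lemma L2_lincomb:
  assumes "u \<in> L2" "v \<in> L2"
  shows "(\<lambda>x. a * u x + b * v x) \<in> L2"
proof -
  have "(\<lambda>x. (a * u x + b * v x)\<^sup>2) = (\<lambda>x. a\<^sup>2 * (u x)\<^sup>2 + 2 * a * b * (u x * v x) + b\<^sup>2 * (v x)\<^sup>2)"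
    by (simp add: power2_eq_square algebra_simps)
  moreover have "integrable \<mu> (\<lambda>x. a\<^sup>2 * (u x)\<^sup>2 + 2 * a * b * (u x * v x) + b\<^sup>2 * (v x)\<^sup>2)"
    using assms L2_mult_integrable[OF assms]
    by (intro Bochner_Integration.integrable_add integrable_mult_right) (auto simp: L2_def)
  ultimately show ?thesis using assms by (simp add: L2_def borel_measurable_add borel_measurable_times)
qed

lemma semi_inner_ip: "semi_inner L2 ip"
  unfolding semi_inner_def
proof (intro conjI ballI allI)
  fix u v w and a b :: real assume *: "u \<in> L2" "v \<in> L2" "w \<in> L2"
  show "ip (\<lambda>x. a * u x + b * v x) w = a * ip u w + b * ip v w"
    unfolding ip_def using L2_mult_integrable[OF *(1,3)] L2_mult_integrable[OF *(2,3)]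
    by (simp add: distrib_right mult.assoc)
qed (auto simp: ip_def L2_lincomb mult.commute)

lemma energy_integrable: "u \<in> N12 \<Longrightarrow> v \<in> N12 \<Longrightarrow> integrable \<mu> (\<lambda>x. D u x \<bullet> D v x)"
  by (intro integrable_inner_L2 D_measurable D_L2)

lemma semi_inner_energy: "semi_inner N12 energy"
  unfolding semi_inner_def
proof (intro conjI ballI allI)
  fix u v w and a b :: real assume *: "u \<in> N12" "v \<in> N12" "w \<in> N12"
  have "energy (\<lambda>x. a * u x + b * v x) w = (\<integral>x. a * (D u x \<bullet> D w x) + b * (D v x \<bullet> D w x) \<partial>\<mu>)"
    unfolding energy_def
  proof (rule integral_cong_AE)
    show "AE x in \<mu>. D (\<lambda>x. a * u x + b * v x) x \<bullet> D w x = a * (D u x \<bullet> D w x) + b * (D v x \<bullet> D w x)"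
      using D_lincomb[OF *(1,2), of a b] by eventually_elim (simp add: inner_add_left)
  qed (use * N12_lincomb in \<open>auto intro!: borel_measurable_inner borel_measurable_add borel_measurable_times D_measurable\<close>)
  also have "\<dots> = a * energy u w + b * energy v w"
    unfolding energy_def using energy_integrable[OF *(1,3)] energy_integrable[OF *(2,3)] by simp
  finally show "energy (\<lambda>x. a * u x + b * v x) w = a * energy u w + b * energy v w" .
qed (auto simp: energy_def N12_lincomb inner_commute)

lemma energy_norm: "energy u u = (\<integral>x. (norm (D u x))\<^sup>2 \<partial>\<mu>)"
  by (simp add: energy_def power2_norm_eq_inner)

lemma energy_nn_integral: "u \<in> N12 \<Longrightarrow> (\<integral>\<^sup>+x. ennreal ((norm (D u x))\<^sup>2) \<partial>\<mu>) = ennreal (energy u u)"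
  unfolding energy_norm by (rule nn_integral_eq_integral[OF D_L2]) auto

lemma ip_nn_integral: "u \<in> L2 \<Longrightarrow> (\<integral>\<^sup>+x. ennreal ((u x)\<^sup>2) \<partial>\<mu>) = ennreal (ip u u)"
  unfolding ip_def by (subst nn_integral_eq_integral) (auto simp: L2_def power2_eq_square)

end

section \<open>Completeness and the representation theorem\<close>

text \<open>The rate 1/8 leaves \<open>(1/4)^j\<close> after the weights \<open>2 ^ Suc j\<close>
  from squaring the series; the sum \<open>2 * K * (4/3)\<close> is rounded up to
  \<open>4 * K\<close>.\<close>

lemma nn_integral_tail_power2_le:
  fixes h :: "nat \<Rightarrow> 'a \<Rightarrow> ennreal"
  assumes m: "\<And>j. h j \<in> borel_measurable M" and K: "0 \<le> K"
    and le: "\<And>j. (\<integral>\<^sup>+x. (h j x)\<^sup>2 \<partial>M) \<le> ennreal (K * (1/8)^j)"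
  shows "(\<integral>\<^sup>+x. (\<Sum>j. h (j + k) x)\<^sup>2 \<partial>M) \<le> ennreal (4 * K * (1/8)^k)"
proof -
  let ?c = "2 * K * (1/8)^k"
  have c: "0 \<le> ?c" using K by simp
  have "(\<integral>\<^sup>+x. (\<Sum>j. h (j + k) x)\<^sup>2 \<partial>M) \<le> (\<integral>\<^sup>+x. (\<Sum>j. 2 ^ Suc j * (h (j + k) x)\<^sup>2) \<partial>M)"
    by (intro nn_integral_mono suminf_power2_le_ennreal)
  also have "\<dots> = (\<Sum>j. 2 ^ Suc j * (\<integral>\<^sup>+x. (h (j + k) x)\<^sup>2 \<partial>M))"
    using m by (subst nn_integral_suminf) (auto simp: nn_integral_cmult)
  also have "\<dots> \<le> (\<Sum>j. ennreal (?c * (1/4)^j))"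
  proof (intro suminf_le)
    fix j
    have "2 ^ Suc j * (\<integral>\<^sup>+x. (h (j + k) x)\<^sup>2 \<partial>M) \<le> ennreal (2 ^ Suc j) * ennreal (K * (1/8)^(j + k))"
      unfolding ennreal_2_power by (intro mult_left_mono le) auto
    also have "\<dots> = ennreal (2 ^ Suc j * (K * (1/8)^(j + k)))" by (rule ennreal_mult[symmetric]) (use K in auto)
    also have "2 ^ Suc j * (K * (1/8)^(j + k)) = ?c * ((2::real)^j * (1/8)^j)" by (simp add: power_add)
    also have "(2::real)^j * (1/8)^j = (1/4)^j" by (simp flip: power_mult_distrib)
    finally show "2 ^ Suc j * (\<integral>\<^sup>+x. (h (j + k) x)\<^sup>2 \<partial>M) \<le> ennreal (?c * (1/4)^j)" .
  qed auto
  also have "\<dots> = ennreal (\<Sum>j. ?c * (1/4)^j)"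
    using c by (intro suminf_ennreal2 summable_mult summable_geometric) auto
  also have "(\<Sum>j. ?c * (1/4)^j) = ?c * (4/3)"
    by (subst suminf_mult) (auto simp: suminf_geometric summable_geometric)
  also have "ennreal (?c * (4/3)) \<le> ennreal (4 * K * (1/8)^k)"
    using c by (intro ennreal_leI) auto
  finally show ?thesis .
qed

context cheeger_space
begin

text \<open>The limit is taken pointwise where the series of differences converges and is 0
  elsewhere, which makes it a function defined everywhere. The tails of the series of upper
  gradients \<open>G\<close> give upper gradients of the errors, and they are small in L2.\<close>

lemma N12_complete:
  fixes w :: "nat \<Rightarrow> 'a \<Rightarrow> real"
  assumes w: "\<And>k. w k \<in> N12" and K: "0 \<le> K"
    and cauchy: "\<And>k. ip (\<lambda>x. w (Suc k) x - w k x) (\<lambda>x. w (Suc k) x - w k x)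
        + energy (\<lambda>x. w (Suc k) x - w k x) (\<lambda>x. w (Suc k) x - w k x) \<le> K * (1/8)^k"
  shows "\<exists>u\<in>N12. (\<lambda>k. ip (\<lambda>x. u x - w k x) (\<lambda>x. u x - w k x)) \<longlonglongrightarrow> 0 \<and>
     (\<lambda>k. energy (\<lambda>x. u x - w k x) (\<lambda>x. u x - w k x)) \<longlonglongrightarrow> 0"
proof -
  define W where "W k = (\<lambda>x. w (Suc k) x - w k x)" for k
  have W: "W k \<in> N12" for k unfolding W_def by (intro N12_diff w)
  have WL2: "W k \<in> L2" for k using W N12_sub_L2 by blast
  have mW [measurable]: "W k \<in> borel_measurable \<mu>" for k by (rule N12D(1)[OF W])
  have mw [measurable]: "w k \<in> borel_measurable \<mu>" for k by (rule N12D(1)[OF w])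
  have nn: "0 \<le> ip (W k) (W k)" "0 \<le> energy (W k) (W k)" for k
    using semi_inner_nonneg[OF semi_inner_ip WL2] semi_inner_nonneg[OF semi_inner_energy W] by auto
  have ipW: "ip (W k) (W k) \<le> K * (1/8)^k" and enW: "energy (W k) (W k) \<le> K * (1/8)^k" for k
    using cauchy[of k] nn[of k] unfolding W_def[symmetric] by linarith+
  \<comment> \<open>One constant for the functions and for their upper gradients:
    \<open>2 * C0\<^sup>2\<close> and the error \<open>(1/8)^k\<close> both come from
    \<open>D_nn_integral_gradient\<close>.\<close>
  define K1 where "K1 = 2 * C0\<^sup>2 * K + 1"
  have C0K: "K \<le> C0\<^sup>2 * K" using C0_ge_1 K by (simp add: mult_le_cancel_right1)
  have K1: "0 \<le> K1" "K \<le> K1" using K C0K by (auto simp: K1_def)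
  have "\<exists>G. upper_gradient (W k) G \<and> (\<integral>\<^sup>+x. (G x)\<^sup>2 \<partial>\<mu>) \<le> ennreal (K1 * (1/8)^k)" for k
  proof -
    obtain G where G: "upper_gradient (W k) G"
      "(\<integral>\<^sup>+x. (G x)\<^sup>2 \<partial>\<mu>) \<le> ennreal (2 * C0\<^sup>2 * (\<integral>x. (norm (D (W k) x))\<^sup>2 \<partial>\<mu>) + (1/8)^k)"
      using D_nn_integral_gradient[OF W, of "(1/8)^k" k] by auto
    have "2 * C0\<^sup>2 * (\<integral>x. (norm (D (W k) x))\<^sup>2 \<partial>\<mu>) \<le> 2 * C0\<^sup>2 * (K * (1/8)^k)"
      using enW[of k] by (intro mult_left_mono) (auto simp: energy_norm)
    then have "2 * C0\<^sup>2 * (\<integral>x. (norm (D (W k) x))\<^sup>2 \<partial>\<mu>) + (1/8)^k \<le> K1 * (1/8)^k"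
      by (simp add: K1_def algebra_simps)
    then show ?thesis using G by (meson ennreal_leI order_trans)
  qed
  then obtain G where G: "\<And>k. upper_gradient (W k) (G k)" "\<And>k. (\<integral>\<^sup>+x. (G k x)\<^sup>2 \<partial>\<mu>) \<le> ennreal (K1 * (1/8)^k)"
    by metis
  have mG [measurable]: "G k \<in> borel_measurable \<mu>" for k
    by (rule borel_sigma_imp_measurable[OF upper_gradient_measurable[OF G(1)]])
  define a where "a k x = ennreal \<bar>W k x\<bar>" for k x
  have ma [measurable]: "a k \<in> borel_measurable \<mu>" for k unfolding a_def by measurable
  have ale: "(\<integral>\<^sup>+x. (a k x)\<^sup>2 \<partial>\<mu>) \<le> ennreal (K1 * (1/8)^k)" for k
  proof -
    have "(\<integral>\<^sup>+x. (a k x)\<^sup>2 \<partial>\<mu>) = ennreal (ip (W k) (W k))"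
      unfolding ip_nn_integral[OF WL2, symmetric] by (simp add: a_def ennreal_power)
    also have "\<dots> \<le> ennreal (K1 * (1/8)^k)"
      by (intro ennreal_leI order_trans[OF ipW mult_right_mono[OF K1(2)]]) auto
    finally show ?thesis .
  qed
  note tail_a = nn_integral_tail_power2_le[of a, OF ma K1(1) ale]
  note tail_G = nn_integral_tail_power2_le[of G, OF mG K1(1) G(2)]
  define F where "F x = (\<Sum>j. a j x)" for x
  have mF [measurable]: "F \<in> borel_measurable \<mu>" unfolding F_def by measurable
  have "(\<integral>\<^sup>+x. (F x)\<^sup>2 \<partial>\<mu>) \<noteq> \<infinity>" using tail_a[of 0] unfolding F_def by (auto simp: top_unique)
  then have AEF: "AE x in \<mu>. (F x)\<^sup>2 \<noteq> \<infinity>" by (intro nn_integral_PInf_AE) auto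
  let ?A = "{x \<in> M. F x = \<infinity>}"
  have A: "?A \<in> sets \<mu>" unfolding space_eq[symmetric] by measurable
  have A0: "emeasure \<mu> ?A = 0"
    using AEF A by (subst (asm) AE_iff_null) (auto simp: space_eq null_sets_def power2_eq_square ennreal_mult_eq_top_iff cong: conj_cong)
  \<comment> \<open>A Borel hull of the divergence set, because it enters an upper gradient.\<close>
  obtain N where N: "N \<in> sets borel_sigma" "?A \<subseteq> N" "emeasure \<mu> (N - ?A) = 0"
    using borel_superset[OF A] by blast
  have Nm: "N \<in> sets \<mu>" using N(1) borel_sets by blast
  have AEN: "AE x in \<mu>. x \<notin> N"
  proof -
    have "N - ?A \<in> null_sets \<mu>" "?A \<in> null_sets \<mu>" using N(3) A0 A Nm by auto
    from AE_not_in[OF this(1)] AE_not_in[OF this(2)] show ?thesis by eventually_elim auto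
  qed
  have summ: "summable (\<lambda>k. \<bar>w (Suc k) x - w k x\<bar>)" if "x \<in> M - N" for x
  proof (rule summable_suminf_not_top)
    have "F x \<noteq> \<infinity>" using that N(2) by blast
    then show "(\<Sum>k. ennreal \<bar>w (Suc k) x - w k x\<bar>) \<noteq> top" by (simp add: F_def a_def W_def)
  qed simp
  define v where "v x = (if summable (\<lambda>k. \<bar>w (Suc k) x - w k x\<bar>) then lim (\<lambda>k. w k x) else 0)" for x
  have vlim: "(\<lambda>k. w k x) \<longlonglongrightarrow> v x" if x: "x \<in> M - N" for x
  proof -
    have "summable (\<lambda>k. w (Suc k) x - w k x)" using summ[OF x] by (rule summable_rabs_cancel)
    then have "convergent (\<lambda>n. w n x - w 0 x)"
      unfolding summable_iff_convergent sum_lessThan_telescope[of "\<lambda>n. w n x"] .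
    then have "convergent (\<lambda>n. w n x)"
      using convergent_diff_const_right_iff[of "\<lambda>n. w n x"] by simp
    then show ?thesis using summ[OF x] by (simp add: v_def convergent_LIMSEQ_iff)
  qed
  \<comment> \<open>Convergence of the series is rewritten as finiteness of \<open>F\<close>, which
    is measurable.\<close>
  have mv [measurable]: "v \<in> borel_measurable \<mu>"
  proof -
    have Fsum: "F x = \<infinity> \<longleftrightarrow> \<not> summable (\<lambda>k. \<bar>w (Suc k) x - w k x\<bar>)" for x
    proof -
      have F: "F x = (\<Sum>k. ennreal \<bar>w (Suc k) x - w k x\<bar>)" by (simp add: F_def a_def W_def)
      show ?thesis
      proof (cases "summable (\<lambda>k. \<bar>w (Suc k) x - w k x\<bar>)")
        case True
        then have "F x = ennreal (\<Sum>k. \<bar>w (Suc k) x - w k x\<bar>)" unfolding F by (intro suminf_ennreal2) auto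
        then show ?thesis using True by simp
      next
        case False
        then have "(\<Sum>k. ennreal \<bar>w (Suc k) x - w k x\<bar>) = top"
          using summable_suminf_not_top[OF abs_ge_zero, of "\<lambda>k. w (Suc k) x - w k x"] by blast
        then show ?thesis using False F by simp
      qed
    qed
    have veq: "v x = (if F x = \<infinity> then 0 else lim (\<lambda>k. w k x))" for x
      unfolding v_def using Fsum[of x] by argo
    have "v = (\<lambda>x. if F x = \<infinity> then 0 else lim (\<lambda>k. w k x))" by (rule ext) (rule veq)
    moreover have "(\<lambda>x. if F x = \<infinity> then 0 else lim (\<lambda>k. w k x)) \<in> borel_measurable \<mu>"
      by (intro measurable_If borel_measurable_lim_metric mw measurable_const) (use mF in measurable)
    ultimately show ?thesis by simp
  qed
  \<comment> \<open>The value \<open>top\<close> on the null set \<open>N\<close> disposes of the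
    curves inside \<open>N\<close> and does not change the L2 norm.\<close>
  define R where "R k x = (\<Sum>j. G (j + k) x) + top * indicator N x" for k x
  have ug: "upper_gradient (\<lambda>x. v x - w k x) (R k)" for k
    unfolding R_def by (rule upper_gradient_limit[OF G(1)[unfolded W_def] N(1) summ v_def])
  have Rle: "(\<integral>\<^sup>+x. (R k x)\<^sup>2 \<partial>\<mu>) \<le> ennreal (4 * K1 * (1/8)^k)" for k
  proof -
    have "(\<integral>\<^sup>+x. (R k x)\<^sup>2 \<partial>\<mu>) = (\<integral>\<^sup>+x. (\<Sum>j. G (j + k) x)\<^sup>2 \<partial>\<mu>)"
      by (rule nn_integral_cong_AE) (use AEN in \<open>auto simp: R_def elim!: eventually_mono\<close>)
    then show ?thesis using tail_G by simp
  qed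
  have vle: "(\<integral>\<^sup>+x. ennreal ((v x - w k x)\<^sup>2) \<partial>\<mu>) \<le> ennreal (4 * K1 * (1/8)^k)" for k
  proof -
    have "(\<integral>\<^sup>+x. ennreal ((v x - w k x)\<^sup>2) \<partial>\<mu>) \<le> (\<integral>\<^sup>+x. (\<Sum>j. a (j + k) x)\<^sup>2 \<partial>\<mu>)"
    proof (rule nn_integral_mono_AE)
      show "AE x in \<mu>. ennreal ((v x - w k x)\<^sup>2) \<le> (\<Sum>j. a (j + k) x)\<^sup>2"
        using AEN AE_space
      proof eventually_elim
        case (elim x)
        then have x: "x \<in> M - N" by (simp add: space_eq)
        have s: "summable (\<lambda>j. \<bar>W (j + k) x\<bar>)"
          using summ[OF x] unfolding W_def by (subst summable_iff_shift[of "\<lambda>j. \<bar>w (Suc j) x - w j x\<bar>" k]) simp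
        have "(\<lambda>n. w (n + k) x) \<longlonglongrightarrow> v x" by (rule LIMSEQ_ignore_initial_segment[OF vlim[OF x]])
        from telescope_sums[OF this] have "(\<lambda>j. W (j + k) x) sums (v x - w k x)" by (simp add: W_def)
        then have "\<bar>v x - w k x\<bar> \<le> (\<Sum>j. \<bar>W (j + k) x\<bar>)"
          using summable_rabs[OF s] by (simp add: sums_iff)
        then have "ennreal \<bar>v x - w k x\<bar> \<le> ennreal (\<Sum>j. \<bar>W (j + k) x\<bar>)" by (rule ennreal_leI)
        also have "\<dots> = (\<Sum>j. a (j + k) x)"
          unfolding a_def using s by (intro suminf_ennreal2[symmetric]) auto
        finally have "(ennreal \<bar>v x - w k x\<bar>)\<^sup>2 \<le> (\<Sum>j. a (j + k) x)\<^sup>2" by (rule power_mono) simp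
        then show ?case by (simp add: ennreal_power)
      qed
    qed
    then show ?thesis using tail_a by (meson order_trans)
  qed
  have diffN: "(\<lambda>x. v x - w k x) \<in> N12" for k
  proof -
    have "(\<integral>\<^sup>+x. ennreal ((v x - w k x)\<^sup>2) \<partial>\<mu>) < \<infinity>" "(\<integral>\<^sup>+x. (R k x)\<^sup>2 \<partial>\<mu>) < \<infinity>"
      using vle[of k] Rle[of k] by (auto intro: order_le_less_trans)
    then show ?thesis unfolding N12_def using ug[of k] by auto
  qed
  have v: "v \<in> N12" using N12_add[OF diffN[of 0] w[of 0]] by simp
  have ip_le: "ip (\<lambda>x. v x - w k x) (\<lambda>x. v x - w k x) \<le> 4 * K1 * (1/8)^k" for k
  proof -
    have "ennreal (ip (\<lambda>x. v x - w k x) (\<lambda>x. v x - w k x)) \<le> ennreal (4 * K1 * (1/8)^k)"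
      using vle[of k] diffN[of k] N12_sub_L2 by (subst ip_nn_integral[symmetric]) auto
    then show ?thesis using K1 by (subst (asm) ennreal_le_iff) auto
  qed
  have en_le: "energy (\<lambda>x. v x - w k x) (\<lambda>x. v x - w k x) \<le> C0\<^sup>2 * (4 * K1) * (1/8)^k" for k
  proof -
    have "ennreal (energy (\<lambda>x. v x - w k x) (\<lambda>x. v x - w k x)) \<le> ennreal (C0\<^sup>2) * (\<integral>\<^sup>+x. (R k x)\<^sup>2 \<partial>\<mu>)"
      unfolding energy_nn_integral[OF diffN, symmetric]
      using Rle[of k] by (intro D_nn_integral_le diffN ug) (auto intro: order_le_less_trans)
    also have "\<dots> \<le> ennreal (C0\<^sup>2) * ennreal (4 * K1 * (1/8)^k)"
      by (intro mult_left_mono Rle) auto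
    also have "\<dots> = ennreal (C0\<^sup>2 * (4 * K1) * (1/8)^k)"
      using K1 by (simp add: mult.assoc flip: ennreal_mult)
    finally show ?thesis using K1 by (subst (asm) ennreal_le_iff) auto
  qed
  have geo: "(\<lambda>k. c * (1/8::real)^k) \<longlonglongrightarrow> 0" for c
    using tendsto_mult_left[OF LIMSEQ_power_zero[of "1/8::real"], of c] by simp
  have diffL2: "(\<lambda>x. v x - w k x) \<in> L2" for k using diffN N12_sub_L2 by blast
  have "(\<lambda>k. ip (\<lambda>x. v x - w k x) (\<lambda>x. v x - w k x)) \<longlonglongrightarrow> 0"
    by (rule tendsto_sandwich[OF _ _ tendsto_const geo[of "4 * K1"]])
      (use ip_le semi_inner_nonneg[OF semi_inner_ip diffL2] in auto)
  moreover have "(\<lambda>k. energy (\<lambda>x. v x - w k x) (\<lambda>x. v x - w k x)) \<longlonglongrightarrow> 0"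
    by (rule tendsto_sandwich[OF _ _ tendsto_const geo[of "C0\<^sup>2 * (4 * K1)"]])
      (use en_le semi_inner_nonneg[OF semi_inner_energy diffN] in auto)
  ultimately show ?thesis using v by blast
qed

text \<open>The space \<open>V\<close> need not be closed: \<open>u\<close> is the limit of a minimising sequence of \<open>a * ip w w + energy w w - 2 * ip g w\<close>
  in \<open>V\<close>, but may lie outside \<open>V\<close>.\<close>

lemma Riesz_N12:
  fixes V :: "('a \<Rightarrow> real) set" and g :: "'a \<Rightarrow> real"
  assumes V: "V \<subseteq> N12" "V \<noteq> {}" "\<And>u v a b. u \<in> V \<Longrightarrow> v \<in> V \<Longrightarrow> (\<lambda>x. a * u x + b * v x) \<in> V"
    and a: "0 \<le> a" and K: "0 < K" "\<And>u. u \<in> V \<Longrightarrow> ip u u \<le> K * (a * ip u u + energy u u)"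
    and g: "g \<in> L2"
  obtains u w where "u \<in> N12" "\<And>k. w k \<in> V"
    "(\<lambda>k. ip (\<lambda>x. u x - w k x) (\<lambda>x. u x - w k x)) \<longlonglongrightarrow> 0"
    "(\<lambda>k. energy (\<lambda>x. u x - w k x) (\<lambda>x. u x - w k x)) \<longlonglongrightarrow> 0"
    "\<And>\<phi>. \<phi> \<in> V \<Longrightarrow> a * ip u \<phi> + energy u \<phi> = ip g \<phi>"
    "a * ip u u + energy u u = ip g u" "ip u u \<le> K * (a * ip u u + energy u u)"
proof -
  define B where "B u v = a * ip u v + energy u v" for u v
  have siN: "semi_inner N12 ip"
    by (rule semi_inner_subset[OF semi_inner_ip N12_sub_L2]) (rule N12_lincomb)
  have siB: "semi_inner N12 B"
    unfolding B_def by (rule semi_inner_combine[OF siN semi_inner_energy a])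
  have siBV: "semi_inner V B" by (rule semi_inner_subset[OF siB V(1)]) (rule V(3))
  have VL2: "u \<in> V \<Longrightarrow> u \<in> L2" for u using V(1) N12_sub_L2 by blast
  define J where "J u = B u u - 2 * ip g u" for u
  \<comment> \<open>The square of \<open>K * g - u\<close> is expanded, and \<open>ip u u\<close> is
    then estimated by coercivity.\<close>
  have Jlow: "- K * ip g g \<le> J u" if u: "u \<in> V" for u
  proof -
    have "0 \<le> K\<^sup>2 * ip g g + 2 * K * (-1) * ip g u + (-1)\<^sup>2 * ip u u"
      using semi_inner_nonneg[OF semi_inner_ip L2_lincomb[OF g VL2[OF u], of K "-1"]]
        semi_inner_square[OF semi_inner_ip g VL2[OF u], of K "-1"] by simp
    also have "ip u u \<le> K * B u u" using K(2)[OF u] by (simp add: B_def)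
    finally have "0 \<le> K * (K * ip g g - 2 * ip g u + B u u)" by (simp add: power2_eq_square algebra_simps)
    then have "0 \<le> K * ip g g - 2 * ip g u + B u u" using K(1) by (simp add: zero_le_mult_iff)
    then show ?thesis by (simp add: J_def)
  qed
  define m where "m = Inf (J ` V)"
  have bdd: "bdd_below (J ` V)" using Jlow by (intro bdd_belowI2) auto
  have mle: "m \<le> J u" if "u \<in> V" for u unfolding m_def using bdd that by (intro cInf_lower) auto
  have "\<exists>w\<in>V. J w < m + (1/8)^k" for k
  proof -
    have "m < m + (1/8)^k" by simp
    then have "\<exists>y\<in>J ` V. y < m + (1/8)^k"
      using cInf_less_iff[of "J ` V" "m + (1/8)^k"] bdd V(2) unfolding m_def by blast
    then show ?thesis by blast
  qed
  then obtain w where w: "\<And>k. w k \<in> V" "\<And>k. J (w k) < m + (1/8)^k" by metis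
  have wN: "w k \<in> N12" for k using w(1) V(1) by blast
  let ?\<Delta> = "\<lambda>k x. w (Suc k) x - w k x"
  have DV: "?\<Delta> k \<in> V" for k by (rule semi_inner_closed_diff[OF siBV w(1) w(1)])
  \<comment> \<open>The parallelogram identity: the linear part of \<open>J\<close> cancels, and the
    midpoint lies in \<open>V\<close>, so its value is at least \<open>m\<close>.\<close>
  have BD: "B (?\<Delta> k) (?\<Delta> k) \<le> 4 * (1/8)^k" for k
  proof -
    let ?m = "\<lambda>x. (1/2) * w (Suc k) x + (1/2) * w k x"
    have mV: "?m \<in> V" by (rule V(3)[OF w(1) w(1)])
    have Bm: "B ?m ?m = (1/4) * B (w (Suc k)) (w (Suc k)) + (1/2) * B (w (Suc k)) (w k) + (1/4) * B (w k) (w k)"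
      using semi_inner_square[OF siBV w(1) w(1), of "1/2" "Suc k" "1/2" k] by (simp add: power2_eq_square)
    have lm: "ip g ?m = (1/2) * ip g (w (Suc k)) + (1/2) * ip g (w k)"
      by (rule semi_inner_right[OF semi_inner_ip VL2[OF w(1)] VL2[OF w(1)] g])
    have "B (?\<Delta> k) (?\<Delta> k) = 2 * J (w (Suc k)) + 2 * J (w k) - 4 * J ?m"
      unfolding J_def Bm lm semi_inner_diff_square[OF siBV w(1) w(1)] by simp
    also have "\<dots> \<le> 2 * (1/8)^Suc k + 2 * (1/8)^k"
      using w(2)[of k] w(2)[of "Suc k"] mle[OF mV] by linarith
    also have "\<dots> \<le> 4 * (1/8)^k" by simp
    finally show ?thesis .
  qed
  have "ip (?\<Delta> k) (?\<Delta> k) + energy (?\<Delta> k) (?\<Delta> k) \<le> ((K + 1) * 4) * (1/8)^k" for k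
  proof -
    have "0 \<le> a * ip (?\<Delta> k) (?\<Delta> k)"
      using a semi_inner_nonneg[OF semi_inner_ip VL2[OF DV]] by simp
    then have "ip (?\<Delta> k) (?\<Delta> k) + energy (?\<Delta> k) (?\<Delta> k) \<le> K * B (?\<Delta> k) (?\<Delta> k) + B (?\<Delta> k) (?\<Delta> k)"
      using K(2)[OF DV[of k]] unfolding B_def by linarith
    also have "\<dots> = (K + 1) * B (?\<Delta> k) (?\<Delta> k)" by (simp add: algebra_simps)
    also have "\<dots> \<le> (K + 1) * (4 * (1/8)^k)" using K(1) BD by (intro mult_left_mono) auto
    finally show ?thesis by (simp only: mult.assoc)
  qed
  from N12_complete[OF wN _ this] K(1)
  obtain u where u: "u \<in> N12" "(\<lambda>k. ip (\<lambda>x. u x - w k x) (\<lambda>x. u x - w k x)) \<longlonglongrightarrow> 0"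
     "(\<lambda>k. energy (\<lambda>x. u x - w k x) (\<lambda>x. u x - w k x)) \<longlonglongrightarrow> 0" by auto
  have uL2: "u \<in> L2" using u(1) N12_sub_L2 by blast
  have limB: "(\<lambda>k. B (\<lambda>x. u x - w k x) (\<lambda>x. u x - w k x)) \<longlonglongrightarrow> 0"
    unfolding B_def using tendsto_add[OF tendsto_mult_left[OF u(2), of a] u(3)] by simp
  note Bw = semi_inner_tendsto[OF siB wN u(1) _ limB]
  note Bww = semi_inner_tendsto_square[OF siB wN u(1) limB]
  have gw: "(\<lambda>k. ip g (w k)) \<longlonglongrightarrow> ip g u"
    using semi_inner_tendsto[OF semi_inner_ip VL2[OF w(1)] uL2 g u(2)]
    by (simp add: semi_inner_sym[OF semi_inner_ip _ g] VL2[OF w(1)] uL2)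
  have EL: "B u \<phi> = ip g \<phi>" if \<phi>: "\<phi> \<in> V" for \<phi>
  proof -
    have \<phi>N: "\<phi> \<in> N12" using \<phi> V(1) by blast
    \<comment> \<open>Approximate minimality of \<open>w k\<close> against
      \<open>w k + t \<phi>\<close>, passed to the limit. The function \<open>u\<close> itself is
      never a competitor.\<close>
    have quad: "0 \<le> 2 * t * (B u \<phi> - ip g \<phi>) + t\<^sup>2 * B \<phi> \<phi>" for t
    proof (rule LIMSEQ_le_const)
      show "(\<lambda>k. 2 * t * (B (w k) \<phi> - ip g \<phi>) + t\<^sup>2 * B \<phi> \<phi> + (1/8)^k) \<longlonglongrightarrow> 2 * t * (B u \<phi> - ip g \<phi>) + t\<^sup>2 * B \<phi> \<phi>"
        using tendsto_add[OF tendsto_add[OF tendsto_mult_left[OF tendsto_diff[OF Bw[OF \<phi>N] tendsto_const[of "ip g \<phi>"]], of "2 * t"]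
          tendsto_const[of "t\<^sup>2 * B \<phi> \<phi>"]] LIMSEQ_power_zero[of "1/8::real"]] by simp
      show "\<exists>N. \<forall>k\<ge>N. 0 \<le> 2 * t * (B (w k) \<phi> - ip g \<phi>) + t\<^sup>2 * B \<phi> \<phi> + (1/8)^k"
      proof (intro exI allI impI)
        fix k
        let ?v = "\<lambda>x. 1 * w k x + t * \<phi> x"
        have "m \<le> J ?v" by (rule mle[OF V(3)[OF w(1) \<phi>]])
        also have "J ?v = J (w k) + 2 * t * (B (w k) \<phi> - ip g \<phi>) + t\<^sup>2 * B \<phi> \<phi>"
          unfolding J_def semi_inner_square[OF siBV w(1) \<phi>] semi_inner_right[OF semi_inner_ip VL2[OF w(1)] VL2[OF \<phi>] g]
          by (simp add: algebra_simps)
        finally show "0 \<le> 2 * t * (B (w k) \<phi> - ip g \<phi>) + t\<^sup>2 * B \<phi> \<phi> + (1/8)^k"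
          using w(2)[of k] by linarith
      qed
    qed
    define c where "c = B u \<phi> - ip g \<phi>"
    \<comment> \<open>The summand 1 makes \<open>b\<close> positive. At \<open>t = - c / b\<close>
      the quadratic inequality becomes \<open>c\<^sup>2 \<le> 0\<close>.\<close>
    define b where "b = 1 + B \<phi> \<phi>"
    have b: "0 < b" using semi_inner_nonneg[OF siB \<phi>N] by (simp add: b_def)
    have "0 \<le> 2 * (- c / b) * c + (- c / b)\<^sup>2 * B \<phi> \<phi>" using quad[of "- c / b"] by (simp add: c_def)
    also have "\<dots> \<le> 2 * (- c / b) * c + (- c / b)\<^sup>2 * b"
      by (intro add_left_mono mult_left_mono) (auto simp: b_def)
    also have "\<dots> = - (c\<^sup>2 / b)" using b by (simp add: power2_eq_square field_simps)
    finally have "c\<^sup>2 \<le> 0" using b by (simp add: divide_le_0_iff)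
    then show ?thesis by (simp add: c_def)
  qed
  \<comment> \<open>As \<open>u\<close> may lie outside \<open>V\<close>, it is not a test function;
    the equation is tested with \<open>w k\<close> and the limit is taken on both sides.\<close>
  have Buu: "B u u = ip g u"
  proof (rule LIMSEQ_unique)
    have "B u (w k) = ip g (w k)" for k by (rule EL[OF w(1)])
    then have "B (w k) u = ip g (w k)" for k using semi_inner_sym[OF siB wN u(1)] by simp
    then show "(\<lambda>k. ip g (w k)) \<longlonglongrightarrow> B u u" using Bw[OF u(1)] by simp
    show "(\<lambda>k. ip g (w k)) \<longlonglongrightarrow> ip g u" by (rule gw)
  qed
  have coer: "ip u u \<le> K * B u u"
  proof (rule LIMSEQ_le)
    show "(\<lambda>k. ip (w k) (w k)) \<longlonglongrightarrow> ip u u"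
      by (rule semi_inner_tendsto_square[OF siN wN u(1,2)])
    show "(\<lambda>k. K * B (w k) (w k)) \<longlonglongrightarrow> K * B u u" by (intro tendsto_mult_left Bww)
    show "\<exists>N. \<forall>k\<ge>N. ip (w k) (w k) \<le> K * B (w k) (w k)" using K(2)[OF w(1)] by (simp add: B_def)
  qed
  show ?thesis
    by (rule that[OF u(1) w(1) u(2,3)]) (use EL Buu coer in \<open>auto simp: B_def\<close>)
qed

end

section \<open>Poincare inequalities\<close>

context doubling_space
begin

section \<open>Averages over balls and their oscillation\<close>

lemma average_measurable:
  assumes u: "u \<in> borel_measurable \<mu>"
  shows "(\<lambda>x. average (mball x r) u) \<in> borel_measurable \<mu>"
proof -
  interpret sigma_finite_measure \<mu> by (rule sigma_finite)
  define E where "E = {z \<in> M \<times> M. d (fst z) (snd z) < r}"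
  have E [measurable]: "E \<in> sets (\<mu> \<Otimes>\<^sub>M \<mu>)" unfolding E_def by (rule strip_measurable)
  note u [measurable] ball_emeasure_measurable [measurable]
  have "(\<lambda>x. (\<integral>y. indicator E (x, y) *\<^sub>R u y \<partial>\<mu>) / enn2real (emeasure \<mu> (mball x r))) \<in> borel_measurable \<mu>"
    by measurable
  moreover have "average (mball x r) u = (\<integral>y. indicator E (x, y) *\<^sub>R u y \<partial>\<mu>) / enn2real (emeasure \<mu> (mball x r))"
    if "x \<in> space \<mu>" for x
  proof -
    have "(\<integral>y. indicator E (x, y) *\<^sub>R u y \<partial>\<mu>) = (\<integral>y. indicator (mball x r) y *\<^sub>R u y \<partial>\<mu>)"
      using that by (intro Bochner_Integration.integral_cong) (auto simp: E_def space_eq indicator_def)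
    then show ?thesis by (simp add: average_def set_lebesgue_integral_def measure_def)
  qed
  ultimately show ?thesis by (subst measurable_cong) auto
qed

lemma nn_average_measurable:
  fixes w :: "'a \<Rightarrow> ennreal"
  assumes w: "w \<in> borel_measurable \<mu>"
  shows "(\<lambda>x. (\<integral>\<^sup>+y\<in>mball x r. w y \<partial>\<mu>) / emeasure \<mu> (mball x r)) \<in> borel_measurable \<mu>"
proof -
  interpret sigma_finite_measure \<mu> by (rule sigma_finite)
  define E where "E = {z \<in> M \<times> M. d (fst z) (snd z) < r}"
  have E [measurable]: "E \<in> sets (\<mu> \<Otimes>\<^sub>M \<mu>)" unfolding E_def by (rule strip_measurable)
  note w [measurable] ball_emeasure_measurable [measurable]
  have "(\<lambda>x. (\<integral>\<^sup>+y. w y * indicator E (x, y) \<partial>\<mu>) / emeasure \<mu> (mball x r)) \<in> borel_measurable \<mu>"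
    by measurable
  moreover have "(\<integral>\<^sup>+y\<in>mball x r. w y \<partial>\<mu>) = (\<integral>\<^sup>+y. w y * indicator E (x, y) \<partial>\<mu>)" if "x \<in> space \<mu>" for x
    using that by (intro nn_integral_cong) (auto simp: E_def indicator_def space_eq)
  ultimately show ?thesis
    by (subst measurable_cong[of _ _ "\<lambda>x. (\<integral>\<^sup>+y. w y * indicator E (x, y) \<partial>\<mu>) / emeasure \<mu> (mball x r)"]) auto
qed

lemma nn_average_eq:
  assumes f: "f \<in> borel_measurable \<mu>" "\<And>y. 0 \<le> f y" "integrable \<mu> (\<lambda>y. indicator (mball x r) y * f y)"
    and x: "x \<in> M" "0 < r"
  shows "(\<integral>\<^sup>+y\<in>mball x r. ennreal (f y) \<partial>\<mu>) / emeasure \<mu> (mball x r) = ennreal (average (mball x r) f)"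
    and "0 \<le> average (mball x r) f"
proof -
  have "(\<integral>\<^sup>+y\<in>mball x r. ennreal (f y) \<partial>\<mu>) = (\<integral>\<^sup>+y. ennreal (indicator (mball x r) y * f y) \<partial>\<mu>)"
    by (intro nn_integral_cong) (auto simp: indicator_def)
  also have "\<dots> = ennreal (\<integral>y. indicator (mball x r) y * f y \<partial>\<mu>)"
    using f by (intro nn_integral_eq_integral) auto
  finally have eq: "(\<integral>\<^sup>+y\<in>mball x r. ennreal (f y) \<partial>\<mu>) = ennreal (\<integral>y. indicator (mball x r) y * f y \<partial>\<mu>)" .
  have nn: "0 \<le> (\<integral>y. indicator (mball x r) y * f y \<partial>\<mu>)" using f(2) by (intro Bochner_Integration.integral_nonneg) auto
  show "(\<integral>\<^sup>+y\<in>mball x r. ennreal (f y) \<partial>\<mu>) / emeasure \<mu> (mball x r) = ennreal (average (mball x r) f)"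
    using ball_measure_pos[OF x] nn
    by (simp add: eq ball_measure average_def set_lebesgue_integral_def divide_ennreal)
  show "0 \<le> average (mball x r) f"
    using nn by (simp add: average_def set_lebesgue_integral_def)
qed

lemma integrable_on_ball:
  fixes u :: "'a \<Rightarrow> real"
  assumes "integrable \<mu> u"
  shows "integrable \<mu> (\<lambda>y. indicator (mball x r) y * \<bar>u y - c\<bar>)" "integrable \<mu> (\<lambda>y. indicator (mball x r) y * (u y - c))"
    "integrable \<mu> (\<lambda>y. indicator (mball x r) y * u y)"
proof -
  have i: "integrable \<mu> (indicator (mball x r) :: 'a \<Rightarrow> real)"
    using ball_finite by (intro integrable_real_indicator) auto
  have "integrable \<mu> (\<lambda>y. indicator (mball x r) y *\<^sub>R u y - c * indicator (mball x r) y)"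
    using integrable_mult_indicator[OF ball_sets assms] i by (intro Bochner_Integration.integrable_diff integrable_mult_right) auto
  moreover have eq: "(\<lambda>y. indicator (mball x r) y *\<^sub>R u y - c * indicator (mball x r) y) = (\<lambda>y. indicator (mball x r) y * (u y - c))"
    by (auto simp: indicator_def)
  ultimately show 1: "integrable \<mu> (\<lambda>y. indicator (mball x r) y * (u y - c))" by simp
  have "(\<lambda>y. indicator (mball x r) y * \<bar>u y - c\<bar>) = (\<lambda>y. \<bar>indicator (mball x r) y * (u y - c)\<bar>)"
    by (auto simp: indicator_def)
  then show "integrable \<mu> (\<lambda>y. indicator (mball x r) y * \<bar>u y - c\<bar>)" using integrable_abs[OF 1] by simp
  show "integrable \<mu> (\<lambda>y. indicator (mball x r) y * u y)" using integrable_mult_indicator[OF ball_sets assms] by simp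
qed

text \<open>Used with \<open>c\<close> the average over the larger ball; it compares averages at
  consecutive radii and around nearby centres.\<close>

lemma average_diff_le:
  assumes u: "integrable \<mu> u" and sub: "mball x r \<subseteq> mball y s" and x: "x \<in> M" "0 < r" and y: "y \<in> M" "0 < s"
    and K: "measure \<mu> (mball y s) \<le> K * measure \<mu> (mball x r)"
  shows "\<bar>average (mball x r) u - c\<bar> \<le> K * average (mball y s) (\<lambda>z. \<bar>u z - c\<bar>)"
proof -
  note p = ball_measure_pos[OF x] ball_measure_pos[OF y]
  have "(\<integral>z. indicator (mball x r) z * (u z - c) \<partial>\<mu>) = (\<integral>z. indicator (mball x r) z * u z - c * indicator (mball x r) z \<partial>\<mu>)"
    by (intro Bochner_Integration.integral_cong) (auto simp: indicator_def)
  also have "\<dots> = (\<integral>z. indicator (mball x r) z * u z \<partial>\<mu>) - c * measure \<mu> (mball x r)"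
    using integrable_on_ball(3)[OF u] ball_finite[of x r]
    by (subst Bochner_Integration.integral_diff) (auto intro!: integrable_mult_right integrable_real_indicator)
  finally have "average (mball x r) u - c = (\<integral>z. indicator (mball x r) z * (u z - c) \<partial>\<mu>) / measure \<mu> (mball x r)"
    using p by (simp add: average_def set_lebesgue_integral_def field_simps)
  then have "\<bar>average (mball x r) u - c\<bar> = \<bar>\<integral>z. indicator (mball x r) z * (u z - c) \<partial>\<mu>\<bar> / measure \<mu> (mball x r)"
    using p by simp
  also have "\<dots> \<le> (\<integral>z. indicator (mball y s) z * \<bar>u z - c\<bar> \<partial>\<mu>) / measure \<mu> (mball x r)"
  proof (rule divide_right_mono)
    have "\<bar>\<integral>z. indicator (mball x r) z * (u z - c) \<partial>\<mu>\<bar> \<le> (\<integral>z. \<bar>indicator (mball x r) z * (u z - c)\<bar> \<partial>\<mu>)"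
      by (rule integral_abs_bound)
    also have "\<dots> \<le> (\<integral>z. indicator (mball y s) z * \<bar>u z - c\<bar> \<partial>\<mu>)"
    proof (rule integral_mono)
      show "integrable \<mu> (\<lambda>z. \<bar>indicator (mball x r) z * (u z - c)\<bar>)"
        by (rule integrable_abs[OF integrable_on_ball(2)[OF u]])
      show "\<bar>indicator (mball x r) z * (u z - c)\<bar> \<le> indicator (mball y s) z * \<bar>u z - c\<bar>" for z
        using sub by (auto simp: indicator_def)
    qed (rule integrable_on_ball(1)[OF u])
    finally show "\<bar>\<integral>z. indicator (mball x r) z * (u z - c) \<partial>\<mu>\<bar> \<le> (\<integral>z. indicator (mball y s) z * \<bar>u z - c\<bar> \<partial>\<mu>)" .
  qed (use p in auto)
  also have "\<dots> = (measure \<mu> (mball y s) / measure \<mu> (mball x r)) * average (mball y s) (\<lambda>z. \<bar>u z - c\<bar>)"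
    using p by (simp add: average_def set_lebesgue_integral_def)
  also have "\<dots> \<le> K * average (mball y s) (\<lambda>z. \<bar>u z - c\<bar>)"
  proof (rule mult_right_mono)
    show "measure \<mu> (mball y s) / measure \<mu> (mball x r) \<le> K" using K p by (simp add: field_simps)
    show "0 \<le> average (mball y s) (\<lambda>z. \<bar>u z - c\<bar>)"
      unfolding average_def set_lebesgue_integral_def
      by (intro divide_nonneg_nonneg Bochner_Integration.integral_nonneg) auto
  qed
  finally show ?thesis .
qed

lemma ball_subset: "x \<in> M \<Longrightarrow> y \<in> M \<Longrightarrow> d x y + r \<le> s \<Longrightarrow> mball x r \<subseteq> mball y s"
  using triangle[of y x] by (fastforce simp: commute)

lemma ball_measure_double2:
  assumes "x \<in> M" "0 < r" shows "measure \<mu> (mball x (4 * r)) \<le> Cm\<^sup>2 * measure \<mu> (mball x r)"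
proof -
  have "measure \<mu> (mball x (2 * (2 * r))) \<le> Cm * measure \<mu> (mball x (2 * r))"
    using assms by (intro ball_measure_double) auto
  also have "\<dots> \<le> Cm * (Cm * measure \<mu> (mball x r))"
    using assms Cm_ge_1 by (intro mult_left_mono ball_measure_double) auto
  finally show ?thesis by (simp add: power2_eq_square)
qed

text \<open>The Poincare hypothesis concerns integrable functions, while \<open>N12\<close> controls
  squares. On a set of finite measure \<open>\<bar>u\<bar> \<le> u\<^sup>2 + 1\<close> connects the
  two.\<close>

lemma L2_bounded_support_integrable:
  fixes u :: "'a \<Rightarrow> real"
  assumes m: "u \<in> borel_measurable \<mu>" and i: "integrable \<mu> (\<lambda>x. (u x)\<^sup>2)" and s: "AE x in \<mu>. x \<notin> mball p r \<longrightarrow> u x = 0"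
  shows "integrable \<mu> u"
proof (rule Bochner_Integration.integrable_bound)
  show "integrable \<mu> (\<lambda>x. (u x)\<^sup>2 + indicator (mball p r) x)"
    using i ball_finite[of p r] by (intro Bochner_Integration.integrable_add integrable_real_indicator) auto
  show "AE x in \<mu>. norm (u x) \<le> norm ((u x)\<^sup>2 + indicator (mball p r) x)"
    using s
  proof eventually_elim
    case (elim x)
    have "\<bar>u x\<bar> \<le> (u x)\<^sup>2 + 1" using zero_le_power2[of "\<bar>u x\<bar> - 1/2"] by (simp add: power2_eq_square algebra_simps)
    then show ?case using elim by (cases "x \<in> mball p r") auto
  qed
qed (use m in auto)

end

locale poincare_space = cheeger_space M d \<mu> Cm C0 H D
  for M :: "'a set" and d and \<mu> and Cm and C0 and H and D :: "('a \<Rightarrow> real) \<Rightarrow> 'a \<Rightarrow> 'h :: {real_inner, second_countable_topology}" +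
  fixes A CP :: real
  assumes A_ge_1: "1 \<le> A" and CP_ge_1: "1 \<le> CP" and poincare: "poincare12 A CP"
begin

definition avgD :: "('a \<Rightarrow> real) \<Rightarrow> 'a \<Rightarrow> real \<Rightarrow> real" where
  "avgD u x r = average (mball x (A * r)) (\<lambda>y. (norm (D u y))\<^sup>2)"

lemma integrable_D_ball: "u \<in> N12 \<Longrightarrow> integrable \<mu> (\<lambda>y. indicator (mball x r) y * (norm (D u y))\<^sup>2)"
  using integrable_mult_indicator[OF ball_sets D_L2] by simp

lemma avgD_nonneg: "0 \<le> avgD u x r"
  unfolding avgD_def average_def set_lebesgue_integral_def
  by (intro divide_nonneg_nonneg Bochner_Integration.integral_nonneg) auto

lemma avgD_nn:
  assumes u: "u \<in> N12" and "x \<in> M" "0 < r"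
  shows "ennreal (avgD u x r) = (\<integral>\<^sup>+y\<in>mball x (A * r). ennreal ((norm (D u y))\<^sup>2) \<partial>\<mu>) / emeasure \<mu> (mball x (A * r))"
  unfolding avgD_def using D_measurable[OF u] assms A_ge_1
  by (intro nn_average_eq(1)[symmetric] integrable_D_ball) auto

lemma poincare_D:
  assumes u: "u \<in> N12" "integrable \<mu> u" and x: "x \<in> M" "0 < r"
  shows "average (mball x r) (\<lambda>y. \<bar>u y - average (mball x r) u\<bar>) \<le> (CP * C0) * r * sqrt (avgD u x r)"
proof -
  obtain g where g: "minimal_weak_upper_gradient u g"
    "AE y in \<mu>. g y \<le> ennreal (C0 * norm (D u y)) \<and> ennreal (norm (D u y)) \<le> ennreal C0 * g y"
    using D_minimal[OF u(1)] .
  let ?B = "mball x (A * r)"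
  have mg: "g \<in> borel_measurable \<mu>"
    using g(1) borel_sigma_imp_measurable by (auto simp: minimal_weak_upper_gradient_def weak_upper_gradient_def)
  have le: "AE y in \<mu>. (enn2real (g y))\<^sup>2 \<le> C0\<^sup>2 * (norm (D u y))\<^sup>2"
    using g(2)
  proof eventually_elim
    case (elim y)
    then have "enn2real (g y) \<le> C0 * norm (D u y)" using C0_ge_1 by (intro enn2real_leI) auto
    then have "(enn2real (g y))\<^sup>2 \<le> (C0 * norm (D u y))\<^sup>2" by (intro power_mono) auto
    then show ?case by (simp add: power_mult_distrib)
  qed
  have iD: "integrable \<mu> (\<lambda>y. C0\<^sup>2 * (indicator ?B y * (norm (D u y))\<^sup>2))"
    by (intro integrable_mult_right integrable_D_ball u)
  have ig: "integrable \<mu> (\<lambda>y. indicator ?B y * (enn2real (g y))\<^sup>2)"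
  proof (rule Bochner_Integration.integrable_bound[OF iD])
    show "AE y in \<mu>. norm (indicator ?B y * (enn2real (g y))\<^sup>2) \<le> norm (C0\<^sup>2 * (indicator ?B y * (norm (D u y))\<^sup>2))"
      using le by eventually_elim (auto simp: indicator_def)
  qed (use mg in measurable)
  have "average ?B (\<lambda>y. (enn2real (g y))\<^sup>2) \<le> C0\<^sup>2 * avgD u x r"
  proof -
    have "(\<integral>y. indicator ?B y * (enn2real (g y))\<^sup>2 \<partial>\<mu>) \<le> (\<integral>y. C0\<^sup>2 * (indicator ?B y * (norm (D u y))\<^sup>2) \<partial>\<mu>)"
      by (rule integral_mono_AE[OF ig iD]) (use le in \<open>auto elim!: eventually_mono simp: indicator_def\<close>)
    then show ?thesis
      unfolding avgD_def average_def set_lebesgue_integral_def by (simp add: divide_right_mono)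
  qed
  then have s: "sqrt (average ?B (\<lambda>y. (enn2real (g y))\<^sup>2)) \<le> C0 * sqrt (avgD u x r)"
    using C0_ge_1 real_sqrt_le_mono by (fastforce simp: real_sqrt_mult)
  have "average (mball x r) (\<lambda>y. \<bar>u y - average (mball x r) u\<bar>)
      \<le> CP * r * sqrt (average ?B (\<lambda>y. (enn2real (g y))\<^sup>2))"
    using poincare x u(2) g(1) unfolding poincare12_def by blast
  also have "\<dots> \<le> CP * r * (C0 * sqrt (avgD u x r))"
    using CP_ge_1 x s by (intro mult_left_mono) auto
  finally show ?thesis by (simp add: mult.assoc mult.left_commute)
qed

lemma avgD_integral_le:
  assumes u: "u \<in> N12" and z: "z \<in> M" and r: "0 < r" and R: "R + A * r \<le> R'"
  shows "(\<integral>\<^sup>+x\<in>mball z R. ennreal (avgD u x r) \<partial>\<mu>) \<le> ennreal Cm * (\<integral>\<^sup>+y\<in>mball z R'. ennreal ((norm (D u y))\<^sup>2) \<partial>\<mu>)"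
proof -
  have Ar: "0 < A * r" using A_ge_1 r by simp
  have "(\<integral>\<^sup>+x\<in>mball z R. ennreal (avgD u x r) \<partial>\<mu>)
      = (\<integral>\<^sup>+x\<in>mball z R. ((\<integral>\<^sup>+y\<in>mball x (A * r). ennreal ((norm (D u y))\<^sup>2) \<partial>\<mu>) / emeasure \<mu> (mball x (A * r))) \<partial>\<mu>)"
    by (intro nn_integral_cong) (auto simp: indicator_def space_eq avgD_nn[OF u _ r])
  also have "\<dots> \<le> ennreal Cm * (\<integral>\<^sup>+y\<in>mball z R'. ennreal ((norm (D u y))\<^sup>2) \<partial>\<mu>)"
  proof (rule averaging[OF _ _ Ar])
    fix x assume "x \<in> mball z R"
    then show "mball x (A * r) \<subseteq> mball z R'" using R by (intro ball_subset) (auto simp: commute)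
  qed (use D_measurable[OF u] in measurable)
  finally show ?thesis .
qed

text \<open>Convergence of the averages is obtained from the Poincare inequality; no differentiation theorem is needed.\<close>

lemma average_L1_convergence:
  assumes u: "u \<in> N12" "integrable \<mu> u" and z: "z \<in> M" and R: "0 < R"
  shows "\<exists>K\<ge>0. \<forall>r>0. r \<le> R \<longrightarrow> (\<integral>\<^sup>+y\<in>mball z R. ennreal \<bar>u y - average (mball y r) u\<bar> \<partial>\<mu>) \<le> ennreal (K * r)"
proof -
  note mu [measurable] = N12D(1)[OF u(1)]
  define osc where "osc x r = average (mball x r) (\<lambda>y. \<bar>u y - average (mball x r) u\<bar>)" for x r
  define P where "P = CP * C0"
  have P: "0 \<le> P" using CP_ge_1 C0_ge_1 by (simp add: P_def)
  \<comment> \<open>Weakening the square root to \<open>1 + t\<close> makes the bound linear in the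
    averaged energy, so that it can be integrated over the centre.\<close>
  have oscP: "osc x r \<le> P * r * (1 + avgD u x r)" if "x \<in> M" "0 < r" for x r
  proof -
    have "osc x r \<le> P * r * sqrt (avgD u x r)" unfolding osc_def P_def by (rule poincare_D[OF u that])
    also have "\<dots> \<le> P * r * (1 + avgD u x r)"
    proof (rule mult_left_mono)
      have "0 \<le> (sqrt (avgD u x r) - 1)\<^sup>2" by simp
      then have "2 * sqrt (avgD u x r) \<le> 1 + avgD u x r" using avgD_nonneg[of u x r] by (simp add: power2_diff)
      moreover have "0 \<le> sqrt (avgD u x r)" using avgD_nonneg by simp
      ultimately show "sqrt (avgD u x r) \<le> 1 + avgD u x r" by linarith
    qed (use P that in auto)
    finally show ?thesis .
  qed
  have osc_nn: "ennreal (osc x r) = (\<integral>\<^sup>+y\<in>mball x r. ennreal \<bar>u y - average (mball x r) u\<bar> \<partial>\<mu>) / emeasure \<mu> (mball x r)"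
    and osc0: "0 \<le> osc x r" if "x \<in> M" "0 < r" for x r
    unfolding osc_def using that integrable_on_ball(1)[OF u(2)] mu
    by (auto intro!: nn_average_eq(1)[symmetric] nn_average_eq(2))
  \<comment> \<open>The balls of radius \<open>A * (2 * r)\<close> around points of
    \<open>mball z (2 * R)\<close> stay inside this one, for \<open>r \<le> R\<close>.\<close>
  define I where "I = (\<integral>\<^sup>+y\<in>mball z (2 * R + 2 * A * R). ennreal ((norm (D u y))\<^sup>2) \<partial>\<mu>)"
  have Ifin: "I < \<infinity>"
  proof -
    have "I \<le> (\<integral>\<^sup>+y. ennreal ((norm (D u y))\<^sup>2) \<partial>\<mu>)"
      unfolding I_def by (intro nn_integral_mono) (auto simp: indicator_def)
    also have "\<dots> < \<infinity>" by (simp add: energy_nn_integral[OF u(1)])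
    finally show ?thesis .
  qed
  define K1 where "K1 = measure \<mu> (mball z (2 * R)) + Cm * enn2real I"
  have K1: "0 \<le> K1" using Cm_ge_1 by (simp add: K1_def)
  define c where "c = 2 * Cm ^ 3"
  have c: "0 \<le> c" using Cm_ge_1 by (simp add: c_def)
  have main: "(\<integral>\<^sup>+y\<in>mball z R. ennreal \<bar>u y - average (mball y r) u\<bar> \<partial>\<mu>) \<le> ennreal ((c * (2 * P) * K1) * r)"
    if r: "0 < r" "r \<le> R" for r
  proof -
    define U where "U x = average (mball x (2 * r)) u" for x
    have [measurable]: "U \<in> borel_measurable \<mu>" unfolding U_def by (rule average_measurable[OF mu])
    let ?F = "\<lambda>y x. ennreal \<bar>u y - U x\<bar>"
    have osc_meas: "(\<lambda>x. ennreal (avgD u x (2 * r)) * indicator (mball z (2 * R)) x) \<in> borel_measurable \<mu>"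
    proof -
      have "(\<lambda>x. (\<integral>\<^sup>+y\<in>mball x (A * (2 * r)). ennreal ((norm (D u y))\<^sup>2) \<partial>\<mu>) / emeasure \<mu> (mball x (A * (2 * r)))) \<in> borel_measurable \<mu>"
        using D_measurable[OF u(1)] by (intro nn_average_measurable) auto
      then have "(\<lambda>x. (\<integral>\<^sup>+y\<in>mball x (A * (2 * r)). ennreal ((norm (D u y))\<^sup>2) \<partial>\<mu>) / emeasure \<mu> (mball x (A * (2 * r)))
          * indicator (mball z (2 * R)) x) \<in> borel_measurable \<mu>" by measurable
      then show ?thesis
        by (subst measurable_cong) (use r in \<open>auto simp: avgD_nn[OF u(1)] space_eq\<close>)
    qed
    define Osc where "Osc = (\<integral>\<^sup>+x\<in>mball z (2 * R). ennreal (osc x (2 * r)) \<partial>\<mu>)"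
    have Ole: "Osc \<le> ennreal ((2 * P) * K1 * r)"
    proof -
      have "Osc \<le> (\<integral>\<^sup>+x. ennreal (P * (2 * r)) * (indicator (mball z (2 * R)) x + ennreal (avgD u x (2 * r)) * indicator (mball z (2 * R)) x) \<partial>\<mu>)"
        unfolding Osc_def
      proof (rule nn_integral_mono)
        fix x assume "x \<in> space \<mu>"
        then have x: "x \<in> M" by (simp add: space_eq)
        have "ennreal (osc x (2 * r)) \<le> ennreal (P * (2 * r) * (1 + avgD u x (2 * r)))"
          using oscP[OF x, of "2 * r"] r by (intro ennreal_leI) auto
        also have "\<dots> = ennreal (P * (2 * r)) * (1 + ennreal (avgD u x (2 * r)))"
          using P r avgD_nonneg by (simp add: ennreal_mult ennreal_plus)
        finally show "ennreal (osc x (2 * r)) * indicator (mball z (2 * R)) x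
          \<le> ennreal (P * (2 * r)) * (indicator (mball z (2 * R)) x + ennreal (avgD u x (2 * r)) * indicator (mball z (2 * R)) x)"
          by (cases "x \<in> mball z (2 * R)") auto
      qed
      also have "\<dots> = ennreal (P * (2 * r)) * (emeasure \<mu> (mball z (2 * R)) + (\<integral>\<^sup>+x\<in>mball z (2 * R). ennreal (avgD u x (2 * r)) \<partial>\<mu>))"
        using osc_meas by (subst nn_integral_cmult) (auto simp: nn_integral_add)
      also have "\<dots> \<le> ennreal (P * (2 * r)) * (ennreal (measure \<mu> (mball z (2 * R))) + ennreal Cm * I)"
        unfolding I_def ball_measure using r A_ge_1
        by (intro mult_left_mono add_left_mono avgD_integral_le u z) (auto simp: mult_left_mono)
      also have "I = ennreal (enn2real I)" using Ifin by simp
      also have "ennreal (P * (2 * r)) * (ennreal (measure \<mu> (mball z (2 * R))) + ennreal Cm * ennreal (enn2real I)) = ennreal (P * (2 * r) * K1)"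
        unfolding K1_def using P r Cm_ge_1 by (simp add: ennreal_mult ennreal_plus)
      finally show ?thesis by (simp add: ac_simps)
    qed
    \<comment> \<open>The average around \<open>y\<close> is replaced by \<open>U x\<close>, the
      average over a ball of twice the radius around \<open>x\<close>, and \<open>x\<close> is then
      averaged over \<open>mball y r\<close>. The point is the double integral that results: after
      Fubini the inner variable is \<open>y\<close>, and integrating
      \<open>\<bar>u y - U x\<bar>\<close> over \<open>y\<close> gives an oscillation around
      \<open>x\<close>, to which the Poincare inequality applies.\<close>
    have pt: "ennreal \<bar>u y - average (mball y r) u\<bar>
        \<le> (\<integral>\<^sup>+x\<in>mball y r. (?F y x + ennreal (Cm\<^sup>2) * ennreal (osc x (2 * r))) \<partial>\<mu>) / emeasure \<mu> (mball y r)" if y: "y \<in> M" for y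
    proof -
      have "ennreal \<bar>u y - average (mball y r) u\<bar> * emeasure \<mu> (mball y r) = (\<integral>\<^sup>+x\<in>mball y r. ennreal \<bar>u y - average (mball y r) u\<bar> \<partial>\<mu>)"
        by (rule nn_integral_cmult_indicator[symmetric]) simp
      also have "\<dots> \<le> (\<integral>\<^sup>+x\<in>mball y r. (?F y x + ennreal (Cm\<^sup>2) * ennreal (osc x (2 * r))) \<partial>\<mu>)"
      proof (rule nn_integral_mono)
        fix x assume "x \<in> space \<mu>"
        show "ennreal \<bar>u y - average (mball y r) u\<bar> * indicator (mball y r) x
            \<le> (?F y x + ennreal (Cm\<^sup>2) * ennreal (osc x (2 * r))) * indicator (mball y r) x"
        proof (cases "x \<in> mball y r")
          case True
          then have x: "x \<in> M" "d y x < r" by auto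
          have "measure \<mu> (mball x (2 * r)) \<le> measure \<mu> (mball y (4 * r))"
            using x y r by (intro ball_measure_mono ball_subset) (auto simp: commute)
          then have vol: "measure \<mu> (mball x (2 * r)) \<le> Cm\<^sup>2 * measure \<mu> (mball y r)"
            using ball_measure_double2[OF y r(1)] by simp
          have "\<bar>average (mball y r) u - U x\<bar> \<le> Cm\<^sup>2 * osc x (2 * r)"
            unfolding osc_def U_def
          proof (rule average_diff_le[OF u(2) _ y r(1) x(1) _ vol])
            show "mball y r \<subseteq> mball x (2 * r)" using x y by (intro ball_subset) auto
          qed (use r in simp)
          then have "\<bar>u y - average (mball y r) u\<bar> \<le> \<bar>u y - U x\<bar> + Cm\<^sup>2 * osc x (2 * r)" by linarith
          then have "ennreal \<bar>u y - average (mball y r) u\<bar> \<le> ennreal (\<bar>u y - U x\<bar> + Cm\<^sup>2 * osc x (2 * r))" by (rule ennreal_leI)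
          also have "\<dots> = ?F y x + ennreal (Cm\<^sup>2) * ennreal (osc x (2 * r))"
            using osc0[OF x(1), of "2 * r"] r by (simp add: ennreal_plus ennreal_mult)
          finally show ?thesis using True by simp
        qed auto
      qed
      finally have "ennreal \<bar>u y - average (mball y r) u\<bar> * emeasure \<mu> (mball y r) / emeasure \<mu> (mball y r)
        \<le> (\<integral>\<^sup>+x\<in>mball y r. (?F y x + ennreal (Cm\<^sup>2) * ennreal (osc x (2 * r))) \<partial>\<mu>) / emeasure \<mu> (mball y r)"
        by (rule divide_right_mono_ennreal)
      then show ?thesis using ball_pos[OF y r(1)] ball_finite[of y r] by (simp add: ennreal_mult_divide_eq)
    qed
    have mosc: "(\<lambda>x. ennreal (osc x (2 * r))) \<in> borel_measurable \<mu>"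
    proof -
      interpret sigma_finite_measure \<mu> by (rule sigma_finite)
      define E where "E = {z \<in> M \<times> M. d (fst z) (snd z) < 2 * r}"
      have E [measurable]: "E \<in> sets (\<mu> \<Otimes>\<^sub>M \<mu>)" unfolding E_def by (rule strip_measurable)
      note ball_emeasure_measurable [measurable]
      have "(\<lambda>x. (\<integral>\<^sup>+y. ?F y x * indicator E (x, y) \<partial>\<mu>) / emeasure \<mu> (mball x (2 * r))) \<in> borel_measurable \<mu>"
        by measurable
      moreover have "ennreal (osc x (2 * r)) = (\<integral>\<^sup>+y. ?F y x * indicator E (x, y) \<partial>\<mu>) / emeasure \<mu> (mball x (2 * r))"
        if "x \<in> space \<mu>" for x
      proof -
        have "(\<integral>\<^sup>+y\<in>mball x (2 * r). ?F y x \<partial>\<mu>) = (\<integral>\<^sup>+y. ?F y x * indicator E (x, y) \<partial>\<mu>)"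
          using that by (intro nn_integral_cong) (auto simp: E_def indicator_def space_eq)
        then show ?thesis using osc_nn[of x "2 * r"] that r by (simp add: space_eq U_def)
      qed
      ultimately show ?thesis by (subst measurable_cong) auto
    qed
    let ?G = "\<lambda>y x. ?F y x + ennreal (Cm\<^sup>2) * ennreal (osc x (2 * r))"
    have "(\<integral>\<^sup>+y\<in>mball z R. ennreal \<bar>u y - average (mball y r) u\<bar> \<partial>\<mu>)
        \<le> (\<integral>\<^sup>+y\<in>mball z R. ((\<integral>\<^sup>+x\<in>mball y r. ?G y x \<partial>\<mu>) / emeasure \<mu> (mball y r)) \<partial>\<mu>)"
      using pt by (intro nn_integral_mono) (auto simp: indicator_def space_eq)
    also have "\<dots> \<le> ennreal Cm * (\<integral>\<^sup>+x\<in>mball z (2 * R). ((\<integral>\<^sup>+y\<in>mball x r. ?G y x \<partial>\<mu>) / emeasure \<mu> (mball x r)) \<partial>\<mu>)"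
    proof (rule averaging_Fubini[OF _ _ r(1)])
      show "(\<lambda>(y, x). ?G y x) \<in> borel_measurable (\<mu> \<Otimes>\<^sub>M \<mu>)" using mosc by measurable
      fix x assume "x \<in> mball z R"
      then show "mball x r \<subseteq> mball z (2 * R)" using r by (intro ball_subset) (auto simp: commute)
    qed auto
    also have "\<dots> \<le> ennreal Cm * (\<integral>\<^sup>+x\<in>mball z (2 * R). (ennreal (2 * Cm\<^sup>2) * ennreal (osc x (2 * r))) \<partial>\<mu>)"
    \<comment> \<open>Both summands of \<open>?G\<close> reduce to \<open>osc x (2 * r)\<close>: the
      first by enlarging the ball of integration, with loss \<open>Cm \<le> Cm\<^sup>2\<close>, the
      second because it does not depend on \<open>y\<close>. Hence the factor
      \<open>2 * Cm\<^sup>2\<close>.\<close>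
    proof (intro mult_left_mono nn_integral_mono)
      fix x assume "x \<in> space \<mu>"
      then have x: "x \<in> M" by (simp add: space_eq)
      have v: "0 < measure \<mu> (mball x r)" "0 < measure \<mu> (mball x (2 * r))"
        using ball_measure_pos[OF x] r by auto
      have "(\<integral>\<^sup>+y\<in>mball x r. ?G y x \<partial>\<mu>) = (\<integral>\<^sup>+y\<in>mball x r. ?F y x \<partial>\<mu>) + ennreal (Cm\<^sup>2) * ennreal (osc x (2 * r)) * emeasure \<mu> (mball x r)"
        unfolding distrib_right by (subst nn_integral_add) (auto simp: nn_integral_cmult_indicator)
      also have "\<dots> \<le> (\<integral>\<^sup>+y\<in>mball x (2 * r). ?F y x \<partial>\<mu>) + ennreal (Cm\<^sup>2) * ennreal (osc x (2 * r)) * emeasure \<mu> (mball x r)"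
        using r by (intro add_right_mono nn_integral_mono) (auto simp: indicator_def)
      also have "(\<integral>\<^sup>+y\<in>mball x (2 * r). ?F y x \<partial>\<mu>) = ennreal (osc x (2 * r)) * emeasure \<mu> (mball x (2 * r))"
        using osc_nn[OF x, of "2 * r"] r ball_pos[OF x, of "2 * r"] ball_finite[of x "2 * r"]
        by (simp add: U_def ennreal_divide_times ennreal_times_divide mult_divide_eq_ennreal)
      also have "\<dots> + ennreal (Cm\<^sup>2) * ennreal (osc x (2 * r)) * emeasure \<mu> (mball x r)
          \<le> ennreal (2 * Cm\<^sup>2) * ennreal (osc x (2 * r)) * emeasure \<mu> (mball x r)"
      proof -
        let ?o = "osc x (2 * r)" and ?m = "measure \<mu> (mball x r)" and ?m2 = "measure \<mu> (mball x (2 * r))"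
        have o: "0 \<le> ?o" using osc0[OF x] r by simp
        have "Cm \<le> Cm\<^sup>2" using Cm_ge_1 by (simp add: power2_eq_square)
        then have "?m2 \<le> Cm\<^sup>2 * ?m" using ball_measure_double[OF x r(1)] v by (meson mult_right_mono less_imp_le order_trans)
        then have "?o * ?m2 \<le> ?o * (Cm\<^sup>2 * ?m)" using o by (rule mult_left_mono)
        then have "?o * ?m2 + Cm\<^sup>2 * ?o * ?m \<le> 2 * Cm\<^sup>2 * ?o * ?m" by (simp add: algebra_simps)
        then have "ennreal (?o * ?m2 + Cm\<^sup>2 * ?o * ?m) \<le> ennreal (2 * Cm\<^sup>2 * ?o * ?m)" by (rule ennreal_leI)
        then show ?thesis using o v by (simp add: ball_measure ennreal_plus ennreal_mult)
      qed
      finally have "(\<integral>\<^sup>+y\<in>mball x r. ?G y x \<partial>\<mu>) / emeasure \<mu> (mball x r)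
          \<le> ennreal (2 * Cm\<^sup>2) * ennreal (osc x (2 * r)) * emeasure \<mu> (mball x r) / emeasure \<mu> (mball x r)"
        by (rule divide_right_mono_ennreal)
      also have "\<dots> = ennreal (2 * Cm\<^sup>2) * ennreal (osc x (2 * r))"
        using ball_pos[OF x r(1)] ball_finite[of x r] by (simp add: ennreal_mult_divide_eq)
      finally show "(\<integral>\<^sup>+y\<in>mball x r. ?G y x \<partial>\<mu>) / emeasure \<mu> (mball x r) * indicator (mball z (2 * R)) x
          \<le> ennreal (2 * Cm\<^sup>2) * ennreal (osc x (2 * r)) * indicator (mball z (2 * R)) x"
        by (intro mult_right_mono) auto
    qed auto
    also have "\<dots> = ennreal Cm * (ennreal (2 * Cm\<^sup>2) * Osc)"
      unfolding Osc_def mult.assoc using mosc by (subst nn_integral_cmult) auto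
    also have "\<dots> \<le> ennreal Cm * (ennreal (2 * Cm\<^sup>2) * ennreal ((2 * P) * K1 * r))"
      by (intro mult_left_mono Ole) auto
    also have "\<dots> = ennreal ((c * (2 * P) * K1) * r)"
      using Cm_ge_1 P K1 r by (simp add: c_def power3_eq_cube power2_eq_square ac_simps flip: ennreal_mult)
    finally show ?thesis .
  qed
  show ?thesis
    using main c P K1 by (intro exI[of _ "c * (2 * P) * K1"]) auto
qed

end

section \<open>The L2 Poincare inequality and its consequences\<close>

context poincare_space
begin

text \<open>This is \<open>16 * c\<^sup>2 * Cm\<close> with
  \<open>c = 2 * Cm\<^sup>2 * (CP * C0)\<close> the telescoping constant: 16 is 8 times the
  geometric sum 2, and the last \<open>Cm\<close> comes from averaging the energy.\<close>

definition CP2 :: real where "CP2 = 64 * Cm ^ 5 * (CP * C0)\<^sup>2"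

lemma CP2_nonneg: "0 \<le> CP2"
  using Cm_ge_1 by (simp add: CP2_def)

text \<open>Telescoping over the balls \<open>mball x (2\<^sup>1\<^sup>-\<^sup>i R)\<close>; the weights \<open>2\<^sup>i\<^sup>+\<^sup>1\<close> lost by squaring the sum are absorbed by
  the squared radii.\<close>

lemma poincare_L2_integrable:
  assumes u: "u \<in> N12" "integrable \<mu> u" and z: "z \<in> M" and R: "0 < R"
  shows "(\<integral>\<^sup>+x\<in>mball z R. ennreal ((u x - average (mball z R) u)\<^sup>2) \<partial>\<mu>)
    \<le> ennreal (CP2 * R\<^sup>2) * (\<integral>\<^sup>+x\<in>mball z (3 * A * R). ennreal ((norm (D u x))\<^sup>2) \<partial>\<mu>)"
proof -
  note mu [measurable] = N12D(1)[OF u(1)]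
  \<comment> \<open>Starts at \<open>2 * R\<close> so that the first ball around any
    \<open>x\<close> in \<open>mball z R\<close> contains \<open>mball z R\<close>.\<close>
  define \<rho> where "\<rho> i = 2 * R * (1/2)^i" for i :: nat
  have \<rho>: "0 < \<rho> i" for i using R by (simp add: \<rho>_def)
  have \<rho>S: "\<rho> i = 2 * \<rho> (Suc i)" for i by (simp add: \<rho>_def)
  define osc where "osc x r = average (mball x r) (\<lambda>y. \<bar>u y - average (mball x r) u\<bar>)" for x r
  define P where "P = CP * C0"
  have P: "0 \<le> P" using CP_ge_1 C0_ge_1 by (simp add: P_def)
  have osc_le: "osc x r \<le> P * r * sqrt (avgD u x r)" if "x \<in> M" "0 < r" for x r
    unfolding osc_def P_def by (rule poincare_D[OF u that])
  define U where "U i x = average (mball x (\<rho> i)) u" for i x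
  define u0 where "u0 = average (mball z R) u"
  \<comment> \<open>The factor 2 leaves half of \<open>a 0 x\<close> for the passage from the fixed
    ball to the first ball around \<open>x\<close>; the series of the \<open>a i x\<close> then
    bounds the whole difference.\<close>
  define c where "c = 2 * Cm\<^sup>2 * P"
  have c: "0 \<le> c" using P by (simp add: c_def)
  define a where "a i x = c * \<rho> i * sqrt (avgD u x (\<rho> i))" for i x
  have a0: "0 \<le> a i x" for i x using c \<rho>[of i] avgD_nonneg by (simp add: a_def)
  have Cm2: "Cm \<le> Cm\<^sup>2" using Cm_ge_1 by (simp add: power2_eq_square)
  have step: "\<bar>U (Suc i) x - U i x\<bar> \<le> a i x / 2" if x: "x \<in> M" for i x
  proof -
    have "\<bar>U (Suc i) x - U i x\<bar> \<le> Cm * osc x (\<rho> i)"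
      unfolding U_def osc_def
    proof (rule average_diff_le[OF u(2) _ x \<rho> x \<rho>])
      show "mball x (\<rho> (Suc i)) \<subseteq> mball x (\<rho> i)" using \<rho>[of "Suc i"] \<rho>S[of i] by auto
      show "measure \<mu> (mball x (\<rho> i)) \<le> Cm * measure \<mu> (mball x (\<rho> (Suc i)))"
        unfolding \<rho>S[of i] by (rule ball_measure_double[OF x \<rho>])
    qed
    also have "\<dots> \<le> Cm\<^sup>2 * (P * \<rho> i * sqrt (avgD u x (\<rho> i)))"
    proof (rule mult_mono[OF Cm2 osc_le[OF x \<rho>]])
      show "0 \<le> osc x (\<rho> i)" unfolding osc_def average_def set_lebesgue_integral_def
        by (intro divide_nonneg_nonneg Bochner_Integration.integral_nonneg) auto
    qed simp
    finally show ?thesis by (simp add: a_def c_def)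
  qed
  have start: "\<bar>u0 - U 0 x\<bar> \<le> a 0 x / 2" if x: "x \<in> mball z R" for x
  proof -
    have xM: "x \<in> M" "d z x < R" using x by auto
    have "\<bar>u0 - U 0 x\<bar> \<le> Cm\<^sup>2 * osc x (\<rho> 0)"
      unfolding U_def osc_def u0_def
    proof (rule average_diff_le[OF u(2) _ z R xM(1) \<rho>])
      show "mball z R \<subseteq> mball x (\<rho> 0)" using xM z R by (intro ball_subset) (auto simp: \<rho>_def)
      have "measure \<mu> (mball x (\<rho> 0)) \<le> measure \<mu> (mball z (4 * R))"
        using xM z R by (intro ball_measure_mono ball_subset) (auto simp: \<rho>_def commute)
      then show "measure \<mu> (mball x (\<rho> 0)) \<le> Cm\<^sup>2 * measure \<mu> (mball z R)"
        using ball_measure_double2[OF z R] by simp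
    qed
    also have "\<dots> \<le> Cm\<^sup>2 * (P * \<rho> 0 * sqrt (avgD u x (\<rho> 0)))"
      by (intro mult_left_mono osc_le xM \<rho>) auto
    finally show ?thesis by (simp add: a_def c_def)
  qed
  have bound: "\<bar>U n x - u0\<bar> \<le> a 0 x / 2 + (\<Sum>i<n. a i x / 2)" if x: "x \<in> mball z R" for n x
  proof (induction n)
    case 0
    then show ?case using start[OF x] by (simp add: abs_minus_commute)
  next
    case (Suc n)
    have "\<bar>U (Suc n) x - u0\<bar> \<le> \<bar>U n x - u0\<bar> + \<bar>U (Suc n) x - U n x\<bar>" by linarith
    then show ?case using Suc step[of x n] x by auto
  qed
  have bound': "ennreal \<bar>U n x - u0\<bar> \<le> (\<Sum>i. ennreal (a i x))" if x: "x \<in> mball z R" for n x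
  proof -
    have "\<bar>U n x - u0\<bar> \<le> a 0 x / 2 + (\<Sum>i<Suc n. a i x / 2)"
      using bound[OF x, of n] a0[of n x] by simp
    also have "(\<Sum>i<Suc n. a i x / 2) \<le> (\<Sum>i<Suc n. a i x) - a 0 x / 2"
      using sum_mono[of "{..<n}" "\<lambda>i. a (Suc i) x / 2" "\<lambda>i. a (Suc i) x"] a0
      by (simp add: sum.lessThan_Suc_shift del: sum.lessThan_Suc)
    finally have "\<bar>U n x - u0\<bar> \<le> (\<Sum>i<Suc n. a i x)" by simp
    then have "ennreal \<bar>U n x - u0\<bar> \<le> ennreal (\<Sum>i<Suc n. a i x)" by (rule ennreal_leI)
    also have "\<dots> = (\<Sum>i<Suc n. ennreal (a i x))" using a0 by (intro sum_ennreal[symmetric]) auto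
    also have "\<dots> \<le> (\<Sum>i. ennreal (a i x))" by (rule sum_le_suminf) auto
    finally show ?thesis .
  qed
  obtain K where K: "0 \<le> K" "\<And>r. 0 < r \<Longrightarrow> r \<le> R \<Longrightarrow>
      (\<integral>\<^sup>+y\<in>mball z R. ennreal \<bar>u y - average (mball y r) u\<bar> \<partial>\<mu>) \<le> ennreal (K * r)"
    using average_L1_convergence[OF u z R] by blast
  have mU [measurable]: "U i \<in> borel_measurable \<mu>" for i unfolding U_def by (rule average_measurable[OF mu])
  \<comment> \<open>L1 errors of order \<open>(1/2)^i\<close> are summable, so convergence holds
    almost everywhere along these radii. The index is shifted because \<open>\<rho> 0\<close>
    exceeds \<open>R\<close>.\<close>
  have conv: "AE x in \<mu>. x \<in> mball z R \<longrightarrow> (\<lambda>n. U n x) \<longlonglongrightarrow> u x"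
  proof -
    let ?h = "\<lambda>i x. ennreal \<bar>u x - U (Suc i) x\<bar> * indicator (mball z R) x"
    have "(\<integral>\<^sup>+x. (\<Sum>i. ?h i x) \<partial>\<mu>) = (\<Sum>i. \<integral>\<^sup>+x. ?h i x \<partial>\<mu>)"
      by (rule nn_integral_suminf) measurable
    also have "\<dots> \<le> (\<Sum>i. ennreal (K * R * (1/2)^i))"
    proof (intro suminf_le)
      fix i
      have "(\<integral>\<^sup>+x. ?h i x \<partial>\<mu>) \<le> ennreal (K * \<rho> (Suc i))"
        unfolding U_def
        using R power_le_one[of "1/2::real" i] by (intro K(2) \<rho>) (auto simp: \<rho>_def)
      then show "(\<integral>\<^sup>+x. ?h i x \<partial>\<mu>) \<le> ennreal (K * R * (1/2)^i)" by (simp add: \<rho>_def mult.assoc)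
    qed auto
    also have "\<dots> < \<infinity>"
      using K(1) R by (subst suminf_ennreal2) (auto intro!: summable_mult summable_geometric)
    finally have "(\<integral>\<^sup>+x. (\<Sum>i. ?h i x) \<partial>\<mu>) \<noteq> \<infinity>" by simp
    then have "AE x in \<mu>. (\<Sum>i. ?h i x) \<noteq> \<infinity>" by (intro nn_integral_PInf_AE) measurable
    then show ?thesis
    proof eventually_elim
      case (elim x)
      show ?case
      proof
        assume x: "x \<in> mball z R"
        have "(\<Sum>i. ennreal \<bar>u x - U (Suc i) x\<bar>) \<noteq> top" using elim x by simp
        then have "summable (\<lambda>i. \<bar>u x - U (Suc i) x\<bar>)"
          using summable_suminf_not_top[OF abs_ge_zero, of "\<lambda>i. u x - U (Suc i) x"] by blast
        then have "(\<lambda>i. \<bar>u x - U (Suc i) x\<bar>) \<longlonglongrightarrow> 0" by (rule summable_LIMSEQ_zero)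
        then have "(\<lambda>i. u x - U (Suc i) x) \<longlonglongrightarrow> 0" by (simp add: tendsto_rabs_zero_iff)
        from tendsto_diff[OF tendsto_const[of "u x"] this] have "(\<lambda>i. U (Suc i) x) \<longlonglongrightarrow> u x" by simp
        then show "(\<lambda>n. U n x) \<longlonglongrightarrow> u x" by (rule LIMSEQ_imp_Suc)
      qed
    qed
  qed
  let ?I = "\<integral>\<^sup>+x\<in>mball z (3 * A * R). ennreal ((norm (D u x))\<^sup>2) \<partial>\<mu>"
  have pt: "AE x in \<mu>. ennreal ((u x - u0)\<^sup>2) * indicator (mball z R) x
      \<le> (\<Sum>i. ennreal (8 * c\<^sup>2 * R\<^sup>2 * (1/2)^i) * (ennreal (avgD u x (\<rho> i)) * indicator (mball z R) x))"
    using conv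
  proof eventually_elim
    case (elim x)
    show ?case
    proof (cases "x \<in> mball z R")
      case True
      have "(\<lambda>n. ennreal \<bar>U n x - u0\<bar>) \<longlonglongrightarrow> ennreal \<bar>u x - u0\<bar>"
        using elim True by (intro tendsto_ennrealI tendsto_intros) auto
      then have "ennreal \<bar>u x - u0\<bar> \<le> (\<Sum>i. ennreal (a i x))"
        by (rule LIMSEQ_le_const2) (use bound'[OF True] in blast)
      then have "(ennreal \<bar>u x - u0\<bar>)\<^sup>2 \<le> (\<Sum>i. ennreal (a i x))\<^sup>2" by (rule power_mono) simp
      also have "\<dots> \<le> (\<Sum>i. 2 ^ Suc i * (ennreal (a i x))\<^sup>2)" by (rule suminf_power2_le_ennreal)
      also have "\<dots> = (\<Sum>i. ennreal (8 * c\<^sup>2 * R\<^sup>2 * (1/2)^i) * ennreal (avgD u x (\<rho> i)))"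
      proof (rule suminf_cong)
        fix i
        have "2 ^ Suc i * (ennreal (a i x))\<^sup>2 = ennreal (2 ^ Suc i) * ennreal ((a i x)\<^sup>2)"
          using a0 by (simp add: ennreal_2_power ennreal_power del: power_Suc)
        also have "\<dots> = ennreal (2 ^ Suc i * (a i x)\<^sup>2)" by (rule ennreal_mult[symmetric]) auto
        also have "2 ^ Suc i * (a i x)\<^sup>2 = (8 * c\<^sup>2 * R\<^sup>2 * (2^i * ((1/2)^i)\<^sup>2)) * avgD u x (\<rho> i)"
          using avgD_nonneg[of u x "\<rho> i"] by (simp add: a_def \<rho>_def power_mult_distrib)
        also have "(2::real)^i * ((1/2)^i)\<^sup>2 = (1/2)^i"
          by (simp add: power2_eq_square power_one_over)
        finally show "2 ^ Suc i * (ennreal (a i x))\<^sup>2 = ennreal (8 * c\<^sup>2 * R\<^sup>2 * (1/2)^i) * ennreal (avgD u x (\<rho> i))"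
          using avgD_nonneg by (simp add: ennreal_mult)
      qed
      finally show ?thesis using True by (simp add: ennreal_power)
    qed simp
  qed
  have mavg: "(\<lambda>x. ennreal (avgD u x (\<rho> i)) * indicator (mball z R) x) \<in> borel_measurable \<mu>" for i
  proof -
    have "(\<lambda>x. (\<integral>\<^sup>+y\<in>mball x (A * \<rho> i). ennreal ((norm (D u y))\<^sup>2) \<partial>\<mu>) / emeasure \<mu> (mball x (A * \<rho> i))
       * indicator (mball z R) x) \<in> borel_measurable \<mu>"
      using D_measurable[OF u(1)] by (intro borel_measurable_times_ennreal nn_average_measurable) auto
    then show ?thesis
      by (subst measurable_cong) (use \<rho> in \<open>auto simp: avgD_nn[OF u(1)] space_eq\<close>)
  qed
  have "(\<integral>\<^sup>+x\<in>mball z R. ennreal ((u x - u0)\<^sup>2) \<partial>\<mu>)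
      \<le> (\<integral>\<^sup>+x. (\<Sum>i. ennreal (8 * c\<^sup>2 * R\<^sup>2 * (1/2)^i) * (ennreal (avgD u x (\<rho> i)) * indicator (mball z R) x)) \<partial>\<mu>)"
    by (rule nn_integral_mono_AE[OF pt])
  also have "\<dots> = (\<Sum>i. ennreal (8 * c\<^sup>2 * R\<^sup>2 * (1/2)^i) * (\<integral>\<^sup>+x\<in>mball z R. ennreal (avgD u x (\<rho> i)) \<partial>\<mu>))"
    using mavg by (subst nn_integral_suminf) (auto simp: nn_integral_cmult)
  also have "\<dots> \<le> (\<Sum>i. ennreal (8 * c\<^sup>2 * R\<^sup>2 * (1/2)^i) * (ennreal Cm * ?I))"
  \<comment> \<open>The largest averaging radius is \<open>A * (2 * R)\<close>, and
    \<open>R + 2 * A * R \<le> 3 * A * R\<close> by \<open>A \<ge> 1\<close>. This is the factor 3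
    in the dilation.\<close>
  proof (intro suminf_le mult_left_mono avgD_integral_le u z \<rho>)
    fix i
    have "A * \<rho> i \<le> A * (2 * R)"
      using A_ge_1 R power_le_one[of "1/2::real" i] by (intro mult_left_mono) (auto simp: \<rho>_def)
    moreover have "R \<le> A * R" using A_ge_1 R by simp
    ultimately show "R + A * \<rho> i \<le> 3 * A * R" by simp
  qed auto
  also have "\<dots> = (\<Sum>i. ennreal (8 * c\<^sup>2 * R\<^sup>2 * (1/2)^i)) * (ennreal Cm * ?I)"
    by (rule ennreal_suminf_multc)
  also have "(\<Sum>i. ennreal (8 * c\<^sup>2 * R\<^sup>2 * (1/2)^i)) = ennreal (\<Sum>i. 8 * c\<^sup>2 * R\<^sup>2 * (1/2)^i)"
    by (intro suminf_ennreal2 summable_mult summable_geometric) auto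
  also have "(\<Sum>i. 8 * c\<^sup>2 * R\<^sup>2 * (1/2::real)^i) = 16 * c\<^sup>2 * R\<^sup>2"
    by (subst suminf_mult) (auto simp: suminf_geometric summable_geometric)
  also have "ennreal (16 * c\<^sup>2 * R\<^sup>2) * (ennreal Cm * ?I) = ennreal (16 * c\<^sup>2 * R\<^sup>2 * Cm) * ?I"
    using Cm_ge_1 by (simp add: ennreal_mult mult.assoc)
  also have "16 * c\<^sup>2 * R\<^sup>2 * Cm = CP2 * R\<^sup>2"
    by (simp add: c_def CP2_def P_def power2_eq_square power_numeral_reduce)
  finally show ?thesis unfolding u0_def .
qed

text \<open>Integrability is gained by a cut-off equal to 1 on \<open>mball z (3 * A * R)\<close>.
  On that ball the function is unchanged and, by locality, so is its derivative.\<close>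

lemma poincare_L2:
  assumes u: "u \<in> N12" and z: "z \<in> M" and R: "0 < R"
  shows "(\<integral>\<^sup>+x\<in>mball z R. ennreal ((u x - average (mball z R) u)\<^sup>2) \<partial>\<mu>)
    \<le> ennreal (CP2 * R\<^sup>2) * (\<integral>\<^sup>+x\<in>mball z (3 * A * R). ennreal ((norm (D u x))\<^sup>2) \<partial>\<mu>)"
proof -
  define S where "S = 3 * A * R"
  have S: "R \<le> S" "0 < S"
  proof -
    have "1 * R \<le> (3 * A) * R" using A_ge_1 R by (intro mult_right_mono) auto
    then show "R \<le> S" "0 < S" using R by (auto simp: S_def)
  qed
  define v where "v x = bump z S x * u x" for x
  have v: "v \<in> N12" unfolding v_def by (rule bump_mult_N12[OF z S(2) u])
  have veq: "v x = u x" if "x \<in> mball z S" for x using bump_eq_1[OF S(2) that] by (simp add: v_def)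
  have "AE x in \<mu>. x \<notin> mball z (2 * S) \<longrightarrow> v x = 0"
    using AE_space by eventually_elim (use bump_neq_0[OF S(2) z] in \<open>auto simp: v_def space_eq\<close>)
  then have "integrable \<mu> v" by (rule L2_bounded_support_integrable[OF N12D(1)[OF v] N12_L2[OF v]])
  from poincare_L2_integrable[OF v this z R]
  have le: "(\<integral>\<^sup>+x\<in>mball z R. ennreal ((v x - average (mball z R) v)\<^sup>2) \<partial>\<mu>)
    \<le> ennreal (CP2 * R\<^sup>2) * (\<integral>\<^sup>+x\<in>mball z S. ennreal ((norm (D v x))\<^sup>2) \<partial>\<mu>)" unfolding S_def .
  have sub: "mball z R \<subseteq> mball z S" using S by auto
  have "average (mball z R) v = average (mball z R) u"
    unfolding average_def set_lebesgue_integral_def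
    using veq sub by (intro arg_cong2[where f="(/)"] Bochner_Integration.integral_cong) (auto simp: indicator_def)
  moreover have "(\<integral>\<^sup>+x\<in>mball z R. ennreal ((v x - k)\<^sup>2) \<partial>\<mu>) = (\<integral>\<^sup>+x\<in>mball z R. ennreal ((u x - k)\<^sup>2) \<partial>\<mu>)" for k
    using veq sub by (intro nn_integral_cong) (auto simp: indicator_def)
  moreover have "(\<integral>\<^sup>+x\<in>mball z S. ennreal ((norm (D v x))\<^sup>2) \<partial>\<mu>) = (\<integral>\<^sup>+x\<in>mball z S. ennreal ((norm (D u x))\<^sup>2) \<partial>\<mu>)"
    by (rule nn_integral_cong_AE) (use D_eq_on[OF v u] veq in \<open>auto elim!: eventually_mono simp: indicator_def\<close>)
  ultimately show ?thesis using le by (simp add: S_def)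
qed

text \<open>Where \<open>u\<close> vanishes, the deviation from the average \<open>\<alpha>\<close>
  is \<open>\<alpha>\<close> itself. A zero set of comparable measure therefore bounds the average
  by the oscillation.\<close>

lemma poincare_vanishing:
  assumes u: "u \<in> N12" and z: "z \<in> M" and R: "0 < R" and q: "q \<in> M" "0 < s" "mball q s \<subseteq> mball z R"
    and v: "AE x in \<mu>. x \<in> mball q s \<longrightarrow> u x = 0" and K: "measure \<mu> (mball z R) \<le> K * measure \<mu> (mball q s)" "0 \<le> K"
  shows "(\<integral>\<^sup>+x\<in>mball z R. ennreal ((u x)\<^sup>2) \<partial>\<mu>)
    \<le> ennreal ((2 + 2 * K) * CP2 * R\<^sup>2) * (\<integral>\<^sup>+x\<in>mball z (3 * A * R). ennreal ((norm (D u x))\<^sup>2) \<partial>\<mu>)"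
proof -
  note mu [measurable] = N12D(1)[OF u]
  define \<alpha> where "\<alpha> = average (mball z R) u"
  let ?J = "\<integral>\<^sup>+x\<in>mball z R. ennreal ((u x - \<alpha>)\<^sup>2) \<partial>\<mu>"
  have "ennreal (\<alpha>\<^sup>2) * emeasure \<mu> (mball q s) = (\<integral>\<^sup>+x\<in>mball q s. ennreal (\<alpha>\<^sup>2) \<partial>\<mu>)"
    by (rule nn_integral_cmult_indicator[symmetric]) simp
  also have "\<dots> \<le> ?J"
    by (rule nn_integral_mono_AE) (use v q(3) in \<open>auto elim!: eventually_mono simp: indicator_def\<close>)
  finally have \<alpha>: "ennreal (\<alpha>\<^sup>2) * emeasure \<mu> (mball q s) \<le> ?J" .
  have "ennreal (\<alpha>\<^sup>2) * emeasure \<mu> (mball z R) \<le> ennreal (\<alpha>\<^sup>2) * (ennreal K * emeasure \<mu> (mball q s))"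
    unfolding ball_measure using K by (intro mult_left_mono) (auto simp: ennreal_leI simp flip: ennreal_mult)
  also have "\<dots> = ennreal K * (ennreal (\<alpha>\<^sup>2) * emeasure \<mu> (mball q s))" by (simp add: ac_simps)
  also have "\<dots> \<le> ennreal K * ?J" by (intro mult_left_mono \<alpha>) auto
  finally have \<alpha>': "ennreal (\<alpha>\<^sup>2) * emeasure \<mu> (mball z R) \<le> ennreal K * ?J" .
  have "(\<integral>\<^sup>+x\<in>mball z R. ennreal ((u x)\<^sup>2) \<partial>\<mu>)
      \<le> (\<integral>\<^sup>+x. 2 * (ennreal ((u x - \<alpha>)\<^sup>2) * indicator (mball z R) x) + 2 * (ennreal (\<alpha>\<^sup>2) * indicator (mball z R) x) \<partial>\<mu>)"
  proof (rule nn_integral_mono)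
    fix x
    have "(u x)\<^sup>2 \<le> 2 * (u x - \<alpha>)\<^sup>2 + 2 * \<alpha>\<^sup>2"
      using zero_le_power2[of "u x - 2 * \<alpha>"] by (simp add: power2_eq_square algebra_simps)
    then have "ennreal ((u x)\<^sup>2) \<le> ennreal (2 * (u x - \<alpha>)\<^sup>2 + 2 * \<alpha>\<^sup>2)" by (rule ennreal_leI)
    also have "\<dots> = 2 * ennreal ((u x - \<alpha>)\<^sup>2) + 2 * ennreal (\<alpha>\<^sup>2)" by (simp add: ennreal_plus ennreal_mult)
    finally show "ennreal ((u x)\<^sup>2) * indicator (mball z R) x
      \<le> 2 * (ennreal ((u x - \<alpha>)\<^sup>2) * indicator (mball z R) x) + 2 * (ennreal (\<alpha>\<^sup>2) * indicator (mball z R) x)"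
      by (cases "x \<in> mball z R") auto
  qed
  also have "\<dots> = 2 * ?J + 2 * (ennreal (\<alpha>\<^sup>2) * emeasure \<mu> (mball z R))"
    by (simp add: nn_integral_add nn_integral_cmult nn_integral_cmult_indicator)
  also have "\<dots> \<le> 2 * ?J + 2 * (ennreal K * ?J)" by (intro add_left_mono mult_left_mono \<alpha>') auto
  also have "\<dots> = ennreal (2 + 2 * K) * ?J" using K(2) by (simp add: ennreal_plus ennreal_mult distrib_right mult.assoc)
  also have "\<dots> \<le> ennreal (2 + 2 * K) * (ennreal (CP2 * R\<^sup>2) * (\<integral>\<^sup>+x\<in>mball z (3 * A * R). ennreal ((norm (D u x))\<^sup>2) \<partial>\<mu>))"
    unfolding \<alpha>_def by (intro mult_left_mono poincare_L2[OF u z R]) auto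
  also have "\<dots> = ennreal ((2 + 2 * K) * CP2 * R\<^sup>2) * (\<integral>\<^sup>+x\<in>mball z (3 * A * R). ennreal ((norm (D u x))\<^sup>2) \<partial>\<mu>)"
    using K(2) CP2_nonneg by (simp add: ennreal_mult mult.assoc)
  finally show ?thesis .
qed

text \<open>The space is connected: the indicator of a ball with an empty annulus around it would have \<open>0\<close> as an
  upper gradient.\<close>

lemma annulus_nonempty:
  assumes x: "x \<in> M" and s: "0 < s" and p: "p \<in> M" "s \<le> d x p"
  shows "\<exists>q\<in>M. s \<le> d x q \<and> d x q < 2 * s"
proof (rule ccontr)
  assume "\<not> ?thesis"
  then have gap: "d x q < s \<or> 2 * s \<le> d x q" if "q \<in> M" for q using that by force
  define u where "u y = (indicator (mball x s) y :: real)" for y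
  have ug: "upper_gradient u (\<lambda>_. 0)"
  proof (rule upper_gradientI)
    fix l \<Gamma> assume arc: "arc_length_curve l \<Gamma>"
    note l = arc_length_curveD(1)[OF arc] and \<Gamma>M = arc_length_curveD(2)[OF arc]
    let ?f = "\<lambda>t. d x (\<Gamma> t)"
    have Lip: "\<bar>?f t - ?f t'\<bar> \<le> \<bar>t - t'\<bar>" if "t \<in> {0..l}" "t' \<in> {0..l}" for t t'
    proof -
      have "d (\<Gamma> t) (\<Gamma> t') \<le> \<bar>t - t'\<bar>"
        using arc_length_curve_dist[OF arc, of t t'] arc_length_curve_dist[OF arc, of t' t] that
        by (cases "t \<le> t'") (auto simp: commute)
      then show ?thesis
        using triangle[of x "\<Gamma> t" "\<Gamma> t'"] triangle[of x "\<Gamma> t'" "\<Gamma> t"] \<Gamma>M that x by (auto simp: commute)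
    qed
    have cont: "continuous_on {0..l} ?f"
      unfolding continuous_on_iff dist_real_def using Lip by (meson order_le_less_trans)
    have "u (\<Gamma> l) = u (\<Gamma> 0)"
    proof (rule ccontr)
      assume ne: "u (\<Gamma> l) \<noteq> u (\<Gamma> 0)"
      have M0: "\<Gamma> 0 \<in> M" "\<Gamma> l \<in> M" using \<Gamma>M l by auto
      \<comment> \<open>A curve joining the two sides would meet the sphere of radius
        \<open>s\<close>, which lies in the empty annulus.\<close>
      have "\<exists>t\<in>{0..l}. ?f t = s"
      proof (cases "?f 0 < s")
        case True
        then have "s \<le> ?f l" using ne M0 x by (auto simp: u_def indicator_def)
        then show ?thesis using IVT'[of ?f 0 s l] True l cont by auto
      next
        case False
        then have "?f l < s" using ne M0 x by (auto simp: u_def indicator_def)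
        then show ?thesis using IVT2'[of ?f l s 0] False l cont by auto
      qed
      then show False using gap \<Gamma>M s by fastforce
    qed
    then show "ennreal \<bar>u (\<Gamma> l) - u (\<Gamma> 0)\<bar> \<le> (\<integral>\<^sup>+x\<in>{0..l}. 0 \<partial>lborel)" by simp
  qed simp
  have uN: "u \<in> N12"
  proof -
    have "(\<integral>\<^sup>+ y. ennreal ((u y)\<^sup>2) \<partial>\<mu>) = (\<integral>\<^sup>+ y. indicator (mball x s) y \<partial>\<mu>)"
      by (intro nn_integral_cong) (auto simp: u_def indicator_def)
    then have "(\<integral>\<^sup>+ y. ennreal ((u y)\<^sup>2) \<partial>\<mu>) < \<infinity>" using ball_finite[of x s] by simp
    moreover have "u \<in> borel_measurable \<mu>" unfolding u_def by measurable
    ultimately show ?thesis unfolding N12_def using ug by (auto intro!: exI[of _ "\<lambda>_. 0"])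
  qed
  have D0: "(\<integral>\<^sup>+y. ennreal ((norm (D u y))\<^sup>2) \<partial>\<mu>) = 0"
    using D_nn_integral_le[OF uN ug] by simp
  have dp: "2 * s \<le> d x p" using gap[OF p(1)] p(2) by auto
  \<comment> \<open>Large enough to contain both \<open>mball x s\<close>, where
    \<open>u = 1\<close>, and \<open>mball p s\<close>, where \<open>u = 0\<close>. The energy is 0,
    so the size of the constant below is irrelevant.\<close>
  define R where "R = d x p + s"
  have R: "0 < R" using s dp by (simp add: R_def)
  have "(\<integral>\<^sup>+y\<in>mball x R. ennreal ((u y)\<^sup>2) \<partial>\<mu>)
    \<le> ennreal ((2 + 2 * (measure \<mu> (mball x R) / measure \<mu> (mball p s))) * CP2 * R\<^sup>2)
        * (\<integral>\<^sup>+y\<in>mball x (3 * A * R). ennreal ((norm (D u y))\<^sup>2) \<partial>\<mu>)"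
  proof (rule poincare_vanishing[OF uN x R p(1) s])
    show "mball p s \<subseteq> mball x R" using x p by (intro ball_subset) (auto simp: R_def commute)
    have "u y = 0" if "y \<in> mball p s" for y
      using that dp triangle[of x y p] x p by (auto simp: u_def indicator_def commute)
    then show "AE y in \<mu>. y \<in> mball p s \<longrightarrow> u y = 0" by simp
    show "measure \<mu> (mball x R) \<le> measure \<mu> (mball x R) / measure \<mu> (mball p s) * measure \<mu> (mball p s)"
      using ball_measure_pos[OF p(1) s] by simp
  qed simp
  also have "(\<integral>\<^sup>+y\<in>mball x (3 * A * R). ennreal ((norm (D u y))\<^sup>2) \<partial>\<mu>) \<le> (\<integral>\<^sup>+y. ennreal ((norm (D u y))\<^sup>2) \<partial>\<mu>)"
    by (intro nn_integral_mono) (auto simp: indicator_def)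
  finally have "(\<integral>\<^sup>+y\<in>mball x R. ennreal ((u y)\<^sup>2) \<partial>\<mu>) \<le> 0"
    using D0 by (auto simp: mult_left_mono)
  moreover have "emeasure \<mu> (mball x s) \<le> (\<integral>\<^sup>+y\<in>mball x R. ennreal ((u y)\<^sup>2) \<partial>\<mu>)"
  proof -
    have "emeasure \<mu> (mball x s) = (\<integral>\<^sup>+y. indicator (mball x s) y \<partial>\<mu>)" by simp
    also have "\<dots> \<le> (\<integral>\<^sup>+y\<in>mball x R. ennreal ((u y)\<^sup>2) \<partial>\<mu>)"
      using dp s by (intro nn_integral_mono) (auto simp: u_def indicator_def R_def)
    finally show ?thesis .
  qed
  ultimately show False using ball_pos[OF x s] by (metis leD order_trans)
qed

text \<open>The constant of \<open>poincare_vanishing\<close> at radius \<open>8 * r\<close>: 64 is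
  the squared radius ratio, and \<open>Cm ^ 4\<close> compares \<open>mball x (8 * r)\<close> with
  \<open>mball q r\<close> through \<open>mball q (16 * r)\<close>.\<close>

definition CF :: real where "CF = (2 + 2 * Cm ^ 4) * CP2 * 64"

lemma CF_nonneg: "0 \<le> CF"
  using CP2_nonneg Cm_ge_1 by (simp add: CF_def)

text \<open>The point \<open>p\<close> may be far away, but connectedness supplies a point
  \<open>q\<close> at distance comparable to \<open>r\<close>. The ball \<open>mball q r\<close>
  misses the support of \<open>u\<close> and has measure comparable to that of
  \<open>mball x (8 * r)\<close>.\<close>

lemma friedrichs:
  assumes u: "u \<in> N12" and x: "x \<in> M" and r: "0 < r" and p: "p \<in> M" "2 * r \<le> d x p"
    and v: "AE y in \<mu>. y \<notin> mball x r \<longrightarrow> u y = 0"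
  shows "ip u u \<le> CF * r\<^sup>2 * energy u u"
proof -
  obtain q where q: "q \<in> M" "2 * r \<le> d x q" "d x q < 4 * r"
    using annulus_nonempty[OF x, of "2 * r" p] p r by auto
  have uL2: "u \<in> L2" using u N12_sub_L2 by blast
  have "(\<integral>\<^sup>+y\<in>mball x (8 * r). ennreal ((u y)\<^sup>2) \<partial>\<mu>)
      \<le> ennreal ((2 + 2 * Cm ^ 4) * CP2 * (8 * r)\<^sup>2) * (\<integral>\<^sup>+y\<in>mball x (3 * A * (8 * r)). ennreal ((norm (D u y))\<^sup>2) \<partial>\<mu>)"
  proof (rule poincare_vanishing[OF u x _ q(1) r])
    show "mball q r \<subseteq> mball x (8 * r)" using x q r by (intro ball_subset) (auto simp: commute)
    show "AE y in \<mu>. y \<in> mball q r \<longrightarrow> u y = 0"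
      using v
    proof eventually_elim
      case (elim y)
      show ?case
      proof
        assume "y \<in> mball q r"
        then have "y \<notin> mball x r" using triangle[of x y q] q x by (auto simp: commute)
        then show "u y = 0" using elim by simp
      qed
    qed
    have "measure \<mu> (mball x (8 * r)) \<le> measure \<mu> (mball q (4 * (4 * r)))"
      using x q r by (intro ball_measure_mono ball_subset) auto
    also have "\<dots> \<le> Cm\<^sup>2 * measure \<mu> (mball q (4 * r))" using r by (intro ball_measure_double2 q) auto
    also have "\<dots> \<le> Cm\<^sup>2 * (Cm\<^sup>2 * measure \<mu> (mball q r))" by (intro mult_left_mono ball_measure_double2 q r) auto
    finally show "measure \<mu> (mball x (8 * r)) \<le> Cm ^ 4 * measure \<mu> (mball q r)"
      by (simp add: power2_eq_square power4_eq_xxxx mult.assoc)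
  qed (use r Cm_ge_1 in auto)
  also have "\<dots> \<le> ennreal ((2 + 2 * Cm ^ 4) * CP2 * (8 * r)\<^sup>2) * (\<integral>\<^sup>+y. ennreal ((norm (D u y))\<^sup>2) \<partial>\<mu>)"
    by (intro mult_left_mono nn_integral_mono) (auto simp: indicator_def)
  also have "(2 + 2 * Cm ^ 4) * CP2 * (8 * r)\<^sup>2 = CF * r\<^sup>2" by (simp add: CF_def power_mult_distrib)
  also have "(\<integral>\<^sup>+y. ennreal ((norm (D u y))\<^sup>2) \<partial>\<mu>) = ennreal (energy u u)" by (rule energy_nn_integral[OF u])
  also have "(\<integral>\<^sup>+y\<in>mball x (8 * r). ennreal ((u y)\<^sup>2) \<partial>\<mu>) = (\<integral>\<^sup>+y. ennreal ((u y)\<^sup>2) \<partial>\<mu>)"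
    by (rule nn_integral_cong_AE) (use v r in \<open>auto elim!: eventually_mono simp: indicator_def\<close>)
  also have "\<dots> = ennreal (ip u u)" by (rule ip_nn_integral[OF uL2])
  also have "ennreal (CF * r\<^sup>2) * ennreal (energy u u) = ennreal (CF * r\<^sup>2 * energy u u)"
    using CF_nonneg semi_inner_nonneg[OF semi_inner_energy u] by (intro ennreal_mult[symmetric]) auto
  finally show ?thesis
    using CF_nonneg semi_inner_nonneg[OF semi_inner_energy u] by (subst (asm) ennreal_le_iff) auto
qed

end

section \<open>Capacity, harmonicity and the resolvent\<close>

context Metric_space
begin

lemma upper_gradient_abs:
  assumes "upper_gradient u g"
  shows "upper_gradient (\<lambda>x. \<bar>u x\<bar>) g"
proof (rule upper_gradientI)
  fix l \<Gamma> assume arc: "arc_length_curve l \<Gamma>"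
  have "ennreal \<bar>\<bar>u (\<Gamma> l)\<bar> - \<bar>u (\<Gamma> 0)\<bar>\<bar> \<le> ennreal \<bar>u (\<Gamma> l) - u (\<Gamma> 0)\<bar>" by (rule ennreal_leI) linarith
  also have "\<dots> \<le> (\<integral>\<^sup>+x\<in>{0..l}. g (\<Gamma> x) \<partial>lborel)"
    using upper_gradientD[OF assms arc, of 0 l] arc_length_curveD(1)[OF arc] by simp
  finally show "ennreal \<bar>\<bar>u (\<Gamma> l)\<bar> - \<bar>u (\<Gamma> 0)\<bar>\<bar> \<le> (\<integral>\<^sup>+x\<in>{0..l}. g (\<Gamma> x) \<partial>lborel)" .
qed (rule upper_gradient_measurable[OF assms])

end

context metric_measure_space
begin

lemma N12_abs: "u \<in> N12 \<Longrightarrow> (\<lambda>x. \<bar>u x\<bar>) \<in> N12"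
  unfolding N12_def using upper_gradient_abs by auto

section \<open>Capacity and zero boundary values\<close>

lemma capacity2_mono: "E \<subseteq> E' \<Longrightarrow> capacity2 E \<le> capacity2 E'"
  unfolding capacity2_def by (intro INF_superset_mono) auto

text \<open>If \<open>u\<close> and \<open>v\<close> are admissible for the capacities of two sets,
  then \<open>\<bar>u\<bar> + \<bar>v\<bar>\<close> is admissible for their union. The factors 2 are
  harmless since only sets of capacity zero are united.\<close>

lemma N12_norm_sq_abs_add_le:
  assumes u: "u \<in> N12" and v: "v \<in> N12"
  shows "N12_norm_sq (\<lambda>x. \<bar>u x\<bar> + \<bar>v x\<bar>) \<le> 2 * N12_norm_sq u + 2 * N12_norm_sq v"
proof -
  note m = N12D(1)[OF u] N12D(1)[OF v]
  let ?G = "\<lambda>u. INF g \<in> {g. upper_gradient u g}. \<integral>\<^sup>+ x. (g x)\<^sup>2 \<partial>\<mu>"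
  have "(\<integral>\<^sup>+ x. ennreal ((\<bar>u x\<bar> + \<bar>v x\<bar>)\<^sup>2) \<partial>\<mu>) \<le> (\<integral>\<^sup>+ x. 2 * ennreal ((u x)\<^sup>2) + 2 * ennreal ((v x)\<^sup>2) \<partial>\<mu>)"
  proof (rule nn_integral_mono)
    fix x
    have "ennreal ((\<bar>u x\<bar> + \<bar>v x\<bar>)\<^sup>2) = (ennreal \<bar>u x\<bar> + ennreal \<bar>v x\<bar>)\<^sup>2"
      by (simp add: ennreal_power flip: ennreal_plus)
    also have "\<dots> \<le> 2 * (ennreal \<bar>u x\<bar>)\<^sup>2 + 2 * (ennreal \<bar>v x\<bar>)\<^sup>2" by (rule ennreal_power2_add_le)
    finally show "ennreal ((\<bar>u x\<bar> + \<bar>v x\<bar>)\<^sup>2) \<le> 2 * ennreal ((u x)\<^sup>2) + 2 * ennreal ((v x)\<^sup>2)"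
      by (simp add: ennreal_power)
  qed
  also have "\<dots> = 2 * (\<integral>\<^sup>+ x. ennreal ((u x)\<^sup>2) \<partial>\<mu>) + 2 * (\<integral>\<^sup>+ x. ennreal ((v x)\<^sup>2) \<partial>\<mu>)"
    using m by (simp add: nn_integral_add nn_integral_cmult)
  finally have 1: "(\<integral>\<^sup>+ x. ennreal ((\<bar>u x\<bar> + \<bar>v x\<bar>)\<^sup>2) \<partial>\<mu>) \<le> \<dots>" .
  have gen: "?G (\<lambda>x. \<bar>u x\<bar> + \<bar>v x\<bar>) \<le> 2 * (\<integral>\<^sup>+ x. (g x)\<^sup>2 \<partial>\<mu>) + 2 * (\<integral>\<^sup>+ x. (h x)\<^sup>2 \<partial>\<mu>)"
    if g: "upper_gradient u g" and h: "upper_gradient v h" for g h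
  proof -
    note mg = borel_sigma_imp_measurable[OF upper_gradient_measurable[OF g]]
      borel_sigma_imp_measurable[OF upper_gradient_measurable[OF h]]
    have "upper_gradient (\<lambda>x. \<bar>u x\<bar> + \<bar>v x\<bar>) (\<lambda>x. g x + h x)"
      using upper_gradient_lincomb[OF upper_gradient_abs[OF g] upper_gradient_abs[OF h], of 1 1] by simp
    then have "?G (\<lambda>x. \<bar>u x\<bar> + \<bar>v x\<bar>) \<le> (\<integral>\<^sup>+ x. (g x + h x)\<^sup>2 \<partial>\<mu>)" by (intro INF_lower) auto
    also have "\<dots> \<le> (\<integral>\<^sup>+ x. 2 * (g x)\<^sup>2 + 2 * (h x)\<^sup>2 \<partial>\<mu>)" by (intro nn_integral_mono ennreal_power2_add_le)
    also have "\<dots> = 2 * (\<integral>\<^sup>+ x. (g x)\<^sup>2 \<partial>\<mu>) + 2 * (\<integral>\<^sup>+ x. (h x)\<^sup>2 \<partial>\<mu>)"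
      using mg by (simp add: nn_integral_add nn_integral_cmult)
    finally show ?thesis .
  qed
  have fin: "?G u < \<infinity>" "?G v < \<infinity>"
    using N12D(3)[OF u] N12D(3)[OF v] by (auto simp: INF_less_iff)
  have 2: "?G (\<lambda>x. \<bar>u x\<bar> + \<bar>v x\<bar>) \<le> 2 * ?G u + 2 * ?G v"
  proof (rule ennreal_le_epsilon)
    fix e :: real assume e: "0 < e"
    have lt: "t < t + ennreal (e / 4)" if "t < \<infinity>" for t
      using that e by (cases t) (auto simp: ennreal_less_iff simp flip: ennreal_plus)
    obtain g where g: "upper_gradient u g" "(\<integral>\<^sup>+ x. (g x)\<^sup>2 \<partial>\<mu>) < ?G u + ennreal (e / 4)"
      using lt[OF fin(1)] unfolding INF_less_iff by auto
    obtain h where h: "upper_gradient v h" "(\<integral>\<^sup>+ x. (h x)\<^sup>2 \<partial>\<mu>) < ?G v + ennreal (e / 4)"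
      using lt[OF fin(2)] unfolding INF_less_iff by auto
    have "?G (\<lambda>x. \<bar>u x\<bar> + \<bar>v x\<bar>) \<le> 2 * (?G u + ennreal (e / 4)) + 2 * (?G v + ennreal (e / 4))"
      using gen[OF g(1) h(1)] g(2) h(2) by (meson add_mono less_imp_le mult_left_mono order_trans zero_le)
    also have "\<dots> = 2 * ?G u + 2 * ?G v + (2 * ennreal (e / 4) + 2 * ennreal (e / 4))"
      by (simp only: distrib_left ac_simps)
    also have "2 * ennreal (e / 4) + 2 * ennreal (e / 4) = ennreal e"
    proof -
      have "2 * ennreal (e / 4) = ennreal (2 * (e / 4))" by (subst ennreal_mult) (use e in auto)
      then show ?thesis using e by (simp flip: ennreal_plus)
    qed
    finally show "?G (\<lambda>x. \<bar>u x\<bar> + \<bar>v x\<bar>) \<le> 2 * ?G u + 2 * ?G v + ennreal e" .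
  qed
  show ?thesis
    unfolding N12_norm_sq_def using add_mono[OF 1 2] by (simp add: distrib_left ac_simps)
qed

text \<open>This makes \<open>N12_zero\<close> a linear space, as \<open>Riesz_N12\<close>
  requires.\<close>

lemma capacity2_zero_Un:
  assumes "capacity2 E = 0" "capacity2 E' = 0"
  shows "capacity2 (E \<union> E') = 0"
proof -
  have "capacity2 (E \<union> E') \<le> 0"
  proof (rule ennreal_le_epsilon)
    fix e :: real assume e: "0 < e"
    then have "capacity2 E < ennreal (e / 4)" "capacity2 E' < ennreal (e / 4)" using assms by auto
    then obtain u v where u: "u \<in> N12" "\<And>x. x \<in> E \<Longrightarrow> 1 \<le> u x" "N12_norm_sq u < ennreal (e / 4)"
      and v: "v \<in> N12" "\<And>x. x \<in> E' \<Longrightarrow> 1 \<le> v x" "N12_norm_sq v < ennreal (e / 4)"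
      unfolding capacity2_def INF_less_iff by auto
    have "1 \<le> \<bar>u x\<bar> + \<bar>v x\<bar>" if "x \<in> E \<union> E'" for x
      using that u(2)[of x] v(2)[of x] by (auto simp: abs_if)
    then have "capacity2 (E \<union> E') \<le> N12_norm_sq (\<lambda>x. \<bar>u x\<bar> + \<bar>v x\<bar>)"
      unfolding capacity2_def using N12_add[OF N12_abs[OF u(1)] N12_abs[OF v(1)]] by (intro INF_lower) auto
    also have "\<dots> \<le> 2 * N12_norm_sq u + 2 * N12_norm_sq v" by (rule N12_norm_sq_abs_add_le[OF u(1) v(1)])
    also have "\<dots> \<le> 2 * ennreal (e / 4) + 2 * ennreal (e / 4)"
      using u(3) v(3) by (intro add_mono mult_left_mono) auto
    also have "2 * ennreal (e / 4) + 2 * ennreal (e / 4) = ennreal e"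
    proof -
      have "2 * ennreal (e / 4) = ennreal (2 * (e / 4))" by (subst ennreal_mult) (use e in auto)
      then show ?thesis using e by (simp flip: ennreal_plus)
    qed
    finally show "capacity2 (E \<union> E') \<le> 0 + ennreal e" by simp
  qed
  then show ?thesis by simp
qed

lemma zero_N12: "(\<lambda>_. 0) \<in> N12"
proof -
  have "upper_gradient (\<lambda>_. 0) (\<lambda>_. 0)" by (rule upper_gradientI) auto
  then show ?thesis unfolding N12_def by (auto intro!: exI[of _ "\<lambda>_. 0"])
qed

lemma N12_zero_sub: "N12_zero U \<subseteq> N12"
  by (auto simp: N12_zero_def)

lemma zero_N12_zero: "(\<lambda>_. 0) \<in> N12_zero U"
proof -
  have "upper_gradient (\<lambda>_. 0) (\<lambda>_. 0)" by (rule upper_gradientI) auto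
  then have "(INF g \<in> {g. upper_gradient (\<lambda>_. 0) g}. \<integral>\<^sup>+ x. (g x)\<^sup>2 \<partial>\<mu>) \<le> (\<integral>\<^sup>+ x. 0\<^sup>2 \<partial>\<mu>)"
    by (intro INF_lower) auto
  then have "N12_norm_sq (\<lambda>_. 0) = 0" by (simp add: N12_norm_sq_def)
  moreover have "capacity2 {} \<le> N12_norm_sq (\<lambda>_. 0)"
    unfolding capacity2_def using zero_N12 by (intro INF_lower) auto
  ultimately show ?thesis using zero_N12 by (simp add: N12_zero_def)
qed

lemma N12_zero_lincomb:
  assumes "u \<in> N12_zero U" "v \<in> N12_zero U"
  shows "(\<lambda>x. a * u x + b * v x) \<in> N12_zero U"
proof -
  have "capacity2 {x \<in> M - U. a * u x + b * v x \<noteq> 0} \<le> capacity2 ({x \<in> M - U. u x \<noteq> 0} \<union> {x \<in> M - U. v x \<noteq> 0})"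
    by (rule capacity2_mono) auto
  also have "\<dots> = 0" using assms by (intro capacity2_zero_Un) (auto simp: N12_zero_def)
  finally show ?thesis using assms N12_lincomb by (simp add: N12_zero_def)
qed

text \<open>Capacity dominates measure, because an admissible function has square at least 1 on the
  set. The boundary condition up to capacity zero thus becomes one that integrals can use.\<close>

lemma N12_zero_AE:
  assumes u: "u \<in> N12_zero U" and U: "openin mtopology U"
  shows "AE x in \<mu>. x \<notin> U \<longrightarrow> u x = 0"
proof -
  have uN: "u \<in> N12" using u N12_zero_sub by blast
  let ?E = "{x \<in> M - U. u x \<noteq> 0}"
  have "{x \<in> space \<mu>. u x \<noteq> 0} \<in> sets \<mu>" using N12D(1)[OF uN] by measurable
  then have "{x \<in> space \<mu>. u x \<noteq> 0} - U \<in> sets \<mu>" using openin_subset_sets[OF U] by blast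
  moreover have "{x \<in> space \<mu>. u x \<noteq> 0} - U = ?E" by (auto simp: space_eq)
  ultimately have E: "?E \<in> sets \<mu>" by simp
  have "emeasure \<mu> ?E \<le> capacity2 ?E"
    unfolding capacity2_def
  proof (rule INF_greatest)
    fix w assume w: "w \<in> {w \<in> N12. \<forall>x\<in>?E. 1 \<le> w x}"
    have "emeasure \<mu> ?E = (\<integral>\<^sup>+x. indicator ?E x \<partial>\<mu>)" using E by simp
    also have "\<dots> \<le> (\<integral>\<^sup>+x. ennreal ((w x)\<^sup>2) \<partial>\<mu>)"
    proof (rule nn_integral_mono)
      fix x
      show "indicator ?E x \<le> ennreal ((w x)\<^sup>2)"
      proof (cases "x \<in> ?E")
        case True
        then have "1 \<le> w x" using w by blast
        then have "1 \<le> (w x)\<^sup>2" by (simp add: one_le_power)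
        then have "ennreal 1 \<le> ennreal ((w x)\<^sup>2)" by (rule ennreal_leI)
        then show ?thesis using True by simp
      qed simp
    qed
    also have "\<dots> \<le> N12_norm_sq w" by (simp add: N12_norm_sq_def)
    finally show "emeasure \<mu> ?E \<le> N12_norm_sq w" .
  qed
  then have "?E \<in> null_sets \<mu>" using u E by (auto simp: N12_zero_def)
  from AE_not_in[OF this] show ?thesis using AE_space by eventually_elim (auto simp: space_eq)
qed

end

section \<open>Harmonic functions and the resolvent\<close>

context cheeger_space
begin

lemma derivative_on_self: "u \<in> N12 \<Longrightarrow> openin mtopology U \<Longrightarrow> derivative_on D U u (D u)"
  unfolding derivative_on_def by blast

text \<open>The neighbourhoods in \<open>derivative_on\<close> vary with the point. Balls with
  centres in a countable dense set and rational radii on which the equality holds still cover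
  \<open>U\<close>, so only countably many null sets are discarded.\<close>

lemma derivative_on_unique:
  assumes u: "u \<in> N12" and v: "derivative_on D U u v"
  shows "AE x in \<mu>. x \<in> U \<longrightarrow> v x = D u x"
proof -
  obtain Q where Q: "countable Q" "Q \<subseteq> M" "mtopology closure_of Q = M"
    using separable unfolding separable_space_def by auto
  let ?P = "{qr \<in> Q \<times> \<rat>. AE x in \<mu>. x \<in> mball (fst qr) (snd qr) \<longrightarrow> v x = D u x}"
  have cover: "\<exists>qr\<in>?P. x \<in> mball (fst qr) (snd qr)" if "x \<in> U" for x
  proof -
    from bspec[OF v[unfolded derivative_on_def] that]
    obtain V where V: "openin mtopology V" "x \<in> V" "V \<subseteq> U"
      and ex: "\<exists>w\<in>N12. (\<forall>y\<in>V. w y = u y) \<and> (AE y in \<mu>. y \<in> V \<longrightarrow> v y = D w y)"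
      by (elim exE conjE) (rule that)
    from ex obtain w where w: "w \<in> N12" "\<forall>y\<in>V. w y = u y" "AE y in \<mu>. y \<in> V \<longrightarrow> v y = D w y"
      by (elim bexE conjE) (rule that)
    obtain r where r: "r > 0" "mball x r \<subseteq> V" using V by (auto simp: openin_mtopology)
    have x: "x \<in> M" using V openin_subset[of mtopology V] by auto
    then have "x \<in> mtopology closure_of Q" using Q by simp
    then obtain q where q: "q \<in> Q" "q \<in> mball x (r / 3)"
      unfolding metric_closure_of using divide_pos_pos[OF r(1) zero_less_numeral] by blast
    \<comment> \<open>\<open>s > r / 3\<close> puts \<open>x\<close> into \<open>mball q s\<close>,
      and \<open>s < r / 2\<close> keeps \<open>mball q s\<close> inside
      \<open>mball x r\<close>.\<close>
    obtain s where s: "s \<in> \<rat>" "r / 3 < s" "s < r / 2" using Rats_dense_in_real[of "r / 3" "r / 2"] r by auto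
    have "mball q s \<subseteq> mball x r"
    proof
      fix y assume "y \<in> mball q s"
      then show "y \<in> mball x r" using q s r triangle[of x q y] x by auto
    qed
    then have sub: "mball q s \<subseteq> V" using r by blast
    have "AE y in \<mu>. y \<in> mball q s \<longrightarrow> v y = D u y"
      using w(3) D_eq_on[OF w(1) u] by eventually_elim (use w(2) sub in auto)
    then have "(q, s) \<in> ?P" using q s by simp
    moreover have "x \<in> mball q s" using q s x by (auto simp: commute)
    ultimately show ?thesis by force
  qed
  have "countable ?P" using Q(1) countable_rat by (intro countable_subset[of ?P "Q \<times> \<rat>"]) auto
  then have "AE x in \<mu>. \<forall>qr\<in>?P. x \<in> mball (fst qr) (snd qr) \<longrightarrow> v x = D u x"
    by (subst AE_ball_countable) auto
  then show ?thesis by eventually_elim (use cover in blast)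
qed

text \<open>From the Euler-Lagrange equation to minimality by convexity: the square of
  \<open>D \<phi>\<close> is dropped and the cross term integrates to 0. All comparison functions
  used later lie in \<open>N12\<close> globally, so their derivative on \<open>U\<close> is simply
  \<open>D h\<close>.\<close>

lemma cheeger_harmonic_onI:
  assumes h: "h \<in> N12" and U: "openin mtopology U"
    and EL: "\<And>\<phi>. \<phi> \<in> N12_zero U \<Longrightarrow> energy h \<phi> = 0"
  shows "cheeger_harmonic_on D U h"
proof -
  have Us: "U \<in> sets \<mu>" by (rule openin_subset_sets[OF U])
  have nn: "(\<integral>\<^sup>+ x \<in> U. ennreal ((norm (D w x))\<^sup>2) \<partial>\<mu>) = ennreal (\<integral>x. indicator U x * (norm (D w x))\<^sup>2 \<partial>\<mu>)"
    "integrable \<mu> (\<lambda>x. indicator U x * (norm (D w x))\<^sup>2)" if w: "w \<in> N12" for w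
  proof -
    show i: "integrable \<mu> (\<lambda>x. indicator U x * (norm (D w x))\<^sup>2)"
      using integrable_mult_indicator[OF Us D_L2[OF w]] by simp
    have "(\<integral>\<^sup>+ x \<in> U. ennreal ((norm (D w x))\<^sup>2) \<partial>\<mu>) = (\<integral>\<^sup>+ x. ennreal (indicator U x * (norm (D w x))\<^sup>2) \<partial>\<mu>)"
      by (intro nn_integral_cong) (auto simp: indicator_def)
    then show "(\<integral>\<^sup>+ x \<in> U. ennreal ((norm (D w x))\<^sup>2) \<partial>\<mu>) = ennreal (\<integral>x. indicator U x * (norm (D w x))\<^sup>2 \<partial>\<mu>)"
      using i by (simp add: nn_integral_eq_integral)
  qed
  have "(\<integral>\<^sup>+ x \<in> U. ennreal ((norm (D h x))\<^sup>2) \<partial>\<mu>) \<le> (\<integral>\<^sup>+ x \<in> U. ennreal ((norm (v' x))\<^sup>2) \<partial>\<mu>)"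
    if \<phi>: "\<phi> \<in> N12_zero U" and v': "derivative_on D U (\<lambda>x. h x + \<phi> x) v'" for \<phi> v'
  proof -
    have \<phi>N: "\<phi> \<in> N12" using \<phi> N12_zero_sub by blast
    have s: "(\<lambda>x. h x + \<phi> x) \<in> N12" by (rule N12_add[OF h \<phi>N])
    have D\<phi>: "AE x in \<mu>. x \<notin> U \<longrightarrow> D \<phi> x = 0"
      using N12_zero_AE[OF \<phi> U] D_zero_on_level[OF \<phi>N, of 0] by eventually_elim auto
    have i: "integrable \<mu> (\<lambda>x. D h x \<bullet> D \<phi> x)" by (rule energy_integrable[OF h \<phi>N])
    \<comment> \<open>The cross term stands without an indicator, since \<open>energy\<close>
      integrates over the whole space; this is consistent because \<open>D \<phi>\<close> vanishes
      almost everywhere outside \<open>U\<close>.\<close>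
    have "(\<integral>x. indicator U x * (norm (D h x))\<^sup>2 \<partial>\<mu>)
        = (\<integral>x. indicator U x * (norm (D h x))\<^sup>2 + 2 * (D h x \<bullet> D \<phi> x) \<partial>\<mu>)"
      using EL[OF \<phi>] i nn(2)[OF h] by (simp add: energy_def)
    also have "\<dots> \<le> (\<integral>x. indicator U x * (norm (D (\<lambda>x. h x + \<phi> x) x))\<^sup>2 \<partial>\<mu>)"
    proof (rule integral_mono_AE)
      show "AE x in \<mu>. indicator U x * (norm (D h x))\<^sup>2 + 2 * (D h x \<bullet> D \<phi> x)
          \<le> indicator U x * (norm (D (\<lambda>x. h x + \<phi> x) x))\<^sup>2"
        using D\<phi> D_add[OF h \<phi>N]
      proof eventually_elim
        case (elim x)
        have "(norm (D h x + D \<phi> x))\<^sup>2 = (norm (D h x))\<^sup>2 + 2 * (D h x \<bullet> D \<phi> x) + (norm (D \<phi> x))\<^sup>2"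
          by (simp add: power2_norm_eq_inner inner_add_left inner_add_right inner_commute)
        then show ?case using elim by (cases "x \<in> U") auto
      qed
    qed (use i nn(2)[OF h] nn(2)[OF s] in auto)
    finally have "(\<integral>\<^sup>+ x \<in> U. ennreal ((norm (D h x))\<^sup>2) \<partial>\<mu>) \<le> (\<integral>\<^sup>+ x \<in> U. ennreal ((norm (D (\<lambda>x. h x + \<phi> x) x))\<^sup>2) \<partial>\<mu>)"
      unfolding nn(1)[OF h] nn(1)[OF s] by (rule ennreal_leI)
    also have "\<dots> = (\<integral>\<^sup>+ x \<in> U. ennreal ((norm (v' x))\<^sup>2) \<partial>\<mu>)"
      by (rule nn_integral_cong_AE) (use derivative_on_unique[OF s v'] in \<open>auto elim!: eventually_mono simp: indicator_def\<close>)
    finally show ?thesis .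
  qed
  then show ?thesis
    unfolding cheeger_harmonic_on_def
    using U N12_imp_N12_loc[OF h U] derivative_on_self[OF h U] nn(1)[OF h]
    by (intro conjI exI[of _ "D h"]) auto
qed

text \<open>The weak form of \<open>lam * (F - u) = \<Delta>u\<close>, where \<open>\<Delta>\<close> is the nonnegative operator of the energy form.\<close>

definition resolvent_eq :: "real \<Rightarrow> ('a \<Rightarrow> real) \<Rightarrow> ('a \<Rightarrow> real) \<Rightarrow> bool" where
  "resolvent_eq lam F u \<longleftrightarrow> u \<in> N12 \<and> (\<forall>\<phi>\<in>N12. lam * ip u \<phi> + energy u \<phi> = lam * ip F \<phi>)"

lemma ip_scale_left: "ip (\<lambda>x. a * u x) v = a * ip u v"
  by (simp add: ip_def mult.assoc)

text \<open>With \<open>V\<close> the whole of \<open>N12\<close>, the zeroth order term alone is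
  coercive, with constant \<open>1 / lam\<close>.\<close>

lemma resolvent_exists:
  assumes F: "F \<in> L2" and l: "0 < lam"
  shows "\<exists>u. resolvent_eq lam F u"
proof -
  have FL: "(\<lambda>x. lam * F x) \<in> L2" using L2_lincomb[OF F F, of lam 0] by simp
  obtain u where "u \<in> N12" "\<And>\<phi>. \<phi> \<in> N12 \<Longrightarrow> lam * ip u \<phi> + energy u \<phi> = ip (\<lambda>x. lam * F x) \<phi>"
  proof (rule Riesz_N12[of N12 lam "1 / lam" "\<lambda>x. lam * F x"])
    show "N12 \<noteq> {}" using zero_N12 by blast
    show "ip u u \<le> 1 / lam * (lam * ip u u + energy u u)" if "u \<in> N12" for u
      using semi_inner_nonneg[OF semi_inner_energy that] l by (simp add: distrib_left)
  qed (use l FL N12_lincomb in auto)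
  then show ?thesis unfolding resolvent_eq_def ip_scale_left by blast
qed

text \<open>The penalised Dirichlet energy, that is, the quadratic regularisation functional for
  approximating \<open>F\<close>.\<close>

definition Wfun :: "real \<Rightarrow> ('a \<Rightarrow> real) \<Rightarrow> ('a \<Rightarrow> real) \<Rightarrow> real" where
  "Wfun lam F u = lam * ip (\<lambda>x. F x - u x) (\<lambda>x. F x - u x) + energy u u"

text \<open>By the equation, \<open>Wfun\<close> differs by a constant from
  \<open>?B w w - 2 * ?B u w\<close>. Its excess at \<open>v\<close> over its value at
  \<open>u\<close> is therefore the square of \<open>u - v\<close> in the form
  \<open>?B\<close>.\<close>

lemma resolvent_minimal:
  assumes F: "F \<in> L2" and l: "0 < lam" and u: "resolvent_eq lam F u" and v: "v \<in> N12"
  shows "Wfun lam F u \<le> Wfun lam F v"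
proof -
  have uN: "u \<in> N12" using u by (simp add: resolvent_eq_def)
  have L: "u \<in> L2" "v \<in> L2" using uN v N12_sub_L2 by auto
  have siN: "semi_inner N12 ip"
    by (rule semi_inner_subset[OF semi_inner_ip N12_sub_L2]) (rule N12_lincomb)
  let ?B = "\<lambda>u v. lam * ip u v + energy u v"
  have siB: "semi_inner N12 ?B"
    using l by (intro semi_inner_combine[OF siN semi_inner_energy]) simp
  have W: "Wfun lam F w = lam * ip F F - 2 * ?B u w + ?B w w" if w: "w \<in> N12" for w
  proof -
    have "w \<in> L2" using w N12_sub_L2 by blast
    have "?B u w = lam * ip F w" using u w by (simp add: resolvent_eq_def)
    then show ?thesis
      unfolding Wfun_def semi_inner_diff_square[OF semi_inner_ip F \<open>w \<in> L2\<close>] by (simp add: algebra_simps)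
  qed
  have "0 \<le> ?B u u - 2 * ?B u v + ?B v v"
    using semi_inner_nonneg[OF siB N12_diff[OF uN v]] semi_inner_diff_square[OF siB uN v] by simp
  then show ?thesis unfolding W[OF uN] W[OF v] by (simp add: algebra_simps)
qed

text \<open>The function \<open>\<lambda> \<mapsto> min (\<lambda> \<parallel>F - u\<parallel>\<^sup>2 + E(u))\<close> is increasing, bounded by \<open>E(F)\<close>, and its increments control
  the square function.\<close>

lemma resolvent_square_function:
  fixes u :: "nat \<Rightarrow> 'a \<Rightarrow> real"
  assumes F: "F \<in> N12" and R: "0 < R" and u: "\<And>k. resolvent_eq (4 ^ k / R\<^sup>2) F (u k)"
  shows "(\<Sum>k<n. 4 ^ Suc k / R\<^sup>2 * ip (\<lambda>x. F x - u (Suc k) x) (\<lambda>x. F x - u (Suc k) x)) \<le> 2 * energy F F"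
proof -
  have FL: "F \<in> L2" using F N12_sub_L2 by blast
  define l where "l k = 4 ^ k / R\<^sup>2" for k :: nat
  have l: "0 < l k" for k using R by (simp add: l_def)
  define a where "a k = ip (\<lambda>x. F x - u k x) (\<lambda>x. F x - u k x)" for k
  have uN: "u k \<in> N12" for k using u[of k] by (simp add: resolvent_eq_def)
  have min: "Wfun (l k) F (u k) \<le> Wfun (l k) F v" if "v \<in> N12" for k v
    using resolvent_minimal[OF FL l u[folded l_def] that] .
  have a0: "0 \<le> a k" for k
    unfolding a_def using N12_diff[OF F uN] N12_sub_L2 by (intro semi_inner_nonneg[OF semi_inner_ip]) blast
  have "(\<Sum>k<n. (3/4) * (l (Suc k) * a (Suc k))) \<le> Wfun (l n) F (u n)"
  proof (induction n)
    case 0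
    show ?case using a0[of 0] l[of 0] semi_inner_nonneg[OF semi_inner_energy uN[of 0]] by (simp add: Wfun_def a_def)
  next
    case (Suc n)
    have "Wfun (l n) F (u n) \<le> Wfun (l n) F (u (Suc n))" by (rule min[OF uN])
    \<comment> \<open>Going from \<open>l n\<close> to \<open>l (Suc n) = 4 * l n\<close> with the
      same function adds \<open>3/4\<close> of \<open>l (Suc n) * a (Suc n)\<close>.\<close>
    also have "\<dots> = Wfun (l (Suc n)) F (u (Suc n)) - (3/4) * (l (Suc n) * a (Suc n))"
      by (simp add: Wfun_def a_def l_def)
    finally show ?case using Suc by simp
  qed
  \<comment> \<open>\<open>F\<close> itself is a competitor, and its penalty term is 0.\<close>
  also have "\<dots> \<le> Wfun (l n) F F" by (rule min[OF F])
  also have "\<dots> = energy F F" by (simp add: Wfun_def ip_def)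
  finally have "(3/4) * (\<Sum>k<n. l (Suc k) * a (Suc k)) \<le> energy F F" by (simp add: sum_distrib_left)
  moreover have "0 \<le> energy F F" by (rule semi_inner_nonneg[OF semi_inner_energy F])
  ultimately have "(\<Sum>k<n. l (Suc k) * a (Suc k)) \<le> 2 * energy F F" by linarith
  then show ?thesis by (simp add: l_def a_def)
qed

end

section \<open>The square function estimate\<close>

lemma power2_add_le: "(a + b)\<^sup>2 \<le> 2 * a\<^sup>2 + 2 * (b::real)\<^sup>2"
  using zero_le_power2[of "a - b"] by (simp add: power2_eq_square algebra_simps)

lemma ennreal_le_suminf: "f j \<le> (\<Sum>j. f j :: ennreal)"
  using sum_le_suminf[OF summableI, of "{j}" f] by simp

lemma half_power_squared: "((1/2::real) ^ n)\<^sup>2 = (1/4) ^ n"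
  by (simp add: power2_eq_square flip: power_mult_distrib)

context Metric_space
begin

text \<open>Points more than \<open>4 * r\<close> apart cannot both be within \<open>2 * r\<close>
  of \<open>x\<close>. This is where the bound of \<open>R\<close> by the diameter enters: it
  provides the far point of the Friedrichs inequality.\<close>

lemma far_point:
  assumes R: "ereal R \<le> diam_carrier" and x: "x \<in> M" and r: "4 * r < R"
  shows "\<exists>p\<in>M. 2 * r \<le> d x p"
proof -
  have "ereal (4 * r) < diam_carrier" using R r by (meson ereal_less_eq(3) less_ereal.simps(1) order_less_le_trans)
  then obtain p q where pq: "p \<in> M" "q \<in> M" "4 * r < d p q"
    unfolding diam_carrier_def less_SUP_iff by auto
  then have "4 * r < d x p + d x q" using triangle[of p x q] x by (simp add: commute)
  then have "2 * r \<le> d x p \<or> 2 * r \<le> d x q" by linarith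
  then show ?thesis using pq by blast
qed

end

context poincare_space
begin

text \<open>Constants need not belong to \<open>N12\<close>, as the space may have infinite measure;
  a function that is constant on \<open>U\<close> takes their place. Its derivative vanishes inside
  \<open>U\<close>, that of \<open>\<phi>\<close> outside.\<close>

lemma energy_const_zero:
  assumes e: "e \<in> N12" "\<And>y. y \<in> U \<Longrightarrow> e y = c" and U: "openin mtopology U" and \<phi>: "\<phi> \<in> N12_zero U"
  shows "energy e \<phi> = 0"
proof -
  have \<phi>N: "\<phi> \<in> N12" using \<phi> N12_zero_sub by blast
  have "AE y in \<mu>. D e y \<bullet> D \<phi> y = 0"
    using N12_zero_AE[OF \<phi> U] D_zero_on_level[OF \<phi>N, of 0] D_zero_on_level[OF e(1), of c]
    by eventually_elim (use e(2) in force)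
  then show ?thesis unfolding energy_def by (rule integral_eq_zero_AE)
qed

text \<open>Subtracting from \<open>u\<close> the solution of the Dirichlet problem in the ball with right-hand side \<open>lam * (F - u)\<close>
  makes it harmonic there.\<close>

lemma harmonic_approximation:
  assumes F: "F \<in> N12" and lam: "0 < lam" and u: "resolvent_eq lam F u"
    and x: "x \<in> M" and r: "0 < r" and p: "p \<in> M" "2 * r \<le> d x p"
    and e: "e \<in> N12" "\<And>y. y \<in> mball x r \<Longrightarrow> e y = c" and f: "\<And>y. y \<in> mball x r \<Longrightarrow> f y = F y + e y"
  shows "\<exists>h\<in>N12. cheeger_harmonic_on D (mball x r) h \<and>
    (\<integral>\<^sup>+y\<in>mball x r. ennreal ((f y - h y)\<^sup>2) \<partial>\<mu>)
      \<le> ennreal (2 + 2 * (CF * r\<^sup>2 * lam)\<^sup>2) * (\<integral>\<^sup>+y\<in>mball x r. ennreal ((F y - u y)\<^sup>2) \<partial>\<mu>)"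
proof -
  let ?U = "mball x r"
  have U: "openin mtopology ?U" by simp
  have uN: "u \<in> N12" and uE: "\<And>\<phi>. \<phi> \<in> N12 \<Longrightarrow> lam * ip u \<phi> + energy u \<phi> = lam * ip F \<phi>"
    using u by (auto simp: resolvent_eq_def)
  have FL: "F \<in> L2" and uL: "u \<in> L2" using F uN N12_sub_L2 by auto
  \<comment> \<open>Restricting the datum to the ball does not change its product with functions in
    \<open>N12_zero ?U\<close>, and it makes the final bound local.\<close>
  define \<Delta> where "\<Delta> y = indicator ?U y * (F y - u y)" for y
  have \<Delta>L: "\<Delta> \<in> L2"
  proof -
    have "integrable \<mu> (\<lambda>y. indicator ?U y *\<^sub>R (F y - u y)\<^sup>2)"
      using N12_L2[OF N12_diff[OF F uN]] by (intro integrable_mult_indicator) auto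
    moreover have "(\<lambda>y. indicator ?U y *\<^sub>R (F y - u y)\<^sup>2) = (\<lambda>y. (\<Delta> y)\<^sup>2)"
      by (auto simp: \<Delta>_def indicator_def)
    moreover have "\<Delta> \<in> borel_measurable \<mu>" using N12D(1)[OF F] N12D(1)[OF uN] unfolding \<Delta>_def by measurable
    ultimately show ?thesis by (simp add: L2_def)
  qed
  define g where "g y = lam * \<Delta> y" for y
  have gL: "g \<in> L2" using L2_lincomb[OF \<Delta>L \<Delta>L, of lam 0] by (simp add: g_def[abs_def])
  have V: "N12_zero ?U \<subseteq> N12" "N12_zero ?U \<noteq> {}" using N12_zero_sub zero_N12_zero by blast+
  define K' where "K' = CF * r\<^sup>2"
  have fr: "ip w w \<le> K' * (0 * ip w w + energy w w)" if w: "w \<in> N12_zero ?U" for w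
    using friedrichs[OF _ x r p N12_zero_AE[OF w U]] w V by (auto simp: K'_def)
  have K'0: "0 \<le> K'" using CF_nonneg by (simp add: K'_def)
  have CF_pos: "0 < K'"
  proof -
    have "0 < CF"
      unfolding CF_def CP2_def using Cm_ge_1 CP_ge_1 C0_ge_1 by (simp add: zero_less_mult_iff add_pos_nonneg)
    then show ?thesis using r by (simp add: K'_def)
  qed
  \<comment> \<open>With \<open>a = 0\<close> the coercivity is the Friedrichs inequality. The limit
    \<open>\<psi>\<close> may fail to lie in \<open>N12_zero ?U\<close>, but the equation, its own
    energy identity and the coercive bound survive the limit, and nothing else about
    \<open>\<psi>\<close> is used.\<close>
  obtain \<psi> where \<psi>: "\<psi> \<in> N12" "\<And>\<phi>. \<phi> \<in> N12_zero ?U \<Longrightarrow> energy \<psi> \<phi> = ip g \<phi>"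
    "energy \<psi> \<psi> = ip g \<psi>" "ip \<psi> \<psi> \<le> K' * energy \<psi> \<psi>"
    by (rule Riesz_N12[OF V N12_zero_lincomb _ CF_pos _ gL, of 0]) (use fr in auto)
  have \<psi>L: "\<psi> \<in> L2" using \<psi>(1) N12_sub_L2 by blast
  have ip0: "0 \<le> ip \<psi> \<psi>" "0 \<le> ip \<Delta> \<Delta>" using semi_inner_nonneg[OF semi_inner_ip] \<psi>L \<Delta>L by auto
  \<comment> \<open>Coercivity, the energy identity and Cauchy-Schwarz; one factor of the norm of
    \<open>\<psi>\<close> is then divided out.\<close>
  have bound: "ip \<psi> \<psi> \<le> (CF * r\<^sup>2 * lam)\<^sup>2 * ip \<Delta> \<Delta>"
  proof -
    let ?s = "sqrt (ip \<psi> \<psi>)" and ?t = "sqrt (ip \<Delta> \<Delta>)"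
    have "ip \<psi> \<psi> \<le> K' * (lam * ip \<Delta> \<psi>)" using \<psi>(3,4) by (simp add: g_def[abs_def] ip_scale_left)
    also have "\<dots> \<le> K' * (lam * (?t * ?s))"
      using semi_inner_Cauchy_Schwarz[OF semi_inner_ip \<Delta>L \<psi>L] K'0 lam by (intro mult_left_mono) auto
    finally have le: "?s * ?s \<le> (K' * lam * ?t) * ?s" using ip0 by (simp add: ac_simps)
    have "?s \<le> K' * lam * ?t"
    proof (cases "?s = 0")
      case True
      then show ?thesis using K'0 lam ip0 by simp
    next
      case False
      then have "0 < ?s" using ip0 by (simp add: order_le_less)
      then show ?thesis using le by (simp only: mult_le_cancel_right_pos)
    qed
    then have "?s\<^sup>2 \<le> (K' * lam * ?t)\<^sup>2" using ip0 by (intro power_mono) auto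
    then show ?thesis using ip0 by (simp add: K'_def power_mult_distrib)
  qed
  let ?s = "\<lambda>y. 1 * u y + 1 * e y"
  have sN: "?s \<in> N12" by (rule N12_lincomb[OF uN e(1)])
  \<comment> \<open>\<open>e\<close> restores the constant that was subtracted from
    \<open>f\<close>, so that \<open>f - h = \<Delta> + \<psi>\<close> on the ball.\<close>
  define h where "h = (\<lambda>y. 1 * ?s y + (-1) * \<psi> y)"
  have hN: "h \<in> N12" unfolding h_def by (rule N12_lincomb[OF sN \<psi>(1)])
  have "cheeger_harmonic_on D ?U h"
  proof (rule cheeger_harmonic_onI[OF hN U])
    fix \<phi> assume \<phi>: "\<phi> \<in> N12_zero ?U"
    then have \<phi>N: "\<phi> \<in> N12" using V by blast
    have \<phi>L: "\<phi> \<in> L2" using \<phi>N N12_sub_L2 by blast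
    have "energy h \<phi> = energy u \<phi> + energy e \<phi> - energy \<psi> \<phi>"
      unfolding h_def semi_inner_left[OF semi_inner_energy sN \<psi>(1) \<phi>N] semi_inner_left[OF semi_inner_energy uN e(1) \<phi>N] by simp
    also have "energy e \<phi> = 0" by (rule energy_const_zero[OF e U \<phi>])
    also have "energy \<psi> \<phi> = lam * ip \<Delta> \<phi>" using \<psi>(2)[OF \<phi>] by (simp add: g_def[abs_def] ip_scale_left)
    also have "ip \<Delta> \<phi> = ip (\<lambda>y. F y - u y) \<phi>"
      unfolding ip_def
    proof (rule integral_cong_AE)
      show "AE y in \<mu>. \<Delta> y * \<phi> y = (F y - u y) * \<phi> y"
        using N12_zero_AE[OF \<phi> U] by eventually_elim (auto simp: \<Delta>_def indicator_def)
    qed (use \<Delta>L \<phi>L FL uL in \<open>auto simp: L2_def\<close>)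
    also have "\<dots> = ip F \<phi> - ip u \<phi>" by (rule semi_inner_diff_left[OF semi_inner_ip FL uL \<phi>L])
    finally show "energy h \<phi> = 0" using uE[OF \<phi>N] by (simp add: right_diff_distrib)
  qed
  moreover have "(\<integral>\<^sup>+y\<in>?U. ennreal ((f y - h y)\<^sup>2) \<partial>\<mu>)
      \<le> ennreal (2 + 2 * (CF * r\<^sup>2 * lam)\<^sup>2) * (\<integral>\<^sup>+y\<in>?U. ennreal ((F y - u y)\<^sup>2) \<partial>\<mu>)"
  proof -
    have \<Delta>int: "(\<integral>\<^sup>+y\<in>?U. ennreal ((F y - u y)\<^sup>2) \<partial>\<mu>) = ennreal (ip \<Delta> \<Delta>)"
      unfolding ip_nn_integral[OF \<Delta>L, symmetric]
      by (intro nn_integral_cong) (auto simp: \<Delta>_def indicator_def)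
    have m: "\<Delta> \<in> borel_measurable \<mu>" "\<psi> \<in> borel_measurable \<mu>" using \<Delta>L \<psi>L by (auto simp: L2_def)
    have "(\<integral>\<^sup>+y\<in>?U. ennreal ((f y - h y)\<^sup>2) \<partial>\<mu>) \<le> (\<integral>\<^sup>+y. 2 * ennreal ((\<Delta> y)\<^sup>2) + 2 * ennreal ((\<psi> y)\<^sup>2) \<partial>\<mu>)"
    proof (rule nn_integral_mono)
      fix y
      show "ennreal ((f y - h y)\<^sup>2) * indicator ?U y \<le> 2 * ennreal ((\<Delta> y)\<^sup>2) + 2 * ennreal ((\<psi> y)\<^sup>2)"
      proof (cases "y \<in> ?U")
        case True
        then have "f y - h y = \<Delta> y + \<psi> y" using f[OF True] by (simp add: h_def \<Delta>_def)
        then have "ennreal ((f y - h y)\<^sup>2) \<le> ennreal (2 * (\<Delta> y)\<^sup>2 + 2 * (\<psi> y)\<^sup>2)"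
          using power2_add_le[of "\<Delta> y" "\<psi> y"] by (metis ennreal_leI)
        also have "\<dots> = 2 * ennreal ((\<Delta> y)\<^sup>2) + 2 * ennreal ((\<psi> y)\<^sup>2)" by (simp add: ennreal_plus ennreal_mult)
        finally show ?thesis using True by simp
      qed simp
    qed
    also have "\<dots> = 2 * ennreal (ip \<Delta> \<Delta>) + 2 * ennreal (ip \<psi> \<psi>)"
      using m by (simp add: nn_integral_add nn_integral_cmult ip_nn_integral[OF \<Delta>L] ip_nn_integral[OF \<psi>L])
    also have "\<dots> = ennreal (2 * ip \<Delta> \<Delta> + 2 * ip \<psi> \<psi>)" using ip0 by (simp add: ennreal_plus ennreal_mult)
    also have "\<dots> \<le> ennreal ((2 + 2 * (CF * r\<^sup>2 * lam)\<^sup>2) * ip \<Delta> \<Delta>)"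
      using bound by (intro ennreal_leI) (simp add: algebra_simps)
    also have "\<dots> = ennreal (2 + 2 * (CF * r\<^sup>2 * lam)\<^sup>2) * ennreal (ip \<Delta> \<Delta>)"
      using ip0 by (intro ennreal_mult) auto
    finally show ?thesis unfolding \<Delta>int .
  qed
  ultimately show ?thesis using hN by blast
qed

lemma H_sq_le:
  assumes h: "cheeger_harmonic_on D (mball x r) h" and r: "0 < r" and fh: "f \<in> borel_measurable \<mu>" "h \<in> borel_measurable \<mu>"
    and le: "(\<integral>\<^sup>+y\<in>mball x r. ennreal ((f y - h y)\<^sup>2) \<partial>\<mu>) \<le> T"
  shows "H_sq D f x r \<le> ennreal (1 / r\<^sup>2) * (T / emeasure \<mu> (mball x r))"
proof -
  note fh [measurable]
  have "(\<integral>\<^sup>+ y \<in> mball x r. ennreal (((f y - h y) / r)\<^sup>2) \<partial>\<mu>)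
      = (\<integral>\<^sup>+ y. ennreal (1 / r\<^sup>2) * (ennreal ((f y - h y)\<^sup>2) * indicator (mball x r) y) \<partial>\<mu>)"
    by (intro nn_integral_cong) (simp add: power_divide mult.assoc[symmetric] flip: ennreal_mult)
  also have "\<dots> = ennreal (1 / r\<^sup>2) * (\<integral>\<^sup>+ y \<in> mball x r. ennreal ((f y - h y)\<^sup>2) \<partial>\<mu>)"
    by (intro nn_integral_cmult) simp
  finally have eq: "(\<integral>\<^sup>+ y \<in> mball x r. ennreal (((f y - h y) / r)\<^sup>2) \<partial>\<mu>)
      = ennreal (1 / r\<^sup>2) * (\<integral>\<^sup>+ y \<in> mball x r. ennreal ((f y - h y)\<^sup>2) \<partial>\<mu>)" .
  have "H_sq D f x r \<le> (\<integral>\<^sup>+ y \<in> mball x r. ennreal (((f y - h y) / r)\<^sup>2) \<partial>\<mu>) / emeasure \<mu> (mball x r)"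
    unfolding H_sq_def using h by (intro INF_lower) auto
  also have "\<dots> \<le> (ennreal (1 / r\<^sup>2) * T) / emeasure \<mu> (mball x r)"
    unfolding eq using le by (intro divide_right_mono_ennreal mult_left_mono) auto
  finally show ?thesis by (simp add: ennreal_times_divide)
qed

text \<open>From the squared Leibniz rule: \<open>8 * C0\<^sup>2 * CP2\<close> is
  \<open>C0\<^sup>2 / (2 * R\<^sup>2)\<close> times the Poincare factor
  \<open>CP2 * (4 * R)\<^sup>2\<close>.\<close>

definition CE :: real where "CE = 2 + 8 * C0\<^sup>2 * CP2"
text \<open>Bounds the factor in \<open>harmonic_approximation\<close> when
  \<open>r\<^sup>2 * lam \<le> 1\<close>.\<close>

definition C1 :: real where "C1 = 2 + 2 * CF\<^sup>2"
text \<open>The summands belong to the mean oscillation, the radii below \<open>R / 8\<close> and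
  the radii above. In the last one 8192 is 64 * 16 * 8:
  \<open>1 / r\<^sup>2 \<le> 64 / R\<^sup>2\<close>, the squared radius \<open>4 * R\<close>, and
  \<open>1 / r \<le> 8 / R\<close> integrated over an interval of length \<open>R\<close>.\<close>

definition Cmain :: real where "Cmain = CP2 + 8 * C1 * Cm * CE + 8192 * Cm * CP2"

text \<open>The cut-off function \<open>bump z (2 * R)\<close> is \<open>1\<close> on \<open>mball z (2 * R)\<close>, which contains all balls \<open>mball x r\<close> of the square function.\<close>

lemma energy_localized:
  assumes f: "f \<in> N12" and z: "z \<in> M" and R: "0 < R"
  defines "c \<equiv> average (mball z (4 * R)) f"
  defines "F \<equiv> \<lambda>x. 1 * (bump z (2 * R) x * f x) + (- c) * bump z (2 * R) x"
  shows "F \<in> N12"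
    and "ennreal (energy F F) \<le> ennreal CE * (\<integral>\<^sup>+x\<in>mball z (12 * A * R). ennreal ((norm (D f x))\<^sup>2) \<partial>\<mu>)"
proof -
  define \<eta> where "\<eta> = bump z (2 * R)"
  have R2: "0 < 2 * R" using R by simp
  have \<eta>N: "\<eta> \<in> N12" and \<eta>ug: "upper_gradient \<eta> (\<lambda>x. ennreal (1 / (2 * R)) * indicator (mball z (2 * (2 * R))) x)"
    and \<eta>fin: "(\<integral>\<^sup>+x. (ennreal (1 / (2 * R)) * indicator (mball z (2 * (2 * R))) x)\<^sup>2 \<partial>\<mu>) < \<infinity>"
    unfolding \<eta>_def using bump_N12[OF z R2] by auto
  have \<eta>fN: "(\<lambda>x. \<eta> x * f x) \<in> N12" unfolding \<eta>_def by (rule bump_mult_N12[OF z R2 f])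
  have F_eq: "F = (\<lambda>x. 1 * (\<eta> x * f x) + (- c) * \<eta> x)" by (simp add: F_def \<eta>_def)
  show FN: "F \<in> N12" unfolding F_eq by (rule N12_lincomb[OF \<eta>fN \<eta>N])
  let ?B = "mball z (4 * R)"
  let ?I = "\<integral>\<^sup>+x\<in>mball z (12 * A * R). ennreal ((norm (D f x))\<^sup>2) \<partial>\<mu>"
  have 4: "2 * (2 * R) = 4 * R" by simp
  have pt: "AE x in \<mu>. ennreal ((norm (D F x))\<^sup>2)
      \<le> 2 * (ennreal ((norm (D f x))\<^sup>2) * indicator ?B x) + ennreal (C0\<^sup>2 / (2 * R\<^sup>2)) * (ennreal ((f x - c)\<^sup>2) * indicator ?B x)"
    using D_lincomb[OF \<eta>fN \<eta>N, of 1 "- c"] D_Leibniz[OF \<eta>N f \<eta>fN] D_le_upper_gradient[OF \<eta>N \<eta>ug \<eta>fin]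
      D_zero_on_level[OF \<eta>N, of 0] AE_space
  proof eventually_elim
    case (elim x)
    \<comment> \<open>The average was subtracted before cutting off, so the term with
      \<open>D \<eta>\<close> carries \<open>f - c\<close>; the Poincare inequality compensates its
      factor \<open>1 / R\<close>.\<close>
    then have DF: "D F x = \<eta> x *\<^sub>R D f x + (f x - c) *\<^sub>R D \<eta> x"
      by (simp add: F_eq scaleR_left_diff_distrib)
    show ?case
    proof (cases "x \<in> ?B")
      case False
      then have "\<eta> x = 0" using bump_neq_0[OF R2 z, of x] elim(5) by (auto simp: \<eta>_def space_eq 4)
      then show ?thesis using DF elim(4) by simp
    next
      case True
      have "ennreal (norm (D \<eta> x)) \<le> ennreal (C0 * (1 / (2 * R)))"
        using elim(3) True C0_ge_1 R unfolding 4 by (simp flip: ennreal_mult)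
      then have D\<eta>: "norm (D \<eta> x) \<le> C0 / (2 * R)" using C0_ge_1 R by (subst (asm) ennreal_le_iff) auto
      have "norm (D F x) \<le> norm (D f x) + \<bar>f x - c\<bar> * (C0 / (2 * R))"
      proof -
        have "norm (D F x) \<le> \<bar>\<eta> x\<bar> * norm (D f x) + \<bar>f x - c\<bar> * norm (D \<eta> x)"
          unfolding DF by (metis norm_scaleR norm_triangle_ineq)
        also have "\<dots> \<le> 1 * norm (D f x) + \<bar>f x - c\<bar> * (C0 / (2 * R))"
          using bump_bounds(3) D\<eta> by (intro add_mono mult_mono) (auto simp: \<eta>_def)
        finally show ?thesis by simp
      qed
      then have "(norm (D F x))\<^sup>2 \<le> (norm (D f x) + \<bar>f x - c\<bar> * (C0 / (2 * R)))\<^sup>2" by (intro power_mono) auto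
      also have "\<dots> \<le> 2 * (norm (D f x))\<^sup>2 + 2 * (\<bar>f x - c\<bar> * (C0 / (2 * R)))\<^sup>2"
        by (rule power2_add_le)
      also have "2 * (\<bar>f x - c\<bar> * (C0 / (2 * R)))\<^sup>2 = C0\<^sup>2 / (2 * R\<^sup>2) * (f x - c)\<^sup>2"
        by (simp add: power_mult_distrib power_divide)
      finally have "ennreal ((norm (D F x))\<^sup>2) \<le> ennreal (2 * (norm (D f x))\<^sup>2 + C0\<^sup>2 / (2 * R\<^sup>2) * (f x - c)\<^sup>2)"
        by (rule ennreal_leI)
      also have "\<dots> = 2 * ennreal ((norm (D f x))\<^sup>2) + ennreal (C0\<^sup>2 / (2 * R\<^sup>2)) * ennreal ((f x - c)\<^sup>2)"
        by (subst ennreal_plus, simp, simp, subst (2) ennreal_mult) (simp_all add: ennreal_mult)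
      finally show ?thesis using True by simp
    qed
  qed
  have mf: "f \<in> borel_measurable \<mu>" by (rule N12D(1)[OF f])
  have "ennreal (energy F F) = (\<integral>\<^sup>+x. ennreal ((norm (D F x))\<^sup>2) \<partial>\<mu>)" by (rule energy_nn_integral[OF FN, symmetric])
  also have "\<dots> \<le> (\<integral>\<^sup>+x. 2 * (ennreal ((norm (D f x))\<^sup>2) * indicator ?B x) + ennreal (C0\<^sup>2 / (2 * R\<^sup>2)) * (ennreal ((f x - c)\<^sup>2) * indicator ?B x) \<partial>\<mu>)"
    by (rule nn_integral_mono_AE[OF pt])
  also have "\<dots> = 2 * (\<integral>\<^sup>+x\<in>?B. ennreal ((norm (D f x))\<^sup>2) \<partial>\<mu>) + ennreal (C0\<^sup>2 / (2 * R\<^sup>2)) * (\<integral>\<^sup>+x\<in>?B. ennreal ((f x - c)\<^sup>2) \<partial>\<mu>)"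
    using mf D_measurable[OF f] by (simp add: nn_integral_add nn_integral_cmult)
  also have "\<dots> \<le> 2 * ?I + ennreal (C0\<^sup>2 / (2 * R\<^sup>2)) * (ennreal (CP2 * (4 * R)\<^sup>2) * ?I)"
  \<comment> \<open>The cut-off vanishes outside radius \<open>4 * R\<close>, and
    \<open>poincare_L2\<close> dilates this radius by \<open>3 * A\<close>, giving
    \<open>12 * A * R\<close>.\<close>
  proof (intro add_mono mult_left_mono)
    have "(4 :: real) * R \<le> 12 * A * R" using A_ge_1 R by simp
    then show "(\<integral>\<^sup>+x\<in>?B. ennreal ((norm (D f x))\<^sup>2) \<partial>\<mu>) \<le> ?I"
      by (intro nn_integral_mono) (auto simp: indicator_def)
    show "(\<integral>\<^sup>+x\<in>?B. ennreal ((f x - c)\<^sup>2) \<partial>\<mu>) \<le> ennreal (CP2 * (4 * R)\<^sup>2) * ?I"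
      using poincare_L2[OF f z, of "4 * R"] R unfolding c_def by (simp add: ac_simps)
  qed auto
  also have "\<dots> = ennreal CE * ?I"
  proof -
    have "ennreal (C0\<^sup>2 / (2 * R\<^sup>2)) * ennreal (CP2 * (4 * R)\<^sup>2) = ennreal (C0\<^sup>2 / (2 * R\<^sup>2) * (CP2 * (4 * R)\<^sup>2))"
      using CP2_nonneg by (intro ennreal_mult[symmetric]) auto
    also have "C0\<^sup>2 / (2 * R\<^sup>2) * (CP2 * (4 * R)\<^sup>2) = 8 * C0\<^sup>2 * CP2" using R by (simp add: field_simps power2_eq_square)
    finally have "ennreal (C0\<^sup>2 / (2 * R\<^sup>2)) * (ennreal (CP2 * (4 * R)\<^sup>2) * ?I) = ennreal (8 * C0\<^sup>2 * CP2) * ?I"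
      by (simp only: mult.assoc[symmetric])
    moreover have "ennreal CE = 2 + ennreal (8 * C0\<^sup>2 * CP2)"
      using CP2_nonneg by (simp add: CE_def)
    ultimately show ?thesis by (simp add: distrib_right)
  qed
  finally show "ennreal (energy F F) \<le> ennreal CE * ?I" .
qed

text \<open>\<open>j + 2\<close> is the least \<open>m\<close> with
  \<open>R * (1/2)^m \<le> r\<close>; the assumption on \<open>r\<close> makes it at least
  2.\<close>

lemma dyadic_scale:
  fixes R r :: real
  assumes R: "0 < R" and r: "0 < r" "8 * r < R"
  shows "\<exists>j::nat. R * (1/2)^(j + 2) \<le> r \<and> r < R * (1/2)^(j + 1)"
proof -
  obtain n where n: "(1/2::real)^n < r / R" using real_arch_pow_inv[of "r / R" "1/2"] R r by auto
  define m where "m = (LEAST m. R * (1/2)^m \<le> r)"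
  have ex: "R * (1/2)^n \<le> r" using n R by (simp add: field_simps)
  then have m: "R * (1/2)^m \<le> r" unfolding m_def by (rule LeastI)
  have not: "r < R * (1/2)^i" if "i < m" for i
    using not_less_Least[OF that[unfolded m_def]] by simp
  have "2 \<le> m"
  proof (rule ccontr)
    assume "\<not> 2 \<le> m"
    then have "(1/2::real)^1 \<le> (1/2)^m" by (intro power_decreasing) auto
    then have "R * (1/2) \<le> R * (1/2)^m" using R by simp
    then show False using m r R by linarith
  qed
  then show ?thesis using m not[of "m - 1"] by (intro exI[of _ "m - 2"]) (auto simp: numeral_2_eq_2 Suc_diff_Suc)
qed

section \<open>Summation over the scales\<close>

lemma main_estimate:
  assumes f: "f \<in> N12" and z: "z \<in> M" and R: "0 < R" and diam: "ereal R \<le> diam_carrier"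
  shows "(\<integral>\<^sup>+ x \<in> mball z R. ennreal (((f x - average (mball z R) f) / R)\<^sup>2) \<partial>\<mu>)
      + (\<integral>\<^sup>+ r \<in> {0<..<R}. (\<integral>\<^sup>+ x \<in> mball z R. H_sq D f x r \<partial>\<mu>) / ennreal r \<partial>lborel)
    \<le> ennreal Cmain * (\<integral>\<^sup>+ x \<in> mball z (12 * A * R). ennreal ((norm (D f x))\<^sup>2) \<partial>\<mu>)"
proof -
  let ?I = "\<integral>\<^sup>+x\<in>mball z (12 * A * R). ennreal ((norm (D f x))\<^sup>2) \<partial>\<mu>"
  have mf [measurable]: "f \<in> borel_measurable \<mu>" by (rule N12D(1)[OF f])
  define J where "J = enn2real ?I"
  have I: "?I = ennreal J" and J0: "0 \<le> J"
  proof -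
    have "?I \<le> (\<integral>\<^sup>+x. ennreal ((norm (D f x))\<^sup>2) \<partial>\<mu>)" by (intro nn_integral_mono) (auto simp: indicator_def)
    also have "\<dots> < top" by (simp add: energy_nn_integral[OF f])
    finally show "?I = ennreal J" "0 \<le> J" by (auto simp: J_def)
  qed
  define c where "c = average (mball z (4 * R)) f"
  define \<eta> where "\<eta> = bump z (2 * R)"
  define F where "F = (\<lambda>x. 1 * (\<eta> x * f x) + (- c) * \<eta> x)"
  \<comment> \<open>Where \<open>\<eta> = 1\<close> this is the constant \<open>c\<close>, and
    \<open>f = F + e\<close>.\<close>
  define e where "e x = c * \<eta> x" for x
  have R2: "0 < 2 * R" using R by simp
  have \<eta>N: "\<eta> \<in> N12" unfolding \<eta>_def by (rule bump_N12[OF z R2])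
  have eN: "e \<in> N12" unfolding e_def by (rule N12_scale[OF \<eta>N])
  have me [measurable]: "e \<in> borel_measurable \<mu>" by (rule N12D(1)[OF eN])
  have \<eta>1: "\<eta> y = 1" if "y \<in> mball z (2 * R)" for y unfolding \<eta>_def by (rule bump_eq_1[OF R2 that])
  have FN: "F \<in> N12" and "ennreal (energy F F) \<le> ennreal CE * ennreal J"
    using energy_localized[OF f z R] unfolding F_def \<eta>_def c_def I by auto
  moreover have CE0: "0 \<le> CE" using CP2_nonneg by (simp add: CE_def)
  ultimately have EF: "energy F F \<le> CE * J" using J0 by (simp flip: ennreal_mult)
  have mF [measurable]: "F \<in> borel_measurable \<mu>" by (rule N12D(1)[OF FN])
  have FL: "F \<in> L2" using FN N12_sub_L2 by blast
  have sub: "mball x r \<subseteq> mball z (2 * R)" if "x \<in> mball z R" "r \<le> R" for x r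
    using that z by (intro ball_subset) (auto simp: commute)
  have "\<exists>u. resolvent_eq (4 ^ k / R\<^sup>2) F u" for k :: nat
    using R by (intro resolvent_exists[OF FL]) simp
  then obtain u where u: "\<And>k. resolvent_eq (4 ^ k / R\<^sup>2) F (u k)" by metis
  have uN: "u k \<in> N12" for k using u[of k] by (simp add: resolvent_eq_def)
  have mu [measurable]: "u k \<in> borel_measurable \<mu>" for k by (rule N12D(1)[OF uN])
  have DL: "(\<lambda>x. F x - u k x) \<in> L2" for k using N12_diff[OF FN uN] N12_sub_L2 by blast
  define a where "a k = ip (\<lambda>x. F x - u k x) (\<lambda>x. F x - u k x)" for k
  have a0: "0 \<le> a k" for k unfolding a_def by (rule semi_inner_nonneg[OF semi_inner_ip DL])
  \<comment> \<open>The bound for one dyadic range: \<open>4 * lam\<close> dominates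
    \<open>1 / r\<^sup>2\<close>, \<open>C1\<close> comes from the harmonic approximation and
    \<open>Cm\<close> from averaging. The index \<open>Suc j\<close> matches the sum in
    \<open>resolvent_square_function\<close>.\<close>
  define b where "b j = 4 * C1 * Cm * (4 ^ Suc j / R\<^sup>2 * a (Suc j))" for j
  have C10: "0 \<le> C1" by (simp add: C1_def)
  have Cm0: "0 \<le> Cm" using Cm_ge_1 by simp
  have b0: "0 \<le> b j" for j using C10 Cm0 a0 by (simp add: b_def)
  have sumb: "(\<Sum>j<n. b j) \<le> 8 * C1 * Cm * (CE * J)" for n
  proof -
    have "(\<Sum>j<n. b j) = 4 * C1 * Cm * (\<Sum>j<n. 4 ^ Suc j / R\<^sup>2 * a (Suc j))"
      by (simp only: b_def sum_distrib_left)
    also have "\<dots> \<le> 4 * C1 * Cm * (2 * energy F F)"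
      unfolding a_def using C10 Cm0 by (intro mult_left_mono resolvent_square_function[OF FN R u]) auto
    also have "\<dots> \<le> 4 * C1 * Cm * (2 * (CE * J))"
      using C10 Cm0 EF by (intro mult_left_mono) auto
    finally show ?thesis by simp
  qed
  let ?H = "\<lambda>r. \<integral>\<^sup>+ x \<in> mball z R. H_sq D f x r \<partial>\<mu>"
  have small: "?H r \<le> ennreal (b j)"
    if r: "0 < r" "8 * r < R" and j: "R * (1/2)^(j + 2) \<le> r" "r < R * (1/2)^(j + 1)" for r j
  proof -
    \<comment> \<open>\<open>lam\<close> is the inverse square of the upper end of the dyadic range.
      Hence \<open>r\<^sup>2 * lam \<le> 1\<close>, which bounds the Friedrichs factor, while
      \<open>r\<close> is at least half of that end, which gives
      \<open>1 / r\<^sup>2 \<le> 4 * lam\<close>.\<close>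
    let ?lam = "4 ^ Suc j / R\<^sup>2"
    have lam: "0 < ?lam" using R by simp
    have r2: "r\<^sup>2 * ?lam \<le> 1"
    proof -
      have "r\<^sup>2 \<le> (R * (1/2)^(j + 1))\<^sup>2" using j r by (intro power_mono) auto
      also have "\<dots> = R\<^sup>2 * (1/4)^Suc j" unfolding power_mult_distrib half_power_squared by simp
      finally have "r\<^sup>2 * ?lam \<le> R\<^sup>2 * (1/4)^Suc j * ?lam" using lam by (intro mult_right_mono) auto
      also have "\<dots> = 1" using R by (simp add: power_one_over)
      finally show ?thesis .
    qed
    have r2': "1 / r\<^sup>2 \<le> 4 * ?lam"
    proof -
      have "(R * (1/2)^(j + 2))\<^sup>2 \<le> r\<^sup>2" using j R by (intro power_mono) auto
      moreover have "(R * (1/2)^(j + 2))\<^sup>2 = R\<^sup>2 * (1/4)^(j + 2)" unfolding power_mult_distrib half_power_squared by simp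
      ultimately have "R\<^sup>2 * (1/4)^(j + 2) \<le> r\<^sup>2" by (simp only:)
      then have "1 / r\<^sup>2 \<le> 1 / (R\<^sup>2 * (1/4)^(j + 2))" by (rule divide_left_mono) (use R r in auto)
      also have "\<dots> = 4 * ?lam" using R by (simp add: power_one_over)
      finally show ?thesis .
    qed
    have "(CF * r\<^sup>2 * ?lam)\<^sup>2 \<le> CF\<^sup>2"
    proof (rule power_mono)
      show "CF * r\<^sup>2 * ?lam \<le> CF" using mult_left_mono[OF r2 CF_nonneg] by (simp add: mult.assoc)
      show "0 \<le> CF * r\<^sup>2 * ?lam" using CF_nonneg lam by (intro mult_nonneg_nonneg) auto
    qed
    then have C1: "2 + 2 * (CF * r\<^sup>2 * ?lam)\<^sup>2 \<le> C1" by (simp add: C1_def)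
    let ?w = "\<lambda>y. ennreal ((F y - u (Suc j) y)\<^sup>2)"
    have H: "H_sq D f x r \<le> ennreal (4 * ?lam * C1) * ((\<integral>\<^sup>+y\<in>mball x r. ?w y \<partial>\<mu>) / emeasure \<mu> (mball x r))"
      if x: "x \<in> mball z R" for x
    proof -
      have xM: "x \<in> M" using x by auto
      obtain p where p: "p \<in> M" "2 * r \<le> d x p" using far_point[OF diam xM, of r] r by auto
      have subx: "mball x r \<subseteq> mball z (2 * R)" using sub[OF x] r by simp
      have \<eta>x: "\<eta> y = 1" if "y \<in> mball x r" for y using \<eta>1 subx that by blast
      have "\<exists>h\<in>N12. cheeger_harmonic_on D (mball x r) h \<and>
        (\<integral>\<^sup>+y\<in>mball x r. ennreal ((f y - h y)\<^sup>2) \<partial>\<mu>)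
          \<le> ennreal (2 + 2 * (CF * r\<^sup>2 * ?lam)\<^sup>2) * (\<integral>\<^sup>+y\<in>mball x r. ?w y \<partial>\<mu>)"
      proof (rule harmonic_approximation[OF FN lam u xM r(1) p eN])
        show "e y = c" if "y \<in> mball x r" for y using \<eta>x[OF that] by (simp add: e_def)
        show "f y = F y + e y" if "y \<in> mball x r" for y using \<eta>x[OF that] by (simp add: e_def F_def)
      qed
      then obtain h where hN: "h \<in> N12" and h: "cheeger_harmonic_on D (mball x r) h"
        "(\<integral>\<^sup>+y\<in>mball x r. ennreal ((f y - h y)\<^sup>2) \<partial>\<mu>)
          \<le> ennreal (2 + 2 * (CF * r\<^sup>2 * ?lam)\<^sup>2) * (\<integral>\<^sup>+y\<in>mball x r. ?w y \<partial>\<mu>)" by blast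
      note h = h N12D(1)[OF hN]
      have "(\<integral>\<^sup>+y\<in>mball x r. ennreal ((f y - h y)\<^sup>2) \<partial>\<mu>) \<le> ennreal C1 * (\<integral>\<^sup>+y\<in>mball x r. ?w y \<partial>\<mu>)"
        using h(2) C1 by (meson ennreal_leI mult_right_mono order_trans zero_le)
      from H_sq_le[OF h(1) r(1) mf h(3) this]
      have "H_sq D f x r \<le> ennreal (1 / r\<^sup>2) * (ennreal C1 * (\<integral>\<^sup>+y\<in>mball x r. ?w y \<partial>\<mu>) / emeasure \<mu> (mball x r))" .
      also have "\<dots> \<le> ennreal (4 * ?lam) * (ennreal C1 * (\<integral>\<^sup>+y\<in>mball x r. ?w y \<partial>\<mu>) / emeasure \<mu> (mball x r))"
        using r2' by (intro mult_right_mono ennreal_leI) auto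
      also have "\<dots> = ennreal (4 * ?lam * C1) * ((\<integral>\<^sup>+y\<in>mball x r. ?w y \<partial>\<mu>) / emeasure \<mu> (mball x r))"
      proof -
        have eq: "ennreal (4 * ?lam * C1) = ennreal (4 * ?lam) * ennreal C1"
          using lam C10 by (intro ennreal_mult) auto
        show ?thesis unfolding eq by (simp only: mult.assoc ennreal_times_divide)
      qed
      finally show ?thesis .
    qed
    have "?H r \<le> (\<integral>\<^sup>+x. ennreal (4 * ?lam * C1) * (((\<integral>\<^sup>+y\<in>mball x r. ?w y \<partial>\<mu>) / emeasure \<mu> (mball x r)) * indicator (mball z R) x) \<partial>\<mu>)"
      using H by (intro nn_integral_mono) (auto simp: indicator_def)
    also have "\<dots> = ennreal (4 * ?lam * C1) * (\<integral>\<^sup>+x\<in>mball z R. ((\<integral>\<^sup>+y\<in>mball x r. ?w y \<partial>\<mu>) / emeasure \<mu> (mball x r)) \<partial>\<mu>)"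
      by (intro nn_integral_cmult borel_measurable_times_ennreal nn_average_measurable) measurable
    \<comment> \<open>Integration over the centre \<open>x\<close> undoes the mean over
      \<open>mball x r\<close> at the cost \<open>Cm\<close>.\<close>
    also have "\<dots> \<le> ennreal (4 * ?lam * C1) * (ennreal Cm * (\<integral>\<^sup>+y\<in>mball z (2 * R). ?w y \<partial>\<mu>))"
      by (intro mult_left_mono averaging) (use sub r in auto)
    also have "\<dots> \<le> ennreal (4 * ?lam * C1) * (ennreal Cm * (\<integral>\<^sup>+y. ?w y \<partial>\<mu>))"
      by (intro mult_left_mono nn_integral_mono) (auto simp: indicator_def)
    also have "(\<integral>\<^sup>+y. ?w y \<partial>\<mu>) = ennreal (a (Suc j))" unfolding a_def by (rule ip_nn_integral[OF DL])
    also have "ennreal (4 * ?lam * C1) * (ennreal Cm * ennreal (a (Suc j))) = ennreal (b j)"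
      using lam C10 Cm0 a0 by (simp add: b_def ac_simps flip: ennreal_mult)
    finally show ?thesis .
  qed
  define b' where "b' = 1024 * Cm * CP2 * J"
  have b'0: "0 \<le> b'" using Cm0 CP2_nonneg J0 by (simp add: b'_def)
  let ?v = "\<lambda>y. ennreal ((f y - c)\<^sup>2)"
  have v4: "(\<integral>\<^sup>+y\<in>mball z (4 * R). ?v y \<partial>\<mu>) \<le> ennreal (CP2 * (4 * R)\<^sup>2 * J)"
  proof -
    have "(\<integral>\<^sup>+y\<in>mball z (4 * R). ?v y \<partial>\<mu>) \<le> ennreal (CP2 * (4 * R)\<^sup>2) * ?I"
      using poincare_L2[OF f z, of "4 * R"] R unfolding c_def by (simp add: ac_simps)
    also have "\<dots> = ennreal (CP2 * (4 * R)\<^sup>2 * J)"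
      unfolding I using CP2_nonneg J0 by (intro ennreal_mult[symmetric]) auto
    finally show ?thesis .
  qed
  \<comment> \<open>For these radii \<open>far_point\<close> may not apply. The constant
    \<open>c\<close> is harmonic, and a bound uniform in \<open>r\<close> suffices because
    \<open>dr / r\<close> has bounded mass between \<open>R / 8\<close> and
    \<open>R\<close>.\<close>
  have large: "?H r \<le> ennreal b'" if r: "R \<le> 8 * r" "r < R" for r
  proof -
    have r0: "0 < r" using r R by simp
    have H: "H_sq D f x r \<le> ennreal (64 / R\<^sup>2) * ((\<integral>\<^sup>+y\<in>mball x r. ?v y \<partial>\<mu>) / emeasure \<mu> (mball x r))"
      if x: "x \<in> mball z R" for x
    proof -
      have ec: "e y = c" if "y \<in> mball x r" for y using \<eta>1[of y] sub[OF x, of r] r that by (auto simp: e_def)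
      have harm: "cheeger_harmonic_on D (mball x r) e"
        by (rule cheeger_harmonic_onI[OF eN openin_mball energy_const_zero[OF eN ec openin_mball]])
      have "(\<integral>\<^sup>+y\<in>mball x r. ennreal ((f y - e y)\<^sup>2) \<partial>\<mu>) \<le> (\<integral>\<^sup>+y\<in>mball x r. ?v y \<partial>\<mu>)"
        using ec by (intro nn_integral_mono) (auto simp: indicator_def)
      from H_sq_le[OF harm r0 mf me this]
      have "H_sq D f x r \<le> ennreal (1 / r\<^sup>2) * ((\<integral>\<^sup>+y\<in>mball x r. ?v y \<partial>\<mu>) / emeasure \<mu> (mball x r))" .
      also have "\<dots> \<le> ennreal (64 / R\<^sup>2) * ((\<integral>\<^sup>+y\<in>mball x r. ?v y \<partial>\<mu>) / emeasure \<mu> (mball x r))"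
      proof (intro mult_right_mono ennreal_leI)
        have "R\<^sup>2 \<le> (8 * r)\<^sup>2" using r R by (intro power_mono) auto
        then show "1 / r\<^sup>2 \<le> 64 / R\<^sup>2" using r0 R by (simp add: field_simps power_mult_distrib)
      qed auto
      finally show ?thesis .
    qed
    have "?H r \<le> (\<integral>\<^sup>+x. ennreal (64 / R\<^sup>2) * (((\<integral>\<^sup>+y\<in>mball x r. ?v y \<partial>\<mu>) / emeasure \<mu> (mball x r)) * indicator (mball z R) x) \<partial>\<mu>)"
      using H by (intro nn_integral_mono) (auto simp: indicator_def)
    also have "\<dots> = ennreal (64 / R\<^sup>2) * (\<integral>\<^sup>+x\<in>mball z R. ((\<integral>\<^sup>+y\<in>mball x r. ?v y \<partial>\<mu>) / emeasure \<mu> (mball x r)) \<partial>\<mu>)"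
      by (intro nn_integral_cmult borel_measurable_times_ennreal nn_average_measurable) measurable
    also have "\<dots> \<le> ennreal (64 / R\<^sup>2) * (ennreal Cm * (\<integral>\<^sup>+y\<in>mball z (2 * R). ?v y \<partial>\<mu>))"
      by (intro mult_left_mono averaging) (use sub r r0 in auto)
    also have "\<dots> \<le> ennreal (64 / R\<^sup>2) * (ennreal Cm * (\<integral>\<^sup>+y\<in>mball z (4 * R). ?v y \<partial>\<mu>))"
      using R by (intro mult_left_mono nn_integral_mono) (auto simp: indicator_def)
    also have "\<dots> \<le> ennreal (64 / R\<^sup>2) * (ennreal Cm * ennreal (CP2 * (4 * R)\<^sup>2 * J))"
      by (intro mult_left_mono v4) auto
    also have "\<dots> = ennreal (64 / R\<^sup>2 * (Cm * (CP2 * (4 * R)\<^sup>2 * J)))"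
    proof -
      have *: "0 \<le> CP2 * (4 * R)\<^sup>2 * J" using CP2_nonneg J0 by simp
      show ?thesis
        by (subst ennreal_mult[symmetric], rule Cm0, rule *, subst ennreal_mult[symmetric]) (use Cm0 * in auto)
    qed
    also have "64 / R\<^sup>2 * (Cm * (CP2 * (4 * R)\<^sup>2 * J)) = b'" using R by (simp add: b'_def power_mult_distrib)
    finally show ?thesis .
  qed
  \<comment> \<open>The interval has length \<open>R * (1/2)^(j + 2)\<close>, and
    \<open>1 / r\<close> is at most the inverse of this length on it, so the range contributes
    exactly \<open>b j\<close>.\<close>
  let ?S = "\<lambda>j::nat. {R * (1/2)^(j + 2)..<R * (1/2)^(j + 1)}"
  \<comment> \<open>The inner integral is not known to depend measurably on \<open>r\<close>. It is
    dominated by a measurable step function before sums and integrals are exchanged.\<close>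
  have int_r: "(\<integral>\<^sup>+ r \<in> {0<..<R}. ?H r / ennreal r \<partial>lborel)
      \<le> (\<integral>\<^sup>+ r. (\<Sum>j. ennreal (b j * (2 ^ (j + 2) / R)) * indicator (?S j) r) + ennreal (b' * (8 / R)) * indicator {0..R} r \<partial>lborel)"
  proof (rule nn_integral_mono)
    fix r :: real
    show "?H r / ennreal r * indicator {0<..<R} r
        \<le> (\<Sum>j. ennreal (b j * (2 ^ (j + 2) / R)) * indicator (?S j) r) + ennreal (b' * (8 / R)) * indicator {0..R} r"
    proof (cases "r \<in> {0<..<R}")
      case True
      have div: "?H r / ennreal r \<le> ennreal (t * q)" if "?H r \<le> ennreal t" "1 / r \<le> q" "0 \<le> t" for t q
      proof -
        have "?H r / ennreal r \<le> ennreal t / ennreal r" by (rule divide_right_mono_ennreal[OF that(1)])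
        also have "\<dots> = ennreal (t * (1 / r))" using True that by (simp add: divide_ennreal)
        also have "\<dots> \<le> ennreal (t * q)" using that by (intro ennreal_leI mult_left_mono) auto
        finally show ?thesis .
      qed
      show ?thesis
      proof (cases "8 * r < R")
        case small_r: True
        obtain j where j: "R * (1/2)^(j + 2) \<le> r" "r < R * (1/2)^(j + 1)"
          using dyadic_scale[OF R, of r] True small_r by auto
        have "1 / r \<le> 1 / (R * (1/2)^(j + 2))" using j(1) True R by (intro divide_left_mono) auto
        also have "\<dots> = 2 ^ (j + 2) / R" by (simp add: power_one_over field_simps)
        finally have le: "1 / r \<le> 2 ^ (j + 2) / R" .
        have "?H r / ennreal r \<le> ennreal (b j * (2 ^ (j + 2) / R))"
          by (rule div[OF small[OF _ small_r j] le b0]) (use True in auto)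
        also have "\<dots> = ennreal (b j * (2 ^ (j + 2) / R)) * indicator (?S j) r"
          using j by simp
        also have "\<dots> \<le> (\<Sum>j. ennreal (b j * (2 ^ (j + 2) / R)) * indicator (?S j) r)"
          by (rule ennreal_le_suminf[of "\<lambda>j. ennreal (b j * (2 ^ (j + 2) / R)) * indicator (?S j) r"])
        finally show ?thesis using True by (simp add: add_increasing2)
      next
        case False
        then have "1 / r \<le> 8 / R" using True R by (simp add: field_simps)
        then have "?H r / ennreal r \<le> ennreal (b' * (8 / R))"
          using False True by (intro div large b'0) auto
        then show ?thesis using True by (simp add: add_increasing)
      qed
    qed simp
  qed
  also have "\<dots> = (\<Sum>j. \<integral>\<^sup>+ r. ennreal (b j * (2 ^ (j + 2) / R)) * indicator (?S j) r \<partial>lborel)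
      + (\<integral>\<^sup>+ r. ennreal (b' * (8 / R)) * indicator {0..R} r \<partial>lborel)"
    by (subst nn_integral_add, measurable, subst nn_integral_suminf) auto
  also have "(\<integral>\<^sup>+ r. ennreal (b' * (8 / R)) * indicator {0..R} r \<partial>lborel) = ennreal (8 * b')"
    using R b'0 by (subst nn_integral_cmult_indicator) (auto simp: mult.commute simp flip: ennreal_mult)
  also have "(\<Sum>j. \<integral>\<^sup>+ r. ennreal (b j * (2 ^ (j + 2) / R)) * indicator (?S j) r \<partial>lborel) = (\<Sum>j. ennreal (b j))"
  proof (rule suminf_cong)
    fix j
    have len: "R * (1/2)^(j + 1) - R * (1/2)^(j + 2) = R * (1/2)^(j + 2)" by simp
    have le: "R * (1/2)^(j + 2) \<le> R * (1/2)^(j + 1)" using R by simp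
    have "(\<integral>\<^sup>+ r. ennreal (b j * (2 ^ (j + 2) / R)) * indicator (?S j) r \<partial>lborel)
        = ennreal (b j * (2 ^ (j + 2) / R)) * ennreal (R * (1/2)^(j + 2))"
      using len le by (subst nn_integral_cmult_indicator) auto
    also have "\<dots> = ennreal (b j * (2 ^ (j + 2) / R) * (R * (1/2)^(j + 2)))"
      using b0 R by (intro ennreal_mult[symmetric]) auto
    also have "b j * (2 ^ (j + 2) / R) * (R * (1/2)^(j + 2)) = b j" using R by (simp add: power_one_over)
    finally show "(\<integral>\<^sup>+ r. ennreal (b j * (2 ^ (j + 2) / R)) * indicator (?S j) r \<partial>lborel) = ennreal (b j)" .
  qed
  also have "(\<Sum>j. ennreal (b j)) \<le> ennreal (8 * C1 * Cm * (CE * J))"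
    unfolding suminf_eq_SUP
  proof (rule SUP_least)
    fix n
    have "(\<Sum>j<n. ennreal (b j)) = ennreal (\<Sum>j<n. b j)" using b0 by (intro sum_ennreal) auto
    also have "\<dots> \<le> ennreal (8 * C1 * Cm * (CE * J))" by (intro ennreal_leI sumb)
    finally show "(\<Sum>j<n. ennreal (b j)) \<le> ennreal (8 * C1 * Cm * (CE * J))" .
  qed
  finally have T2: "(\<integral>\<^sup>+ r \<in> {0<..<R}. ?H r / ennreal r \<partial>lborel) \<le> ennreal (8 * C1 * Cm * (CE * J)) + ennreal (8 * b')"
    by (simp add: add_right_mono)
  have T1: "(\<integral>\<^sup>+ x \<in> mball z R. ennreal (((f x - average (mball z R) f) / R)\<^sup>2) \<partial>\<mu>) \<le> ennreal (CP2 * J)"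
  proof -
    let ?m = "average (mball z R) f"
    have "(\<integral>\<^sup>+ x \<in> mball z R. ennreal (((f x - ?m) / R)\<^sup>2) \<partial>\<mu>)
        = (\<integral>\<^sup>+ x. ennreal (1 / R\<^sup>2) * (ennreal ((f x - ?m)\<^sup>2) * indicator (mball z R) x) \<partial>\<mu>)"
      by (intro nn_integral_cong) (simp add: power_divide mult.assoc[symmetric] flip: ennreal_mult)
    also have "\<dots> = ennreal (1 / R\<^sup>2) * (\<integral>\<^sup>+ x \<in> mball z R. ennreal ((f x - ?m)\<^sup>2) \<partial>\<mu>)"
      by (intro nn_integral_cmult) measurable
    also have "\<dots> \<le> ennreal (1 / R\<^sup>2) * (ennreal (CP2 * R\<^sup>2) * (\<integral>\<^sup>+x\<in>mball z (3 * A * R). ennreal ((norm (D f x))\<^sup>2) \<partial>\<mu>))"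
      by (intro mult_left_mono poincare_L2[OF f z R]) auto
    also have "\<dots> \<le> ennreal (1 / R\<^sup>2) * (ennreal (CP2 * R\<^sup>2) * ?I)"
    proof (rule mult_left_mono, rule mult_left_mono, rule nn_integral_mono)
      fix x
      have "3 * A * R \<le> 12 * A * R" using A_ge_1 R by simp
      then show "ennreal ((norm (D f x))\<^sup>2) * indicator (mball z (3 * A * R)) x
          \<le> ennreal ((norm (D f x))\<^sup>2) * indicator (mball z (12 * A * R)) x"
        by (auto simp: indicator_def)
    qed auto
    also have "\<dots> = ennreal (1 / R\<^sup>2 * (CP2 * R\<^sup>2 * J))"
    proof -
      have *: "0 \<le> CP2 * R\<^sup>2" using CP2_nonneg by simp
      show ?thesis
        unfolding I by (subst ennreal_mult[symmetric], rule *, rule J0, subst ennreal_mult[symmetric]) (use * J0 in auto)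
    qed
    also have "1 / R\<^sup>2 * (CP2 * R\<^sup>2 * J) = CP2 * J" using R by simp
    finally show ?thesis .
  qed
  have "(\<integral>\<^sup>+ x \<in> mball z R. ennreal (((f x - average (mball z R) f) / R)\<^sup>2) \<partial>\<mu>)
      + (\<integral>\<^sup>+ r \<in> {0<..<R}. ?H r / ennreal r \<partial>lborel)
      \<le> ennreal (CP2 * J) + (ennreal (8 * C1 * Cm * (CE * J)) + ennreal (8 * b'))"
    by (rule add_mono[OF T1 T2])
  also have "\<dots> = ennreal (CP2 * J + (8 * C1 * Cm * (CE * J) + 8 * b'))"
    using CP2_nonneg J0 C10 Cm0 CE0 b'0 by simp
  also have "CP2 * J + (8 * C1 * Cm * (CE * J) + 8 * b') = Cmain * J"
    by (simp add: Cmain_def b'_def algebra_simps)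
  also have "ennreal (Cmain * J) = ennreal Cmain * ?I"
    unfolding I using CP2_nonneg J0 C10 Cm0 CE0 by (intro ennreal_mult) (auto simp: Cmain_def)
  finally show ?thesis .
qed

end

theorem theorem3:
  shows "\<forall>C0 \<ge> (1::real). \<exists>\<kappa> \<ge> (1::real). \<forall>C_mu \<ge> (1::real). \<forall>A_PI \<ge> (1::real). \<forall>C_PI \<ge> (1::real).
    \<exists>C \<ge> (0::real).
      \<forall>(M :: 'a set) (d :: 'a \<Rightarrow> 'a \<Rightarrow> real) (\<mu> :: 'a measure)
       (H :: 'h :: {real_inner, second_countable_topology} set)
       (D :: ('a \<Rightarrow> real) \<Rightarrow> 'a \<Rightarrow> 'h) (f :: 'a \<Rightarrow> real) (z :: 'a) (R :: real).
        metric_measure_space M d \<mu> \<longrightarrow>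
        metric_measure_space.doubling M d \<mu> C_mu \<longrightarrow>
        metric_measure_space.poincare12 M d \<mu> A_PI C_PI \<longrightarrow>
        metric_measure_space.cheeger_derivative M d \<mu> C0 H D \<longrightarrow>
        f \<in> metric_measure_space.N12 M d \<mu> \<longrightarrow>
        z \<in> M \<longrightarrow> 0 < R \<longrightarrow> ereal R \<le> Metric_space.diam_carrier M d \<longrightarrow>
        (\<integral>\<^sup>+ x \<in> Metric_space.mball M d z R.
            ennreal (((f x - metric_measure_space.average \<mu> (Metric_space.mball M d z R) f) / R)\<^sup>2) \<partial>\<mu>)
        + (\<integral>\<^sup>+ r \<in> {0<..<R}.
             (\<integral>\<^sup>+ x \<in> Metric_space.mball M d z R. metric_measure_space.H_sq M d \<mu> D f x r \<partial>\<mu>)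
               / ennreal r \<partial>lborel)
        \<le> ennreal C *
           (\<integral>\<^sup>+ x \<in> Metric_space.mball M d z (\<kappa> * A_PI * R). ennreal ((norm (D f x))\<^sup>2) \<partial>\<mu>)"
  apply (intro allI impI)
  \<comment> \<open>A pure number, fixed before the doubling and Poincare constants.\<close>
  apply (rule exI[of _ 12])
  apply (intro conjI allI impI)
   apply simp
  subgoal premises const for C0 C_mu A_PI C_PI
    \<comment> \<open>\<open>Cmain\<close> depends on these three numbers alone and can be named
      before the space is given. The absolute value supplies nonnegativity outside the
      locale.\<close>
    apply (rule exI[of _ "\<bar>poincare_space.Cmain C_mu C0 C_PI\<bar>"])
    apply (intro conjI allI impI)
     apply simp
    subgoal premises space for M d \<mu> H D f z R
    proof -
      interpret poincare_space M d \<mu> C_mu C0 H D A_PI C_PI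
        using space const by (simp add: poincare_space_def poincare_space_axioms_def cheeger_space_def
          cheeger_space_axioms_def doubling_space_def doubling_space_axioms_def)
      have "ennreal Cmain \<le> ennreal \<bar>Cmain\<bar>" by (intro ennreal_leI) simp
      then show ?thesis
        using main_estimate[OF space(5-8)] by (meson mult_right_mono order_trans zero_le)
    qed
    done
  done

end
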